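(* Let $(\delta,\sigma)$ be as in case Q or case M described in the context, with $C=\mathbb{C}$. (1) Let $E$ be the field of meromorphic functions on $\hat{\mathbb C}$, the Riemann surface of the logarithm over $\mathbb{C}\setminus\{0\}$, with $\mathbb{C}(x)$ considered as a subfield of $E$. If $f\in E$ satisfies a linear differential equation and a linear $\sigma$-difference equation $$\delta^n(f)+a_{n-1}\delta^{n-1}(f)+\dots+a_0 f=0,\qquad \sigma^m(f)+b_{m-1}\sigma^{m-1}(f)+\dots+b_0 f=0$$ with $a_i,b_i\in\mathbb{C}(x)$, then $$f(x)=\sum_{i=1}^{t}\sum_{j=0}^{t} r_{ij}(x)\,x^{\alpha_i}\log(x)^j$$ for some $t$, some $\alpha_i\in\mathbb{C}$ and $r_{ij}\in\mathbb{C}(x)$; in case M the $\alpha_i$ are moreover rational. Conversely, any function $f(x)=\sum_{i=1}^{t}\sum_{j=0}^{t} r_{ij}(x)\,x^{\alpha_i}\log(x)^j$ with $\alpha_i\in\mathbb{C}$ (with rational $\alpha_i$ in case M) and $r_{ij}\in\mathbb{C}(x)$ satisfies a pair consisting of a linear differential equation $\delta^n(f)+a_{n-1}\delta^{n-1}(f)+\dots+a_0 f=0$ and a linear $\sigma$-difference equation $\sigma^m(f)+b_{m-1}\sigma^{m-1}(f)+\dots+b_0 f=0$, for some positive integers $n,m$ and with coefficients $a_i,b_i\in\mathbb{C}(x)$. (2) If $f\in\mathbb{C}[[x]][x^{-1}]$ (with $\mathbb{C}(x)$ considered as a subfield of $\mathbb{C}[[x]][x^{-1}]$) satisfies a linear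 differential equation $\delta^n(f)+a_{n-1}\delta^{n-1}(f)+\dots+a_0 f=0$ and a linear $\sigma$-difference equation $\sigma^m(f)+b_{m-1}\sigma^{m-1}(f)+\dots+b_0 f=0$ with $a_i,b_i\in\mathbb{C}(x)$, then $f\in\mathbb{C}(x)$.
   Context: Case Q: $\delta=x\,d/dx$ and $\sigma(f)(x)=f(qx)$ with $q\in\mathbb{C}$, $q\ne0$, $q$ not a root of unity; on $\hat{\mathbb C}$ a logarithm of $q$ is fixed, and $qx$ is the point with $\log(qx)=\log q+\log x$. Case M: $\delta=x\,d/dx$ and $\sigma(f)(x)=f(x^q)$ with an integer $q\ge2$; on $\hat{\mathbb C}$, $x^q$ is the point with $\log(x^q)=q\log x$. On $\mathbb{C}[[x]][x^{-1}]$ the operators are given by the same formulas applied to formal Laurent series. *)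

theory Defs
  imports "HOL-Complex_Analysis.Complex_Analysis"
begin

text \<open>
  The Riemann surface of the logarithm over the punctured plane is the universal cover
  \<open>exp\<close> from the complex plane to the punctured plane. A point of the surface is represented by
  its logarithm, which is a global holomorphic coordinate; the underlying point \<open>x\<close> of the
  punctured plane is its exponential. Meromorphic functions on the surface are therefore functions
  \<open>f\<close> with \<open>f meromorphic_on UNIV\<close>.
\<close>

type_synonym log_surface = complex

definition hat_x :: "log_surface \<Rightarrow> complex" where
  "hat_x p = exp p"

definition hat_log :: "log_surface \<Rightarrow> complex" where
  "hat_log p = p"

definition hat_pow :: "complex \<Rightarrow> log_surface \<Rightarrow> complex" where
  "hat_pow \<alpha> p = exp (\<alpha> * hat_log p)"

text \<open>
  Equality in the field of meromorphic functions: the values that a HOL function takes at poles and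
  at removable singularities are irrelevant, so functions are compared off a set without
  accumulation points.
\<close>

definition hat_eq :: "(log_surface \<Rightarrow> complex) \<Rightarrow> (log_surface \<Rightarrow> complex) \<Rightarrow> bool" where
  "hat_eq f g \<longleftrightarrow> eventually (\<lambda>p. f p = g p) (cosparse UNIV)"

definition hat_ratfuns :: "(log_surface \<Rightarrow> complex) set" where
  "hat_ratfuns = {\<lambda>p. poly u (hat_x p) / poly v (hat_x p) | u v :: complex poly. v \<noteq> 0}"

definition fls_ratfuns :: "complex fls set" where
  "fls_ratfuns =
     {fps_to_fls (fps_of_poly u) / fps_to_fls (fps_of_poly v) | u v :: complex poly. v \<noteq> 0}"

text \<open>
  \<open>CaseQ q l\<close> is the \<open>q\<close>-dilation case, where \<open>l\<close> is the fixed logarithm of \<open>q\<close>; \<open>CaseM q\<close> is the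
  Mahler case.
\<close>

datatype sigma_case = CaseQ complex complex | CaseM nat

fun admissible :: "sigma_case \<Rightarrow> bool" where
  "admissible (CaseQ q l) \<longleftrightarrow> q \<noteq> 0 \<and> (\<forall>k>0. q ^ k \<noteq> 1) \<and> exp l = q"
| "admissible (CaseM q) \<longleftrightarrow> q \<ge> 2"

text \<open>\<open>x d/dx\<close> on the surface, the derivative \<open>df/dx\<close> being computed in the global coordinate as
  \<open>df/dp\<close> divided by \<open>dx/dp\<close>.\<close>

definition hat_delta :: "(log_surface \<Rightarrow> complex) \<Rightarrow> log_surface \<Rightarrow> complex" where
  "hat_delta f p = hat_x p * (deriv f p / deriv hat_x p)"

lemma hat_delta_eq_deriv: "hat_delta f = deriv f"
proof -
  have "deriv hat_x p = exp p" for p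
    by (rule DERIV_imp_deriv) (auto simp: hat_x_def [abs_def] intro!: derivative_eq_intros)
  then show ?thesis
    by (simp add: fun_eq_iff hat_delta_def hat_x_def)
qed

text \<open>A point is its logarithm, so \<open>qx\<close> is \<open>l + p\<close> and \<open>x\<close> to the power \<open>q\<close> is \<open>q * p\<close>.\<close>

fun hat_sigma :: "sigma_case \<Rightarrow> (log_surface \<Rightarrow> complex) \<Rightarrow> log_surface \<Rightarrow> complex" where
  "hat_sigma (CaseQ q l) f p = f (l + p)"
| "hat_sigma (CaseM q) f p = f (of_nat q * p)"

definition fls_delta :: "complex fls \<Rightarrow> complex fls" where
  "fls_delta f = fls_X * fls_deriv f"

fun fls_sigma :: "sigma_case \<Rightarrow> complex fls \<Rightarrow> complex fls" where
  "fls_sigma (CaseQ q l) f = fls_compose_fps f (fps_const q * fps_X)"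
| "fls_sigma (CaseM q) f = fls_compose_power f q"

definition hat_satisfies ::
  "((log_surface \<Rightarrow> complex) \<Rightarrow> log_surface \<Rightarrow> complex) \<Rightarrow> nat \<Rightarrow> (log_surface \<Rightarrow> complex) \<Rightarrow> bool" where
  "hat_satisfies T n f \<longleftrightarrow>
     (\<exists>a :: nat \<Rightarrow> log_surface \<Rightarrow> complex. (\<forall>i<n. a i \<in> hat_ratfuns) \<and>
        hat_eq (\<lambda>p. (T ^^ n) f p + (\<Sum>i<n. a i p * (T ^^ i) f p)) (\<lambda>p. 0))"

definition fls_satisfies ::
  "(complex fls \<Rightarrow> complex fls) \<Rightarrow> nat \<Rightarrow> complex fls \<Rightarrow> bool" where
  "fls_satisfies T n f \<longleftrightarrow>
     (\<exists>a :: nat \<Rightarrow> complex fls. (\<forall>i<n. a i \<in> fls_ratfuns) \<and>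
        (T ^^ n) f + (\<Sum>i<n. a i * (T ^^ i) f) = 0)"

fun exponents :: "sigma_case \<Rightarrow> complex set" where
  "exponents (CaseQ q l) = UNIV"
| "exponents (CaseM q) = \<rat>"

definition power_log_form :: "sigma_case \<Rightarrow> (log_surface \<Rightarrow> complex) \<Rightarrow> bool" where
  "power_log_form c f \<longleftrightarrow>
     (\<exists>(t :: nat) (\<alpha> :: nat \<Rightarrow> complex) (r :: nat \<Rightarrow> nat \<Rightarrow> log_surface \<Rightarrow> complex).
        (\<forall>i\<in>{1..t}. \<alpha> i \<in> exponents c) \<and>
        (\<forall>i\<in>{1..t}. \<forall>j\<in>{0..t}. r i j \<in> hat_ratfuns) \<and>
        hat_eq f (\<lambda>p. \<Sum>i=1..t. \<Sum>j=0..t. r i j p * hat_pow (\<alpha> i) p * hat_log p ^ j))"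

end

theory Submission
  imports Defs "HOL-Computational_Algebra.Fundamental_Theorem_Algebra"
begin

text \<open>
  In the coordinate \<open>p = log x\<close> the derivation is \<open>d/dp\<close> and \<open>\<sigma>\<close> is the translation by \<open>log q\<close>, or the
  multiplication by \<open>q\<close>. The core is that a meromorphic function \<open>g\<close> with period \<open>2\<pi>i\<close> satisfying both
  equations is rational in \<open>e\<^sup>p\<close>. Its poles lie over the zeros of the leading coefficient of the
  differential equation, with bounded order, so a polynomial multiple is entire; the Fourier
  coefficients of the latter vanish near \<open>\<plusminus>\<infinity>\<close>. For the dilation they decay faster than exponentially and
  satisfy recurrences with coefficients polynomial in \<open>k\<close>, and in \<open>q\<^sup>k\<close>; comparing the two module
  structures forces such a sequence to be eventually zero. For the Mahler operator, the functional
  equation bounds the growth of \<open>g\<close>.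

  A general \<open>f\<close> and its translates by multiples of \<open>2\<pi>i\<close> solve the same differential equation, hence
  are dependent, so \<open>f\<close> is a sum of terms \<open>G(p) p\<^sup>j\<close> with \<open>G(p + 2\<pi>i) = \<mu> G(p)\<close>. The coefficients of
  the highest power of \<open>p\<close> inherit both equations. Dilations preserve the multipliers \<open>\<mu>\<close>, and
  \<open>e\<^sup>-\<^sup>\<alpha>\<^sup>p G\<close> is periodic; the Mahler operator raises them to the \<open>q\<close>-th power, which forces them to be
  roots of unity, and \<open>G(N p)\<close> is periodic. Subtract and repeat.

  For Laurent series, the coefficients in the dilation case again satisfy both kinds of recurrences
  and are therefore eventually an exponential polynomial. In the Mahler case the series converges; it is
  continued to \<open>Re p < 0\<close> by the functional equation, across \<open>p = 0\<close> by the differential equation on a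
  disc touching \<open>0\<close>, to the half-plane swept by the scaled discs by the functional equation, and
  to the plane by periodicity.
\<close>

section \<open>Linear operators over the polynomials\<close>

text \<open>Functions are compared only off isolated points, and sequences only up to negligible
  ones, so linear algebra over C(x) is carried out with polynomial coefficients and cleared
  denominators, modulo a submodule of negligible functions.

  In the dilation case \<open>|q| = 1\<close> is allowed, so the difference equation alone gives no
  growth estimate. What separates the two kinds of recurrences is algebraic: no rational function
  satisfies \<open>f(X / q) = f(X) + d\<close> with \<open>d \<noteq> 0\<close>, whereas the index
  \<open>k\<close> does change by a constant under the shift. For entire functions the negligible
  sequences are the eventually zero ones, as decay excludes exponential sequences. For formal series
  exponential sequences do occur; the ideal has to contain them and their quotients by polynomials
  in \<open>q ^ k\<close>, and these denominators are removed afterwards.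

  In the Mahler case the obstacle is \<open>p = 0\<close>, that is \<open>x = 1\<close>: it is fixed
  by the scaling and may be singular for the differential equation, so no disc around it is
  available.\<close>

lemma idom_linear_dependence:
  fixes A :: "'i \<Rightarrow> 'j \<Rightarrow> 'r :: idom"
  assumes "finite J" "finite I" "card J < card I"
  shows "\<exists>k. (\<exists>i\<in>I. k i \<noteq> 0) \<and> (\<forall>j\<in>J. (\<Sum>i\<in>I. k i * A i j) = 0)"
  using assms
proof (induction J arbitrary: I A rule: finite_induct)
  case empty
  then obtain i where "i \<in> I" by fastforce
  then show ?case by (intro exI[of _ "\<lambda>_. 1"]) auto
next
  case (insert j0 J)
  show ?case
  proof (cases "\<forall>i\<in>I. A i j0 = 0")
    case True
    have "card J < card I" using insert by simp
    from insert.IH[OF insert.prems(1) this] obtain k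
      where "\<exists>i\<in>I. k i \<noteq> 0" "\<forall>j\<in>J. (\<Sum>i\<in>I. k i * A i j) = 0" by blast
    then show ?thesis using True by (intro exI[of _ k]) auto
  next
    case False
    then obtain r where r: "r \<in> I" "A r j0 \<noteq> 0" by blast
    define I' where "I' = I - {r}"
    have I': "finite I'" "card J < card I'" using insert r by (auto simp: I'_def)
    \<comment> \<open>Fraction-free elimination: column \<open>j0\<close> is cleared by
      cross-multiplying with the pivot row, and the relation found for the remaining rows is scaled
      by the pivot so that it lifts to the original ones.\<close>
    define A' where "A' = (\<lambda>i j. A r j0 * A i j - A i j0 * A r j)"
    from insert.IH[OF I', of A'] obtain k
      where k: "\<exists>i\<in>I'. k i \<noteq> 0" "\<forall>j\<in>J. (\<Sum>i\<in>I'. k i * A' i j) = 0" by blast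
    define k' where "k' = (\<lambda>i. if i = r then - (\<Sum>i\<in>I'. k i * A i j0) else A r j0 * k i)"
    have nz: "\<exists>i\<in>I. k' i \<noteq> 0" using k(1) r by (auto simp: k'_def I'_def)
    have split: "(\<Sum>i\<in>I. k' i * A i j) = (\<Sum>i\<in>I'. k i * A' i j)" for j
    proof -
      have "(\<Sum>i\<in>I. k' i * A i j) = k' r * A r j + (\<Sum>i\<in>I'. k' i * A i j)"
        unfolding I'_def using insert.prems r by (simp add: sum.remove)
      also have "(\<Sum>i\<in>I'. k' i * A i j) = (\<Sum>i\<in>I'. A r j0 * k i * A i j)"
        by (rule sum.cong) (auto simp: k'_def I'_def)
      also have "k' r * A r j + \<dots> = (\<Sum>i\<in>I'. k i * A' i j)"
        by (simp add: k'_def A'_def sum_distrib_left sum_distrib_right right_diff_distrib sum_subtractf mult_ac)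
      finally show ?thesis .
    qed
    have "(\<Sum>i\<in>I. k' i * A i j0) = 0"
      by (simp add: split A'_def mult.commute)
    then show ?thesis using nz k(2) split by (intro exI[of _ k']) auto
  qed
qed

text \<open>Functions form a C[X]-module in which X acts as multiplication by
  \<open>\<theta>\<close>: \<open>exp\<close> on the surface, and \<open>q ^ k\<close> or the index
  \<open>k\<close> for sequences. \<open>Z\<close> is the submodule of functions counted as
  zero.\<close>

locale polymod =
  fixes \<theta> :: "'a \<Rightarrow> complex" and Z :: "('a \<Rightarrow> complex) set"
  assumes Z_zero: "(\<lambda>_. 0) \<in> Z"
    and Z_add: "f \<in> Z \<Longrightarrow> g \<in> Z \<Longrightarrow> (\<lambda>x. f x + g x) \<in> Z"
    and Z_scale: "f \<in> Z \<Longrightarrow> (\<lambda>x. poly p (\<theta> x) * f x) \<in> Z"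
begin

lemma Z_cmult: "f \<in> Z \<Longrightarrow> (\<lambda>x. c * f x) \<in> Z"
  using Z_scale[of f "[:c:]"] by simp

lemma Z_diff: "f \<in> Z \<Longrightarrow> g \<in> Z \<Longrightarrow> (\<lambda>x. f x - g x) \<in> Z"
  using Z_add[OF _ Z_cmult[of g "-1"], of f] by simp

lemma Z_sum: "(\<And>i. i \<in> I \<Longrightarrow> f i \<in> Z) \<Longrightarrow> (\<lambda>x. \<Sum>i\<in>I. f i x) \<in> Z"
  by (induction I rule: infinite_finite_induct) (auto intro: Z_zero Z_add)

text \<open>The span over the fraction field \<open>\<complex>(X)\<close>, modulo \<open>Z\<close>, without denominators.\<close>

definition sspan :: "'i set \<Rightarrow> ('i \<Rightarrow> 'a \<Rightarrow> complex) \<Rightarrow> ('a \<Rightarrow> complex) set" where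
  "sspan J w = {v. \<exists>d p. d \<noteq> 0 \<and>
     (\<lambda>x. poly d (\<theta> x) * v x - (\<Sum>j\<in>J. poly (p j) (\<theta> x) * w j x)) \<in> Z}"

lemma sspanI:
  "d \<noteq> 0 \<Longrightarrow> (\<lambda>x. poly d (\<theta> x) * v x - (\<Sum>j\<in>J. poly (p j) (\<theta> x) * w j x)) \<in> Z
    \<Longrightarrow> v \<in> sspan J w"
  unfolding sspan_def by blast

lemma sspanE:
  assumes "v \<in> sspan J w"
  obtains d p where "d \<noteq> 0"
    "(\<lambda>x. poly d (\<theta> x) * v x - (\<Sum>j\<in>J. poly (p j) (\<theta> x) * w j x)) \<in> Z"
  using assms unfolding sspan_def by blast

lemma sspan_Z: "v \<in> Z \<Longrightarrow> v \<in> sspan J w"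
  by (rule sspanI[of 1 v "\<lambda>_. 0" w J]) auto

lemma sspan_base: "finite J \<Longrightarrow> j \<in> J \<Longrightarrow> w j \<in> sspan J w"
proof (rule sspanI[of 1 _ "\<lambda>i. if i = j then 1 else 0"])
  assume "finite J" "j \<in> J"
  have "(\<Sum>i\<in>J. poly (if i = j then 1 else 0) (\<theta> x) * w i x) = (\<Sum>i\<in>J. if i = j then w j x else 0)" for x
    by (rule sum.cong) auto
  with \<open>finite J\<close> \<open>j \<in> J\<close> show "(\<lambda>x. poly 1 (\<theta> x) * w j x -
      (\<Sum>i\<in>J. poly (if i = j then 1 else 0) (\<theta> x) * w i x)) \<in> Z"
    by (simp add: Z_zero)
qed auto

lemma sspan_add:
  assumes "u \<in> sspan J w" "v \<in> sspan J w"
  shows "(\<lambda>x. u x + v x) \<in> sspan J w"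
proof -
  obtain d p where 1: "d \<noteq> 0"
    "(\<lambda>x. poly d (\<theta> x) * u x - (\<Sum>j\<in>J. poly (p j) (\<theta> x) * w j x)) \<in> Z"
    using assms(1) by (rule sspanE)
  obtain e r where 2: "e \<noteq> 0"
    "(\<lambda>x. poly e (\<theta> x) * v x - (\<Sum>j\<in>J. poly (r j) (\<theta> x) * w j x)) \<in> Z"
    using assms(2) by (rule sspanE)
  show ?thesis
  proof (rule sspanI[of "d * e" _ "\<lambda>j. e * p j + d * r j"])
    have "(\<lambda>x. poly e (\<theta> x) * (poly d (\<theta> x) * u x - (\<Sum>j\<in>J. poly (p j) (\<theta> x) * w j x)) +
       poly d (\<theta> x) * (poly e (\<theta> x) * v x - (\<Sum>j\<in>J. poly (r j) (\<theta> x) * w j x))) \<in> Z"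
      by (intro Z_add Z_scale 1 2)
    also have "(\<lambda>x. poly e (\<theta> x) * (poly d (\<theta> x) * u x - (\<Sum>j\<in>J. poly (p j) (\<theta> x) * w j x)) +
       poly d (\<theta> x) * (poly e (\<theta> x) * v x - (\<Sum>j\<in>J. poly (r j) (\<theta> x) * w j x))) =
       (\<lambda>x. poly (d * e) (\<theta> x) * (u x + v x) - (\<Sum>j\<in>J. poly (e * p j + d * r j) (\<theta> x) * w j x))"
      by (simp add: algebra_simps sum.distrib sum_distrib_left)
    finally show "\<dots> \<in> Z" .
  qed (use 1 2 in auto)
qed

lemma sspan_scale:
  assumes "v \<in> sspan J w"
  shows "(\<lambda>x. poly p (\<theta> x) * v x) \<in> sspan J w"
proof -
  obtain d r where 1: "d \<noteq> 0"
    "(\<lambda>x. poly d (\<theta> x) * v x - (\<Sum>j\<in>J. poly (r j) (\<theta> x) * w j x)) \<in> Z"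
    using assms(1) by (rule sspanE)
  show ?thesis
  proof (rule sspanI[of d _ "\<lambda>j. p * r j"])
    have "(\<lambda>x. poly p (\<theta> x) * (poly d (\<theta> x) * v x - (\<Sum>j\<in>J. poly (r j) (\<theta> x) * w j x))) \<in> Z"
      by (intro Z_scale 1)
    then show "(\<lambda>x. poly d (\<theta> x) * (poly p (\<theta> x) * v x) - (\<Sum>j\<in>J. poly (p * r j) (\<theta> x) * w j x)) \<in> Z"
      by (simp add: algebra_simps sum_distrib_left)
  qed (use 1 in auto)
qed

lemma sspan_sat:
  assumes "(\<lambda>x. poly p (\<theta> x) * v x) \<in> sspan J w" "p \<noteq> 0"
  shows "v \<in> sspan J w"
proof -
  obtain d r where 1: "d \<noteq> 0"
    "(\<lambda>x. poly d (\<theta> x) * (poly p (\<theta> x) * v x) - (\<Sum>j\<in>J. poly (r j) (\<theta> x) * w j x)) \<in> Z"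
    using assms(1) by (rule sspanE)
  then show ?thesis using assms(2)
    by (intro sspanI[of "d * p" _ r]) (auto simp: mult.assoc)
qed

lemma sspan_cmult: "v \<in> sspan J w \<Longrightarrow> (\<lambda>x. c * v x) \<in> sspan J w"
  using sspan_scale[of v J w "[:c:]"] by simp

lemma sspan_diff: "u \<in> sspan J w \<Longrightarrow> v \<in> sspan J w \<Longrightarrow> (\<lambda>x. u x - v x) \<in> sspan J w"
  using sspan_add[OF _ sspan_cmult[of v J w "-1"], of u] by simp

lemma sspan_sum: "(\<And>i. i \<in> I \<Longrightarrow> f i \<in> sspan J w) \<Longrightarrow> (\<lambda>x. \<Sum>i\<in>I. f i x) \<in> sspan J w"
  by (induction I rule: infinite_finite_induct) (auto intro: sspan_Z Z_zero sspan_add)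

lemma sspan_cong: "v \<in> sspan J w \<Longrightarrow> (\<lambda>x. u x - v x) \<in> Z \<Longrightarrow> u \<in> sspan J w"
  using sspan_add[of v J w "\<lambda>x. u x - v x"] sspan_Z by fastforce

lemma sspan_trans:
  assumes "v \<in> sspan J w" "\<And>j. j \<in> J \<Longrightarrow> w j \<in> sspan K u"
  shows "v \<in> sspan K u"
proof -
  obtain d r where 1: "d \<noteq> 0"
    "(\<lambda>x. poly d (\<theta> x) * v x - (\<Sum>j\<in>J. poly (r j) (\<theta> x) * w j x)) \<in> Z"
    using assms(1) by (rule sspanE)
  have "(\<lambda>x. poly d (\<theta> x) * v x) \<in> sspan K u"
    by (rule sspan_cong[OF _ 1(2)]) (intro sspan_sum sspan_scale assms)
  then show ?thesis using 1(1) by (rule sspan_sat)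
qed

text \<open>Clearing each denominator \<open>d i\<close> leaves a matrix over C[X] with more rows
  than columns; the \<open>d i\<close> are multiplied back into the kernel vector, which keeps it
  nonzero.\<close>

lemma sspan_dependent:
  assumes "finite J" "finite I" "card J < card I" "\<And>i. i \<in> I \<Longrightarrow> v i \<in> sspan J w"
  shows "\<exists>k. (\<exists>i\<in>I. k i \<noteq> 0) \<and> (\<lambda>x. \<Sum>i\<in>I. poly (k i) (\<theta> x) * v i x) \<in> Z"
proof -
  have "\<forall>i\<in>I. \<exists>d p. d \<noteq> 0 \<and>
     (\<lambda>x. poly d (\<theta> x) * v i x - (\<Sum>j\<in>J. poly (p j) (\<theta> x) * w j x)) \<in> Z"
    using assms(4) unfolding sspan_def by blast
  from bchoice[OF this] obtain d where "\<forall>i\<in>I. \<exists>p. d i \<noteq> 0 \<and>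
     (\<lambda>x. poly (d i) (\<theta> x) * v i x - (\<Sum>j\<in>J. poly (p j) (\<theta> x) * w j x)) \<in> Z" ..
  from bchoice[OF this] obtain p where dp: "\<And>i. i \<in> I \<Longrightarrow> d i \<noteq> 0"
     "\<And>i. i \<in> I \<Longrightarrow> (\<lambda>x. poly (d i) (\<theta> x) * v i x - (\<Sum>j\<in>J. poly (p i j) (\<theta> x) * w j x)) \<in> Z"
    by blast
  obtain k where k: "\<exists>i\<in>I. k i \<noteq> 0" "\<And>j. j \<in> J \<Longrightarrow> (\<Sum>i\<in>I. k i * p i j) = 0"
    using idom_linear_dependence[OF assms(1-3), of p] by blast
  have "(\<lambda>x. \<Sum>i\<in>I. poly (k i) (\<theta> x) * (poly (d i) (\<theta> x) * v i x - (\<Sum>j\<in>J. poly (p i j) (\<theta> x) * w j x))) \<in> Z"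
    by (intro Z_sum Z_scale dp)
  also have "(\<lambda>x. \<Sum>i\<in>I. poly (k i) (\<theta> x) * (poly (d i) (\<theta> x) * v i x - (\<Sum>j\<in>J. poly (p i j) (\<theta> x) * w j x)))
    = (\<lambda>x. \<Sum>i\<in>I. poly (k i * d i) (\<theta> x) * v i x)"
  proof
    fix x
    have "(\<Sum>i\<in>I. poly (k i) (\<theta> x) * (\<Sum>j\<in>J. poly (p i j) (\<theta> x) * w j x))
       = (\<Sum>j\<in>J. \<Sum>i\<in>I. poly (k i) (\<theta> x) * (poly (p i j) (\<theta> x) * w j x))"
      unfolding sum_distrib_left by (rule sum.swap)
    also have "\<dots> = (\<Sum>j\<in>J. poly (\<Sum>i\<in>I. k i * p i j) (\<theta> x) * w j x)"
      by (simp add: poly_sum sum_distrib_right mult.assoc)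
    also have "\<dots> = 0" by (simp add: k)
    finally show "(\<Sum>i\<in>I. poly (k i) (\<theta> x) * (poly (d i) (\<theta> x) * v i x - (\<Sum>j\<in>J. poly (p i j) (\<theta> x) * w j x)))
      = (\<Sum>i\<in>I. poly (k i * d i) (\<theta> x) * v i x)"
      by (simp add: right_diff_distrib sum_subtractf mult.assoc)
  qed
  finally show ?thesis using k(1) dp(1) by (intro exI[of _ "\<lambda>i. k i * d i"]) auto
qed

text \<open>Steinitz exchange by counting: \<open>u\<close> together with the \<open>v i\<close> is
  one vector too many, and independence of the \<open>v i\<close> forces the coefficient of
  \<open>u\<close> in a dependence to be nonzero.\<close>

lemma sspan_exchange:
  assumes "finite J" "finite I" "card J = card I" "\<And>i. i \<in> I \<Longrightarrow> v i \<in> sspan J w"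
    and indep: "\<And>k. (\<lambda>x. \<Sum>i\<in>I. poly (k i) (\<theta> x) * v i x) \<in> Z \<Longrightarrow> \<forall>i\<in>I. k i = 0"
    and u: "u \<in> sspan J w"
  shows "u \<in> sspan I v"
proof -
  define v' where "v' = (\<lambda>i. case i of None \<Rightarrow> u | Some i \<Rightarrow> v i)"
  obtain k where k: "\<exists>i\<in>insert None (Some ` I). k i \<noteq> 0"
     "(\<lambda>x. \<Sum>i\<in>insert None (Some ` I). poly (k i) (\<theta> x) * v' i x) \<in> Z"
  proof -
    have "\<exists>k. (\<exists>i\<in>insert None (Some ` I). k i \<noteq> 0) \<and>
      (\<lambda>x. \<Sum>i\<in>insert None (Some ` I). poly (k i) (\<theta> x) * v' i x) \<in> Z"
      by (rule sspan_dependent[OF assms(1), where w = w])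
         (use assms u in \<open>auto simp: v'_def card_image\<close>)
    then show ?thesis using that by blast
  qed
  have eq: "(\<Sum>i\<in>insert None (Some ` I). poly (k i) (\<theta> x) * v' i x) =
     poly (k None) (\<theta> x) * u x + (\<Sum>i\<in>I. poly (k (Some i)) (\<theta> x) * v i x)" for x
    using assms(2) by (subst sum.insert) (auto simp: v'_def sum.reindex)
  have nz: "k None \<noteq> 0"
  proof
    assume 0: "k None = 0"
    then have "\<forall>i\<in>I. k (Some i) = 0" using k(2) unfolding eq
      by (intro indep) auto
    then show False using k(1) 0 by auto
  qed
  show ?thesis
    by (rule sspanI[OF nz, of _ "\<lambda>i. - k (Some i)"]) (use k(2) eq in \<open>simp add: sum_negf\<close>)
qed

end

text \<open>Common generalisation of a derivation (\<open>\<tau> = id\<close>) and of a semilinear operator (\<open>\<eta> = 0\<close>).\<close>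

locale skew_operator = polymod \<theta> Z
  for \<theta> :: "'a \<Rightarrow> complex" and Z +
  fixes C :: "('a \<Rightarrow> complex) set" and T :: "('a \<Rightarrow> complex) \<Rightarrow> 'a \<Rightarrow> complex"
    and \<tau> \<eta> :: "complex poly \<Rightarrow> complex poly"
  assumes C_zero: "(\<lambda>_. 0) \<in> C"
    and C_add: "f \<in> C \<Longrightarrow> g \<in> C \<Longrightarrow> (\<lambda>x. f x + g x) \<in> C"
    and C_scale: "f \<in> C \<Longrightarrow> (\<lambda>x. poly p (\<theta> x) * f x) \<in> C"
    and T_C: "f \<in> C \<Longrightarrow> T f \<in> C"
    and T_Z: "f \<in> C \<Longrightarrow> f \<in> Z \<Longrightarrow> T f \<in> Z"
    and T_add: "f \<in> C \<Longrightarrow> g \<in> C \<Longrightarrow> (\<lambda>x. T (\<lambda>x. f x + g x) x - (T f x + T g x)) \<in> Z"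
    and T_scale: "f \<in> C \<Longrightarrow>
      (\<lambda>x. T (\<lambda>x. poly p (\<theta> x) * f x) x - (poly (\<tau> p) (\<theta> x) * T f x + poly (\<eta> p) (\<theta> x) * f x)) \<in> Z"
    and \<tau>_nonzero: "p \<noteq> 0 \<Longrightarrow> \<tau> p \<noteq> 0"
begin

definition has_relation :: "('a \<Rightarrow> complex) \<Rightarrow> bool" where
  "has_relation f \<longleftrightarrow>
     (\<exists>n p. p n \<noteq> 0 \<and> (\<lambda>x. \<Sum>i\<le>n. poly (p i) (\<theta> x) * (T ^^ i) f x) \<in> Z)"

text \<open>A generating system, not a basis, standing for a finite-dimensional space over C(X) that
  is stable under \<open>T\<close>. The iterates of a function with a relation form one, and
  conversely every function of \<open>C\<close> in its span has a relation.\<close>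

definition stable :: "'i set \<Rightarrow> ('i \<Rightarrow> 'a \<Rightarrow> complex) \<Rightarrow> bool" where
  "stable J w \<longleftrightarrow> finite J \<and> (\<forall>j\<in>J. w j \<in> C \<and> T (w j) \<in> sspan J w)"

lemma C_sum: "(\<And>i. i \<in> I \<Longrightarrow> f i \<in> C) \<Longrightarrow> (\<lambda>x. \<Sum>i\<in>I. f i x) \<in> C"
  by (induction I rule: infinite_finite_induct) (auto intro: C_zero C_add)

lemma C_cmult: "f \<in> C \<Longrightarrow> (\<lambda>x. c * f x) \<in> C"
  using C_scale[of f "[:c:]"] by simp

lemma C_diff: "f \<in> C \<Longrightarrow> g \<in> C \<Longrightarrow> (\<lambda>x. f x - g x) \<in> C"
  using C_add[OF _ C_cmult[of g "-1"], of f] by simp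

lemma C_funpow: "f \<in> C \<Longrightarrow> (T ^^ n) f \<in> C"
  by (induction n) (auto intro: T_C)

lemma T_sum:
  assumes "finite I" "\<And>i. i \<in> I \<Longrightarrow> f i \<in> C"
  shows "(\<lambda>x. T (\<lambda>x. \<Sum>i\<in>I. f i x) x - (\<Sum>i\<in>I. T (f i) x)) \<in> Z"
  using assms
proof (induction I rule: finite_induct)
  case empty
  then show ?case using T_Z[OF C_zero Z_zero] by simp
next
  case (insert i I)
  have "(\<lambda>x. (T (\<lambda>x. f i x + (\<Sum>i\<in>I. f i x)) x - (T (f i) x + T (\<lambda>x. \<Sum>i\<in>I. f i x) x)) +
     (T (\<lambda>x. \<Sum>i\<in>I. f i x) x - (\<Sum>i\<in>I. T (f i) x))) \<in> Z"
    using insert by (intro Z_add T_add insert.IH C_sum) auto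
  then show ?case using insert by (simp add: algebra_simps)
qed

text \<open>Apply \<open>T\<close> to \<open>d v = \<Sum> p_j w_j + z\<close>. The twisted product
  rule leaves \<open>\<tau> d\<close> times \<open>T v\<close> plus terms already in the span, and
  \<open>\<tau> d\<close> is nonzero, so it can be cancelled. The remainder \<open>z\<close> lies in
  both \<open>C\<close> and \<open>Z\<close>, as \<open>T_Z\<close> asks.\<close>

lemma T_sspan:
  assumes "stable J w" "v \<in> sspan J w" "v \<in> C"
  shows "T v \<in> sspan J w"
proof -
  have J: "finite J" "\<And>j. j \<in> J \<Longrightarrow> w j \<in> C" "\<And>j. j \<in> J \<Longrightarrow> T (w j) \<in> sspan J w"
    using assms(1) by (auto simp: stable_def)
  obtain d p where 1: "d \<noteq> 0"
    "(\<lambda>x. poly d (\<theta> x) * v x - (\<Sum>j\<in>J. poly (p j) (\<theta> x) * w j x)) \<in> Z"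
    using assms(2) by (rule sspanE)
  let ?dv = "\<lambda>x. poly d (\<theta> x) * v x"
  let ?s = "\<lambda>x. \<Sum>j\<in>J. poly (p j) (\<theta> x) * w j x"
  let ?z = "\<lambda>x. ?dv x - ?s x"
  have C: "?dv \<in> C" "?s \<in> C" by (intro C_scale C_sum assms J)+
  then have zC: "?z \<in> C" by (rule C_diff)
  have *: "T (\<lambda>x. poly (p j) (\<theta> x) * w j x) \<in> sspan J w" if "j \<in> J" for j
    by (rule sspan_cong[OF _ T_scale]) (intro sspan_add sspan_scale sspan_base J that)+
  have s: "T ?s \<in> sspan J w"
    by (rule sspan_cong[OF _ T_sum]) (use J in \<open>auto intro!: sspan_sum * C_scale\<close>)
  have "(\<lambda>x. T (\<lambda>x. ?s x + ?z x) x - (T ?s x + T ?z x)) \<in> Z"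
    by (intro T_add C zC)
  then have "(\<lambda>x. T ?dv x - (T ?s x + T ?z x)) \<in> Z" by simp
  then have dv: "T ?dv \<in> sspan J w"
    by (rule sspan_cong[rotated]) (intro sspan_add s sspan_Z T_Z zC 1)
  have "(\<lambda>x. poly (\<tau> d) (\<theta> x) * T v x) \<in> sspan J w"
  proof (rule sspan_cong)
    show "(\<lambda>x. T ?dv x - poly (\<eta> d) (\<theta> x) * v x) \<in> sspan J w"
      by (intro sspan_diff dv sspan_scale assms)
    have "(\<lambda>x. -1 * (T ?dv x - (poly (\<tau> d) (\<theta> x) * T v x + poly (\<eta> d) (\<theta> x) * v x))) \<in> Z"
      by (intro Z_cmult T_scale assms)
    then show "(\<lambda>x. poly (\<tau> d) (\<theta> x) * T v x - (T ?dv x - poly (\<eta> d) (\<theta> x) * v x)) \<in> Z"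
      by (simp add: algebra_simps)
  qed
  then show ?thesis using \<tau>_nonzero[OF 1(1)] by (rule sspan_sat)
qed

lemma funpow_sspan:
  "stable J w \<Longrightarrow> v \<in> sspan J w \<Longrightarrow> v \<in> C \<Longrightarrow> (T ^^ n) v \<in> sspan J w"
  by (induction n) (auto intro: T_sspan C_funpow)

lemma has_relationI:
  assumes "i \<le> N" "k i \<noteq> 0" "(\<lambda>x. \<Sum>i\<le>N. poly (k i) (\<theta> x) * (T ^^ i) v x) \<in> Z"
  shows "has_relation v"
proof -
  define n where "n = Max {i. i \<le> N \<and> k i \<noteq> 0}"
  have fin: "finite {i. i \<le> N \<and> k i \<noteq> 0}" by simp
  have "n \<in> {i. i \<le> N \<and> k i \<noteq> 0}"
    unfolding n_def by (rule Max_in[OF fin]) (use assms in auto)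
  then have n: "n \<le> N" "k n \<noteq> 0" by auto
  have gt: "k i = 0" if "n < i" "i \<le> N" for i
    using that Max_ge[OF fin, of i] unfolding n_def by fastforce
  have "(\<Sum>i\<le>N. poly (k i) (\<theta> x) * (T ^^ i) v x) = (\<Sum>i\<le>n. poly (k i) (\<theta> x) * (T ^^ i) v x)" for x
    by (rule sum.mono_neutral_right) (use n gt in \<open>auto simp: not_le\<close>)
  then show ?thesis using assms(3) n unfolding has_relation_def by auto
qed

text \<open>The first \<open>card J + 1\<close> iterates stay in a span of \<open>card J\<close>
  generators and are therefore dependent.\<close>

lemma has_relationI_sspan:
  assumes "stable J w" "v \<in> sspan J w" "v \<in> C"
  shows "has_relation v"
proof -
  have J: "finite J" using assms by (auto simp: stable_def)
  obtain k where k: "\<exists>i\<in>{..card J}. k i \<noteq> 0" "(\<lambda>x. \<Sum>i\<le>card J. poly (k i) (\<theta> x) * (T ^^ i) v x) \<in> Z"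
    using sspan_dependent[OF J, of "{..card J}" "\<lambda>i. (T ^^ i) v" w] funpow_sspan[OF assms] by auto
  then show ?thesis using has_relationI[of _ "card J" k v] by auto
qed

lemma relation_stable:
  assumes "p n \<noteq> 0" "(\<lambda>x. \<Sum>i\<le>n. poly (p i) (\<theta> x) * (T ^^ i) f x) \<in> Z" "f \<in> C"
  shows "stable {..<n} (\<lambda>i. (T ^^ i) f)" "f \<in> sspan {..<n} (\<lambda>i. (T ^^ i) f)"
proof -
  let ?w = "\<lambda>i. (T ^^ i) f"
  have top: "(T ^^ n) f \<in> sspan {..<n} ?w"
    by (rule sspanI[OF assms(1), of _ "\<lambda>i. - p i"])
       (use assms(2) in \<open>simp add: sum_negf lessThan_Suc_atMost[symmetric] add.commute\<close>)
  show "stable {..<n} ?w"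
    unfolding stable_def
  proof safe
    fix j assume "j < n"
    then consider "Suc j < n" | "Suc j = n" by linarith
    then show "T ((T ^^ j) f) \<in> sspan {..<n} ?w"
    proof cases
      case 1
      then show ?thesis using sspan_base[of "{..<n}" "Suc j" ?w] by simp
    next
      case 2
      then show ?thesis using top by auto
    qed
  qed (auto intro: C_funpow assms)
  show "f \<in> sspan {..<n} ?w"
  proof (cases "n = 0")
    case True
    then show ?thesis using top by simp
  next
    case False
    then show ?thesis using sspan_base[of "{..<n}" 0 ?w] by simp
  qed
qed

lemma has_relationE:
  assumes "has_relation f" "f \<in> C"
  obtains n where "stable {..<n} (\<lambda>i. (T ^^ i) f)" "f \<in> sspan {..<n} (\<lambda>i. (T ^^ i) f)"
proof -
  obtain n p where "p n \<noteq> 0" "(\<lambda>x. \<Sum>i\<le>n. poly (p i) (\<theta> x) * (T ^^ i) f x) \<in> Z"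
    using assms(1) unfolding has_relation_def by blast
  from relation_stable[OF this assms(2)] show ?thesis by (rule that)
qed

lemma sspan_mono_inj:
  assumes "inj_on h J" "h ` J \<subseteq> K" "finite K" "\<And>j. j \<in> J \<Longrightarrow> w j = u (h j)" "v \<in> sspan J w"
  shows "v \<in> sspan K u"
  using assms(5)
proof (rule sspan_trans)
  fix j assume "j \<in> J"
  then show "w j \<in> sspan K u" using sspan_base[of K "h j" u] assms by auto
qed

text \<open>The two stable systems are put side by side over the disjoint sum of their index
  sets.\<close>

lemma has_relation_add:
  assumes "has_relation f" "has_relation g" "f \<in> C" "g \<in> C"
  shows "has_relation (\<lambda>x. f x + g x)"
proof -
  obtain n where n: "stable {..<n} (\<lambda>i. (T ^^ i) f)" "f \<in> sspan {..<n} (\<lambda>i. (T ^^ i) f)"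
    using assms(1,3) by (rule has_relationE)
  obtain m where m: "stable {..<m} (\<lambda>i. (T ^^ i) g)" "g \<in> sspan {..<m} (\<lambda>i. (T ^^ i) g)"
    using assms(2,4) by (rule has_relationE)
  define K where "K = {..<n} <+> {..<m}"
  define u where "u = case_sum (\<lambda>i. (T ^^ i) f) (\<lambda>i. (T ^^ i) g)"
  have l: "v \<in> sspan K u" if "v \<in> sspan {..<n} (\<lambda>i. (T ^^ i) f)" for v
    by (rule sspan_mono_inj[OF _ _ _ _ that, of Inl]) (auto simp: K_def u_def)
  have r: "v \<in> sspan K u" if "v \<in> sspan {..<m} (\<lambda>i. (T ^^ i) g)" for v
    by (rule sspan_mono_inj[OF _ _ _ _ that, of Inr]) (auto simp: K_def u_def)
  show ?thesis
  proof (rule has_relationI_sspan)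
    show "stable K u" using n(1) m(1) l r unfolding stable_def by (auto simp: K_def u_def)
    show "(\<lambda>x. f x + g x) \<in> sspan K u" by (intro sspan_add l r n m)
  qed (intro C_add assms)
qed

lemma has_relation_scale:
  assumes "has_relation f" "f \<in> C"
  shows "has_relation (\<lambda>x. poly p (\<theta> x) * f x)"
proof -
  obtain n where n: "stable {..<n} (\<lambda>i. (T ^^ i) f)" "f \<in> sspan {..<n} (\<lambda>i. (T ^^ i) f)"
    using assms by (rule has_relationE)
  show ?thesis by (rule has_relationI_sspan[OF n(1)]) (intro sspan_scale n C_scale assms)+
qed

lemma has_relation_cong:
  assumes "has_relation f" "f \<in> C" "g \<in> C" "(\<lambda>x. g x - f x) \<in> Z"
  shows "has_relation g"
proof -
  obtain n where n: "stable {..<n} (\<lambda>i. (T ^^ i) f)" "f \<in> sspan {..<n} (\<lambda>i. (T ^^ i) f)"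
    using assms(1,2) by (rule has_relationE)
  show ?thesis by (rule has_relationI_sspan[OF n(1)]) (rule sspan_cong[OF n(2) assms(4)], rule assms)
qed

lemma has_relation_T:
  assumes "has_relation f" "f \<in> C"
  shows "has_relation (T f)"
proof -
  obtain n where n: "stable {..<n} (\<lambda>i. (T ^^ i) f)" "f \<in> sspan {..<n} (\<lambda>i. (T ^^ i) f)"
    using assms by (rule has_relationE)
  show ?thesis by (rule has_relationI_sspan[OF n(1)]) (intro T_sspan n T_C assms)+
qed

lemma has_relation_zero: "has_relation (\<lambda>_. 0)"
  unfolding has_relation_def by (rule exI[of _ 0], rule exI[of _ "\<lambda>_. 1"]) (simp add: Z_zero)

lemma has_relation_sum:
  "(\<And>i. i \<in> I \<Longrightarrow> f i \<in> C \<and> has_relation (f i)) \<Longrightarrow> has_relation (\<lambda>x. \<Sum>i\<in>I. f i x)"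
proof (induction I rule: infinite_finite_induct)
  case (insert i I)
  have "has_relation (\<lambda>x. f i x + (\<Sum>i\<in>I. f i x))"
    using insert by (intro has_relation_add C_sum) auto
  then show ?case using insert by simp
qed (simp_all add: has_relation_zero)

end

section \<open>Recurrences with coefficients polynomial in \<open>q ^ k\<close> and in
  \<open>k\<close>\<close>

lemma coeff_mult_at_bounds:
  assumes "degree p \<le> a" "degree r \<le> b"
  shows "coeff (p * r) (a + b) = coeff p a * coeff r b"
proof -
  have "coeff (p * r) (a + b) = (\<Sum>i\<le>a + b. coeff p i * coeff r (a + b - i))"
    by (rule coeff_mult)
  also have "\<dots> = (\<Sum>i\<in>{a}. coeff p i * coeff r (a + b - i))"
  proof (rule sum.mono_neutral_right)
    show "\<forall>i\<in>{..a + b} - {a}. coeff p i * coeff r (a + b - i) = 0"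
    proof
      fix i assume "i \<in> {..a + b} - {a}"
      then consider "i > a" | "a + b - i > b" by fastforce
      then show "coeff p i * coeff r (a + b - i) = 0"
        using assms by cases (auto simp: coeff_eq_0)
    qed
  qed auto
  finally show ?thesis by simp
qed

text \<open>The coefficient next to the top one is where a translation of the variable first becomes
  visible.\<close>

lemma coeff_pcompose_translate:
  fixes p :: "'a :: idom poly"
  assumes "degree p \<le> Suc e"
  shows "coeff (pcompose p [:h, 1:]) e = coeff p e + of_nat (Suc e) * h * coeff p (Suc e)"
  using assms
proof (induction p arbitrary: e)
  case 0
  then show ?case by simp
next
  case (pCons c p)
  have deg: "degree p \<le> e"
    using pCons.prems by (cases "p = 0") auto
  have top: "coeff (pcompose p [:h, 1:]) e = coeff p e"
  proof (cases "degree p = e")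
    case True
    have "lead_coeff (pcompose p [:h, 1:]) = lead_coeff p * 1 ^ degree p"
      using lead_coeff_comp[of "[:h, 1:]" p] by simp
    moreover have "degree (pcompose p [:h, 1:]) = e" using True by (simp add: degree_pcompose)
    ultimately show ?thesis using True by simp
  next
    case False
    then show ?thesis using deg by (simp add: coeff_eq_0 degree_pcompose)
  qed
  show ?case
  proof (cases e)
    case 0
    then show ?thesis using top deg by (simp add: pcompose_pCons)
  next
    case (Suc e')
    have "coeff (pcompose p [:h, 1:]) e' = coeff p e' + of_nat (Suc e') * h * coeff p (Suc e')"
      using pCons.IH[of e'] deg Suc by simp
    then show ?thesis using top Suc by (simp add: pcompose_pCons algebra_simps)
  qed
qed

locale not_root_of_unity =
  fixes q :: complex
  assumes q_nonzero: "q \<noteq> 0" and q_power: "\<And>k. k > 0 \<Longrightarrow> q ^ k \<noteq> 1"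
begin

lemma q_power_inj: "q ^ i = q ^ j \<longleftrightarrow> i = j"
proof -
  have *: "q ^ i \<noteq> q ^ j" if "i < j" for i j
  proof
    assume "q ^ i = q ^ j"
    also have "\<dots> = q ^ i * q ^ (j - i)" using that by (simp flip: power_add)
    finally show False using q_nonzero q_power[of "j - i"] that by simp
  qed
  then show ?thesis by (metis linorder_neqE_nat)
qed

text \<open>The substitution \<open>X \<mapsto> X / q\<close>, which is the effect of
  \<open>k \<mapsto> k - 1\<close> on a polynomial in \<open>q ^ k\<close>.\<close>

definition dil :: "complex poly \<Rightarrow> complex poly" where "dil p = pcompose p [:0, 1 / q:]"

lemma coeff_dil: "coeff (dil p) n = coeff p n * (1 / q) ^ n"
  unfolding dil_def by (induction p arbitrary: n) (auto simp: pcompose_pCons coeff_pCons split: nat.splits)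

lemma degree_dil: "degree (dil p) = degree p"
  using q_nonzero by (simp add: dil_def degree_pcompose)

lemma dil_eq_0_iff: "dil p = 0 \<longleftrightarrow> p = 0"
  using q_nonzero by (simp add: dil_def pcompose_eq_0_iff)

text \<open>Divided by \<open>A * dil A\<close>, the assumption says that the rational function
  \<open>f = B / A\<close> satisfies \<open>f(X / q) = f(X) + d\<close>. If \<open>B\<close> has
  larger degree than \<open>A\<close>, the leading terms carry different powers of \<open>q\<close>;
  otherwise they cancel in the top degree and the contribution of \<open>d\<close> remains.\<close>

lemma no_additive_cocycle:
  assumes "A \<noteq> 0" "d > 0" "dil A * B - A * (dil B - of_nat d * dil A) = 0"
  shows False
proof -
  define \<alpha> \<beta> where "\<alpha> = degree A" and "\<beta> = degree B"
  have A: "coeff A \<alpha> \<noteq> 0" using assms(1) by (simp add: \<alpha>_def)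
  have eq: "dil A * B - A * dil B + smult (of_nat d) (A * dil A) = 0"
    using assms(3) by (simp add: algebra_simps of_nat_poly)
  show False
  proof (cases "\<beta> > \<alpha>")
    case True
    then have B: "coeff B \<beta> \<noteq> 0" by (auto simp: \<alpha>_def \<beta>_def leading_coeff_0_iff)
    have "coeff (A * dil A) (\<alpha> + \<beta>) = 0"
      using True degree_mult_le[of A "dil A"] by (intro coeff_eq_0) (simp add: degree_dil \<alpha>_def \<beta>_def)
    then have "coeff (dil A * B - A * dil B + smult (of_nat d) (A * dil A)) (\<alpha> + \<beta>)
       = coeff A \<alpha> * coeff B \<beta> * ((1 / q) ^ \<alpha> - (1 / q) ^ \<beta>)"
      using coeff_mult_at_bounds[of "dil A" \<alpha> B \<beta>] coeff_mult_at_bounds[of A \<alpha> "dil B" \<beta>]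
      by (simp add: coeff_dil degree_dil \<alpha>_def \<beta>_def algebra_simps)
    then have "(1 / q) ^ \<alpha> = (1 / q) ^ \<beta>" using A B eq by simp
    then have "q ^ \<alpha> = q ^ \<beta>" using q_nonzero by (simp add: power_divide)
    then show False using True by (simp add: q_power_inj)
  next
    case False
    then have "degree B \<le> \<alpha>" by (simp add: \<beta>_def)
    then have "coeff (dil A * B - A * dil B + smult (of_nat d) (A * dil A)) (\<alpha> + \<alpha>)
       = of_nat d * (1 / q) ^ \<alpha> * coeff A \<alpha> * coeff A \<alpha>"
      by (simp add: coeff_mult_at_bounds coeff_dil degree_dil \<alpha>_def algebra_simps)
    then show False using A eq q_nonzero assms(2) by simp
  qed
qed

end

definition shift :: "(nat \<Rightarrow> complex) \<Rightarrow> nat \<Rightarrow> complex" where "shift c = (\<lambda>k. c (Suc k))"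

lemma funpow_shift: "(shift ^^ i) c = (\<lambda>k. c (k + i))"
  by (induction i) (auto simp: shift_def)

text \<open>Two instances occur: the eventually zero sequences, and the sequences that some nonzero
  polynomial in \<open>q ^ k\<close> turns into exponential polynomials. Saturation makes the
  quotient torsion-free, and closure under the shift in both directions lets annihilators be
  transported along it.\<close>

locale saturated_sequence_ideal = not_root_of_unity + polymod "\<lambda>k. q ^ k" Z for Z +
  assumes Z_saturated: "d \<noteq> 0 \<Longrightarrow> (\<lambda>k. poly d (q ^ k) * c k) \<in> Z \<Longrightarrow> c \<in> Z"
    and Z_index: "c \<in> Z \<Longrightarrow> (\<lambda>k. of_nat k * c k) \<in> Z"
    and Z_shift: "c \<in> Z \<Longrightarrow> shift c \<in> Z"
    and Z_unshift: "shift c \<in> Z \<Longrightarrow> c \<in> Z"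
    and Z_eventually_zero: "eventually (\<lambda>k. c k = 0) sequentially \<Longrightarrow> c \<in> Z"
begin

sublocale S: skew_operator "\<lambda>k. q ^ k" Z UNIV shift "\<lambda>p. pcompose p [:0, q:]" "\<lambda>_. 0"
proof
  fix f p
  have "poly (pcompose p [:0, q:]) (q ^ k) = poly p (q ^ Suc k)" for k
    by (simp add: poly_pcompose mult.commute)
  then show "(\<lambda>x. shift (\<lambda>x. poly p (q ^ x) * f x) x - (poly (pcompose p [:0, q:]) (q ^ x) * shift f x + poly 0 (q ^ x) * f x)) \<in> Z"
    by (simp add: shift_def Z_zero)
  assume "p \<noteq> 0"
  then show "pcompose p [:0, q:] \<noteq> 0" using q_nonzero by (simp add: pcompose_eq_0_iff)
qed (auto simp: shift_def Z_zero intro: Z_shift[unfolded shift_def])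

sublocale K: skew_operator "\<lambda>k. q ^ k" Z UNIV "\<lambda>c k. of_nat k * c k" "\<lambda>p. p" "\<lambda>_. 0"
proof
  fix f assume "f \<in> Z"
  then show "(\<lambda>k. of_nat k * f k) \<in> Z" by (rule Z_index)
qed (simp_all add: Z_zero algebra_simps)

text \<open>The outer variable stands for the index \<open>k\<close>, the variable of the
  coefficients for \<open>q ^ k\<close>, so \<open>degree a\<close> is the degree in
  \<open>k\<close>.\<close>

definition bieval :: "complex poly poly \<Rightarrow> nat \<Rightarrow> complex" where
  "bieval a k = poly (poly a [:of_nat k:]) (q ^ k)"

lemma bieval_simps [simp]:
  "bieval (a * b) k = bieval a k * bieval b k"
  "bieval (a - b) k = bieval a k - bieval b k"
  "bieval (smult c a) k = poly c (q ^ k) * bieval a k"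
  "bieval 1 k = 1"
  by (simp_all add: bieval_def)

lemma bieval_altdef: "bieval a k = (\<Sum>i\<le>degree a. poly (coeff a i) (q ^ k) * of_nat k ^ i)"
  by (simp add: bieval_def poly_altdef[of a] poly_sum poly_power)

lemma index_power_Z: "c \<in> Z \<Longrightarrow> (\<lambda>k. of_nat k ^ i * c k) \<in> Z"
proof (induction i)
  case (Suc i)
  from Z_index[OF Suc.IH[OF Suc.prems]] show ?case by (simp add: mult.assoc)
qed simp

lemma bieval_Z:
  assumes "c \<in> Z"
  shows "(\<lambda>k. bieval a k * c k) \<in> Z"
proof -
  have "(\<lambda>k. \<Sum>i\<le>degree a. poly (coeff a i) (q ^ k) * (of_nat k ^ i * c k)) \<in> Z"
    by (intro Z_sum Z_scale index_power_Z assms)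
  then show ?thesis by (simp add: bieval_altdef sum_distrib_right mult.assoc)
qed

text \<open>Conjugation by the shift: modulo \<open>Z\<close>, this annihilates \<open>v\<close>
  exactly when \<open>a\<close> annihilates \<open>shift v\<close>.\<close>

definition unshift_poly :: "complex poly poly \<Rightarrow> complex poly poly" where
  "unshift_poly a = pcompose (map_poly dil a) [:-1, 1:]"

lemma bieval_unshift_poly: "bieval (unshift_poly a) (Suc k) = bieval a k"
proof -
  have "poly (poly (map_poly dil a) [:x:]) (q * y) = poly (poly a [:x:]) y" for x y
    by (induction a) (auto simp: map_poly_pCons dil_def poly_pcompose q_nonzero pcompose_0)
  from this[of "of_nat k" "q ^ k"] show ?thesis
    by (simp add: bieval_def unshift_poly_def poly_pcompose one_pCons)
qed

lemma degree_map_dil: "degree (map_poly dil a) = degree a"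
  by (rule degree_map_poly) (simp add: dil_eq_0_iff)

lemma coeff_map_dil: "coeff (map_poly dil a) n = dil (coeff a n)"
  by (rule coeff_map_poly) (simp add: dil_eq_0_iff)

lemma degree_unshift_poly: "degree (unshift_poly a) = degree a"
  by (simp add: unshift_poly_def degree_map_dil degree_pcompose)

lemma lead_coeff_unshift_poly: "coeff (unshift_poly a) (degree a) = dil (coeff a (degree a))"
  using lead_coeff_comp[of "[:-1, 1 :: complex poly:]" "map_poly dil a"]
  by (simp add: unshift_poly_def degree_map_dil coeff_map_dil degree_pcompose)

text \<open>The monic minimal polynomial of the multiplication by the index \<open>k\<close> on such a space would be
  invariant under \<open>k \<mapsto> k - 1\<close>, \<open>q\<^sup>k \<mapsto> q\<^sup>k / q\<close>; the trace coefficient forbids this.\<close>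

lemma shift_index_stable_trivial:
  assumes "S.stable J m" "K.stable J m" "g \<in> sspan J m"
  shows "g \<in> Z"
proof (rule ccontr)
  assume g: "g \<notin> Z"
  have J: "finite J" using assms by (auto simp: S.stable_def)
  \<comment> \<open>The annihilator of the whole span in C[q^k][k]. It is nonzero: each generator
    has a relation for the multiplication by the index, and the product of these polynomials kills
    all generators.\<close>
  define ann where "ann = (\<lambda>a. \<forall>v\<in>sspan J m. (\<lambda>k. bieval a k * v k) \<in> Z)"
  have "\<exists>a. a \<noteq> 0 \<and> ann a"
  proof -
    have "\<exists>a. a \<noteq> 0 \<and> (\<lambda>k. bieval a k * m j k) \<in> Z" if j: "j \<in> J" for j
    proof -
      have "K.has_relation (m j)"
        by (rule K.has_relationI_sspan[OF assms(2)]) (use sspan_base[OF J j] in auto)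
      then obtain n p where np: "p n \<noteq> 0"
        "(\<lambda>k. \<Sum>i\<le>n. poly (p i) (q ^ k) * ((\<lambda>c k. of_nat k * c k) ^^ i) (m j) k) \<in> Z"
        unfolding K.has_relation_def by blast
      have pow: "((\<lambda>c k. of_nat k * c k) ^^ i) c = (\<lambda>k. of_nat k ^ i * c k)" for i and c :: "nat \<Rightarrow> complex"
        by (induction i) (auto simp: algebra_simps)
      define a where "a = (\<Sum>i\<le>n. monom (p i) i)"
      have "coeff a n = p n" by (simp add: a_def coeff_sum)
      then have "a \<noteq> 0" using np by auto
      moreover have "bieval a k = (\<Sum>i\<le>n. poly (p i) (q ^ k) * of_nat k ^ i)" for k
        by (simp add: bieval_def a_def poly_sum poly_monom poly_power)
      ultimately show ?thesis using np(2)
        by (intro exI[of _ a]) (simp add: pow sum_distrib_right mult.assoc)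
    qed
    then have "\<forall>j\<in>J. \<exists>a. a \<noteq> 0 \<and> (\<lambda>k. bieval a k * m j k) \<in> Z" by blast
    from bchoice[OF this] obtain a where a: "\<And>j. j \<in> J \<Longrightarrow> a j \<noteq> 0"
      "\<And>j. j \<in> J \<Longrightarrow> (\<lambda>k. bieval (a j) k * m j k) \<in> Z" by blast
    define b where "b = (\<Prod>j\<in>J. a j)"
    have "b \<noteq> 0" using a J by (simp add: b_def)
    moreover have bm: "(\<lambda>k. bieval b k * m j k) \<in> Z" if "j \<in> J" for j
    proof -
      have "(\<lambda>k. bieval (\<Prod>j\<in>J - {j}. a j) k * (bieval (a j) k * m j k)) \<in> Z"
        by (intro bieval_Z a that)
      moreover have "bieval b k = bieval (\<Prod>j\<in>J - {j}. a j) k * bieval (a j) k" for k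
        using J that by (simp add: b_def prod.remove)
      ultimately show ?thesis by (simp add: mult.assoc)
    qed
    moreover have "ann b"
      unfolding ann_def
    proof
      fix v assume "v \<in> sspan J m"
      then obtain d p where dp: "d \<noteq> 0"
        "(\<lambda>k. poly d (q ^ k) * v k - (\<Sum>j\<in>J. poly (p j) (q ^ k) * m j k)) \<in> Z" by (rule sspanE)
      have "(\<lambda>k. bieval b k * (poly d (q ^ k) * v k - (\<Sum>j\<in>J. poly (p j) (q ^ k) * m j k))
          + (\<Sum>j\<in>J. poly (p j) (q ^ k) * (bieval b k * m j k))) \<in> Z"
        by (rule Z_add[OF bieval_Z[OF dp(2)]], rule Z_sum, rule Z_scale, rule bm)
      then have "(\<lambda>k. poly d (q ^ k) * (bieval b k * v k)) \<in> Z"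
        by (simp add: algebra_simps sum_distrib_left)
      then show "(\<lambda>k. bieval b k * v k) \<in> Z" by (rule Z_saturated[OF dp(1)])
    qed
    ultimately show ?thesis by blast
  qed
  then obtain a where a: "a \<noteq> 0" "ann a" "\<And>b. b \<noteq> 0 \<Longrightarrow> ann b \<Longrightarrow> degree a \<le> degree b"
    using ex_has_least_nat[of "\<lambda>a. a \<noteq> 0 \<and> ann a" _ degree] by blast
  define d where "d = degree a"
  \<comment> \<open>A polynomial of degree \<open>0\<close> in \<open>k\<close> is a nonzero
    polynomial in \<open>q ^ k\<close>; by saturation it can only annihilate elements of the
    ideal.\<close>
  have "d > 0"
  proof (rule ccontr)
    assume "\<not> d > 0"
    then obtain c where c: "a = [:c:]" by (auto simp: d_def elim: degree_eq_zeroE)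
    have "(\<lambda>k. poly c (q ^ k) * g k) \<in> Z"
      using a(2) assms(3) c by (auto simp: ann_def bieval_def)
    then show False using g a(1) c Z_saturated[of c g] by auto
  qed
  define a' where "a' = unshift_poly a"
  have ann': "ann a'"
    unfolding ann_def
  proof
    fix v assume "v \<in> sspan J m"
    then have "shift v \<in> sspan J m" using S.T_sspan[OF assms(1)] by auto
    then have "(\<lambda>k. bieval a k * shift v k) \<in> Z" using a(2) by (auto simp: ann_def)
    also have "(\<lambda>k. bieval a k * shift v k) = shift (\<lambda>k. bieval a' k * v k)"
      by (simp add: shift_def a'_def bieval_unshift_poly)
    finally show "(\<lambda>k. bieval a' k * v k) \<in> Z" by (rule Z_unshift)
  qed
  define A B where "A = coeff a d" and "B = coeff a (d - 1)"
  have A: "A \<noteq> 0" using a(1) by (simp add: A_def d_def)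
  have a'_coeff: "coeff a' d = dil A" "coeff a' (d - 1) = dil B - of_nat d * dil A"
  proof -
    show "coeff a' d = dil A" by (simp add: a'_def d_def A_def lead_coeff_unshift_poly)
    have "degree (map_poly dil a) \<le> Suc (d - 1)" using \<open>d > 0\<close> by (simp add: degree_map_dil d_def)
    from coeff_pcompose_translate[OF this, of "-1"]
    show "coeff a' (d - 1) = dil B - of_nat d * dil A"
      using \<open>d > 0\<close> by (simp add: a'_def unshift_poly_def coeff_map_dil A_def B_def)
  qed
  \<comment> \<open>Both summands have the coefficient \<open>A * dil A\<close> in degree
    \<open>d\<close>, so \<open>b\<close> is an annihilator of smaller degree and must vanish. Its
    coefficient in degree \<open>d - 1\<close> is the identity excluded by
    \<open>no_additive_cocycle\<close>.\<close>
  define b where "b = smult (dil A) a - smult A a'"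
  have "b = 0"
  proof (rule ccontr)
    assume b: "b \<noteq> 0"
    have "ann b"
      unfolding ann_def
    proof
      fix v assume v: "v \<in> sspan J m"
      have "(\<lambda>k. poly (dil A) (q ^ k) * (bieval a k * v k) - poly A (q ^ k) * (bieval a' k * v k)) \<in> Z"
        by (intro Z_diff Z_scale) (use a(2) ann' v in \<open>auto simp: ann_def\<close>)
      then show "(\<lambda>k. bieval b k * v k) \<in> Z" by (simp add: b_def algebra_simps)
    qed
    then have "d \<le> degree b" using a(3)[OF b] by (simp add: d_def)
    moreover have "degree b \<le> d"
      unfolding b_def by (intro degree_diff_le order_trans[OF degree_smult_le])
        (simp_all add: d_def a'_def degree_unshift_poly)
    moreover have "coeff b d = 0" by (simp add: b_def a'_coeff A_def mult.commute)
    ultimately show False using b by (metis le_antisym leading_coeff_0_iff)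
  qed
  then have "coeff b (d - 1) = 0" by simp
  then have "dil A * B - A * (dil B - of_nat d * dil A) = 0"
    using a'_coeff(2) by (simp add: b_def B_def)
  then show False by (rule no_additive_cocycle[OF A \<open>d > 0\<close>])
qed

end

lemma poly_as_sum_le:
  fixes x :: "'a :: comm_semiring_1"
  assumes "degree p \<le> n"
  shows "poly p x = (\<Sum>j\<le>n. coeff p j * x ^ j)"
  unfolding poly_altdef using assms
  by (intro sum.mono_neutral_left) (auto simp: coeff_eq_0)

context saturated_sequence_ideal
begin

abbreviation index_power :: "nat \<Rightarrow> (nat \<Rightarrow> complex) \<Rightarrow> nat \<Rightarrow> complex" where
  "index_power j v \<equiv> (\<lambda>k. of_nat k ^ j * v k)"

lemma index_power_sspan:
  assumes "v \<in> sspan I w"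
  shows "index_power j v \<in> sspan I (\<lambda>i. index_power j (w i))"
proof -
  obtain d p where 1: "d \<noteq> 0"
    "(\<lambda>k. poly d (q ^ k) * v k - (\<Sum>i\<in>I. poly (p i) (q ^ k) * w i k)) \<in> Z"
    using assms by (rule sspanE)
  from index_power_Z[OF 1(2), of j] show ?thesis
    by (intro sspanI[OF 1(1), of _ p]) (simp add: algebra_simps sum_distrib_left)
qed

lemma shift_index_power:
  "shift (index_power D v) =
     (\<lambda>k. \<Sum>l\<le>D. of_nat (D choose l) * index_power l (shift v) k)"
proof
  fix k
  have "(of_nat (Suc k) :: complex) ^ D = (\<Sum>l\<le>D. of_nat (D choose l) * of_nat k ^ l)"
    using binomial_ring[of "of_nat k :: complex" 1 D] by (simp add: add.commute)
  then show "shift (index_power D v) k = (\<Sum>l\<le>D. of_nat (D choose l) * index_power l (shift v) k)"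
    by (simp add: shift_def sum_distrib_right mult.assoc)
qed

definition order_le :: "(nat \<Rightarrow> complex) \<Rightarrow> nat \<Rightarrow> bool" where
  "order_le g n \<longleftrightarrow> (\<exists>p. p n \<noteq> 0 \<and> (\<lambda>k. \<Sum>i\<le>n. poly (p i) (q ^ k) * (shift ^^ i) g k) \<in> Z)"

text \<open>Among the elements of \<open>B\<close> outside \<open>Z\<close>, take \<open>g\<close>
  with a \<open>q ^ k\<close>-recurrence of least order \<open>n\<close>, and let \<open>U\<close>
  be the span of its shifts. By minimality, every element of \<open>B\<close> in \<open>U\<close>
  outside \<open>Z\<close> generates \<open>U\<close> with its shifts. Sorting the other recurrence
  of \<open>g\<close> by powers of \<open>k\<close> gives combinations \<open>u j\<close> of shifts
  of \<open>g\<close> with constant coefficients. Were some \<open>u j\<close> outside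
  \<open>Z\<close>, the last such index \<open>D\<close> would make the sum of the spaces
  \<open>k ^ j U\<close>, \<open>j < D\<close>, stable under the shift and under multiplication by
  \<open>k\<close>, which is impossible. So every \<open>u j\<close> lies in \<open>Z\<close>, and
  \<open>const\<close> applies.\<close>

theorem bifinite_in_ideal:
  assumes B_add: "\<And>f g. f \<in> B \<Longrightarrow> g \<in> B \<Longrightarrow> (\<lambda>k. f k + g k) \<in> B"
    and B_cmult: "\<And>f c. f \<in> B \<Longrightarrow> (\<lambda>k. c * f k) \<in> B"
    and B_shift: "\<And>f. f \<in> B \<Longrightarrow> shift f \<in> B"
    and QF: "\<And>f. f \<in> B \<Longrightarrow> S.has_relation f"
    and PF: "\<And>f. f \<in> B \<Longrightarrow> \<exists>n P. P n \<noteq> 0 \<and>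
       (\<lambda>k. \<Sum>i\<le>n. poly (P i) (of_nat k) * f (k + i)) \<in> Z"
    and const: "\<And>f n p i. f \<in> B \<Longrightarrow> i \<le> n \<Longrightarrow> p i \<noteq> 0 \<Longrightarrow>
       (\<lambda>k. \<Sum>i\<le>n. p i * f (k + i)) \<in> Z \<Longrightarrow> f \<in> Z"
    and "f \<in> B"
  shows "f \<in> Z"
proof (rule ccontr)
  assume "f \<notin> Z"
  define R where "R = (\<lambda>n. \<exists>g. g \<in> B \<and> g \<notin> Z \<and> order_le g n)"
  have "\<exists>n. R n"
    using QF[OF \<open>f \<in> B\<close>] \<open>f \<in> B\<close> \<open>f \<notin> Z\<close>
    unfolding R_def order_le_def S.has_relation_def by blast
  then obtain n where n: "R n" "\<And>m. R m \<Longrightarrow> n \<le> m"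
    by (metis LeastI_ex Least_le)
  then obtain g p where g: "g \<in> B" "g \<notin> Z" and p: "p n \<noteq> 0"
    "(\<lambda>k. \<Sum>i\<le>n. poly (p i) (q ^ k) * (shift ^^ i) g k) \<in> Z"
    unfolding R_def order_le_def by blast
  define w where "w = (\<lambda>i. (shift ^^ i) g)"
  define U where "U = sspan {..<n} w"
  note st = S.relation_stable[of p n g, OF p UNIV_I, folded w_def]
  have gU: "g \<in> U" unfolding U_def by (rule st)
  have U_shift: "shift v \<in> U" if "v \<in> U" for v
    using S.T_sspan[OF st(1)] that by (auto simp: U_def)
  have npos: "n > 0"
  proof (rule ccontr)
    assume "\<not> n > 0"
    then have "(\<lambda>k. poly (p 0) (q ^ k) * g k) \<in> Z" "p 0 \<noteq> 0" using p by auto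
    then show False using g Z_saturated by blast
  qed
  \<comment> \<open>A dependence among the first \<open>n\<close> shifts of \<open>u\<close> is a
    relation of order below \<open>n\<close>.\<close>
  have indep: "\<forall>i\<in>{..<n}. c i = 0"
    if u: "u \<in> B" "u \<notin> Z" and z: "(\<lambda>k. \<Sum>i\<in>{..<n}. poly (c i) (q ^ k) * (shift ^^ i) u k) \<in> Z" for u c
  proof (rule ccontr)
    assume nz: "\<not> (\<forall>i\<in>{..<n}. c i = 0)"
    define N where "N = {i. i < n \<and> c i \<noteq> 0}"
    have N: "finite N" "N \<noteq> {}" using nz by (auto simp: N_def)
    define m where "m = Max N"
    have m: "m < n" "c m \<noteq> 0" using Max_in[OF N] by (auto simp: m_def N_def)
    have gt: "c i = 0" if "m < i" "i < n" for i
    proof (rule ccontr)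
      assume "c i \<noteq> 0"
      then have "i \<in> N" using that by (simp add: N_def)
      then show False using Max_ge[OF N(1)] that by (fastforce simp: m_def)
    qed
    have "(\<Sum>i\<in>{..<n}. poly (c i) (q ^ k) * (shift ^^ i) u k) = (\<Sum>i\<le>m. poly (c i) (q ^ k) * (shift ^^ i) u k)" for k
      by (rule sum.mono_neutral_right) (use m gt in \<open>auto simp: not_le\<close>)
    then have "order_le u m" using z m unfolding order_le_def by auto
    then have "R m" using u by (auto simp: R_def)
    then show False using n(2) m(1) by fastforce
  qed
  have generates: "v \<in> sspan {..<n} (\<lambda>i. (shift ^^ i) u)"
    if u: "u \<in> B" "u \<notin> Z" "u \<in> U" and v: "v \<in> U" for u v
  proof (rule sspan_exchange[of "{..<n}" "{..<n}" _ w])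
    show "(shift ^^ i) u \<in> sspan {..<n} w" for i
      using S.funpow_sspan[OF st(1)] u(3) by (auto simp: U_def)
    show "v \<in> sspan {..<n} w" using v by (simp add: U_def)
  qed (use indep[OF u(1,2)] in auto)
  obtain N P where P: "P N \<noteq> 0" "(\<lambda>k. \<Sum>i\<le>N. poly (P i) (of_nat k) * g (k + i)) \<in> Z"
    using PF[OF g(1)] by blast
  define E where "E = Max ((\<lambda>i. degree (P i)) ` {..N})"
  have E: "degree (P i) \<le> E" if "i \<le> N" for i
    unfolding E_def by (rule Max_ge) (use that in auto)
  \<comment> \<open>As \<open>E\<close> bounds all degrees in \<open>k\<close>, the recurrence reads
    \<open>\<Sum> k ^ j u j\<close>, summed over \<open>j \<le> E\<close>.\<close>
  define u where "u = (\<lambda>j k. \<Sum>i\<le>N. coeff (P i) j * g (k + i))"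
  have uU: "u j \<in> U" for j
  proof -
    have "(\<lambda>k. \<Sum>i\<le>N. coeff (P i) j * (shift ^^ i) g k) \<in> U"
      unfolding U_def using S.funpow_sspan[OF st(1), of g] gU
      by (intro sspan_sum sspan_cmult) (auto simp: U_def)
    then show ?thesis by (simp add: u_def funpow_shift)
  qed
  have uB: "u j \<in> B" for j
  proof -
    have gB: "(\<lambda>k. g (k + i)) \<in> B" for i
    proof -
      have "(shift ^^ i) g \<in> B" by (induction i) (use g B_shift in auto)
      then show ?thesis by (simp add: funpow_shift)
    qed
    have "(\<lambda>k. \<Sum>i\<le>m. coeff (P i) j * g (k + i)) \<in> B" for m
    proof (induction m)
      case 0
      then show ?case using B_cmult[OF g(1), of "coeff (P 0) j"] by simp
    next
      case (Suc m)
      show ?case unfolding sum.atMost_Suc by (rule B_add[OF Suc B_cmult[OF gB]])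
    qed
    then show ?thesis by (simp add: u_def)
  qed
  have rel: "(\<lambda>k. \<Sum>j\<le>E. of_nat k ^ j * u j k) \<in> Z"
  proof -
    have "poly (P i) x = (\<Sum>j\<le>E. coeff (P i) j * x ^ j)" if "i \<le> N" for i and x :: complex
      using E[OF that] by (rule poly_as_sum_le)
    then have "(\<Sum>i\<le>N. poly (P i) (of_nat k) * g (k + i)) = (\<Sum>i\<le>N. \<Sum>j\<le>E. of_nat k ^ j * (coeff (P i) j * g (k + i)))" for k
      by (intro sum.cong) (auto simp: sum_distrib_left sum_distrib_right mult_ac)
    also have "(\<Sum>i\<le>N. \<Sum>j\<le>E. of_nat k ^ j * (coeff (P i) j * g (k + i))) = (\<Sum>j\<le>E. of_nat k ^ j * u j k)" for k
      unfolding u_def sum_distrib_left by (rule sum.swap)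
    finally show ?thesis using P(2) by simp
  qed
  have "u j \<in> Z" if "j \<le> E" for j
  proof (rule ccontr)
    assume "u j \<notin> Z"
    define N where "N = {i. i \<le> E \<and> u i \<notin> Z}"
    have N: "finite N" "N \<noteq> {}" using \<open>j \<le> E\<close> \<open>u j \<notin> Z\<close> by (auto simp: N_def)
    define D where "D = Max N"
    have D: "D \<le> E" "u D \<notin> Z" using Max_in[OF N] by (auto simp: D_def N_def)
    have gt: "u i \<in> Z" if "i \<in> {D<..E}" for i
    proof (rule ccontr)
      assume "u i \<notin> Z"
      then have "i \<in> N" using that by (simp add: N_def)
      then show False using Max_ge[OF N(1)] that by (fastforce simp: D_def)
    qed
    have "(\<lambda>k. (\<Sum>j\<le>E. of_nat k ^ j * u j k) - (\<Sum>j\<in>{D<..E}. of_nat k ^ j * u j k)) \<in> Z"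
      by (intro Z_diff rel Z_sum index_power_Z gt)
    moreover have "(\<Sum>j\<le>E. of_nat k ^ j * u j k) - (\<Sum>j\<in>{D<..E}. of_nat k ^ j * u j k) = (\<Sum>j\<le>D. of_nat k ^ j * u j k)" for k
    proof -
      have "{..E} = {..D} \<union> {D<..E}" "{..D} \<inter> {D<..E} = {}" using D by auto
      then show ?thesis by (simp add: sum.union_disjoint)
    qed
    ultimately have relD: "(\<lambda>k. \<Sum>j\<le>D. of_nat k ^ j * u j k) \<in> Z" by simp
    have "D > 0"
    proof (rule ccontr)
      assume "\<not> D > 0"
      then have "D = 0" by simp
      then show False using relD D(2) by simp
    qed
    \<comment> \<open>Generators of \<open>M\<close>, the sum of the \<open>k ^ j U\<close> with
      \<open>j < D\<close>. The point is that \<open>k ^ D U\<close> lies in \<open>M\<close> as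
      well.\<close>
    define J where "J = {..<D} \<times> {..<n}"
    define m where "m = (\<lambda>(j, i). index_power j (w i))"
    define M where "M = sspan J m"
    have finJ: "finite J" by (simp add: J_def)
    have low: "index_power j v \<in> M" if "j < D" "v \<in> U" for j v
      unfolding M_def
    proof (rule sspan_trans)
      show "index_power j v \<in> sspan {..<n} (\<lambda>i. index_power j (w i))"
        by (rule index_power_sspan) (use that in \<open>simp add: U_def\<close>)
      fix i assume "i \<in> {..<n}"
      then show "index_power j (w i) \<in> sspan J m"
        using sspan_base[OF finJ, of "(j, i)" m] that by (auto simp: J_def m_def)
    qed
    have wU: "w i \<in> U" for i
      using S.funpow_sspan[OF st(1)] gU by (auto simp: U_def w_def)
    have S_stable: "S.stable J m"
      unfolding S.stable_def
    proof (intro conjI ballI finJ UNIV_I)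
      fix ji assume "ji \<in> J"
      then obtain j i where ji: "ji = (j, i)" "j < D" by (auto simp: J_def)
      have "shift (index_power j (w i)) \<in> M"
        unfolding shift_index_power M_def
        by (intro sspan_sum sspan_cmult) (use low[unfolded M_def] ji(2) U_shift wU in auto)
      then show "shift (m ji) \<in> sspan J m" by (simp add: ji m_def M_def)
    qed
    \<comment> \<open>By the relation, \<open>k ^ D u D\<close> lies in \<open>M\<close>. Shifting
      \<open>k ^ D v\<close> gives \<open>k ^ D\<close> times the shift of \<open>v\<close> plus
      lower powers of \<open>k\<close>, so membership passes to all shifts of \<open>u D\<close>,
      and these generate \<open>U\<close>.\<close>
    have top: "index_power D ((shift ^^ i) (u D)) \<in> M" for i
    proof (induction i)
      case 0
      have "(\<lambda>k. -1 * (\<Sum>j<D. of_nat k ^ j * u j k)) \<in> M"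
        unfolding M_def by (intro sspan_cmult sspan_sum) (use low[unfolded M_def] uU in auto)
      then have "index_power D (u D) \<in> M"
        unfolding M_def by (rule sspan_cong) (use relD in \<open>simp add: lessThan_Suc_atMost[symmetric] add.commute\<close>)
      then show ?case by simp
    next
      case (Suc i)
      let ?v = "(shift ^^ i) (u D)"
      have vU: "shift ?v \<in> U" using S.funpow_sspan[OF st(1), of "u D"] uU U_shift by (auto simp: U_def)
      have "shift (index_power D ?v) \<in> M"
        using S.T_sspan[OF S_stable] Suc by (auto simp: M_def)
      then have "(\<lambda>k. shift (index_power D ?v) k - (\<Sum>l<D. of_nat (D choose l) * index_power l (shift ?v) k)) \<in> M"
        unfolding M_def by (intro sspan_diff sspan_sum sspan_cmult) (use low[unfolded M_def] vU in auto)
      then show ?case by (simp add: shift_index_power lessThan_Suc_atMost[symmetric])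
    qed
    have topw: "index_power D (w i) \<in> M" for i
      unfolding M_def
    proof (rule sspan_trans)
      show "index_power D (w i) \<in> sspan {..<n} (\<lambda>i. index_power D ((shift ^^ i) (u D)))"
        by (rule index_power_sspan, rule generates[OF uB D(2) uU wU])
    qed (use top[unfolded M_def] in auto)
    have K_stable: "K.stable J m"
      unfolding K.stable_def
    proof (intro conjI ballI finJ UNIV_I)
      fix ji assume "ji \<in> J"
      then obtain j i where ji: "ji = (j, i)" "j < D" by (auto simp: J_def)
      have "index_power (Suc j) (w i) \<in> M"
        using low[of "Suc j" "w i"] topw[of i] wU ji(2) by (cases "Suc j = D") auto
      then show "(\<lambda>k. of_nat k * m ji k) \<in> sspan J m" by (simp add: ji m_def M_def mult.assoc)
    qed
    have "g \<in> sspan J m" using low[OF \<open>D > 0\<close> gU] by (simp add: M_def)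
    then show False using shift_index_stable_trivial[OF S_stable K_stable] g by blast
  qed
  moreover obtain j where j: "coeff (P N) j \<noteq> 0" using P(1) by (metis leading_coeff_0_iff)
  moreover have "j \<le> E" using E[of N] le_degree[OF j] by simp
  ultimately have "(\<lambda>k. \<Sum>i\<le>N. coeff (P i) j * g (k + i)) \<in> Z" by (simp add: u_def)
  then have "g \<in> Z" using const[of g N N "\<lambda>i. coeff (P i) j"] g(1) j by simp
  then show False using g by simp
qed

end

section \<open>Exponential polynomials\<close>

text \<open>The operator \<open>R \<mapsto> \<mu> R(x + h) - \<nu> R\<close> keeps the degree if
  \<open>\<nu> \<noteq> \<mu>\<close> and lowers it by one if \<open>\<nu> = \<mu>\<close>. In both
  cases one monomial matches the leading term of \<open>Q\<close>, and induction on the degree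
  removes the rest.\<close>

lemma twisted_difference_surj:
  fixes \<nu> \<mu> h :: "'a :: field_char_0"
  assumes "\<mu> \<noteq> 0" "h \<noteq> 0"
  shows "\<exists>R. smult \<mu> (pcompose R [:h, 1:]) - smult \<nu> R = Q"
proof (induction "degree Q" arbitrary: Q rule: less_induct)
  case less
  define L where "L = (\<lambda>R. smult \<mu> (pcompose R [:h, 1:]) - smult \<nu> R)"
  define n where "n = degree Q"
  have L_add: "L (R + R') = L R + L R'" for R R'
    by (simp add: L_def pcompose_add smult_add_right)
  have coeff_L: "coeff (L R) e = \<mu> * (coeff R e + of_nat (Suc e) * h * coeff R (Suc e)) - \<nu> * coeff R e"
    if "degree R \<le> Suc e" for R e
    by (simp only: L_def coeff_diff coeff_smult coeff_pcompose_translate[OF that])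
  have deg_L: "degree (L R) \<le> degree R" for R
    unfolding L_def by (intro degree_diff_le order_trans[OF degree_smult_le]) (auto simp: degree_pcompose)
  obtain R where R: "degree (L R) \<le> n" "coeff (L R) n = coeff Q n"
  proof (cases "\<nu> = \<mu>")
    case True
    define R where "R = monom (coeff Q n / (\<mu> * of_nat (Suc n) * h)) (Suc n)"
    have dR: "degree R \<le> Suc n" by (simp add: R_def degree_monom_le)
    have "coeff (L R) (Suc n) = 0"
      using coeff_L[of R "Suc n"] dR by (simp add: True R_def)
    moreover have "degree (L R) \<le> Suc n" using deg_L dR by (rule order_trans)
    ultimately have "degree (L R) \<le> n" by (metis le_SucE leading_coeff_0_iff degree_0 le0)
    moreover have "coeff (L R) n = coeff Q n"
      using coeff_L[of R n] dR assms by (simp add: True R_def del: of_nat_Suc)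
    ultimately show ?thesis by (rule that)
  next
    case False
    define R where "R = monom (coeff Q n / (\<mu> - \<nu>)) n"
    have dR: "degree R \<le> n" by (simp add: R_def degree_monom_le)
    have "degree (L R) \<le> n" using deg_L dR by (rule order_trans)
    moreover have "coeff (L R) n = coeff Q n"
    proof -
      have "coeff (L R) n = (\<mu> - \<nu>) * coeff R n"
        using coeff_L[of R n] dR by (simp add: coeff_eq_0 algebra_simps)
      then show ?thesis using False by (simp add: R_def)
    qed
    ultimately show ?thesis by (rule that)
  qed
  define Q' where "Q' = Q - L R"
  have Q': "degree Q' \<le> n" "coeff Q' n = 0"
    unfolding Q'_def using R by (auto simp: n_def intro: degree_diff_le)
  have "\<exists>R'. L R' = Q'"
  proof (cases "Q' = 0")
    case True
    then show ?thesis by (intro exI[of _ 0]) (simp add: L_def)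
  next
    case False
    then have "degree Q' < n" using Q' by (metis le_neq_implies_less leading_coeff_0_iff)
    then show ?thesis using less[of Q'] by (simp add: L_def n_def)
  qed
  then obtain R' where "L R' = Q'" ..
  then have "L (R + R') = Q" by (simp add: L_add Q'_def)
  then show ?case by (auto simp: L_def)
qed

text \<open>The functions \<open>k\<^sup>j \<nu>\<^sup>k\<close> are already independent on as many consecutive integers as there are of them.\<close>

lemma exp_polynomial_independent:
  fixes Q :: "'a :: field_char_0 \<Rightarrow> 'a poly"
  assumes "finite \<Lambda>" "0 \<notin> \<Lambda>"
    and "\<And>k. k0 \<le> k \<Longrightarrow> k < k0 + (\<Sum>\<mu>\<in>\<Lambda>. if Q \<mu> = 0 then 0 else Suc (degree (Q \<mu>))) \<Longrightarrow>
      (\<Sum>\<mu>\<in>\<Lambda>. poly (Q \<mu>) (of_nat k) * \<mu> ^ k) = 0"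
    and "\<mu> \<in> \<Lambda>"
  shows "Q \<mu> = 0"
proof -
  define sz where "sz = (\<lambda>p :: 'a poly. if p = 0 then 0 else Suc (degree p))"
  have "\<forall>\<mu>\<in>\<Lambda>. Q \<mu> = 0"
    if "\<And>k. k0 \<le> k \<Longrightarrow> k < k0 + (\<Sum>\<mu>\<in>\<Lambda>. sz (Q \<mu>)) \<Longrightarrow> (\<Sum>\<mu>\<in>\<Lambda>. poly (Q \<mu>) (of_nat k) * \<mu> ^ k) = 0"
    using that
  proof (induction "\<Sum>\<mu>\<in>\<Lambda>. sz (Q \<mu>)" arbitrary: Q)
    case 0
    then show ?case using assms(1) by (auto simp: sz_def split: if_splits)
  next
    case (Suc N)
    have "\<exists>\<mu>\<in>\<Lambda>. sz (Q \<mu>) \<noteq> 0"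
    proof (rule ccontr)
      assume "\<not> (\<exists>\<mu>\<in>\<Lambda>. sz (Q \<mu>) \<noteq> 0)"
      then have "(\<Sum>\<mu>\<in>\<Lambda>. sz (Q \<mu>)) = 0" by simp
      then show False using Suc.hyps(2) by simp
    qed
    then obtain \<mu> where \<mu>: "\<mu> \<in> \<Lambda>" "Q \<mu> \<noteq> 0" unfolding sz_def by metis
    have \<mu>0: "\<mu> \<noteq> 0" using \<mu> assms by auto
    \<comment> \<open>The operator \<open>S - \<mu>\<close>, with \<open>S\<close> the shift, keeps
      the degrees of all other terms and lowers that of the \<open>\<mu>\<close>-term by one. The
      total size drops by one, and so does the length of the window on which the sum is known to
      vanish.\<close>
    define Q' where "Q' = (\<lambda>\<nu>. smult \<nu> (pcompose (Q \<nu>) [:1, 1:]) - smult \<mu> (Q \<nu>))"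
    have coeff_Q': "coeff (Q' \<nu>) e = \<nu> * (coeff (Q \<nu>) e + of_nat (Suc e) * coeff (Q \<nu>) (Suc e)) - \<mu> * coeff (Q \<nu>) e"
      if "degree (Q \<nu>) \<le> Suc e" for \<nu> e
      by (simp only: Q'_def coeff_diff coeff_smult coeff_pcompose_translate[OF that] mult_1_right)
    have deg_Q': "degree (Q' \<nu>) \<le> degree (Q \<nu>)" for \<nu>
      unfolding Q'_def by (intro degree_diff_le order_trans[OF degree_smult_le]) (auto simp: degree_pcompose)
    have sz_ne: "sz (Q' \<nu>) = sz (Q \<nu>) \<and> (Q' \<nu> = 0 \<longrightarrow> Q \<nu> = 0)" if "\<nu> \<noteq> \<mu>" for \<nu>
    proof (cases "Q \<nu> = 0")
      case True
      then show ?thesis by (simp add: Q'_def)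
    next
      case False
      have "coeff (Q' \<nu>) (degree (Q \<nu>)) = (\<nu> - \<mu>) * lead_coeff (Q \<nu>)"
        by (subst coeff_Q') (auto simp: coeff_eq_0 algebra_simps)
      then have "coeff (Q' \<nu>) (degree (Q \<nu>)) \<noteq> 0" using that False by simp
      then have "Q' \<nu> \<noteq> 0" "degree (Q' \<nu>) = degree (Q \<nu>)"
        using deg_Q'[of \<nu>] le_degree[of "Q' \<nu>"] by (auto intro: le_antisym)
      then show ?thesis using False by (simp add: sz_def)
    qed
    have sz_eq: "Suc (sz (Q' \<mu>)) = sz (Q \<mu>)"
    proof (cases "degree (Q \<mu>)")
      case 0
      then obtain c where "Q \<mu> = [:c:]" by (metis degree_eq_zeroE)
      then have "Q' \<mu> = 0" by (simp add: Q'_def)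
      then show ?thesis using \<mu> 0 by (simp add: sz_def)
    next
      case (Suc e)
      have "coeff (Q' \<mu>) (Suc e) = 0"
        using coeff_Q'[of \<mu> "Suc e"] Suc by (simp add: coeff_eq_0)
      then have le: "degree (Q' \<mu>) \<le> e"
        using deg_Q'[of \<mu>] Suc by (metis le_SucE leading_coeff_0_iff degree_0 le0)
      have "coeff (Q' \<mu>) e = \<mu> * of_nat (Suc e) * lead_coeff (Q \<mu>)"
        using coeff_Q'[of \<mu> e] Suc by (simp add: algebra_simps)
      then have "coeff (Q' \<mu>) e \<noteq> 0" using \<mu>0 \<mu>(2) by (simp del: of_nat_Suc)
      then have "Q' \<mu> \<noteq> 0" "degree (Q' \<mu>) = e" using le le_degree[of "Q' \<mu>"] by (auto intro: le_antisym)
      then show ?thesis using \<mu> Suc by (simp add: sz_def)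
    qed
    have rest: "(\<Sum>\<nu>\<in>\<Lambda> - {\<mu>}. sz (Q' \<nu>)) = (\<Sum>\<nu>\<in>\<Lambda> - {\<mu>}. sz (Q \<nu>))"
      using sz_ne by (intro sum.cong) auto
    have N: "N = (\<Sum>\<nu>\<in>\<Lambda>. sz (Q' \<nu>))"
      using Suc.hyps(2) sum.remove[OF assms(1) \<mu>(1), of "\<lambda>\<nu>. sz (Q \<nu>)"]
        sum.remove[OF assms(1) \<mu>(1), of "\<lambda>\<nu>. sz (Q' \<nu>)"] rest sz_eq by simp
    have "\<forall>\<nu>\<in>\<Lambda>. Q' \<nu> = 0"
    proof (rule Suc.hyps(1)[OF N])
      fix k assume k: "k0 \<le> k" "k < k0 + (\<Sum>\<nu>\<in>\<Lambda>. sz (Q' \<nu>))"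
      have "(\<Sum>\<nu>\<in>\<Lambda>. poly (Q' \<nu>) (of_nat k) * \<nu> ^ k) =
         (\<Sum>\<nu>\<in>\<Lambda>. poly (Q \<nu>) (of_nat (Suc k)) * \<nu> ^ Suc k) - \<mu> * (\<Sum>\<nu>\<in>\<Lambda>. poly (Q \<nu>) (of_nat k) * \<nu> ^ k)"
        by (simp add: Q'_def poly_pcompose sum_distrib_left sum_subtractf algebra_simps)
      also have "\<dots> = 0" using Suc.prems[of k] Suc.prems[of "Suc k"] k N Suc.hyps(2) by simp
      finally show "(\<Sum>\<nu>\<in>\<Lambda>. poly (Q' \<nu>) (of_nat k) * \<nu> ^ k) = 0" .
    qed
    then have zero: "Q \<nu> = 0" if "\<nu> \<in> \<Lambda>" "\<nu> \<noteq> \<mu>" for \<nu> using sz_ne that by blast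
    have "Q' \<mu> = 0" using \<open>\<forall>\<nu>\<in>\<Lambda>. Q' \<nu> = 0\<close> \<mu> by blast
    then have "sz (Q \<mu>) = 1" using sz_eq by (simp add: sz_def)
    then obtain c where c: "Q \<mu> = [:c:]" using \<mu> by (auto simp: sz_def elim: degree_eq_zeroE)
    have "(\<Sum>\<nu>\<in>\<Lambda>. poly (Q \<nu>) (of_nat k0) * \<nu> ^ k0) = 0"
      using Suc.prems[of k0] Suc.hyps(2) by simp
    also have "(\<Sum>\<nu>\<in>\<Lambda>. poly (Q \<nu>) (of_nat k0) * \<nu> ^ k0) = c * \<mu> ^ k0"
      using sum.remove[OF assms(1) \<mu>(1), of "\<lambda>\<nu>. poly (Q \<nu>) (of_nat k0) * \<nu> ^ k0"] zero c by simp
    finally show ?case using \<mu> \<mu>0 c by simp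
  qed
  then have "\<forall>\<mu>\<in>\<Lambda>. Q \<mu> = 0" using assms(3) by (simp add: sz_def)
  then show ?thesis using assms(4) by blast
qed

text \<open>Sequences that satisfy a linear recurrence with constant coefficients. A characteristic
  root \<open>0\<close> affects finitely many terms only, so it is absorbed by the word eventually;
  with \<open>0 \<notin> \<Lambda>\<close> the coefficients become unique.\<close>

definition exp_polynomial :: "(nat \<Rightarrow> complex) \<Rightarrow> bool" where
  "exp_polynomial c \<longleftrightarrow> (\<exists>\<Lambda> Q. finite \<Lambda> \<and> 0 \<notin> \<Lambda> \<and>
     eventually (\<lambda>k. c k = (\<Sum>\<mu>\<in>\<Lambda>. poly (Q \<mu>) (of_nat k) * \<mu> ^ k)) sequentially)"

lemma exp_polynomialE:
  assumes "exp_polynomial c"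
  obtains \<Lambda> Q where "finite \<Lambda>" "0 \<notin> \<Lambda>" "\<And>\<mu>. \<mu> \<notin> \<Lambda> \<Longrightarrow> Q \<mu> = 0"
     "eventually (\<lambda>k. c k = (\<Sum>\<mu>\<in>\<Lambda>. poly (Q \<mu>) (of_nat k) * \<mu> ^ k)) sequentially"
proof -
  obtain \<Lambda> Q where "finite \<Lambda>" "0 \<notin> \<Lambda>"
     "eventually (\<lambda>k. c k = (\<Sum>\<mu>\<in>\<Lambda>. poly (Q \<mu>) (of_nat k) * \<mu> ^ k)) sequentially"
    using assms unfolding exp_polynomial_def by blast
  then show ?thesis by (intro that[of \<Lambda> "\<lambda>\<mu>. if \<mu> \<in> \<Lambda> then Q \<mu> else 0"]) (auto simp: if_distrib[of poly] cong: sum.cong)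
qed

lemma exp_polynomial_cong:
  assumes "exp_polynomial c" "eventually (\<lambda>k. d k = c k) sequentially"
  shows "exp_polynomial d"
proof -
  obtain \<Lambda> Q where "finite \<Lambda>" "0 \<notin> \<Lambda>"
     "eventually (\<lambda>k. c k = (\<Sum>\<mu>\<in>\<Lambda>. poly (Q \<mu>) (of_nat k) * \<mu> ^ k)) sequentially"
    using assms(1) unfolding exp_polynomial_def by blast
  moreover from this(3) assms(2) have "eventually (\<lambda>k. d k = (\<Sum>\<mu>\<in>\<Lambda>. poly (Q \<mu>) (of_nat k) * \<mu> ^ k)) sequentially"
    by eventually_elim simp
  ultimately show ?thesis unfolding exp_polynomial_def by blast
qed

lemma exp_polynomial_basic:
  "\<mu> \<noteq> 0 \<Longrightarrow> exp_polynomial (\<lambda>k. poly Q (of_nat k) * \<mu> ^ k)"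
  unfolding exp_polynomial_def by (intro exI[of _ "{\<mu>}"] exI[of _ "\<lambda>_. Q"]) auto

lemma exp_polynomial_zero: "exp_polynomial (\<lambda>_. 0)"
  unfolding exp_polynomial_def by (intro exI[of _ "{}"]) auto

lemma exp_polynomial_add:
  assumes "exp_polynomial c" "exp_polynomial d"
  shows "exp_polynomial (\<lambda>k. c k + d k)"
proof -
  obtain \<Lambda> Q where 1: "finite \<Lambda>" "0 \<notin> \<Lambda>" "\<And>\<mu>. \<mu> \<notin> \<Lambda> \<Longrightarrow> Q \<mu> = 0"
     "eventually (\<lambda>k. c k = (\<Sum>\<mu>\<in>\<Lambda>. poly (Q \<mu>) (of_nat k) * \<mu> ^ k)) sequentially"
    by (rule exp_polynomialE[OF assms(1)]) (rule that)
  obtain \<Lambda>' Q' where 2: "finite \<Lambda>'" "0 \<notin> \<Lambda>'" "\<And>\<mu>. \<mu> \<notin> \<Lambda>' \<Longrightarrow> Q' \<mu> = 0"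
     "eventually (\<lambda>k. d k = (\<Sum>\<mu>\<in>\<Lambda>'. poly (Q' \<mu>) (of_nat k) * \<mu> ^ k)) sequentially"
    by (rule exp_polynomialE[OF assms(2)]) (rule that)
  have "eventually (\<lambda>k. c k + d k = (\<Sum>\<mu>\<in>\<Lambda> \<union> \<Lambda>'. poly (Q \<mu> + Q' \<mu>) (of_nat k) * \<mu> ^ k)) sequentially"
    using 1(4) 2(4)
  proof eventually_elim
    case (elim k)
    have "c k = (\<Sum>\<mu>\<in>\<Lambda> \<union> \<Lambda>'. poly (Q \<mu>) (of_nat k) * \<mu> ^ k)"
      unfolding elim by (rule sum.mono_neutral_left) (use 1 2 in auto)
    moreover have "d k = (\<Sum>\<mu>\<in>\<Lambda> \<union> \<Lambda>'. poly (Q' \<mu>) (of_nat k) * \<mu> ^ k)"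
      unfolding elim by (rule sum.mono_neutral_left) (use 1 2 in auto)
    ultimately show ?case by (simp add: sum.distrib algebra_simps)
  qed
  then show ?thesis unfolding exp_polynomial_def using 1 2
    by (intro exI[of _ "\<Lambda> \<union> \<Lambda>'"] exI[of _ "\<lambda>\<mu>. Q \<mu> + Q' \<mu>"]) auto
qed

lemma exp_polynomial_sum:
  "(\<And>i. i \<in> I \<Longrightarrow> exp_polynomial (f i)) \<Longrightarrow> exp_polynomial (\<lambda>k. \<Sum>i\<in>I. f i k)"
proof (induction I rule: infinite_finite_induct)
  case (insert i I)
  have "exp_polynomial (\<lambda>k. f i k + (\<Sum>i\<in>I. f i k))"
    by (rule exp_polynomial_add[OF insert.prems insert.IH]) (auto intro: insert.prems)
  then show ?case using insert.hyps by simp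
qed (simp_all add: exp_polynomial_zero)

text \<open>Any additive operation on sequences is checked on the terms \<open>Q(k) \<mu>\<^sup>k\<close> only.\<close>

lemma exp_polynomial_map:
  assumes "exp_polynomial c"
    and "\<And>Q \<mu>. \<mu> \<noteq> 0 \<Longrightarrow> exp_polynomial (\<lambda>k. g k * (poly Q (of_nat (h k)) * \<mu> ^ h k))"
    and "filterlim h at_top sequentially"
  shows "exp_polynomial (\<lambda>k. g k * c (h k))"
proof -
  obtain \<Lambda> Q where 1: "finite \<Lambda>" "0 \<notin> \<Lambda>"
     "eventually (\<lambda>k. c k = (\<Sum>\<mu>\<in>\<Lambda>. poly (Q \<mu>) (of_nat k) * \<mu> ^ k)) sequentially"
    using assms(1) unfolding exp_polynomial_def by blast
  have "exp_polynomial (\<lambda>k. \<Sum>\<mu>\<in>\<Lambda>. g k * (poly (Q \<mu>) (of_nat (h k)) * \<mu> ^ h k))"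
    by (rule exp_polynomial_sum, rule assms(2)) (use 1 in auto)
  moreover have "eventually (\<lambda>k. c (h k) = (\<Sum>\<mu>\<in>\<Lambda>. poly (Q \<mu>) (of_nat (h k)) * \<mu> ^ h k)) sequentially"
    by (rule eventually_compose_filterlim[OF 1(3) assms(3)])
  then have "eventually (\<lambda>k. g k * c (h k) = (\<Sum>\<mu>\<in>\<Lambda>. g k * (poly (Q \<mu>) (of_nat (h k)) * \<mu> ^ h k))) sequentially"
    by eventually_elim (simp add: sum_distrib_left)
  ultimately show ?thesis by (rule exp_polynomial_cong)
qed

lemma exp_polynomial_index_poly:
  assumes "exp_polynomial c"
  shows "exp_polynomial (\<lambda>k. poly P (of_nat k) * c k)"
proof (rule exp_polynomial_map[OF assms])
  fix Q and \<mu> :: complex assume "\<mu> \<noteq> 0"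
  from exp_polynomial_basic[OF this, of "P * Q"]
  show "exp_polynomial (\<lambda>k. poly P (of_nat k) * (poly Q (of_nat k) * \<mu> ^ k))"
    by (simp add: mult.assoc)
qed (rule filterlim_ident)

lemma exp_polynomial_cmult: "exp_polynomial c \<Longrightarrow> exp_polynomial (\<lambda>k. a * c k)"
  using exp_polynomial_index_poly[of c "[:a:]"] by simp

lemma exp_polynomial_geometric:
  assumes "exp_polynomial c" "a \<noteq> 0"
  shows "exp_polynomial (\<lambda>k. a ^ k * c k)"
proof (rule exp_polynomial_map[OF assms(1)])
  fix Q and \<mu> :: complex assume "\<mu> \<noteq> 0"
  from exp_polynomial_basic[of "a * \<mu>" Q] this assms
  show "exp_polynomial (\<lambda>k. a ^ k * (poly Q (of_nat k) * \<mu> ^ k))"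
    by (simp add: power_mult_distrib mult_ac)
qed (rule filterlim_ident)

lemma exp_polynomial_poly_geometric:
  assumes "exp_polynomial c" "a \<noteq> 0"
  shows "exp_polynomial (\<lambda>k. poly d (a ^ k) * c k)"
proof -
  have "exp_polynomial (\<lambda>k. \<Sum>i\<le>degree d. coeff d i * ((a ^ i) ^ k * c k))"
    by (rule exp_polynomial_sum, rule exp_polynomial_cmult, rule exp_polynomial_geometric)
       (use assms in auto)
  then show ?thesis
    by (simp add: poly_altdef sum_distrib_left sum_distrib_right mult_ac flip: power_mult)
qed

lemma exp_polynomial_shift:
  assumes "exp_polynomial c"
  shows "exp_polynomial (shift c)"
proof -
  have "exp_polynomial (\<lambda>k. 1 * c (Suc k))"
  proof (rule exp_polynomial_map[OF assms])
    fix Q and \<mu> :: complex assume "\<mu> \<noteq> 0"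
    from exp_polynomial_basic[OF this, of "smult \<mu> (pcompose Q [:1, 1:])"]
    show "exp_polynomial (\<lambda>k. 1 * (poly Q (of_nat (Suc k)) * \<mu> ^ Suc k))"
      by (simp add: poly_pcompose mult_ac)
  qed (rule filterlim_Suc)
  then show ?thesis by (simp add: shift_def)
qed

lemma exp_polynomial_unshift:
  assumes "exp_polynomial (shift c)"
  shows "exp_polynomial c"
proof -
  have "exp_polynomial (\<lambda>k. 1 * shift c (k - 1))"
  proof (rule exp_polynomial_map[OF assms])
    fix Q and \<mu> :: complex assume "\<mu> \<noteq> 0"
    have "exp_polynomial (\<lambda>k. poly (smult (1 / \<mu>) (pcompose Q [:-1, 1:])) (of_nat k) * \<mu> ^ k)"
      using \<open>\<mu> \<noteq> 0\<close> by (rule exp_polynomial_basic)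
    then show "exp_polynomial (\<lambda>k. 1 * (poly Q (of_nat (k - 1)) * \<mu> ^ (k - 1)))"
    proof (rule exp_polynomial_cong)
      show "\<forall>\<^sub>F k in sequentially. 1 * (poly Q (of_nat (k - 1)) * \<mu> ^ (k - 1)) =
          poly (smult (1 / \<mu>) (pcompose Q [:- 1, 1:])) (of_nat k) * \<mu> ^ k"
        using eventually_gt_at_top[of 0]
      proof eventually_elim
        case (elim k)
        then show ?case using \<open>\<mu> \<noteq> 0\<close> by (cases k) (auto simp: poly_pcompose)
      qed
    qed
  qed (rule filterlim_minus_const_nat_at_top)
  then show ?thesis
  proof (rule exp_polynomial_cong)
    show "\<forall>\<^sub>F k in sequentially. c k = 1 * shift c (k - 1)"
      using eventually_gt_at_top[of 0] by eventually_elim (simp add: shift_def)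
  qed
qed

text \<open>For \<open>\<nu> \<noteq> 0\<close> a particular solution is found term by term with
  \<open>twisted_difference_surj\<close>, and what remains is eventually a multiple of
  \<open>\<nu> ^ k\<close>. For \<open>\<nu> = 0\<close> the equation is only a shift.\<close>

lemma exp_polynomial_solve_first_order:
  assumes "exp_polynomial (\<lambda>k. c (Suc k) - \<nu> * c k)"
  shows "exp_polynomial c"
proof (cases "\<nu> = 0")
  case True
  then show ?thesis using assms exp_polynomial_unshift by (simp add: shift_def)
next
  case False
  obtain \<Lambda> Q where 1: "finite \<Lambda>" "0 \<notin> \<Lambda>"
     "eventually (\<lambda>k. c (Suc k) - \<nu> * c k = (\<Sum>\<mu>\<in>\<Lambda>. poly (Q \<mu>) (of_nat k) * \<mu> ^ k)) sequentially"
    using assms unfolding exp_polynomial_def by blast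
  have "\<forall>\<mu>\<in>\<Lambda>. \<exists>R. smult \<mu> (pcompose R [:1, 1:]) - smult \<nu> R = Q \<mu>"
    using 1(2) by (intro ballI twisted_difference_surj) auto
  from bchoice[OF this] obtain R where R: "\<And>\<mu>. \<mu> \<in> \<Lambda> \<Longrightarrow> smult \<mu> (pcompose (R \<mu>) [:1, 1:]) - smult \<nu> (R \<mu>) = Q \<mu>"
    by blast
  define s where "s = (\<lambda>k. \<Sum>\<mu>\<in>\<Lambda>. poly (R \<mu>) (of_nat k) * \<mu> ^ k)"
  have s: "s (Suc k) - \<nu> * s k = (\<Sum>\<mu>\<in>\<Lambda>. poly (Q \<mu>) (of_nat k) * \<mu> ^ k)" for k
  proof -
    have "s (Suc k) - \<nu> * s k = (\<Sum>\<mu>\<in>\<Lambda>. poly (smult \<mu> (pcompose (R \<mu>) [:1, 1:]) - smult \<nu> (R \<mu>)) (of_nat k) * \<mu> ^ k)"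
      by (simp add: s_def poly_pcompose sum_distrib_left sum_subtractf algebra_simps)
    then show ?thesis by (simp add: R)
  qed
  define d where "d = (\<lambda>k. c k - s k)"
  have "eventually (\<lambda>k. d (Suc k) = \<nu> * d k) sequentially"
    using 1(3) by eventually_elim (use s in \<open>simp add: d_def algebra_simps\<close>)
  then obtain N where N: "\<And>k. k \<ge> N \<Longrightarrow> d (Suc k) = \<nu> * d k" by (auto simp: eventually_sequentially)
  have dk: "d k = (d N / \<nu> ^ N) * \<nu> ^ k" if "k \<ge> N" for k
    using that by (induction k rule: dec_induct) (use False N in auto)
  have "exp_polynomial (\<lambda>k. poly [:d N / \<nu> ^ N:] (of_nat k) * \<nu> ^ k)"
    using False by (rule exp_polynomial_basic)
  then have "exp_polynomial d"
  proof (rule exp_polynomial_cong)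
    show "\<forall>\<^sub>F k in sequentially. d k = poly [:d N / \<nu> ^ N:] (of_nat k) * \<nu> ^ k"
      using eventually_ge_at_top[of N]
    proof eventually_elim
      case (elim k)
      show ?case using dk[OF elim] by simp
    qed
  qed
  moreover have "exp_polynomial s"
    unfolding s_def by (rule exp_polynomial_sum, rule exp_polynomial_basic) (use 1 in auto)
  ultimately have "exp_polynomial (\<lambda>k. d k + s k)" by (rule exp_polynomial_add)
  then show ?thesis by (simp add: d_def)
qed

text \<open>The characteristic polynomial splits over the complex numbers; a root
  \<open>\<nu>\<close> reduces the equation to one of smaller degree for
  \<open>c (k + 1) - \<nu> c k\<close>.\<close>

lemma exp_polynomial_solve:
  assumes "p \<noteq> 0" "exp_polynomial (\<lambda>k. \<Sum>i\<le>degree p. coeff p i * c (k + i))"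
  shows "exp_polynomial c"
  using assms
proof (induction "degree p" arbitrary: p c)
  case 0
  then obtain a where a: "p = [:a:]" "a \<noteq> 0" by (metis degree_eq_zeroE pCons_0_0)
  then have "exp_polynomial (\<lambda>k. a * c k)" using 0 by simp
  from exp_polynomial_cmult[OF this, of "1 / a"] show ?case using a by simp
next
  case (Suc n)
  then obtain \<nu> where "poly p \<nu> = 0"
    using fundamental_theorem_of_algebra_alt[of p] by fastforce
  then obtain r where r: "p = [:-\<nu>, 1:] * r" by (metis poly_eq_0_iff_dvd dvdE)
  then have r0: "r \<noteq> 0" using Suc.prems by auto
  have deg: "degree p = Suc (degree r)" unfolding r using r0 by (subst degree_mult_eq) auto
  define c' where "c' = (\<lambda>k. c (Suc k) - \<nu> * c k)"
  have "(\<Sum>i\<le>degree p. coeff p i * c (k + i)) = (\<Sum>i\<le>degree r. coeff r i * c' (k + i))" for k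
  proof -
    have cp: "coeff p i = (case i of 0 \<Rightarrow> 0 | Suc j \<Rightarrow> coeff r j) - \<nu> * coeff r i" for i
      by (simp add: r coeff_pCons split: nat.splits)
    have "(\<Sum>i\<le>degree p. coeff p i * c (k + i)) =
      (\<Sum>i\<le>Suc (degree r). (case i of 0 \<Rightarrow> 0 | Suc j \<Rightarrow> coeff r j) * c (k + i)) - \<nu> * (\<Sum>i\<le>Suc (degree r). coeff r i * c (k + i))"
      by (simp add: deg cp sum_subtractf sum_distrib_left algebra_simps del: sum.atMost_Suc)
    also have "(\<Sum>i\<le>Suc (degree r). (case i of 0 \<Rightarrow> 0 | Suc j \<Rightarrow> coeff r j) * c (k + i)) =
      (\<Sum>i\<le>degree r. coeff r i * c (Suc (k + i)))"
      by (subst sum.atMost_Suc_shift) simp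
    also have "(\<Sum>i\<le>Suc (degree r). coeff r i * c (k + i)) = (\<Sum>i\<le>degree r. coeff r i * c (k + i))"
      by (simp add: coeff_eq_0)
    finally show ?thesis by (simp add: c'_def sum_subtractf sum_distrib_left algebra_simps)
  qed
  then have "exp_polynomial (\<lambda>k. \<Sum>i\<le>degree r. coeff r i * c' (k + i))"
    using Suc.prems by simp
  then have "exp_polynomial c'" using Suc.hyps r0 deg by auto
  then show ?case unfolding c'_def by (rule exp_polynomial_solve_first_order)
qed

section \<open>Sequences satisfying both kinds of recurrences\<close>

definition eventually_zero :: "(nat \<Rightarrow> complex) set" where
  "eventually_zero = {c. eventually (\<lambda>k. c k = 0) sequentially}"

lemma eventually_zero_add:
  assumes "f \<in> eventually_zero" "g \<in> eventually_zero"
  shows "(\<lambda>x. f x + g x) \<in> eventually_zero"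
  using assms unfolding eventually_zero_def mem_Collect_eq by eventually_elim simp

lemma eventually_zero_mult: "f \<in> eventually_zero \<Longrightarrow> (\<lambda>x. h x * f x) \<in> eventually_zero"
  unfolding eventually_zero_def mem_Collect_eq by (elim eventually_mono) simp

lemma eventually_zero_shift_iff: "shift f \<in> eventually_zero \<longleftrightarrow> f \<in> eventually_zero"
  unfolding eventually_zero_def shift_def using eventually_sequentially_Suc[of "\<lambda>k. f k = 0"] by simp

text \<open>A relation here means that the sequence is P-recursive, the coefficients being
  polynomials in the index. Its counterpart with coefficients in \<open>q ^ k\<close> is
  \<open>E0.S.has_relation\<close>.\<close>

interpretation index_shift: skew_operator "of_nat :: nat \<Rightarrow> complex" eventually_zero UNIV shift
  "\<lambda>p. pcompose p [:1, 1:]" "\<lambda>_. 0"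
proof
  show "(\<lambda>_. 0) \<in> eventually_zero" by (simp add: eventually_zero_def)
  show "f \<in> eventually_zero \<Longrightarrow> g \<in> eventually_zero \<Longrightarrow> (\<lambda>x. f x + g x) \<in> eventually_zero" for f g
    by (rule eventually_zero_add)
  show "f \<in> eventually_zero \<Longrightarrow> (\<lambda>x. poly p (of_nat x) * f x) \<in> eventually_zero" for f p
    by (rule eventually_zero_mult)
  show "f \<in> eventually_zero \<Longrightarrow> shift f \<in> eventually_zero" for f
    by (simp add: eventually_zero_shift_iff)
qed (auto simp: shift_def eventually_zero_def poly_pcompose pcompose_eq_0_iff)

text \<open>The factors \<open>a ^ i\<close> produced by the shifts are constants and go into the
  coefficients.\<close>

lemma index_shift_geometric:
  assumes "index_shift.has_relation c" "a \<noteq> 0"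
  shows "index_shift.has_relation (\<lambda>k. a ^ k * c k)"
proof -
  obtain n P where P: "P n \<noteq> 0" "(\<lambda>k. \<Sum>i\<le>n. poly (P i) (of_nat k) * (shift ^^ i) c k) \<in> eventually_zero"
    using assms(1) unfolding index_shift.has_relation_def by blast
  have "(\<lambda>k. a ^ k * (\<Sum>i\<le>n. poly (P i) (of_nat k) * (shift ^^ i) c k)) \<in> eventually_zero"
    by (rule eventually_zero_mult[OF P(2)])
  also have "(\<lambda>k. a ^ k * (\<Sum>i\<le>n. poly (P i) (of_nat k) * (shift ^^ i) c k)) =
    (\<lambda>k. \<Sum>i\<le>n. poly (smult (1 / a ^ i) (P i)) (of_nat k) * (shift ^^ i) (\<lambda>k. a ^ k * c k) k)"
    using assms(2) by (auto simp: fun_eq_iff funpow_shift sum_distrib_left power_add intro!: sum.cong)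
  finally show ?thesis using P(1) assms(2)
    by (intro index_shift.has_relationI[of n n "\<lambda>i. smult (1 / a ^ i) (P i)"]) auto
qed

lemma index_shift_poly_geometric:
  assumes "index_shift.has_relation c" "a \<noteq> 0"
  shows "index_shift.has_relation (\<lambda>k. poly d (a ^ k) * c k)"
proof -
  have *: "index_shift.has_relation (\<lambda>k. coeff d i * ((a ^ i) ^ k * c k))" for i
    using index_shift.has_relation_scale[OF index_shift_geometric[OF assms(1), of "a ^ i"] UNIV_I, of "[:coeff d i:]"] assms(2)
    by simp
  have "index_shift.has_relation (\<lambda>k. \<Sum>i\<le>degree d. coeff d i * ((a ^ i) ^ k * c k))"
    by (rule index_shift.has_relation_sum) (use * in auto)
  then show ?thesis by (simp add: poly_altdef sum_distrib_left sum_distrib_right mult_ac flip: power_mult)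
qed

context not_root_of_unity
begin

text \<open>Since \<open>q\<close> is not a root of unity, \<open>q ^ k\<close> meets each of the
  finitely many roots at most once.\<close>

lemma poly_geometric_nonzero:
  assumes "d \<noteq> 0"
  shows "eventually (\<lambda>k. poly d (q ^ k) \<noteq> 0) sequentially"
proof -
  have "finite ((\<lambda>k. q ^ k) -` {x. poly d x = 0})"
    by (rule finite_vimageI) (use assms in \<open>auto simp: poly_roots_finite inj_def q_power_inj\<close>)
  then show ?thesis
    by (simp add: vimage_def eventually_cofinite flip: cofinite_eq_sequentially)
qed

sublocale E0: saturated_sequence_ideal q eventually_zero
proof
  fix d :: "complex poly" and c :: "nat \<Rightarrow> complex"
  assume "d \<noteq> 0" "(\<lambda>k. poly d (q ^ k) * c k) \<in> eventually_zero"
  from poly_geometric_nonzero[OF this(1)] this(2) show "c \<in> eventually_zero"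
    unfolding eventually_zero_def mem_Collect_eq by eventually_elim simp
next
  show "(\<lambda>_. 0) \<in> eventually_zero" by (simp add: eventually_zero_def)
next
  fix c :: "nat \<Rightarrow> complex"
  assume "\<forall>\<^sub>F k in sequentially. c k = 0"
  then show "c \<in> eventually_zero" by (simp add: eventually_zero_def)
qed (simp_all add: eventually_zero_shift_iff eventually_zero_mult eventually_zero_add)

text \<open>For \<open>const\<close>: a recurrence with constant coefficients expresses
  \<open>f k\<close> by later values, so some later value is at least \<open>1 / K\<close> times as
  large. Iterating this contradicts decay faster than every exponential unless
  \<open>f k = 0\<close>.\<close>

lemma bifinite_rapidly_decaying:
  assumes "E0.S.has_relation c" "index_shift.has_relation c"
    and "\<And>\<rho>. \<rho> > 0 \<Longrightarrow> \<exists>C. \<forall>k. cmod (c k) * \<rho> ^ k \<le> C"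
  shows "c \<in> eventually_zero"
proof -
  define B where "B = {c. E0.S.has_relation c \<and> index_shift.has_relation c \<and>
     (\<forall>\<rho>>0. \<exists>C. \<forall>k. cmod (c k) * \<rho> ^ k \<le> C)}"
  show ?thesis
  proof (rule E0.bifinite_in_ideal[of B])
    show "c \<in> B" using assms by (simp add: B_def)
  next
    fix f g assume fg: "f \<in> B" "g \<in> B"
    have "\<exists>C. \<forall>k. cmod (f k + g k) * \<rho> ^ k \<le> C" if \<rho>: "\<rho> > 0" for \<rho>
    proof -
      obtain C where C: "\<And>k. cmod (f k) * \<rho> ^ k \<le> C" using fg \<rho> unfolding B_def by blast
      obtain D where D: "\<And>k. cmod (g k) * \<rho> ^ k \<le> D" using fg \<rho> unfolding B_def by blast
      have "cmod (f k + g k) * \<rho> ^ k \<le> C + D" for k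
      proof -
        have "cmod (f k + g k) * \<rho> ^ k \<le> (cmod (f k) + cmod (g k)) * \<rho> ^ k"
          using \<rho> by (intro mult_right_mono norm_triangle_ineq) auto
        then show ?thesis using C[of k] D[of k] by (simp add: algebra_simps)
      qed
      then show ?thesis by blast
    qed
    then show "(\<lambda>k. f k + g k) \<in> B" using fg
      unfolding B_def by (auto intro: E0.S.has_relation_add index_shift.has_relation_add)
  next
    fix f a assume f: "f \<in> B"
    have "\<exists>C. \<forall>k. cmod (a * f k) * \<rho> ^ k \<le> C" if \<rho>: "\<rho> > 0" for \<rho>
    proof -
      obtain C where C: "\<And>k. cmod (f k) * \<rho> ^ k \<le> C" using f \<rho> unfolding B_def by blast
      have "cmod (a * f k) * \<rho> ^ k \<le> cmod a * C" for k
        using mult_left_mono[OF C[of k], of "cmod a"] by (simp add: norm_mult mult.assoc)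
      then show ?thesis by blast
    qed
    then show "(\<lambda>k. a * f k) \<in> B" using f
      E0.S.has_relation_scale[of f "[:a:]"] index_shift.has_relation_scale[of f "[:a:]"]
      unfolding B_def by auto
  next
    fix f assume f: "f \<in> B"
    have "\<exists>C. \<forall>k. cmod (shift f k) * \<rho> ^ k \<le> C" if \<rho>: "\<rho> > 0" for \<rho>
    proof -
      obtain C where C: "\<And>k. cmod (f k) * \<rho> ^ k \<le> C" using f \<rho> unfolding B_def by blast
      have "cmod (shift f k) * \<rho> ^ k \<le> C / \<rho>" for k
        using C[of "Suc k"] \<rho> by (simp add: shift_def field_simps)
      then show ?thesis by blast
    qed
    then show "shift f \<in> B" using f
      unfolding B_def by (auto intro: E0.S.has_relation_T index_shift.has_relation_T)
  next
    fix f assume "f \<in> B"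
    then show "E0.S.has_relation f" by (simp add: B_def)
  next
    fix f assume "f \<in> B"
    then show "\<exists>n P. P n \<noteq> 0 \<and> (\<lambda>k. \<Sum>i\<le>n. poly (P i) (of_nat k) * f (k + i)) \<in> eventually_zero"
      by (auto simp: B_def index_shift.has_relation_def funpow_shift)
  next
    fix f n p i
    assume f: "f \<in> B" and i: "i \<le> n" "p i \<noteq> (0 :: complex)"
      and rel: "(\<lambda>k. \<Sum>i\<le>n. p i * f (k + i)) \<in> eventually_zero"
    \<comment> \<open>The lowest nonzero coefficient, so that the recurrence can be solved for
      \<open>f k\<close> in terms of later values.\<close>
    define m where "m = (LEAST i. p i \<noteq> 0)"
    have "p m \<noteq> 0" unfolding m_def by (rule LeastI) (rule i(2))
    moreover have "p j = 0" if "j < m" for j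
      using not_less_Least[of j "\<lambda>i. p i \<noteq> 0"] that unfolding m_def by blast
    moreover have "m \<le> i" unfolding m_def by (rule Least_le) (rule i(2))
    then have "m \<le> n" using i(1) by simp
    ultimately have m: "p m \<noteq> 0" "\<And>j. j < m \<Longrightarrow> p j = 0" "m \<le> n" by blast+
    obtain k0 where k0: "\<And>k. k \<ge> k0 \<Longrightarrow> (\<Sum>i\<le>n. p i * f (k + i)) = 0"
      using rel by (auto simp: eventually_zero_def eventually_sequentially)
    \<comment> \<open>If all later values were smaller than \<open>cmod (f k) / K\<close>, the
      recurrence would give \<open>cmod (f k) \<le> (K - 1) / K * cmod (f k)\<close>; the summand
      \<open>1\<close> produces this contradiction.\<close>
    define K where "K = 1 + (\<Sum>j\<in>{m<..n}. cmod (p j)) / cmod (p m)"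
    have K: "K \<ge> 1" by (simp add: K_def sum_nonneg)
    have step: "\<exists>k'>k. cmod (f k) \<le> K * cmod (f k')" if k: "k \<ge> k0 + m" for k
    proof (rule ccontr)
      assume "\<not> ?thesis"
      then have *: "K * cmod (f k') < cmod (f k)" if "k' > k" for k' using that by force
      have "0 = (\<Sum>i\<le>n. p i * f (k - m + i))" using k0[of "k - m"] k by simp
      also have "\<dots> = (\<Sum>i\<in>{m..n}. p i * f (k - m + i))"
        by (rule sum.mono_neutral_right) (use m in auto)
      also have "{m..n} = insert m {m<..n}" using m(3) by auto
      also have "(\<Sum>i\<in>insert m {m<..n}. p i * f (k - m + i)) = p m * f k + (\<Sum>i\<in>{m<..n}. p i * f (k - m + i))"
        using k by simp
      finally have "p m * f k = - (\<Sum>i\<in>{m<..n}. p i * f (k - m + i))" by (simp add: eq_neg_iff_add_eq_0)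
      then have "cmod (p m) * cmod (f k) = cmod (\<Sum>i\<in>{m<..n}. p i * f (k - m + i))"
        by (metis norm_minus_cancel norm_mult)
      also have "\<dots> \<le> (\<Sum>i\<in>{m<..n}. cmod (p i) * (cmod (f k) / K))"
      proof (rule sum_norm_le)
        fix i assume "i \<in> {m<..n}"
        then have "k < k - m + i" using k by auto
        from *[OF this] have "cmod (f (k - m + i)) \<le> cmod (f k) / K"
          using K by (simp add: pos_le_divide_eq mult.commute)
        then show "cmod (p i * f (k - m + i)) \<le> cmod (p i) * (cmod (f k) / K)"
          unfolding norm_mult by (rule mult_left_mono) simp
      qed
      also have "\<dots> = (\<Sum>i\<in>{m<..n}. cmod (p i)) * (cmod (f k) / K)"
        by (rule sum_distrib_right[symmetric])
      also have "(\<Sum>i\<in>{m<..n}. cmod (p i)) = cmod (p m) * (K - 1)"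
        using m(1) by (simp add: K_def)
      finally have "cmod (p m) * cmod (f k) \<le> cmod (p m) * ((K - 1) * (cmod (f k) / K))"
        by (simp only: mult.assoc)
      then have "cmod (f k) \<le> (K - 1) * (cmod (f k) / K)"
        using m(1) by (subst (asm) mult_le_cancel_left_pos) auto
      then have "cmod (f k) * K \<le> (K - 1) * cmod (f k)" using K by (simp add: field_simps)
      then have "cmod (f k) \<le> 0" by (simp add: algebra_simps)
      moreover have "0 < cmod (f k)" using *[of "Suc k"] K by (smt (verit) mult_nonneg_nonneg norm_ge_zero lessI)
      ultimately show False by simp
    qed
    \<comment> \<open>Decay at the rate \<open>2 * K\<close> beats the loss of a factor
      \<open>K\<close> per step.\<close>
    obtain C where C: "\<And>k. cmod (f k) * (2 * K) ^ k \<le> C"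
    proof -
      have "\<forall>\<rho>>0. \<exists>C. \<forall>k. cmod (f k) * \<rho> ^ k \<le> C" using f unfolding B_def by blast
      moreover have "0 < 2 * K" using K by simp
      ultimately show ?thesis using that by blast
    qed
    have "f k = 0" if k: "k \<ge> k0 + m" for k
    proof -
      have chain: "\<exists>k'. k' \<ge> k + j \<and> cmod (f k) \<le> K ^ j * cmod (f k')" for j
      proof (induction j)
        case 0
        then show ?case by (intro exI[of _ k]) simp
      next
        case (Suc j)
        then obtain k' where k': "k' \<ge> k + j" "cmod (f k) \<le> K ^ j * cmod (f k')" by blast
        obtain k'' where k'': "k'' > k'" "cmod (f k') \<le> K * cmod (f k'')" using step[of k'] k k' by auto
        have "K ^ j * cmod (f k') \<le> K ^ j * (K * cmod (f k''))" using k'' K by (intro mult_left_mono) auto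
        then show ?case using k' k'' by (intro exI[of _ k'']) (auto simp: mult_ac)
      qed
      have bound: "cmod (f k) \<le> C * (1 / 2) ^ j" for j
      proof -
        obtain k' where k': "k' \<ge> k + j" "cmod (f k) \<le> K ^ j * cmod (f k')" using chain by blast
        have "cmod (f k') * (2 * K) ^ j \<le> cmod (f k') * (2 * K) ^ k'"
          using k' K by (intro mult_left_mono power_increasing) auto
        also have "\<dots> \<le> C" by (rule C)
        finally have "K ^ j * cmod (f k') \<le> C * (1 / 2) ^ j"
          by (simp add: power_mult_distrib power_one_over field_simps)
        then show ?thesis using k'(2) by simp
      qed
      have "(\<lambda>j. C * (1 / 2) ^ j) \<longlonglongrightarrow> C * 0"
        by (intro tendsto_mult tendsto_const LIMSEQ_power_zero) simp
      then have "cmod (f k) \<le> 0" by (intro LIMSEQ_le_const[of _ "0::real"]) (use bound in auto)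
      then show ?thesis by simp
    qed
    then show "f \<in> eventually_zero" by (auto simp: eventually_zero_def eventually_sequentially)
  qed
qed

text \<open>Comparing coefficients in \<open>(q\<^sup>k - a) e = (k - \<kappa>) f\<close>, the values at \<open>\<kappa>\<close> of the polynomial
  coefficients of \<open>e\<close> satisfy \<open>Q\<^sub>\<mu>(\<kappa>) = a Q\<^bsub>q\<mu>\<^esub>(\<kappa>)\<close>, so they vanish by finiteness.\<close>

lemma exp_polynomial_divide_linear:
  assumes "exp_polynomial (\<lambda>k. (of_nat k - \<kappa>) * z k)"
    and "exp_polynomial (\<lambda>k. (q ^ k - a) * z k)"
  shows "exp_polynomial z"
proof -
  obtain \<Lambda> Q where 1: "finite \<Lambda>" "0 \<notin> \<Lambda>" "\<And>\<mu>. \<mu> \<notin> \<Lambda> \<Longrightarrow> Q \<mu> = 0"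
     "eventually (\<lambda>k. (of_nat k - \<kappa>) * z k = (\<Sum>\<mu>\<in>\<Lambda>. poly (Q \<mu>) (of_nat k) * \<mu> ^ k)) sequentially"
    by (rule exp_polynomialE[OF assms(1)]) (rule that)
  obtain \<Lambda>' F where 2: "finite \<Lambda>'" "0 \<notin> \<Lambda>'" "\<And>\<mu>. \<mu> \<notin> \<Lambda>' \<Longrightarrow> F \<mu> = 0"
     "eventually (\<lambda>k. (q ^ k - a) * z k = (\<Sum>\<mu>\<in>\<Lambda>'. poly (F \<mu>) (of_nat k) * \<mu> ^ k)) sequentially"
    by (rule exp_polynomialE[OF assms(2)]) (rule that)
  \<comment> \<open>Multiplication by \<open>q ^ k\<close> moves the coefficient of
    \<open>\<mu> ^ k\<close> to \<open>q \<mu>\<close>, so these exponents are included.\<close>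
  define \<Lambda>'' where "\<Lambda>'' = \<Lambda> \<union> (\<lambda>\<mu>. q * \<mu>) ` \<Lambda> \<union> \<Lambda>'"
  have fin: "finite \<Lambda>''" "0 \<notin> \<Lambda>''" using 1 2 q_nonzero by (auto simp: \<Lambda>''_def)
  \<comment> \<open>The coefficient of \<open>\<mu> ^ k\<close> in
    \<open>(q ^ k - a) e - (k - \<kappa>) f\<close>, where \<open>e\<close> and \<open>f\<close> are
    the two given exponential polynomials.\<close>
  define D where "D = (\<lambda>\<mu>. Q (\<mu> / q) - smult a (Q \<mu>) - [:-\<kappa>, 1:] * F \<mu>)"
  have "eventually (\<lambda>k. (\<Sum>\<mu>\<in>\<Lambda>''. poly (D \<mu>) (of_nat k) * \<mu> ^ k) = 0) sequentially"
    using 1(4) 2(4)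
  proof eventually_elim
    case (elim k)
    have e: "(\<Sum>\<mu>\<in>\<Lambda>''. poly (Q \<mu>) (of_nat k) * \<mu> ^ k) = (of_nat k - \<kappa>) * z k"
      unfolding elim(1) by (rule sum.mono_neutral_right) (use fin 1 in \<open>auto simp: \<Lambda>''_def\<close>)
    have f: "(\<Sum>\<mu>\<in>\<Lambda>''. poly (F \<mu>) (of_nat k) * \<mu> ^ k) = (q ^ k - a) * z k"
      unfolding elim(2) by (rule sum.mono_neutral_right) (use fin 2 in \<open>auto simp: \<Lambda>''_def\<close>)
    have "(\<Sum>\<mu>\<in>\<Lambda>''. poly (Q (\<mu> / q)) (of_nat k) * \<mu> ^ k) = (\<Sum>\<mu>\<in>(\<lambda>\<mu>. q * \<mu>) ` \<Lambda>. poly (Q (\<mu> / q)) (of_nat k) * \<mu> ^ k)"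
    proof (rule sum.mono_neutral_right)
      show "\<forall>i\<in>\<Lambda>'' - (\<lambda>\<mu>. q * \<mu>) ` \<Lambda>. poly (Q (i / q)) (of_nat k) * i ^ k = 0"
      proof
        fix i assume "i \<in> \<Lambda>'' - (\<lambda>\<mu>. q * \<mu>) ` \<Lambda>"
        then have "i / q \<notin> \<Lambda>" using q_nonzero by (auto simp: image_iff)
        then show "poly (Q (i / q)) (of_nat k) * i ^ k = 0" by (simp add: 1)
      qed
    qed (use fin in \<open>auto simp: \<Lambda>''_def\<close>)
    also have "\<dots> = (\<Sum>\<mu>\<in>\<Lambda>. poly (Q \<mu>) (of_nat k) * (q * \<mu>) ^ k)"
      using q_nonzero by (subst sum.reindex) (auto simp: inj_on_def)
    also have "\<dots> = q ^ k * ((of_nat k - \<kappa>) * z k)"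
      unfolding elim(1) by (simp add: sum_distrib_left power_mult_distrib mult_ac)
    finally have g: "(\<Sum>\<mu>\<in>\<Lambda>''. poly (Q (\<mu> / q)) (of_nat k) * \<mu> ^ k) = q ^ k * ((of_nat k - \<kappa>) * z k)" .
    have "(\<Sum>\<mu>\<in>\<Lambda>''. poly (D \<mu>) (of_nat k) * \<mu> ^ k) =
       (\<Sum>\<mu>\<in>\<Lambda>''. poly (Q (\<mu> / q)) (of_nat k) * \<mu> ^ k) - a * (\<Sum>\<mu>\<in>\<Lambda>''. poly (Q \<mu>) (of_nat k) * \<mu> ^ k)
       - (of_nat k - \<kappa>) * (\<Sum>\<mu>\<in>\<Lambda>''. poly (F \<mu>) (of_nat k) * \<mu> ^ k)"
      by (simp add: D_def sum_distrib_left sum_subtractf[symmetric] algebra_simps)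
    then show ?case unfolding e f g by (simp add: algebra_simps)
  qed
  then obtain k0 where k0: "\<And>k. k \<ge> k0 \<Longrightarrow> (\<Sum>\<mu>\<in>\<Lambda>''. poly (D \<mu>) (of_nat k) * \<mu> ^ k) = 0"
    by (auto simp: eventually_sequentially)
  have D: "D \<mu> = 0" if "\<mu> \<in> \<Lambda>''" for \<mu>
    by (rule exp_polynomial_independent[OF fin _ that, of k0]) (use k0 in auto)
  have step: "poly (Q \<mu>) \<kappa> = a * poly (Q (q * \<mu>)) \<kappa>" if "\<mu> \<in> \<Lambda>" for \<mu>
  proof -
    have "q * \<mu> \<in> \<Lambda>''" using that by (auto simp: \<Lambda>''_def)
    then have "poly (D (q * \<mu>)) \<kappa> = 0" by (simp add: D)
    then show ?thesis using q_nonzero by (simp add: D_def)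
  qed
  have root: "poly (Q \<mu>) \<kappa> = 0" if "\<mu> \<in> \<Lambda>" for \<mu>
  proof (rule ccontr)
    assume nz: "poly (Q \<mu>) \<kappa> \<noteq> 0"
    have *: "q ^ n * \<mu> \<in> \<Lambda> \<and> poly (Q (q ^ n * \<mu>)) \<kappa> \<noteq> 0" for n
    proof (induction n)
      case 0
      then show ?case using that nz by simp
    next
      case (Suc n)
      then have "poly (Q (q ^ Suc n * \<mu>)) \<kappa> \<noteq> 0" using step[of "q ^ n * \<mu>"] by (auto simp: mult.assoc)
      then show ?case using 1(3)[of "q ^ Suc n * \<mu>"] by force
    qed
    \<comment> \<open>The orbit of \<open>\<mu>\<close> under multiplication by \<open>q\<close> is
      infinite, yet nonvanishing propagates along it inside the finite set
      \<open>\<Lambda>\<close>.\<close>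
    have "inj (\<lambda>n. q ^ n * \<mu>)"
      using that 1(2) by (auto simp: inj_def q_power_inj)
    moreover have "range (\<lambda>n. q ^ n * \<mu>) \<subseteq> \<Lambda>" using * by auto
    ultimately show False using 1(1) finite_subset finite_imageD by (metis infinite_UNIV_nat)
  qed
  define R where "R = (\<lambda>\<mu>. Q \<mu> div [:-\<kappa>, 1:])"
  have R: "Q \<mu> = [:-\<kappa>, 1:] * R \<mu>" if "\<mu> \<in> \<Lambda>" for \<mu>
    using root[OF that] by (simp only: R_def poly_eq_0_iff_dvd dvd_mult_div_cancel)
  have "finite {k. of_nat k = \<kappa>}"
  proof (rule finite_subset)
    show "{k. of_nat k = \<kappa>} \<subseteq> {nat \<lfloor>Re \<kappa>\<rfloor>}" by auto
  qed simp
  then have ne: "eventually (\<lambda>k. of_nat k \<noteq> \<kappa>) sequentially"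
    by (simp add: eventually_cofinite flip: cofinite_eq_sequentially)
  have "exp_polynomial (\<lambda>k. \<Sum>\<mu>\<in>\<Lambda>. poly (R \<mu>) (of_nat k) * \<mu> ^ k)"
    unfolding exp_polynomial_def using 1 by (intro exI[of _ \<Lambda>] exI[of _ R]) auto
  then show ?thesis
  proof (rule exp_polynomial_cong)
    show "\<forall>\<^sub>F k in sequentially. z k = (\<Sum>\<mu>\<in>\<Lambda>. poly (R \<mu>) (of_nat k) * \<mu> ^ k)"
      using 1(4) ne
    proof eventually_elim
      case (elim k)
      have "(of_nat k - \<kappa>) * z k = (of_nat k - \<kappa>) * (\<Sum>\<mu>\<in>\<Lambda>. poly (R \<mu>) (of_nat k) * \<mu> ^ k)"
        unfolding elim(1) sum_distrib_left
      proof (rule sum.cong[OF refl])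
        fix \<mu> assume "\<mu> \<in> \<Lambda>"
        show "poly (Q \<mu>) (of_nat k) * \<mu> ^ k = (of_nat k - \<kappa>) * (poly (R \<mu>) (of_nat k) * \<mu> ^ k)"
          by (simp only: R[OF \<open>\<mu> \<in> \<Lambda>\<close>]) (simp add: algebra_simps)
      qed
      then show ?case using elim(2) by simp
    qed
  qed
qed

lemma exp_polynomial_divide_index_poly:
  assumes "P \<noteq> 0" "exp_polynomial (\<lambda>k. poly P (of_nat k) * z k)"
    and "exp_polynomial (\<lambda>k. (q ^ k - a) * z k)"
  shows "exp_polynomial z"
  using assms(1,2)
proof (induction "degree P" arbitrary: P)
  case 0
  then obtain b where "P = [:b:]" "b \<noteq> 0" by (metis degree_eq_zeroE pCons_0_0)
  then show ?case using exp_polynomial_cmult[OF 0(3), of "1 / b"] by simp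
next
  case (Suc n)
  then obtain \<kappa> where "poly P \<kappa> = 0"
    using fundamental_theorem_of_algebra_alt[of P] by fastforce
  then obtain r where r: "P = [:-\<kappa>, 1:] * r" by (metis poly_eq_0_iff_dvd dvdE)
  then have r0: "r \<noteq> 0" using Suc.prems by auto
  have deg: "degree P = Suc (degree r)" unfolding r using r0 by (subst degree_mult_eq) auto
  have "exp_polynomial (\<lambda>k. poly r (of_nat k) * z k)"
  proof (rule exp_polynomial_divide_linear)
    show "exp_polynomial (\<lambda>k. (of_nat k - \<kappa>) * (poly r (of_nat k) * z k))"
      using Suc.prems(2) by (simp add: r algebra_simps)
    show "exp_polynomial (\<lambda>k. (q ^ k - a) * (poly r (of_nat k) * z k))"
      using exp_polynomial_index_poly[OF assms(3), of r] by (simp add: mult_ac)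
  qed
  then show ?case using Suc.hyps r0 deg by auto
qed

text \<open>Let \<open>D\<close> be the product of the \<open>l s\<close> with \<open>s < n\<close>.
  Multiplying the recurrence by \<open>D(q ^ k)\<close> turns every lower term into an exponential
  polynomial, hence \<open>D(q ^ k) P n (k) c (k + n)\<close> is one, and so is
  \<open>l n (q ^ k) P n (k) c (k + n)\<close>. For \<open>a \<noteq> 0\<close> the roots
  \<open>a / q ^ s\<close> are distinct, so \<open>D\<close> and \<open>l n\<close> are coprime and
  \<open>P n (k) c (k + n)\<close> is an exponential polynomial. The factor \<open>P n (k)\<close>
  is divided out last.\<close>

lemma index_recursive_divide_linear:
  assumes "index_shift.has_relation c" "exp_polynomial (\<lambda>k. (q ^ k - a) * c k)" "a \<noteq> 0"
  shows "exp_polynomial c"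
proof -
  obtain n P where P: "P n \<noteq> 0" "(\<lambda>k. \<Sum>i\<le>n. poly (P i) (of_nat k) * (shift ^^ i) c k) \<in> eventually_zero"
    using assms(1) unfolding index_shift.has_relation_def by blast
  define l where "l = (\<lambda>s. [:-a, q ^ s:])"
  define D where "D = (\<Prod>s<n. l s)"
  define e where "e = (\<lambda>k. (q ^ k - a) * c k)"
  have e: "exp_polynomial e" using assms(2) by (simp add: e_def)
  have eS: "exp_polynomial (\<lambda>k. e (k + s))" for s
  proof -
    have "exp_polynomial ((shift ^^ s) e)"
      by (induction s) (auto intro: e exp_polynomial_shift)
    then show ?thesis by (simp add: funpow_shift)
  qed
  have l: "poly (l s) (q ^ k) * c (k + s) = e (k + s)" for s k
    by (simp add: l_def e_def power_add algebra_simps)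
  have terms: "exp_polynomial (\<lambda>k. poly (P s) (of_nat k) * (poly (\<Prod>s'\<in>{..<n} - {s}. l s') (q ^ k) * e (k + s)))" for s
    by (rule exp_polynomial_index_poly, rule exp_polynomial_poly_geometric) (rule eS, rule q_nonzero)
  have "exp_polynomial (\<lambda>k. poly (P n) (of_nat k) * (poly D (q ^ k) * c (k + n)))"
  proof (rule exp_polynomial_cong)
    show "exp_polynomial (\<lambda>k. -1 * (\<Sum>s<n. poly (P s) (of_nat k) * (poly (\<Prod>s'\<in>{..<n} - {s}. l s') (q ^ k) * e (k + s))))"
      by (rule exp_polynomial_cmult, rule exp_polynomial_sum, rule terms)
    show "\<forall>\<^sub>F k in sequentially. poly (P n) (of_nat k) * (poly D (q ^ k) * c (k + n)) =
       -1 * (\<Sum>s<n. poly (P s) (of_nat k) * (poly (\<Prod>s'\<in>{..<n} - {s}. l s') (q ^ k) * e (k + s)))"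
      using P(2) unfolding eventually_zero_def mem_Collect_eq
    proof eventually_elim
      case (elim k)
      have "poly D (q ^ k) * c (k + s) = poly (\<Prod>s'\<in>{..<n} - {s}. l s') (q ^ k) * e (k + s)" if "s < n" for s
      proof -
        have "D = l s * (\<Prod>s'\<in>{..<n} - {s}. l s')" using that by (simp add: D_def prod.remove)
        then show ?thesis by (simp add: l[symmetric] mult_ac)
      qed
      then have "(\<Sum>s<n. poly (P s) (of_nat k) * (poly (\<Prod>s'\<in>{..<n} - {s}. l s') (q ^ k) * e (k + s)))
        = (\<Sum>s<n. poly (P s) (of_nat k) * (poly D (q ^ k) * c (k + s)))"
        by (intro sum.cong) auto
      also have "\<dots> = poly D (q ^ k) * (\<Sum>s<n. poly (P s) (of_nat k) * c (k + s))"
        by (simp add: sum_distrib_left mult_ac)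
      also have "(\<Sum>s<n. poly (P s) (of_nat k) * c (k + s)) = - poly (P n) (of_nat k) * c (k + n)"
        using elim by (simp add: funpow_shift lessThan_Suc_atMost[symmetric] eq_neg_iff_add_eq_0)
      finally show ?case by simp
    qed
  qed
  then have A: "exp_polynomial (\<lambda>k. poly D (q ^ k) * (poly (P n) (of_nat k) * c (k + n)))"
    by (simp add: mult_ac)
  have B: "exp_polynomial (\<lambda>k. poly (l n) (q ^ k) * (poly (P n) (of_nat k) * c (k + n)))"
    using exp_polynomial_index_poly[OF eS[of n], of "P n"] by (simp add: l[symmetric] mult_ac)
  \<comment> \<open>The root of \<open>l n\<close>. Dividing \<open>D - [:poly D r:]\<close> by
    \<open>X - r\<close> yields the Bezout identity for \<open>D\<close> and \<open>l n\<close>,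
    with the nonzero constant \<open>poly D r\<close>.\<close>
  define r where "r = a / q ^ n"
  have "poly (l s) r \<noteq> 0" if "s < n" for s
  proof -
    have "q ^ n \<noteq> q ^ s" using that q_power_inj by simp
    then show ?thesis using assms(3) q_nonzero by (simp add: l_def r_def field_simps)
  qed
  then have b: "poly D r \<noteq> 0" by (simp add: D_def poly_prod)
  have "[:-r, 1:] dvd D - [:poly D r:]" by (simp add: poly_eq_0_iff_dvd[symmetric])
  then obtain w where w: "D - [:poly D r:] = [:-r, 1:] * w" by (rule dvdE)
  have lr: "[:-r, 1:] = smult (1 / q ^ n) (l n)" using q_nonzero by (simp add: l_def r_def)
  have "D - [:poly D r:] = smult (1 / q ^ n) (l n * w)" unfolding w lr by simp
  then have "poly (D - [:poly D r:]) x = poly (smult (1 / q ^ n) (l n * w)) x" for x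
    by (rule arg_cong)
  then have "poly D x - poly D r = 1 / q ^ n * (poly (l n) x * poly w x)" for x
    unfolding poly_diff poly_smult poly_mult by simp
  then have bez: "poly D r = poly D x - 1 / q ^ n * (poly w x * poly (l n) x)" for x
    by (metis diff_diff_eq2 add_diff_cancel_left' mult.commute)
  have "exp_polynomial (\<lambda>k. 1 / poly D r * (poly D (q ^ k) * (poly (P n) (of_nat k) * c (k + n))
     + (- 1 / q ^ n) * (poly w (q ^ k) * (poly (l n) (q ^ k) * (poly (P n) (of_nat k) * c (k + n))))))"
    by (rule exp_polynomial_cmult, rule exp_polynomial_add[OF A],
        rule exp_polynomial_cmult, rule exp_polynomial_poly_geometric[OF B q_nonzero])
  also have "(\<lambda>k. 1 / poly D r * (poly D (q ^ k) * (poly (P n) (of_nat k) * c (k + n))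
     + (- 1 / q ^ n) * (poly w (q ^ k) * (poly (l n) (q ^ k) * (poly (P n) (of_nat k) * c (k + n)))))) =
     (\<lambda>k. poly (P n) (of_nat k) * (shift ^^ n) c k)"
  proof
    fix k
    have "poly D (q ^ k) * X + (- 1 / q ^ n) * (poly w (q ^ k) * (poly (l n) (q ^ k) * X)) = poly D r * X" for X
      unfolding bez[of "q ^ k"] by (simp add: algebra_simps)
    then show "1 / poly D r * (poly D (q ^ k) * (poly (P n) (of_nat k) * c (k + n))
     + (- 1 / q ^ n) * (poly w (q ^ k) * (poly (l n) (q ^ k) * (poly (P n) (of_nat k) * c (k + n))))) =
     poly (P n) (of_nat k) * (shift ^^ n) c k" using b by (simp only:) (simp add: funpow_shift)
  qed
  finally have "exp_polynomial (\<lambda>k. poly (P n) (of_nat k) * (shift ^^ n) c k)" .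
  moreover have "exp_polynomial (\<lambda>k. (q ^ k - a / q ^ n) * (shift ^^ n) c k)"
    using exp_polynomial_cmult[OF eS[of n], of "1 / q ^ n"] q_nonzero
    by (simp add: e_def funpow_shift power_add field_simps)
  ultimately have "exp_polynomial ((shift ^^ n) c)"
    by (rule exp_polynomial_divide_index_poly[OF P(1)])
  then show ?thesis by (induction n) (auto intro: exp_polynomial_unshift)
qed

text \<open>The roots of \<open>d\<close> are removed one at a time. A root \<open>0\<close>
  contributes the factor \<open>q ^ k\<close>, which is undone by a geometric factor. For another
  root, the product of \<open>c\<close> with the remaining factor is still P-recursive, so the
  linear case applies to it.\<close>

lemma index_recursive_divide_poly:
  assumes "d \<noteq> 0" "index_shift.has_relation c" "exp_polynomial (\<lambda>k. poly d (q ^ k) * c k)"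
  shows "exp_polynomial c"
  using assms(1,3)
proof (induction "degree d" arbitrary: d)
  case 0
  then obtain b where "d = [:b:]" "b \<noteq> 0" by (metis degree_eq_zeroE pCons_0_0)
  then show ?case using exp_polynomial_cmult[OF 0(3), of "1 / b"] by simp
next
  case (Suc n)
  then obtain a where "poly d a = 0"
    using fundamental_theorem_of_algebra_alt[of d] by fastforce
  then obtain r where r: "d = [:-a, 1:] * r" by (metis poly_eq_0_iff_dvd dvdE)
  then have r0: "r \<noteq> 0" using Suc.prems by auto
  have deg: "degree d = Suc (degree r)" unfolding r using r0 by (subst degree_mult_eq) auto
  have *: "exp_polynomial (\<lambda>k. (q ^ k - a) * (poly r (q ^ k) * c k))"
    using Suc.prems(2) by (simp add: r algebra_simps)
  have "exp_polynomial (\<lambda>k. poly r (q ^ k) * c k)"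
  proof (cases "a = 0")
    case True
    then show ?thesis using exp_polynomial_geometric[OF *, of "1 / q"] q_nonzero
      by (simp add: power_divide field_simps)
  next
    case False
    then show ?thesis
      using index_recursive_divide_linear[OF index_shift_poly_geometric[OF assms(2) q_nonzero, of r] *] by simp
  qed
  then show ?case using Suc.hyps r0 deg by auto
qed

text \<open>Exponential polynomials alone do not form a saturated ideal; this is their saturation by
  polynomials in \<open>q ^ k\<close>.\<close>

definition quotients :: "(nat \<Rightarrow> complex) set" where
  "quotients = {c. \<exists>d. d \<noteq> 0 \<and> exp_polynomial (\<lambda>k. poly d (q ^ k) * c k)}"

sublocale E1: saturated_sequence_ideal q quotients
proof
  show "(\<lambda>_. 0) \<in> quotients"
    unfolding quotients_def by (auto intro!: exI[of _ 1] exp_polynomial_zero)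
next
  fix f g assume "f \<in> quotients" "g \<in> quotients"
  then obtain d e where d: "d \<noteq> 0" "exp_polynomial (\<lambda>k. poly d (q ^ k) * f k)"
    and e: "e \<noteq> 0" "exp_polynomial (\<lambda>k. poly e (q ^ k) * g k)"
    by (auto simp: quotients_def)
  have "exp_polynomial (\<lambda>k. poly e (q ^ k) * (poly d (q ^ k) * f k) + poly d (q ^ k) * (poly e (q ^ k) * g k))"
    by (rule exp_polynomial_add; rule exp_polynomial_poly_geometric) (rule d e q_nonzero)+
  then have "exp_polynomial (\<lambda>k. poly (d * e) (q ^ k) * (f k + g k))" by (simp add: algebra_simps)
  then show "(\<lambda>x. f x + g x) \<in> quotients" using d e unfolding quotients_def by (auto intro!: exI[of _ "d * e"])
next
  fix f p assume "f \<in> quotients"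
  then obtain d where d: "d \<noteq> 0" "exp_polynomial (\<lambda>k. poly d (q ^ k) * f k)"
    by (auto simp: quotients_def)
  from exp_polynomial_poly_geometric[OF d(2) q_nonzero, of p] d(1)
  show "(\<lambda>x. poly p (q ^ x) * f x) \<in> quotients"
    unfolding quotients_def by (auto intro!: exI[of _ d] simp: mult_ac)
next
  fix d c assume "d \<noteq> 0" "(\<lambda>k. poly d (q ^ k) * c k) \<in> quotients"
  then obtain e where "e \<noteq> 0" "exp_polynomial (\<lambda>k. poly e (q ^ k) * (poly d (q ^ k) * c k))"
    by (auto simp: quotients_def)
  then show "c \<in> quotients" using \<open>d \<noteq> 0\<close>
    unfolding quotients_def by (auto simp: mult.assoc intro!: exI[of _ "e * d"])
next
  fix f assume "f \<in> quotients"
  then obtain d where d: "d \<noteq> 0" "exp_polynomial (\<lambda>k. poly d (q ^ k) * f k)"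
    by (auto simp: quotients_def)
  from exp_polynomial_index_poly[OF d(2), of "[:0, 1:]"] d(1)
  show "(\<lambda>k. of_nat k * f k) \<in> quotients"
    unfolding quotients_def by (auto intro!: exI[of _ d] simp: mult_ac)
next
  fix f assume "f \<in> quotients"
  then obtain d where d: "d \<noteq> 0" "exp_polynomial (\<lambda>k. poly d (q ^ k) * f k)"
    by (auto simp: quotients_def)
  have "exp_polynomial (\<lambda>k. poly (pcompose d [:0, q:]) (q ^ k) * shift f k)"
    using exp_polynomial_shift[OF d(2)] by (simp add: shift_def poly_pcompose mult.commute)
  moreover have "pcompose d [:0, q:] \<noteq> 0" using d(1) q_nonzero by (simp add: pcompose_eq_0_iff)
  ultimately show "shift f \<in> quotients" unfolding quotients_def by blast
next
  fix f assume "shift f \<in> quotients"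
  then obtain d where d: "d \<noteq> 0" "exp_polynomial (\<lambda>k. poly d (q ^ k) * shift f k)"
    by (auto simp: quotients_def)
  have "shift (\<lambda>k. poly (dil d) (q ^ k) * f k) = (\<lambda>k. poly d (q ^ k) * shift f k)"
    using q_nonzero by (simp add: shift_def dil_def poly_pcompose)
  then have "exp_polynomial (\<lambda>k. poly (dil d) (q ^ k) * f k)"
    using d(2) by (metis exp_polynomial_unshift)
  moreover have "dil d \<noteq> 0" using d(1) by (simp add: dil_eq_0_iff)
  ultimately show "f \<in> quotients" unfolding quotients_def by blast
next
  fix c assume "\<forall>\<^sub>F k in sequentially. c k = (0 :: complex)"
  then have "exp_polynomial c" by (rule exp_polynomial_cong[OF exp_polynomial_zero])
  then show "c \<in> quotients" unfolding quotients_def by (auto intro!: exI[of _ 1])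
qed

text \<open>If a combination of shifts with constant coefficients lies in \<open>quotients\<close>,
  it is also P-recursive, hence an honest exponential polynomial, and the recurrence can be solved.
  The same division removes the denominator of \<open>c\<close> at the end.\<close>

theorem bifinite_exp_polynomial:
  assumes "E0.S.has_relation c" "index_shift.has_relation c"
  shows "exp_polynomial c"
proof -
  define B where "B = {c. E0.S.has_relation c \<and> index_shift.has_relation c}"
  have quot: "exp_polynomial f" if "index_shift.has_relation f" "f \<in> quotients" for f
    using that index_recursive_divide_poly unfolding quotients_def by blast
  have sub: "f \<in> quotients" if "f \<in> eventually_zero" for f
    using that E1.Z_eventually_zero by (simp add: eventually_zero_def)
  have "c \<in> quotients"
  proof (rule E1.bifinite_in_ideal[of B])
    show "c \<in> B" using assms by (simp add: B_def)
  next
    fix f g assume "f \<in> B" "g \<in> B"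
    then show "(\<lambda>k. f k + g k) \<in> B"
      unfolding B_def by (auto intro: E0.S.has_relation_add index_shift.has_relation_add)
  next
    fix f a assume "f \<in> B"
    then show "(\<lambda>k. a * f k) \<in> B"
      using E0.S.has_relation_scale[of f "[:a:]"] index_shift.has_relation_scale[of f "[:a:]"]
      unfolding B_def by auto
  next
    fix f assume "f \<in> B"
    then show "shift f \<in> B"
      unfolding B_def by (auto intro: E0.S.has_relation_T index_shift.has_relation_T)
  next
    fix f assume "f \<in> B"
    then show "E1.S.has_relation f"
      unfolding B_def E0.S.has_relation_def E1.S.has_relation_def using sub by blast
  next
    fix f assume "f \<in> B"
    then show "\<exists>n P. P n \<noteq> 0 \<and> (\<lambda>k. \<Sum>i\<le>n. poly (P i) (of_nat k) * f (k + i)) \<in> quotients"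
      unfolding B_def index_shift.has_relation_def funpow_shift using sub by blast
  next
    fix f n p i
    assume f: "f \<in> B" and i: "i \<le> n" "p i \<noteq> (0 :: complex)"
      and rel: "(\<lambda>k. \<Sum>i\<le>n. p i * f (k + i)) \<in> quotients"
    have PF: "index_shift.has_relation (\<lambda>k. p i * (shift ^^ i) f k)" for i
    proof -
      have "index_shift.has_relation ((shift ^^ i) f)"
        by (induction i) (use f in \<open>auto simp: B_def intro: index_shift.has_relation_T\<close>)
      from index_shift.has_relation_scale[OF this UNIV_I, of "[:p i:]"] show ?thesis by simp
    qed
    have "index_shift.has_relation (\<lambda>k. \<Sum>i\<le>n. p i * (shift ^^ i) f k)"
      by (rule index_shift.has_relation_sum) (use PF in auto)
    from quot[OF this] rel have ep: "exp_polynomial (\<lambda>k. \<Sum>i\<le>n. p i * f (k + i))"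
      by (simp add: funpow_shift)
    define P where "P = (\<Sum>i\<le>n. monom (p i) i)"
    have cP: "coeff P i = (if i \<le> n then p i else 0)" for i by (simp add: P_def coeff_sum)
    have "P \<noteq> 0" using i cP[of i] by auto
    moreover have "(\<Sum>i\<le>degree P. coeff P i * f (k + i)) = (\<Sum>i\<le>n. p i * f (k + i))" for k
    proof -
      have "(\<Sum>i\<le>degree P. coeff P i * f (k + i)) = (\<Sum>i\<le>n. coeff P i * f (k + i))"
      proof (rule sum.mono_neutral_left)
        show "{..degree P} \<subseteq> {..n}" using degree_le[of n P] cP by auto
        show "\<forall>i\<in>{..n} - {..degree P}. coeff P i * f (k + i) = 0" using coeff_eq_0[of P] by auto
      qed simp
      then show ?thesis by (simp add: cP)
    qed
    ultimately have "exp_polynomial f" using ep exp_polynomial_solve[of P f] by simp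
    then show "f \<in> quotients" unfolding quotients_def by (auto intro!: exI[of _ 1])
  qed
  then show ?thesis using quot assms by blast
qed

end

section \<open>Functions on the surface of the logarithm\<close>

definition almost_zero :: "(complex \<Rightarrow> complex) set" where
  "almost_zero = {f. hat_eq f (\<lambda>_. 0)}"

abbreviation meromorphic :: "(complex \<Rightarrow> complex) set" where
  "meromorphic \<equiv> {f. f meromorphic_on UNIV}"

lemma hat_eq_iff: "hat_eq f g \<longleftrightarrow> (\<forall>z. eventually (\<lambda>p. f p = g p) (at z))"
  by (simp add: hat_eq_def eventually_cosparse_open_eq)

lemma hat_eq_refl [simp]: "hat_eq f f"
  by (simp add: hat_eq_iff)

lemma hat_eq_sym: "hat_eq f g \<Longrightarrow> hat_eq g f"
  by (simp add: hat_eq_def eq_commute)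

lemma hat_eq_trans: "hat_eq f g \<Longrightarrow> hat_eq g h \<Longrightarrow> hat_eq f h"
  unfolding hat_eq_def by (auto elim: eventually_elim2)

lemma hat_eqI_eventually:
  "eventually P (cosparse UNIV) \<Longrightarrow> (\<And>p. P p \<Longrightarrow> f p = g p) \<Longrightarrow> hat_eq f g"
  unfolding hat_eq_def by (erule eventually_mono) auto

lemma diff_almost_zero_iff: "(\<lambda>x. f x - g x) \<in> almost_zero \<longleftrightarrow> hat_eq f g"
  by (simp add: almost_zero_def hat_eq_def)

lemma eventually_at_affine:
  assumes "eventually P (at (a * z + b))" "a \<noteq> (0 :: complex)"
  shows "eventually (\<lambda>p. P (a * p + b)) (at z)"
proof -
  have "filterlim (\<lambda>p. a * p + b) (at (a * z + b)) (at z)"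
    by (rule filterlim_atI) (use assms(2) in \<open>auto intro!: tendsto_intros simp: eventually_at_filter\<close>)
  with assms(1) show ?thesis by (rule eventually_compose_filterlim)
qed

lemma eventually_cosparse_affine:
  "eventually P (cosparse (UNIV :: complex set)) \<Longrightarrow> a \<noteq> 0 \<Longrightarrow> eventually (\<lambda>p. P (a * p + b)) (cosparse UNIV)"
  unfolding eventually_cosparse_open_eq[OF open_UNIV] using eventually_at_affine by blast

lemma hat_eq_affine: "hat_eq f g \<Longrightarrow> a \<noteq> 0 \<Longrightarrow> hat_eq (\<lambda>p. f (a * p + b)) (\<lambda>p. g (a * p + b))"
  unfolding hat_eq_def by (rule eventually_cosparse_affine)

lemma eventually_at_deriv_eq:
  assumes "eventually (\<lambda>p. f p = g p) (at z)"
  shows "eventually (\<lambda>p. deriv f p = deriv g p) (at z)"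
proof -
  obtain S where S: "open S" "z \<in> S" "\<And>p. p \<in> S \<Longrightarrow> p \<noteq> z \<Longrightarrow> f p = g p"
    using assms by (auto simp: eventually_at_topological)
  have "deriv f p = deriv g p" if "p \<in> S" "p \<noteq> z" for p
  proof (rule deriv_cong_ev)
    have "eventually (\<lambda>p. p \<in> S - {z}) (nhds p)"
      by (rule eventually_nhds_in_open) (use S that in auto)
    then show "eventually (\<lambda>p. f p = g p) (nhds p)" by eventually_elim (use S in auto)
  qed simp
  then show ?thesis using S unfolding eventually_at_topological by blast
qed

lemma hat_eq_deriv: "hat_eq f g \<Longrightarrow> hat_eq (deriv f) (deriv g)"
  by (simp add: hat_eq_iff eventually_at_deriv_eq)

lemma hat_eq_funpow:
  assumes "\<And>f g. hat_eq f g \<Longrightarrow> hat_eq (T f) (T g)" "hat_eq f g"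
  shows "hat_eq ((T ^^ n) f) ((T ^^ n) g)"
  by (induction n) (use assms in auto)

lemma meromorphic_affine:
  assumes "f meromorphic_on UNIV"
  shows "(\<lambda>p. f (a * p + b)) meromorphic_on UNIV"
proof -
  have "(\<lambda>p. a * p + b) analytic_on UNIV" by (intro analytic_intros)
  from meromorphic_on_compose[OF assms this] show ?thesis by simp
qed

lemma meromorphic_exp_poly: "(\<lambda>p. poly u (exp p)) meromorphic_on A"
  unfolding poly_altdef by (intro analytic_on_imp_meromorphic_on analytic_intros)

text \<open>Distinct points with the same exponential are at distance at least
  \<open>2 pi\<close>.\<close>

lemma exp_avoids: "eventually (\<lambda>p. exp p \<noteq> (r :: complex)) (at z)"
proof (cases "exp z = r")
  case False
  have "((\<lambda>p. exp p) \<longlongrightarrow> exp z) (at z)" by (intro tendsto_intros)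
  then show ?thesis using False by (rule tendsto_imp_eventually_ne)
next
  case True
  have "eventually (\<lambda>p. p \<in> ball z 1 - {z}) (at z)"
    by (rule eventually_at_in_open) auto
  then show ?thesis
  proof eventually_elim
    case (elim p)
    show ?case
    proof
      assume "exp p = r"
      then have "exp p = exp z" using True by simp
      then obtain n :: int where n: "p = z + of_real (of_int (2 * n) * pi) * \<i>" unfolding exp_eq by blast
      then have "n \<noteq> 0" using elim by auto
      have "norm (p - z) = 2 * pi * \<bar>of_int n\<bar>" using n by (simp add: norm_mult)
      moreover have "\<bar>of_int n :: real\<bar> \<ge> 1" using \<open>n \<noteq> 0\<close> by linarith
      then have "2 * pi * \<bar>of_int n :: real\<bar> \<ge> 2 * pi * 1" by (intro mult_left_mono) auto
      moreover have "norm (p - z) < 1" using elim by (simp add: dist_norm norm_minus_commute)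
      ultimately show False using pi_gt3 by simp
    qed
  qed
qed

lemma eventually_poly_exp_nonzero:
  fixes v :: "complex poly"
  assumes "v \<noteq> 0"
  shows "eventually (\<lambda>p. poly v (exp p) \<noteq> 0) (cosparse UNIV)"
proof -
  have "eventually (\<lambda>p. \<forall>r\<in>{r. poly v r = 0}. exp p \<noteq> r) (at z)" for z
    by (rule eventually_ball_finite[OF poly_roots_finite[OF assms]]) (rule ballI, rule exp_avoids)
  then have "eventually (\<lambda>p. poly v (exp p) \<noteq> 0) (at z)" for z
    by (rule eventually_mono) auto
  then show ?thesis by (simp add: eventually_cosparse_open_eq)
qed

interpretation almost: polymod exp almost_zero
proof
  fix f g assume "f \<in> almost_zero" "g \<in> almost_zero"
  then show "(\<lambda>x. f x + g x) \<in> almost_zero"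
    unfolding almost_zero_def hat_eq_def mem_Collect_eq by eventually_elim simp
next
  fix f p assume "f \<in> almost_zero"
  then show "(\<lambda>x. poly p (exp x) * f x) \<in> almost_zero"
    unfolding almost_zero_def hat_eq_def mem_Collect_eq by eventually_elim simp
qed (simp add: almost_zero_def)

lemma meromorphic_eventually_differentiable:
  "f meromorphic_on UNIV \<Longrightarrow> eventually (\<lambda>z. f field_differentiable at z) (cosparse UNIV)"
  by (drule meromorphic_on_imp_analytic_cosparse, erule eventually_mono)
     (simp add: analytic_on_imp_differentiable_at)

text \<open>The derivative of \<open>P(exp p)\<close> with respect to \<open>p\<close> is
  \<open>exp p\<close> times \<open>P'(exp p)\<close>, which gives the second coefficient
  map.\<close>

interpretation hat_D: skew_operator exp almost_zero meromorphic deriv "\<lambda>p. p" "\<lambda>p. [:0, 1:] * pderiv p"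
proof
  fix f g :: "complex \<Rightarrow> complex"
  assume fg: "f \<in> meromorphic" "g \<in> meromorphic"
  show "(\<lambda>x. f x + g x) \<in> meromorphic" using fg by (auto intro: meromorphic_intros)
  have "eventually (\<lambda>z. f field_differentiable at z \<and> g field_differentiable at z) (cosparse UNIV)"
    using fg by (intro eventually_conj meromorphic_eventually_differentiable) auto
  then have "hat_eq (deriv (\<lambda>x. f x + g x)) (\<lambda>x. deriv f x + deriv g x)"
    by (rule hat_eqI_eventually) (simp add: deriv_add)
  then show "(\<lambda>x. deriv (\<lambda>x. f x + g x) x - (deriv f x + deriv g x)) \<in> almost_zero"
    by (simp add: diff_almost_zero_iff)
next
  fix f :: "complex \<Rightarrow> complex" and p
  assume f: "f \<in> meromorphic"
  show "(\<lambda>x. poly p (exp x) * f x) \<in> meromorphic"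
    using f by (auto intro!: meromorphic_intros meromorphic_exp_poly)
  have "eventually (\<lambda>z. f field_differentiable at z) (cosparse UNIV)"
    using f by (intro meromorphic_eventually_differentiable) auto
  then have "hat_eq (deriv (\<lambda>x. poly p (exp x) * f x)) (\<lambda>x. poly p (exp x) * deriv f x + poly ([:0, 1:] * pderiv p) (exp x) * f x)"
  proof (rule hat_eqI_eventually)
    fix z assume "f field_differentiable at z"
    then have f': "(f has_field_derivative deriv f z) (at z)" by (simp add: field_differentiable_derivI)
    have "((\<lambda>x. poly p (exp x)) has_field_derivative poly (pderiv p) (exp z) * exp z) (at z)"
      by (rule DERIV_chain2[OF poly_DERIV DERIV_exp])
    from DERIV_imp_deriv[OF DERIV_mult[OF this f']]
    show "deriv (\<lambda>x. poly p (exp x) * f x) z = poly p (exp z) * deriv f z + poly ([:0, 1:] * pderiv p) (exp z) * f z"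
      by (simp add: algebra_simps)
  qed
  then show "(\<lambda>x. deriv (\<lambda>x. poly p (exp x) * f x) x - (poly p (exp x) * deriv f x + poly ([:0, 1:] * pderiv p) (exp x) * f x)) \<in> almost_zero"
    by (simp add: diff_almost_zero_iff)
next
  fix f :: "complex \<Rightarrow> complex"
  assume "f \<in> almost_zero"
  then have "hat_eq (deriv f) (deriv (\<lambda>_. 0))" unfolding almost_zero_def by (auto dest: hat_eq_deriv)
  then show "deriv f \<in> almost_zero" by (simp add: almost_zero_def)
qed (auto intro: meromorphic_intros)

text \<open>In the coordinate \<open>p = log x\<close> both cases of \<open>\<sigma>\<close> are composition with an affine map.\<close>

fun slope offset :: "sigma_case \<Rightarrow> complex" where
  "slope (CaseQ q l) = 1"
| "slope (CaseM q) = of_nat q"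
| "offset (CaseQ q l) = l"
| "offset (CaseM q) = 0"

fun sigma_poly :: "sigma_case \<Rightarrow> complex poly \<Rightarrow> complex poly" where
  "sigma_poly (CaseQ q l) p = pcompose p [:0, q:]"
| "sigma_poly (CaseM q) p = pcompose p (monom 1 q)"

lemma hat_sigma_affine: "hat_sigma c f = (\<lambda>p. f (slope c * p + offset c))"
  by (cases c) (auto simp: fun_eq_iff add.commute)

lemma slope_nonzero: "admissible c \<Longrightarrow> slope c \<noteq> 0"
  by (cases c) auto

lemma poly_sigma_poly: "admissible c \<Longrightarrow> poly (sigma_poly c p) (exp x) = poly p (exp (slope c * x + offset c))"
proof (cases c)
  case (CaseM q)
  then show ?thesis by (simp add: poly_pcompose poly_monom exp_of_nat_mult)
qed (auto simp: poly_pcompose exp_add mult.commute)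

lemma sigma_poly_nonzero:
  assumes "admissible c" "p \<noteq> 0"
  shows "sigma_poly c p \<noteq> 0"
  using assms by (cases c) (auto simp: pcompose_eq_0_iff degree_monom_eq)

lemma hat_eq_sigma: "admissible c \<Longrightarrow> hat_eq f g \<Longrightarrow> hat_eq (hat_sigma c f) (hat_sigma c g)"
  unfolding hat_sigma_affine by (intro hat_eq_affine slope_nonzero)

lemma hat_sigma_skew_operator:
  assumes "admissible c"
  shows "skew_operator exp almost_zero meromorphic (hat_sigma c) (sigma_poly c) (\<lambda>_. 0)"
proof
  fix f :: "complex \<Rightarrow> complex" and p
  assume "f \<in> meromorphic"
  then show "hat_sigma c f \<in> meromorphic" by (simp add: hat_sigma_affine meromorphic_affine)
  show "(\<lambda>x. hat_sigma c (\<lambda>x. poly p (exp x) * f x) x - (poly (sigma_poly c p) (exp x) * hat_sigma c f x + poly 0 (exp x) * f x)) \<in> almost_zero"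
    using assms by (simp add: hat_sigma_affine poly_sigma_poly almost.Z_zero)
next
  fix f :: "complex \<Rightarrow> complex"
  assume "f \<in> almost_zero"
  then show "hat_sigma c f \<in> almost_zero"
    using hat_eq_sigma[OF assms, of f "\<lambda>_. 0"] by (simp add: almost_zero_def hat_sigma_affine)
qed (use assms sigma_poly_nonzero hat_D.C_add hat_D.C_scale hat_D.C_zero
      in \<open>auto simp: hat_sigma_affine almost.Z_zero\<close>)

text \<open>The common denominator \<open>V\<close> becomes the coefficient of order
  \<open>n\<close>; the equation may be multiplied by it because its zeros are isolated.\<close>

lemma hat_satisfies_imp_relation:
  assumes "hat_satisfies T n f"
  shows "\<exists>p. p n \<noteq> 0 \<and> (\<lambda>x. \<Sum>i\<le>n. poly (p i) (exp x) * (T ^^ i) f x) \<in> almost_zero"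
proof -
  obtain a where a: "\<And>i. i < n \<Longrightarrow> a i \<in> hat_ratfuns"
    and eq: "hat_eq (\<lambda>p. (T ^^ n) f p + (\<Sum>i<n. a i p * (T ^^ i) f p)) (\<lambda>p. 0)"
    using assms by (auto simp: hat_satisfies_def)
  have "\<forall>i\<in>{..<n}. \<exists>u v. v \<noteq> 0 \<and> a i = (\<lambda>p. poly u (exp p) / poly v (exp p))"
    using a unfolding hat_ratfuns_def hat_x_def by blast
  from bchoice[OF this] obtain u where "\<forall>i\<in>{..<n}. \<exists>v. v \<noteq> 0 \<and> a i = (\<lambda>p. poly (u i) (exp p) / poly v (exp p))" ..
  from bchoice[OF this] obtain v where uv: "\<And>i. i < n \<Longrightarrow> v i \<noteq> 0"
    "\<And>i. i < n \<Longrightarrow> a i = (\<lambda>p. poly (u i) (exp p) / poly (v i) (exp p))" by blast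
  define V where "V = (\<Prod>i<n. v i)"
  define P where "P = (\<lambda>i. if i < n then u i * (\<Prod>j\<in>{..<n} - {i}. v j) else V)"
  have V: "V \<noteq> 0" using uv by (simp add: V_def)
  have "hat_eq (\<lambda>x. \<Sum>i\<le>n. poly (P i) (exp x) * (T ^^ i) f x) (\<lambda>_. 0)"
  proof (rule hat_eqI_eventually)
    show "eventually (\<lambda>p. (T ^^ n) f p + (\<Sum>i<n. a i p * (T ^^ i) f p) = 0 \<and> poly V (exp p) \<noteq> 0) (cosparse UNIV)"
      using eq V by (intro eventually_conj eventually_poly_exp_nonzero) (auto simp: hat_eq_def)
  next
    fix x assume x: "(T ^^ n) f x + (\<Sum>i<n. a i x * (T ^^ i) f x) = 0 \<and> poly V (exp x) \<noteq> 0"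
    have "poly (P i) (exp x) = poly V (exp x) * a i x" if "i < n" for i
    proof -
      have "V = v i * (\<Prod>j\<in>{..<n} - {i}. v j)" using that by (simp add: V_def prod.remove)
      then show ?thesis using that x by (simp add: P_def uv)
    qed
    then have "(\<Sum>i<n. poly (P i) (exp x) * (T ^^ i) f x) = poly V (exp x) * (\<Sum>i<n. a i x * (T ^^ i) f x)"
      by (simp add: sum_distrib_left mult.assoc)
    then have "(\<Sum>i\<le>n. poly (P i) (exp x) * (T ^^ i) f x) = poly V (exp x) * ((T ^^ n) f x + (\<Sum>i<n. a i x * (T ^^ i) f x))"
      by (simp add: lessThan_Suc_atMost[symmetric] P_def algebra_simps)
    then show "(\<Sum>i\<le>n. poly (P i) (exp x) * (T ^^ i) f x) = 0" using x by simp
  qed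
  then show ?thesis using V by (intro exI[of _ P]) (auto simp: P_def almost_zero_def)
qed

lemma relation_imp_hat_satisfies:
  assumes "p n \<noteq> 0" "(\<lambda>x. \<Sum>i\<le>n. poly (p i) (exp x) * (T ^^ i) f x) \<in> almost_zero"
  shows "hat_satisfies T n f"
  unfolding hat_satisfies_def
proof (intro exI conjI allI impI)
  let ?a = "\<lambda>i x. poly (p i) (hat_x x) / poly (p n) (hat_x x)"
  show "?a i \<in> hat_ratfuns" for i using assms(1) by (auto simp: hat_ratfuns_def)
  show "hat_eq (\<lambda>x. (T ^^ n) f x + (\<Sum>i<n. ?a i x * (T ^^ i) f x)) (\<lambda>p. 0)"
  proof (rule hat_eqI_eventually)
    show "eventually (\<lambda>x. (\<Sum>i\<le>n. poly (p i) (exp x) * (T ^^ i) f x) = 0 \<and> poly (p n) (exp x) \<noteq> 0) (cosparse UNIV)"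
      using assms by (intro eventually_conj eventually_poly_exp_nonzero) (auto simp: hat_eq_def almost_zero_def)
    fix x assume x: "(\<Sum>i\<le>n. poly (p i) (exp x) * (T ^^ i) f x) = 0 \<and> poly (p n) (exp x) \<noteq> 0"
    then have "((T ^^ n) f x + (\<Sum>i<n. ?a i x * (T ^^ i) f x)) * poly (p n) (exp x) = 0"
      by (simp add: lessThan_Suc_atMost[symmetric] algebra_simps sum_distrib_left hat_x_def)
    then show "(T ^^ n) f x + (\<Sum>i<n. ?a i x * (T ^^ i) f x) = 0" using x by simp
  qed
qed

lemma hat_satisfies_cong:
  assumes "\<And>f g. hat_eq f g \<Longrightarrow> hat_eq (T f) (T g)" "hat_eq f g" "hat_satisfies T n g"
  shows "hat_satisfies T n f"
proof -
  obtain p where p: "p n \<noteq> 0" "(\<lambda>x. \<Sum>i\<le>n. poly (p i) (exp x) * (T ^^ i) g x) \<in> almost_zero"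
    using hat_satisfies_imp_relation[OF assms(3)] by blast
  have "eventually (\<lambda>x. \<forall>i\<in>{..n}. (T ^^ i) f x = (T ^^ i) g x) (cosparse UNIV)"
    by (rule eventually_ball_finite) (use hat_eq_funpow[OF assms(1,2)] in \<open>auto simp: hat_eq_def\<close>)
  then have "hat_eq (\<lambda>x. \<Sum>i\<le>n. poly (p i) (exp x) * (T ^^ i) f x) (\<lambda>x. \<Sum>i\<le>n. poly (p i) (exp x) * (T ^^ i) g x)"
    by (rule hat_eqI_eventually) auto
  then show ?thesis using p hat_eq_trans by (intro relation_imp_hat_satisfies[of p]) (auto simp: almost_zero_def)
qed

lemma skew_relation_imp_hat_satisfies:
  assumes "skew_operator exp almost_zero meromorphic T \<tau> \<eta>"
    and "skew_operator.has_relation exp almost_zero T f" "f \<in> meromorphic"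
  shows "\<exists>n>0. hat_satisfies T n f"
proof -
  interpret T: skew_operator exp almost_zero meromorphic T \<tau> \<eta> by fact
  obtain n p where p: "p n \<noteq> 0" "(\<lambda>x. \<Sum>i\<le>n. poly (p i) (exp x) * (T ^^ i) f x) \<in> almost_zero"
    using assms(2) unfolding T.has_relation_def by blast
  show ?thesis
  proof (cases "n = 0")
    case False
    then show ?thesis using relation_imp_hat_satisfies[of p, OF p] by blast
  next
    \<comment> \<open>A relation of order \<open>0\<close> forces \<open>f\<close> to vanish off
      isolated points. Since a positive order is wanted, the equation \<open>T f = 0\<close> takes
      its place.\<close>
    case True
    then have "hat_eq (\<lambda>x. poly (p 0) (exp x) * f x) (\<lambda>_. 0)" using p(2) by (simp add: almost_zero_def)
    moreover have "p 0 \<noteq> 0" using p(1) True by simp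
    ultimately have "eventually (\<lambda>x. poly (p 0) (exp x) * f x = 0 \<and> poly (p 0) (exp x) \<noteq> 0) (cosparse UNIV)"
      by (intro eventually_conj eventually_poly_exp_nonzero) (auto simp: hat_eq_def)
    then have "f \<in> almost_zero" unfolding almost_zero_def by (auto elim!: hat_eqI_eventually)
    then have "T f \<in> almost_zero" using assms(3) by (intro T.T_Z)
    then have "hat_satisfies T 1 f"
      by (intro relation_imp_hat_satisfies[of "\<lambda>i. if i = 1 then 1 else 0"]) auto
    then show ?thesis by blast
  qed
qed

section \<open>Fourier coefficients of periodic entire functions\<close>

abbreviation period :: complex where "period \<equiv> of_real (2 * pi) * \<i>"

definition entire_periodic :: "(complex \<Rightarrow> complex) \<Rightarrow> bool" where
  "entire_periodic g \<longleftrightarrow> g holomorphic_on UNIV \<and> (\<forall>p. g (p + period) = g p)"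

text \<open>Not divided by the period, so the constant function \<open>1\<close> has mean
  \<open>2 pi i\<close>.\<close>

definition mean :: "(complex \<Rightarrow> complex) \<Rightarrow> complex" where
  "mean g = contour_integral (linepath 0 period) g"

text \<open>Up to the factor \<open>2 pi i\<close>, the \<open>k\<close>-th Laurent coefficient of
  \<open>g\<close> as a function of \<open>x = exp p\<close>.\<close>

definition fourier :: "(complex \<Rightarrow> complex) \<Rightarrow> int \<Rightarrow> complex" where
  "fourier g k = mean (\<lambda>p. g p * exp (- of_int k * p))"

lemma exp_int_period: "exp (of_int k * (p + period)) = exp (of_int k * p :: complex)"
proof -
  have "of_int k * (p + period) = of_int k * p + of_int (2 * k) * pi * \<i>"
    by (simp add: algebra_simps)
  then show ?thesis unfolding exp_eq by (metis of_int_mult of_real_mult of_real_of_int_eq)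
qed

lemma exp_period: "exp (p + period) = exp (p :: complex)"
  using exp_int_period[of 1 p] by simp

lemma entire_periodicI: "g holomorphic_on UNIV \<Longrightarrow> (\<And>p. g (p + period) = g p) \<Longrightarrow> entire_periodic g"
  by (simp add: entire_periodic_def)

lemma entire_periodic_int_period:
  assumes "entire_periodic g"
  shows "g (a + of_int n * period) = g a"
proof -
  have nat: "g (w + of_nat k * period) = g w" for w k
  proof (induction k)
    case (Suc k)
    have "w + of_nat (Suc k) * period = (w + of_nat k * period) + period" by (simp add: algebra_simps)
    then show ?case using Suc assms unfolding entire_periodic_def by metis
  qed simp
  show ?thesis
  proof (cases "n \<ge> 0")
    case True
    then show ?thesis using nat[of a "nat n"] by simp
  next
    case False
    then show ?thesis using nat[of "a + of_int n * period" "nat (- n)"] by simp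
  qed
qed

lemma entire_periodic_exp_int: "entire_periodic (\<lambda>p. exp (of_int k * p))"
  by (rule entire_periodicI) (auto intro!: holomorphic_intros simp only: exp_int_period)

lemma entire_periodic_mult: "entire_periodic f \<Longrightarrow> entire_periodic g \<Longrightarrow> entire_periodic (\<lambda>p. f p * g p)"
  by (auto simp: entire_periodic_def intro!: holomorphic_intros)

lemma entire_periodic_diff: "entire_periodic f \<Longrightarrow> entire_periodic g \<Longrightarrow> entire_periodic (\<lambda>p. f p - g p)"
  by (auto simp: entire_periodic_def intro!: holomorphic_intros)

lemma entire_periodic_sum: "(\<And>i. i \<in> I \<Longrightarrow> entire_periodic (f i)) \<Longrightarrow> entire_periodic (\<lambda>p. \<Sum>i\<in>I. f i p)"
  by (auto simp: entire_periodic_def intro!: holomorphic_intros sum.cong)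

lemma entire_periodic_cmult: "entire_periodic f \<Longrightarrow> entire_periodic (\<lambda>p. c * f p)"
  by (auto simp: entire_periodic_def intro!: holomorphic_intros)

lemma entire_periodic_fourier: "entire_periodic g \<Longrightarrow> entire_periodic (\<lambda>p. g p * exp (- of_int k * p))"
  using entire_periodic_mult[OF _ entire_periodic_exp_int[of "-k"]] by simp

lemma entire_periodic_deriv:
  assumes "entire_periodic g"
  shows "entire_periodic (deriv g)"
proof (rule entire_periodicI)
  show "deriv g holomorphic_on UNIV" using assms by (auto simp: entire_periodic_def intro: holomorphic_deriv)
  fix p
  have "deriv (\<lambda>w. g (w + period)) p = deriv g p"
    using assms by (simp add: entire_periodic_def)
  moreover have "deriv (\<lambda>w. g (w + period)) p = deriv g (p + period)"
  proof (rule DERIV_imp_deriv)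
    have "(g has_field_derivative deriv g (p + period)) (at (p + period))"
      using assms by (auto simp: entire_periodic_def intro!: holomorphic_derivI[of g UNIV])
    then show "((\<lambda>w. g (w + period)) has_field_derivative deriv g (p + period)) (at p)"
      by (simp add: DERIV_shift)
  qed
  ultimately show "deriv g (p + period) = deriv g p" by simp
qed

lemma entire_periodic_affine:
  assumes "entire_periodic g"
  shows "entire_periodic (\<lambda>p. g (of_int a * p + b))"
proof (rule entire_periodicI)
  have "g \<circ> (\<lambda>p. of_int a * p + b) holomorphic_on UNIV"
    using assms by (intro holomorphic_on_compose_gen[of _ _ g UNIV]) (auto simp: entire_periodic_def intro!: holomorphic_intros)
  then show "(\<lambda>p. g (of_int a * p + b)) holomorphic_on UNIV" by (simp add: o_def)
  fix p
  have "of_int a * (p + period) + b = (of_int a * p + b) + of_int a * period" by (simp add: algebra_simps)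
  then show "g (of_int a * (p + period) + b) = g (of_int a * p + b)"
    using entire_periodic_int_period[OF assms] by metis
qed

lemma entire_primitive:
  assumes "g holomorphic_on UNIV"
  obtains G where "\<And>x. (G has_field_derivative g x) (at x)"
    "\<And>a b. contour_integral (linepath a b) g = G b - G a"
proof -
  obtain G where G: "\<And>x. x \<in> UNIV \<Longrightarrow> (G has_field_derivative g x) (at x within UNIV)"
    using holomorphic_convex_primitive'[OF _ _ assms] by auto
  have "contour_integral (linepath a b) g = G b - G a" for a b
    using contour_integral_primitive[OF G, of "linepath a b"] by (auto intro: contour_integral_unique)
  then show ?thesis using that G by auto
qed

text \<open>With a primitive \<open>G\<close>, the integral is \<open>G(a + period) - G(a)\<close>,
  whose derivative in \<open>a\<close> vanishes by periodicity. This lets the contour be moved to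
  any line \<open>Re p = \<rho>\<close>.\<close>

lemma mean_base_point:
  assumes "entire_periodic g"
  shows "contour_integral (linepath a (a + period)) g = mean g"
proof -
  obtain G where G: "\<And>x. (G has_field_derivative g x) (at x)"
    "\<And>a b. contour_integral (linepath a b) g = G b - G a"
    using entire_primitive assms unfolding entire_periodic_def by blast
  have "((\<lambda>a. G (a + period) - G a) has_field_derivative g (a + period) - g a) (at a)" for a
    by (intro DERIV_diff G) (use G[of "a + period"] in \<open>simp add: DERIV_shift\<close>)
  then have "((\<lambda>a. G (a + period) - G a) has_field_derivative 0) (at a)" for a
    using assms by (simp add: entire_periodic_def)
  then have "\<exists>c. \<forall>a\<in>UNIV. G (a + period) - G a = c"
    by (intro has_field_derivative_zero_constant) auto
  then have "G (a + period) - G a = G (0 + period) - G 0" by (metis UNIV_I)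
  then show ?thesis by (simp add: mean_def G)
qed

lemma mean_affine_translate:
  assumes "entire_periodic g"
  shows "mean (\<lambda>p. g (p + l)) = mean g"
proof -
  obtain G where G: "\<And>x. (G has_field_derivative g x) (at x)"
    "\<And>a b. contour_integral (linepath a b) g = G b - G a"
    using entire_primitive assms unfolding entire_periodic_def by blast
  have "((\<lambda>p. G (p + l)) has_field_derivative g (x + l)) (at x)" for x
    using G(1)[of "x + l"] by (simp add: DERIV_shift)
  then have "((\<lambda>p. g (p + l)) has_contour_integral (G (period + l) - G (0 + l))) (linepath 0 period)"
    using contour_integral_primitive[of UNIV "\<lambda>p. G (p + l)" "\<lambda>p. g (p + l)" "linepath 0 period"]
    by simp
  then have "mean (\<lambda>p. g (p + l)) = G (period + l) - G (0 + l)"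
    unfolding mean_def by (rule contour_integral_unique)
  also have "\<dots> = contour_integral (linepath l (l + period)) g" by (simp add: G add.commute)
  also have "\<dots> = mean g" by (rule mean_base_point[OF assms])
  finally show ?thesis .
qed

lemma mean_reflect:
  assumes "entire_periodic g"
  shows "mean (\<lambda>p. g (- p)) = mean g"
proof -
  obtain G where G: "\<And>x. (G has_field_derivative g x) (at x)"
    "\<And>a b. contour_integral (linepath a b) g = G b - G a"
    using entire_primitive assms unfolding entire_periodic_def by blast
  have "((\<lambda>p. - G (- p)) has_field_derivative g (- p)) (at p)" for p
    using DERIV_minus[OF DERIV_chain2[OF G(1)[of "- p"] DERIV_minus[OF DERIV_ident]]] by simp
  then have "((\<lambda>p. g (- p)) has_contour_integral (- G (- period) - (- G (- 0)))) (linepath 0 period)"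
    using contour_integral_primitive[of UNIV "\<lambda>p. - G (- p)" "\<lambda>p. g (- p)" "linepath 0 period"] by simp
  then have "mean (\<lambda>p. g (- p)) = G 0 - G (- period)"
    unfolding mean_def by (simp add: contour_integral_unique)
  also have "\<dots> = contour_integral (linepath (- period) (- period + period)) g" by (simp add: G)
  also have "\<dots> = mean g" by (rule mean_base_point[OF assms])
  finally show ?thesis .
qed

lemma mean_deriv:
  assumes "entire_periodic g" "\<And>x. (g has_field_derivative g' x) (at x)"
  shows "mean g' = 0"
proof -
  have "(g' has_contour_integral (g period - g 0)) (linepath 0 period)"
    using contour_integral_primitive[of UNIV g g' "linepath 0 period"] assms(2) by simp
  then have "mean g' = g period - g 0" unfolding mean_def by (rule contour_integral_unique)
  also have "g period = g 0" using assms(1) unfolding entire_periodic_def by (metis add_0)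
  finally show ?thesis by simp
qed

lemma entire_contour_integrable:
  "g holomorphic_on UNIV \<Longrightarrow> g contour_integrable_on (linepath a b)"
  by (intro contour_integrable_continuous_linepath holomorphic_on_imp_continuous_on)
     (auto intro: holomorphic_on_subset)

lemma mean_cmult:
  "entire_periodic g \<Longrightarrow> mean (\<lambda>p. c * g p) = c * mean g"
  unfolding mean_def entire_periodic_def
  by (intro contour_integral_lmul entire_contour_integrable) auto

lemma mean_diff:
  "entire_periodic f \<Longrightarrow> entire_periodic g \<Longrightarrow> mean (\<lambda>p. f p - g p) = mean f - mean g"
  unfolding mean_def entire_periodic_def
  by (intro contour_integral_diff entire_contour_integrable) auto

lemma mean_sum:
  "finite I \<Longrightarrow> (\<And>i. i \<in> I \<Longrightarrow> entire_periodic (f i)) \<Longrightarrow> mean (\<lambda>p. \<Sum>i\<in>I. f i p) = (\<Sum>i\<in>I. mean (f i))"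
  unfolding mean_def entire_periodic_def
  by (intro contour_integral_sum entire_contour_integrable) auto

lemma closed_segment_vertical_Re:
  "p \<in> closed_segment (of_real \<rho>) (of_real \<rho> + period) \<Longrightarrow> Re p = \<rho>"
  by (auto simp: in_segment algebra_simps)

lemma mean_bound:
  assumes "entire_periodic g" "\<And>p. Re p = \<rho> \<Longrightarrow> norm (g p) \<le> B"
  shows "norm (mean g) \<le> B * (2 * pi)"
proof -
  have "norm (contour_integral (linepath (of_real \<rho>) (of_real \<rho> + period)) g) \<le> B * norm (of_real \<rho> + period - of_real \<rho>)"
  proof (rule contour_integral_bound_linepath)
    show "g contour_integrable_on linepath (of_real \<rho>) (of_real \<rho> + period)"
      using assms(1) by (auto simp: entire_periodic_def intro: entire_contour_integrable)
    show "0 \<le> B" using assms(2)[of "of_real \<rho>"] by (simp add: order_trans[OF norm_ge_zero])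
    show "norm (g p) \<le> B" if "p \<in> closed_segment (of_real \<rho>) (of_real \<rho> + period)" for p
      using assms(2) closed_segment_vertical_Re[OF that] by blast
  qed
  then show ?thesis using mean_base_point[OF assms(1)] by (simp add: norm_mult)
qed

text \<open>A multiple of the period moves every point of the strip into one compact
  rectangle.\<close>

lemma periodic_bounded_on_vertical_strip:
  assumes "entire_periodic g"
  shows "\<exists>B. \<forall>p. a \<le> Re p \<and> Re p \<le> b \<longrightarrow> norm (g p) \<le> B"
proof -
  have "compact (cbox (Complex a 0) (Complex b (2 * pi)))" by (rule compact_cbox)
  moreover have "continuous_on (cbox (Complex a 0) (Complex b (2 * pi))) g"
    using assms by (auto simp: entire_periodic_def intro: holomorphic_on_imp_continuous_on holomorphic_on_subset)
  ultimately have "bounded (g ` cbox (Complex a 0) (Complex b (2 * pi)))"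
    using compact_continuous_image compact_imp_bounded by blast
  then obtain B where B: "\<And>p. p \<in> cbox (Complex a 0) (Complex b (2 * pi)) \<Longrightarrow> norm (g p) \<le> B"
    by (auto simp: bounded_iff)
  have "norm (g p) \<le> B" if p: "a \<le> Re p" "Re p \<le> b" for p
  proof -
    define n where "n = \<lfloor>Im p / (2 * pi)\<rfloor>"
    define p' where "p' = p - of_int n * period"
    have "Re p' = Re p" by (simp add: p'_def)
    have im: "Im p' = Im p - of_int n * (2 * pi)" by (simp add: p'_def)
    have "of_int n \<le> Im p / (2 * pi)" "Im p / (2 * pi) < of_int n + 1" unfolding n_def by linarith+
    then have "of_int n * (2 * pi) \<le> Im p" "Im p < (of_int n + 1) * (2 * pi)"
      by (simp_all add: field_simps)
    then have "p' \<in> cbox (Complex a 0) (Complex b (2 * pi))"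
      using p im \<open>Re p' = Re p\<close> by (simp add: in_cbox_complex_iff algebra_simps)
    then have "norm (g p') \<le> B" by (rule B)
    moreover have "g (p' + of_int n * period) = g p'" by (rule entire_periodic_int_period[OF assms])
    then have "g p' = g p" by (simp add: p'_def)
    ultimately show ?thesis by simp
  qed
  then show ?thesis by blast
qed

lemma fourier_exp_mult: "fourier (\<lambda>p. exp (of_nat i * p) * g p) k = fourier g (k - int i)"
proof -
  have "exp (of_nat i * p) * exp (- of_int k * p) = exp (- of_int (k - int i) * p)" for p :: complex
    by (subst exp_add[symmetric]) (simp add: algebra_simps)
  then have "exp (of_nat i * p) * g p * exp (- of_int k * p) = g p * exp (- of_int (k - int i) * p)" for p
    by (metis mult.assoc mult.commute)
  then show ?thesis by (simp only: fourier_def)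
qed

lemma fourier_cmult: "entire_periodic g \<Longrightarrow> fourier (\<lambda>p. c * g p) k = c * fourier g k"
  unfolding fourier_def using mean_cmult[OF entire_periodic_fourier, of g c k] by (simp add: mult.assoc)

lemma fourier_diff:
  "entire_periodic f \<Longrightarrow> entire_periodic g \<Longrightarrow> fourier (\<lambda>p. f p - g p) k = fourier f k - fourier g k"
  unfolding fourier_def
  using mean_diff[OF entire_periodic_fourier entire_periodic_fourier, of f g k k] by (simp add: left_diff_distrib)

lemma fourier_sum:
  "finite I \<Longrightarrow> (\<And>i. i \<in> I \<Longrightarrow> entire_periodic (f i)) \<Longrightarrow> fourier (\<lambda>p. \<Sum>i\<in>I. f i p) k = (\<Sum>i\<in>I. fourier (f i) k)"
  unfolding fourier_def using mean_sum[of I "\<lambda>i p. f i p * exp (- of_int k * p)"] entire_periodic_fourier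
  by (simp add: sum_distrib_right)

lemma fourier_deriv:
  assumes "entire_periodic g"
  shows "fourier (deriv g) k = of_int k * fourier g k"
proof -
  have "((\<lambda>p. g p * exp (- of_int k * p)) has_field_derivative
      (deriv g p * exp (- of_int k * p) - of_int k * (g p * exp (- of_int k * p)))) (at p)" for p
    using assms by (auto simp: entire_periodic_def algebra_simps
        intro!: derivative_eq_intros holomorphic_derivI[of g UNIV])
  from mean_deriv[OF entire_periodic_fourier[OF assms] this]
  have "mean (\<lambda>p. deriv g p * exp (- of_int k * p)) - mean (\<lambda>p. of_int k * (g p * exp (- of_int k * p))) = 0"
    using mean_diff[OF entire_periodic_fourier[OF entire_periodic_deriv[OF assms]]
        entire_periodic_cmult[OF entire_periodic_fourier[OF assms]]] by simp
  then show ?thesis using mean_cmult[OF entire_periodic_fourier[OF assms], of "of_int k" k] by (simp add: fourier_def)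
qed

lemma fourier_funpow_deriv:
  assumes "entire_periodic g"
  shows "entire_periodic ((deriv ^^ j) g) \<and> fourier ((deriv ^^ j) g) k = of_int k ^ j * fourier g k"
  by (induction j) (auto simp: assms fourier_deriv entire_periodic_deriv)

lemma fourier_translate:
  assumes "entire_periodic g"
  shows "fourier (\<lambda>p. g (p + l)) k = exp (of_int k * l) * fourier g k"
proof -
  have "exp (- of_int k * p) = exp (of_int k * l) * exp (- of_int k * (p + l))" for p
    by (subst exp_add[symmetric]) (simp add: algebra_simps)
  then have "g (p + l) * exp (- of_int k * p) = exp (of_int k * l) * (g (p + l) * exp (- of_int k * (p + l)))" for p
    by (metis mult.assoc mult.commute)
  then have "fourier (\<lambda>p. g (p + l)) k = mean (\<lambda>p. exp (of_int k * l) * (g (p + l) * exp (- of_int k * (p + l))))"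
    by (simp only: fourier_def)
  also have "\<dots> = exp (of_int k * l) * mean (\<lambda>p. g (p + l) * exp (- of_int k * (p + l)))"
    using entire_periodic_affine[OF entire_periodic_fourier[OF assms, of k], of 1 l] by (intro mean_cmult) simp
  also have "mean (\<lambda>p. g (p + l) * exp (- of_int k * (p + l))) = fourier g k"
    unfolding fourier_def by (rule mean_affine_translate[OF entire_periodic_fourier[OF assms]])
  finally show ?thesis .
qed

lemma fourier_reflect:
  assumes "entire_periodic g"
  shows "fourier (\<lambda>p. g (- p)) k = fourier g (- k)"
  using mean_reflect[OF entire_periodic_fourier[OF assms, of "- k"]] by (simp add: fourier_def)

lemma fourier_bound:
  assumes "entire_periodic g" "\<And>p. Re p = \<rho> \<Longrightarrow> norm (g p) \<le> B"
  shows "norm (fourier g k) \<le> B * exp (- of_int k * \<rho>) * (2 * pi)"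
  unfolding fourier_def
proof (rule mean_bound[OF entire_periodic_fourier[OF assms(1)]])
  fix p :: complex assume "Re p = \<rho>"
  then show "norm (g p * exp (- of_int k * p)) \<le> B * exp (- of_int k * \<rho>)"
    using assms(2) by (simp add: norm_mult mult_right_mono)
qed

lemma fourier_exp_int: "fourier (\<lambda>p. exp (of_int j * p)) k = (if j = k then period else 0)"
proof (cases "j = k")
  case True
  then have "fourier (\<lambda>p. exp (of_int j * p)) k = mean (\<lambda>_. 1)"
    by (simp add: fourier_def flip: exp_add)
  also have "\<dots> = period" by (simp add: mean_def contour_integral_unique[OF has_contour_integral_const_linepath])
  finally show ?thesis using True by simp
next
  case False
  define m where "m = j - k"
  have "m \<noteq> 0" using False by (simp add: m_def)
  have "mean (\<lambda>p. exp (of_int m * p)) = 0"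
  proof (rule mean_deriv[of "\<lambda>p. 1 / of_int m * exp (of_int m * p)"])
    show "entire_periodic (\<lambda>p. 1 / of_int m * exp (of_int m * p))"
      by (intro entire_periodic_cmult entire_periodic_exp_int)
    show "((\<lambda>p. 1 / of_int m * exp (of_int m * p)) has_field_derivative exp (of_int m * x)) (at x)" for x
      using \<open>m \<noteq> 0\<close> by (auto intro!: derivative_eq_intros)
  qed
  moreover have "exp (of_int j * p) * exp (- of_int k * p) = exp (of_int m * p)" for p :: complex
    by (simp add: m_def algebra_simps flip: exp_add)
  ultimately show ?thesis using False by (simp add: fourier_def)
qed

section \<open>Uniqueness of Fourier coefficients\<close>

text \<open>\<open>f / (1 - r)\<close> is a geometric series whose terms all integrate to
  \<open>0\<close>; the remainder \<open>E N\<close> after \<open>N\<close> terms is bounded by a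
  constant times \<open>\<kappa> ^ N\<close>.\<close>

lemma geometric_kernel_integral_zero:
  fixes f r :: "complex \<Rightarrow> complex"
  assumes cont: "continuous_on (closed_segment a b) f" "continuous_on (closed_segment a b) r"
    and r: "\<And>p. p \<in> closed_segment a b \<Longrightarrow> norm (r p) \<le> \<kappa>" and \<kappa>: "0 \<le> \<kappa>" "\<kappa> < 1"
    and zero: "\<And>i :: nat. contour_integral (linepath a b) (\<lambda>p. f p * r p ^ i) = 0"
  shows "contour_integral (linepath a b) (\<lambda>p. f p / (1 - r p)) = 0"
proof -
  define E where "E = (\<lambda>N p. f p / (1 - r p) * r p ^ N)"
  have ne: "1 - r p \<noteq> 0" if "p \<in> closed_segment a b" for p using r[OF that] \<kappa> by auto
  have contE: "continuous_on (closed_segment a b) (E N)" for N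
    unfolding E_def by (intro continuous_intros cont) (use ne in auto)
  have "compact (E 0 ` closed_segment a b)" by (rule compact_continuous_image[OF contE compact_segment])
  from compact_imp_bounded[OF this]
  obtain B where "\<forall>x\<in>E 0 ` closed_segment a b. norm x \<le> B" unfolding bounded_iff by blast
  then have B: "norm (E 0 p) \<le> B" if "p \<in> closed_segment a b" for p using that by simp
  have B0: "0 \<le> B" using B[of a] by (simp add: order_trans[OF norm_ge_zero])
  let ?I = "contour_integral (linepath a b) (\<lambda>p. f p / (1 - r p))"
  have "norm ?I \<le> B * \<kappa> ^ N * norm (b - a)" for N
  proof -
    have "f p / (1 - r p) = (\<Sum>i<N. f p * r p ^ i) + E N p" if p: "p \<in> closed_segment a b" for p
    proof -
      have "(\<Sum>i<N. r p ^ i) = (1 - r p ^ N) / (1 - r p)" using ne[OF p] by (simp add: sum_gp_strict)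
      then show ?thesis by (simp add: E_def sum_distrib_left[symmetric] diff_divide_distrib right_diff_distrib)
    qed
    then have "?I = contour_integral (linepath a b) (\<lambda>p. (\<Sum>i<N. f p * r p ^ i) + E N p)"
      by (intro contour_integral_cong) auto
    also have "\<dots> = (\<Sum>i<N. contour_integral (linepath a b) (\<lambda>p. f p * r p ^ i)) + contour_integral (linepath a b) (E N)"
      by (subst contour_integral_add, simp_all add: contour_integral_sum contour_integrable_continuous_linepath contE cont continuous_intros)
    finally have "?I = contour_integral (linepath a b) (E N)" by (simp add: zero)
    moreover have "norm (contour_integral (linepath a b) (E N)) \<le> B * \<kappa> ^ N * norm (b - a)"
    proof (rule contour_integral_bound_linepath[OF contour_integrable_continuous_linepath[OF contE]])
      fix p assume p: "p \<in> closed_segment a b"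
      have "norm (E N p) = norm (E 0 p) * norm (r p) ^ N" by (simp add: E_def norm_mult norm_power norm_divide)
      also have "\<dots> \<le> B * \<kappa> ^ N" using B[OF p] r[OF p] B0 by (intro mult_mono power_mono) auto
      finally show "norm (E N p) \<le> B * \<kappa> ^ N" .
    qed (use B0 \<kappa> in auto)
    ultimately show ?thesis by simp
  qed
  moreover have "(\<lambda>N. B * \<kappa> ^ N * norm (b - a)) \<longlonglongrightarrow> B * 0 * norm (b - a)"
    using \<kappa> by (intro tendsto_intros LIMSEQ_power_zero) auto
  ultimately have "norm ?I \<le> 0" using LIMSEQ_le_const[of _ 0 "norm ?I"] by auto
  then show ?thesis by simp
qed

text \<open>\<open>\<Sum> z\<^sup>k / w\<^bsup>k+1\<^esup>\<close> is the Cauchy kernel \<open>1/(w - z)\<close> outside the disc of radius \<open>\<bar>z\<bar>\<close>, and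
  \<open>- \<Sum> w\<^sup>k / z\<^bsup>k+1\<^esup>\<close> inside it.\<close>

lemma vanishing_cauchy_integral:
  assumes g: "entire_periodic g" and van: "\<And>k. fourier g k = 0"
    and z: "exp \<rho> \<noteq> norm z" "z \<noteq> 0"
  shows "contour_integral (linepath (of_real \<rho>) (of_real \<rho> + period)) (\<lambda>p. g p * exp p / (exp p - z)) = 0"
proof -
  let ?L = "linepath (of_real \<rho>) (of_real \<rho> + period)"
  let ?seg = "closed_segment (of_real \<rho>) (of_real \<rho> + period)"
  have norm_exp: "norm (exp p) = exp \<rho>" if "p \<in> ?seg" for p
    using closed_segment_vertical_Re[OF that] by simp
  have cont: "continuous_on ?seg g"
    using g by (auto simp: entire_periodic_def intro: holomorphic_on_imp_continuous_on holomorphic_on_subset)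
  have fourier_L: "contour_integral ?L (\<lambda>p. c * (g p * exp (- of_int k * p))) = 0" for c k
    using mean_base_point[OF entire_periodic_cmult[OF entire_periodic_fourier[OF g, of k], of c], of "of_real \<rho>"]
      mean_cmult[OF entire_periodic_fourier[OF g, of k], of c] van[of k] by (simp add: fourier_def)
  show ?thesis
  proof (cases "exp \<rho> > norm z")
    case True
    have e: "g p * (z / exp p) ^ i = z ^ i * (g p * exp (- of_int (int i) * p))" for p i
      using exp_of_nat_mult[of i p] by (simp add: power_divide exp_minus field_simps)
    have "contour_integral ?L (\<lambda>p. g p / (1 - z / exp p)) = 0"
    proof (rule geometric_kernel_integral_zero[where \<kappa> = "norm z / exp \<rho>", OF cont])
      show "continuous_on ?seg (\<lambda>p. z / exp p)" by (intro continuous_intros) auto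
      show "norm (z / exp p) \<le> norm z / exp \<rho>" if "p \<in> ?seg" for p unfolding norm_divide norm_exp[OF that] ..
      show "contour_integral ?L (\<lambda>p. g p * (z / exp p) ^ i) = 0" for i unfolding e by (rule fourier_L)
    qed (use True in auto)
    moreover have "g p / (1 - z / exp p) = g p * exp p / (exp p - z)" for p
      by (simp add: divide_simps)
    ultimately show ?thesis by simp
  next
    case False
    then have lt: "exp \<rho> < norm z" using z by simp
    have e: "- (g p * exp p / z) * (exp p / z) ^ i = (- 1 / z ^ Suc i) * (g p * exp (- of_int (- int (Suc i)) * p))" for p i
      using exp_of_nat_mult[of "Suc i" p] by (simp add: power_divide field_simps del: of_nat_Suc)
    have zero: "contour_integral ?L (\<lambda>p. - (g p * exp p / z) / (1 - exp p / z)) = 0"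
    proof (rule geometric_kernel_integral_zero[where \<kappa> = "exp \<rho> / norm z"])
      show "continuous_on ?seg (\<lambda>p. - (g p * exp p / z))" "continuous_on ?seg (\<lambda>p. exp p / z)"
        by (intro continuous_intros cont; use z in simp)+
      show "norm (exp p / z) \<le> exp \<rho> / norm z" if "p \<in> ?seg" for p unfolding norm_divide norm_exp[OF that] ..
      show "contour_integral ?L (\<lambda>p. - (g p * exp p / z) * (exp p / z) ^ i) = 0" for i unfolding e by (rule fourier_L)
    qed (use lt z in auto)
    have kernel: "- (g p * exp p / z) / (1 - exp p / z) = g p * exp p / (exp p - z)" if "exp p \<noteq> z" for p
      using z that by (simp add: divide_simps) (simp add: algebra_simps)
    have "contour_integral ?L (\<lambda>p. - (g p * exp p / z) / (1 - exp p / z)) = contour_integral ?L (\<lambda>p. g p * exp p / (exp p - z))"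
    proof (intro contour_integral_cong refl)
      fix p assume "p \<in> path_image ?L"
      then have "p \<in> ?seg" by simp
      then have "exp p \<noteq> z" using norm_exp z by metis
      with kernel show "- (g p * exp p / z) / (1 - exp p / z) = g p * exp p / (exp p - z)" by blast
    qed
    then show ?thesis using zero by simp
  qed
qed

text \<open>\<open>g\<close> descends to a holomorphic function \<open>h\<close> on the punctured
  plane. The integrals of \<open>h w / (w - z)\<close> over circles around \<open>0\<close> on
  either side of \<open>z\<close> vanish. By the residue theorem the smaller circle shows that the
  residue at \<open>0\<close> vanishes, and the larger one then gives
  \<open>h z = 0\<close>.\<close>

lemma fourier_unique:
  assumes g: "entire_periodic g" and van: "\<And>k. fourier g k = 0"
  shows "g p = 0"
proof -
  define z where "z = exp p"
  have z0: "z \<noteq> 0" by (simp add: z_def)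
  define h where "h = (\<lambda>w. g (Ln w))"
  note per = entire_periodic_int_period[OF g]
  have h_exp: "h (exp a) = g a" for a
  proof -
    have "exp (Ln (exp a)) = exp a" by simp
    then obtain n :: int where "Ln (exp a) = a + of_real (of_int (2 * n) * pi) * \<i>" unfolding exp_eq by blast
    then have "Ln (exp a) = a + of_int n * period" by simp
    then show ?thesis using per unfolding h_def by metis
  qed
  \<comment> \<open>A second branch of the logarithm, holomorphic across the negative axis, where
    \<open>Ln\<close> is not.\<close>
  have h_alt: "h w = g (Ln (- w) + of_real pi * \<i>)" if "w \<noteq> 0" for w
  proof -
    have "exp (Ln (- w) + of_real pi * \<i>) = w" using that by (simp add: exp_add)
    then show ?thesis using h_exp by metis
  qed
  have gd: "g field_differentiable at a" for a
    using g by (auto simp: entire_periodic_def intro: holomorphic_on_imp_differentiable_at)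
  have hd: "h field_differentiable at w" if "w \<noteq> 0" for w
  proof (cases "w \<in> \<real>\<^sub>\<le>\<^sub>0")
    case False
    then have "Ln field_differentiable at w" by (rule field_differentiable_at_Ln)
    then show ?thesis unfolding h_def using field_differentiable_compose[OF _ gd] by (simp add: o_def)
  next
    case True
    then have "- w \<notin> \<real>\<^sub>\<le>\<^sub>0" using that by (auto simp: complex_nonpos_Reals_iff complex_eq_iff)
    then have "Ln field_differentiable at (- w)" by (rule field_differentiable_at_Ln)
    then have "(Ln \<circ> uminus) field_differentiable at w"
      by (intro field_differentiable_compose field_differentiable_minus field_differentiable_ident)
    then have "(\<lambda>w. Ln (- w) + of_real pi * \<i>) field_differentiable at w"
      by (intro field_differentiable_add) (simp_all add: o_def)
    from field_differentiable_compose[OF this gd]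
    have d: "(\<lambda>w. g (Ln (- w) + of_real pi * \<i>)) field_differentiable at w" by (simp add: o_def)
    have ev: "eventually (\<lambda>w. g (Ln (- w) + of_real pi * \<i>) = h w) (nhds w)"
      using t1_space_nhds[OF that] by eventually_elim (simp add: h_alt)
    obtain D where "((\<lambda>w. g (Ln (- w) + of_real pi * \<i>)) has_field_derivative D) (at w)"
      using d by (auto simp: field_differentiable_def)
    then have "(h has_field_derivative D) (at w)"
      using DERIV_cong_ev[OF refl ev refl] by simp
    then show ?thesis by (auto simp: field_differentiable_def)
  qed
  have h_holo: "h holomorphic_on S" if "0 \<notin> S" for S
    unfolding holomorphic_on_def
  proof
    fix w assume "w \<in> S"
    then have "h field_differentiable at w" using that by (intro hd) auto
    then show "h field_differentiable at w within S" by (rule field_differentiable_at_within)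
  qed
  define F where "F = (\<lambda>w. h w / (w - z))"
  have circle: "contour_integral (circlepath 0 (exp \<rho>)) F = 0" if \<rho>: "exp \<rho> \<noteq> norm z" for \<rho> :: real
  proof -
    \<comment> \<open>The circle is the image of the vertical segment under
      \<open>exp\<close>.\<close>
    have "contour_integral (circlepath 0 (exp \<rho>)) F =
      contour_integral (linepath (of_real \<rho>) (of_real \<rho> + period)) (\<lambda>p. g p * exp p / (exp p - z))"
      unfolding contour_integral_integral
    proof (rule integral_cong)
      fix t :: real
      define a where "a = linepath (of_real \<rho>) (of_real \<rho> + period) t"
      have "a = of_real \<rho> + of_real t * period" by (simp add: a_def linepath_def algebra_simps scaleR_conv_of_real)
      then have ea: "exp a = exp (of_real \<rho>) * exp (2 * of_real pi * \<i> * of_real t)"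
        by (simp add: exp_add mult_ac)
      have c: "circlepath 0 (exp \<rho>) t = exp a"
        unfolding ea by (simp add: circlepath exp_of_real)
      have "vector_derivative (circlepath 0 (exp \<rho>)) (at t) = period * exp a"
        unfolding ea by (simp add: vector_derivative_circlepath exp_of_real)
      then show "F (circlepath 0 (exp \<rho>) t) * vector_derivative (circlepath 0 (exp \<rho>)) (at t) =
         g (linepath (of_real \<rho>) (of_real \<rho> + period) t) * exp (linepath (of_real \<rho>) (of_real \<rho> + period) t) /
         (exp (linepath (of_real \<rho>) (of_real \<rho> + period) t) - z) *
         vector_derivative (linepath (of_real \<rho>) (of_real \<rho> + period)) (at t)"
        unfolding a_def[symmetric] c by (simp add: F_def h_exp)
    qed
    then show ?thesis using vanishing_cauchy_integral[OF g van \<rho> z0] by simp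
  qed
  have F_holo: "F holomorphic_on UNIV - {0, z}"
    unfolding F_def by (intro holomorphic_intros h_holo) auto
  have res: "(\<Sum>a\<in>{0, z}. winding_number (circlepath 0 (exp \<rho>)) a * residue F a) = 0" if \<rho>: "exp \<rho> \<noteq> norm z" for \<rho> :: real
  proof -
    have "contour_integral (circlepath 0 (exp \<rho>)) F =
       2 * pi * \<i> * (\<Sum>a\<in>{0, z}. winding_number (circlepath 0 (exp \<rho>)) a * residue F a)"
    proof (rule Residue_theorem[OF open_UNIV connected_UNIV _ F_holo])
      show "path_image (circlepath 0 (exp \<rho>)) \<subseteq> UNIV - {0, z}"
        using \<rho> by (auto simp: path_image_circlepath)
    qed auto
    then show ?thesis using circle[OF \<rho>] by simp
  qed
  define \<rho>1 \<rho>2 where "\<rho>1 = ln (norm z) + 1" and "\<rho>2 = ln (norm z) - 1"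
  have \<rho>1: "exp \<rho>1 > norm z" and \<rho>2: "exp \<rho>2 < norm z"
  proof -
    have "exp (ln (norm z)) < exp \<rho>1" "exp \<rho>2 < exp (ln (norm z))" unfolding \<rho>1_def \<rho>2_def exp_less_cancel_iff by simp_all
    then show "exp \<rho>1 > norm z" "exp \<rho>2 < norm z" using z0 by simp_all
  qed
  have w0: "winding_number (circlepath 0 (exp \<rho>)) 0 = 1" for \<rho>
    by (rule winding_number_circlepath) simp
  have wz1: "winding_number (circlepath 0 (exp \<rho>1)) z = 1"
    by (rule winding_number_circlepath) (use \<rho>1 in simp)
  have wz2: "winding_number (circlepath 0 (exp \<rho>2)) z = 0"
    by (rule winding_number_zero_outside[of _ "cball 0 (exp \<rho>2)"]) (use \<rho>2 in \<open>auto simp: path_image_circlepath\<close>)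
  have "residue F 0 + residue F z = 0" using res[of \<rho>1] \<rho>1 z0 by (simp add: w0 wz1)
  moreover have "residue F 0 = 0" using res[of \<rho>2] \<rho>2 z0 by (simp add: w0 wz2)
  moreover have "residue F z = h z"
    unfolding F_def by (rule residue_simple[of "- {0}"]) (use z0 h_holo in auto)
  ultimately have "h z = 0" by simp
  then show ?thesis using h_exp by (simp add: z_def)
qed

text \<open>The Laurent polynomial \<open>G\<close> with the same coefficients differs from
  \<open>g\<close> by a function all of whose Fourier coefficients vanish. The factor
  \<open>exp p ^ N\<close> clears its negative powers.\<close>

lemma entire_periodic_laurent_polynomial:
  assumes g: "entire_periodic g" and van: "\<And>k. \<bar>k\<bar> > int N \<Longrightarrow> fourier g k = 0"
  shows "\<exists>u. \<forall>p. g p = poly u (exp p) / exp p ^ N"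
proof -
  define c where "c = (\<lambda>k. fourier g k / period)"
  have period0: "period \<noteq> 0" by simp
  define G where "G = (\<lambda>p. \<Sum>k\<in>{-int N..int N}. c k * exp (of_int k * p))"
  have G: "entire_periodic G"
    unfolding G_def by (intro entire_periodic_sum entire_periodic_cmult entire_periodic_exp_int)
  have "fourier G k = fourier g k" for k
  proof -
    have "fourier G k = (\<Sum>j\<in>{-int N..int N}. c j * (if j = k then period else 0))"
      unfolding G_def
      by (subst fourier_sum) (auto simp: fourier_cmult entire_periodic_cmult entire_periodic_exp_int fourier_exp_int simp del: of_int_minus)
    also have "\<dots> = (if k \<in> {-int N..int N} then c k * period else 0)" by (simp add: if_distrib cong: if_cong)
    also have "\<dots> = fourier g k" using van[of k] by (auto simp: c_def)
    finally show ?thesis .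
  qed
  then have "fourier (\<lambda>p. g p - G p) k = 0" for k
    using fourier_diff[OF g G, of k] by simp
  from fourier_unique[OF entire_periodic_diff[OF g G] this] have "g p - G p = 0" for p .
  then have gG: "g p = G p" for p by simp
  define u where "u = (\<Sum>k\<in>{-int N..int N}. monom (c k) (nat (k + int N)))"
  have "g p = poly u (exp p) / exp p ^ N" for p
  proof -
    have "poly u (exp p) = (\<Sum>k\<in>{-int N..int N}. c k * exp p ^ nat (k + int N))"
      by (simp add: u_def poly_sum poly_monom)
    also have "\<dots> = (\<Sum>k\<in>{-int N..int N}. c k * exp (of_int k * p) * exp p ^ N)"
    proof (rule sum.cong[OF refl])
      fix k assume "k \<in> {-int N..int N}"
      then have k: "of_nat (nat (k + int N)) = (of_int k + of_nat N :: complex)"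
        by (metis atLeastAtMost_iff add.commute diff_ge_0_iff_ge diff_minus_eq_add of_int_add of_int_of_nat_eq of_nat_nat)
      have "exp p ^ nat (k + int N) = exp (of_nat (nat (k + int N)) * p)" by (simp only: exp_of_nat_mult)
      also have "\<dots> = exp (of_int k * p) * exp p ^ N"
        unfolding k by (simp add: exp_add exp_of_nat_mult exp_of_nat2_mult algebra_simps)
      finally show "c k * exp p ^ nat (k + int N) = c k * exp (of_int k * p) * exp p ^ N" by simp
    qed
    also have "\<dots> = G p * exp p ^ N" by (simp add: G_def sum_distrib_right)
    finally show ?thesis by (simp add: gG)
  qed
  then show ?thesis by blast
qed

section \<open>From functional equations to recurrences\<close>

text \<open>Degree and order change places: a term \<open>x ^ i\<close> in the coefficient of order
  \<open>j\<close> becomes a shift by \<open>i\<close> multiplied by \<open>\<theta> ^ j\<close>.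
  With \<open>s = N - i\<close> all shifts are nonnegative.\<close>

lemma coefficient_relation:
  fixes c \<theta> :: "int \<Rightarrow> complex"
  assumes "\<And>k. (\<Sum>j\<le>n. \<Sum>i\<le>N. coeff (p j) i * (\<theta> (k - int i) ^ j * c (k - int i))) = 0"
  shows "(\<Sum>s\<le>N. poly (\<Sum>j\<le>n. monom (coeff (p j) (N - s)) j) (\<theta> (k + int s)) * c (k + int s)) = 0"
proof -
  have "(\<Sum>s\<le>N. poly (\<Sum>j\<le>n. monom (coeff (p j) (N - s)) j) (\<theta> (k + int s)) * c (k + int s)) =
     (\<Sum>s\<le>N. \<Sum>j\<le>n. coeff (p j) (N - s) * (\<theta> (k + int s) ^ j * c (k + int s)))"
    by (simp add: poly_sum poly_monom sum_distrib_right mult.assoc)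
  also have "\<dots> = (\<Sum>i\<le>N. \<Sum>j\<le>n. coeff (p j) i * (\<theta> (k + int N - int i) ^ j * c (k + int N - int i)))"
    by (rule sum.reindex_bij_witness[of _ "\<lambda>i. N - i" "\<lambda>i. N - i"]) (auto simp: of_nat_diff algebra_simps)
  also have "\<dots> = (\<Sum>j\<le>n. \<Sum>i\<le>N. coeff (p j) i * (\<theta> (k + int N - int i) ^ j * c (k + int N - int i)))"
    by (rule sum.swap)
  also have "\<dots> = 0" by (rule assms)
  finally show ?thesis .
qed

text \<open>The shift is chosen such that the leading coefficient of \<open>p j\<close> appears in
  it.\<close>

lemma coefficient_relation_nonzero:
  assumes "j \<le> n" "p j \<noteq> 0" "\<And>j. j \<le> n \<Longrightarrow> degree (p j) \<le> N"
  obtains s where "s \<le> N" "(\<Sum>j\<le>n. monom (coeff (p j :: complex poly) (N - s)) j) \<noteq> 0"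
proof -
  define s where "s = N - degree (p j)"
  have "N - s = degree (p j)" using assms(3)[OF assms(1)] by (simp add: s_def)
  then have "coeff (\<Sum>j\<le>n. monom (coeff (p j) (N - s)) j) j = lead_coeff (p j)"
    using assms(1) by (simp add: coeff_sum)
  then have "(\<Sum>j\<le>n. monom (coeff (p j) (N - s)) j) \<noteq> 0" using assms(2) by auto
  moreover have "s \<le> N" by (simp add: s_def)
  ultimately show ?thesis using that by blast
qed

text \<open>\<open>coefficient_relation\<close> evaluates the polynomials at \<open>k + s\<close>;
  composing with a translation rewrites them in \<open>k\<close>.\<close>

lemma index_shift_coefficients:
  fixes c :: "int \<Rightarrow> complex"
  assumes "j \<le> n" "p j \<noteq> 0" "\<And>j. j \<le> n \<Longrightarrow> degree (p j) \<le> N"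
    and "\<And>k. (\<Sum>j\<le>n. \<Sum>i\<le>N. coeff (p j) i * (of_int (k - int i) ^ j * c (k - int i))) = 0"
  shows "index_shift.has_relation (\<lambda>k. c (int k))"
proof -
  obtain s where s: "s \<le> N" "(\<Sum>j\<le>n. monom (coeff (p j) (N - s)) j) \<noteq> 0"
    by (rule coefficient_relation_nonzero[of j n p N, OF assms(1-3)])
  show ?thesis
  proof (rule index_shift.has_relationI[OF s(1)])
    show "pcompose (\<Sum>j\<le>n. monom (coeff (p j) (N - s)) j) [:of_nat s, 1:] \<noteq> 0"
      using s(2) by (simp add: pcompose_eq_0_iff)
    show "(\<lambda>k. \<Sum>s\<le>N. poly (pcompose (\<Sum>j\<le>n. monom (coeff (p j) (N - s)) j) [:of_nat s, 1:]) (of_nat k) *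
        (shift ^^ s) (\<lambda>k. c (int k)) k) \<in> eventually_zero"
    proof -
      have "(\<Sum>s\<le>N. poly (\<Sum>j\<le>n. monom (coeff (p j) (N - s)) j) (of_int (int k + int s)) * c (int k + int s)) = 0" for k
        by (rule coefficient_relation[OF assms(4)])
      then show ?thesis by (simp add: eventually_zero_def funpow_shift poly_pcompose add.commute)
    qed
  qed
qed

lemma (in not_root_of_unity) geometric_shift_coefficients:
  fixes c :: "int \<Rightarrow> complex"
  assumes "j \<le> n" "p j \<noteq> 0" "\<And>j. j \<le> n \<Longrightarrow> degree (p j) \<le> N"
    and "\<And>k. (\<Sum>j\<le>n. \<Sum>i\<le>N. coeff (p j) i * ((q powi (k - int i)) ^ j * c (k - int i))) = 0"
  shows "E0.S.has_relation (\<lambda>k. c (int k))"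
proof -
  obtain s where s: "s \<le> N" "(\<Sum>j\<le>n. monom (coeff (p j) (N - s)) j) \<noteq> 0"
    by (rule coefficient_relation_nonzero[of j n p N, OF assms(1-3)])
  have pow: "q powi (int k + int s) = q ^ k * q ^ s" for k s
    using q_nonzero by (simp add: power_int_add)
  show ?thesis
  proof (rule E0.S.has_relationI[OF s(1)])
    show "pcompose (\<Sum>j\<le>n. monom (coeff (p j) (N - s)) j) [:0, q ^ s:] \<noteq> 0"
      using s(2) q_nonzero by (simp add: pcompose_eq_0_iff)
    show "(\<lambda>k. \<Sum>s\<le>N. poly (pcompose (\<Sum>j\<le>n. monom (coeff (p j) (N - s)) j) [:0, q ^ s:]) (q ^ k) *
        (shift ^^ s) (\<lambda>k. c (int k)) k) \<in> eventually_zero"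
    proof -
      have "(\<Sum>s\<le>N. poly (\<Sum>j\<le>n. monom (coeff (p j) (N - s)) j) (q powi (int k + int s)) * c (int k + int s)) = 0" for k
        by (rule coefficient_relation[OF assms(4)])
      then show ?thesis by (simp add: eventually_zero_def funpow_shift poly_pcompose pow mult.commute)
    qed
  qed
qed

lemma entire_periodic_exp_poly_mult:
  assumes "entire_periodic g"
  shows "entire_periodic (\<lambda>p. poly P (exp p) * g p)"
proof -
  have "entire_periodic (\<lambda>p. \<Sum>i\<le>degree P. coeff P i * (exp (of_int (int i) * p) * g p))"
    by (intro entire_periodic_sum entire_periodic_cmult entire_periodic_mult entire_periodic_exp_int assms)
  then show ?thesis by (simp add: poly_altdef sum_distrib_right exp_of_nat_mult mult.assoc)
qed

lemma fourier_exp_poly_mult: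
  assumes "entire_periodic g" "degree P \<le> N"
  shows "fourier (\<lambda>p. poly P (exp p) * g p) k = (\<Sum>i\<le>N. coeff P i * fourier g (k - int i))"
proof -
  have e: "entire_periodic (\<lambda>p. exp (of_nat i * p) * g p)" for i
    using entire_periodic_mult[OF entire_periodic_exp_int[of "int i"] assms(1)] by simp
  have "poly P (exp p) * g p = (\<Sum>i\<le>N. coeff P i * (exp (of_nat i * p) * g p))" for p
    using poly_as_sum_le[OF assms(2), of "exp p"] by (simp add: sum_distrib_right exp_of_nat_mult mult.assoc)
  then have "fourier (\<lambda>p. poly P (exp p) * g p) k = fourier (\<lambda>p. \<Sum>i\<le>N. coeff P i * (exp (of_nat i * p) * g p)) k"
    by simp
  also have "\<dots> = (\<Sum>i\<le>N. coeff P i * fourier g (k - int i))"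
    using e by (subst fourier_sum) (auto simp: fourier_cmult fourier_exp_mult entire_periodic_cmult)
  finally show ?thesis .
qed

lemma fourier_relation:
  assumes "\<And>j. j \<le> n \<Longrightarrow> entire_periodic (F j)" "\<And>j. j \<le> n \<Longrightarrow> degree (p j) \<le> N"
    and "\<And>j k. j \<le> n \<Longrightarrow> fourier (F j) k = \<theta> k ^ j * c k"
    and "\<And>x. (\<Sum>j\<le>n. poly (p j) (exp x) * F j x) = 0"
  shows "(\<Sum>j\<le>n. \<Sum>i\<le>N. coeff (p j) i * (\<theta> (k - int i) ^ j * c (k - int i))) = 0"
proof -
  have "fourier (\<lambda>x. \<Sum>j\<le>n. poly (p j) (exp x) * F j x) k = (\<Sum>j\<le>n. fourier (\<lambda>x. poly (p j) (exp x) * F j x) k)"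
    by (rule fourier_sum) (auto intro: entire_periodic_exp_poly_mult assms)
  also have "\<dots> = (\<Sum>j\<le>n. \<Sum>i\<le>N. coeff (p j) i * (\<theta> (k - int i) ^ j * c (k - int i)))"
    by (rule sum.cong) (auto simp: fourier_exp_poly_mult[OF assms(1,2)] assms(3))
  finally show ?thesis unfolding assms(4) by (simp add: fourier_def mean_def)
qed

lemma degree_bound_exists: "\<exists>N. \<forall>j\<le>(n::nat). degree (p j) \<le> N"
  by (intro exI[of _ "Max ((\<lambda>j. degree (p j)) ` {..n})"]) auto

text \<open>Integrating along \<open>Re p = ln \<rho>\<close> bounds the \<open>k\<close>-th
  coefficient by a constant times \<open>1 / \<rho> ^ k\<close>, for every
  \<open>\<rho> > 0\<close>, so the coefficients decay faster than any exponential while satisfying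
  both kinds of recurrences.\<close>

lemma (in not_root_of_unity) fourier_vanish_dilation:
  assumes g: "entire_periodic g" and l: "exp l = q"
    and p: "j \<le> n" "p j \<noteq> 0" "\<And>x. (\<Sum>j\<le>n. poly (p j) (exp x) * (deriv ^^ j) g x) = 0"
    and r: "i \<le> m" "r i \<noteq> 0" "\<And>x. (\<Sum>j\<le>m. poly (r j) (exp x) * g (x + of_nat j * l)) = 0"
  shows "\<exists>K. \<forall>k>K. fourier g (int k) = 0"
proof -
  obtain N where N: "\<And>j. j \<le> n \<Longrightarrow> degree (p j) \<le> N" using degree_bound_exists by blast
  obtain M where M: "\<And>j. j \<le> m \<Longrightarrow> degree (r j) \<le> M" using degree_bound_exists by blast
  have "index_shift.has_relation (\<lambda>k. fourier g (int k))"
  proof (rule index_shift_coefficients[of j n p N, OF p(1,2) N])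
    show "(\<Sum>j\<le>n. \<Sum>i\<le>N. coeff (p j) i * (of_int (k - int i) ^ j * fourier g (k - int i))) = 0" for k
      by (rule fourier_relation[of n "\<lambda>j. (deriv ^^ j) g" p N of_int])
         (use fourier_funpow_deriv[OF g] N p in auto)
  qed
  moreover have "E0.S.has_relation (\<lambda>k. fourier g (int k))"
  proof (rule geometric_shift_coefficients[of i m r M, OF r(1,2) M])
    have "fourier (\<lambda>x. g (x + of_nat j * l)) k = (q powi k) ^ j * fourier g k" for j k
    proof -
      have "exp (of_int k * (of_nat j * l)) = (q powi k) ^ j"
        by (metis exp_of_nat_mult exp_power_int l mult.left_commute)
      then show ?thesis by (simp add: fourier_translate[OF g])
    qed
    moreover have "entire_periodic (\<lambda>x. g (x + of_nat j * l))" for j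
      using entire_periodic_affine[OF g, of 1] by simp
    ultimately show "(\<Sum>j\<le>m. \<Sum>i\<le>M. coeff (r j) i * ((q powi (k - int i)) ^ j * fourier g (k - int i))) = 0" for k
      by (intro fourier_relation[of m "\<lambda>j x. g (x + of_nat j * l)" r M "\<lambda>k. q powi k"])
         (use M r in auto)
  qed
  moreover have "\<exists>C. \<forall>k. norm (fourier g (int k)) * \<rho> ^ k \<le> C" if \<rho>: "\<rho> > 0" for \<rho>
  proof -
    obtain B where "\<forall>p. ln \<rho> \<le> Re p \<and> Re p \<le> ln \<rho> \<longrightarrow> norm (g p) \<le> B"
      using periodic_bounded_on_vertical_strip[OF g] by blast
    then have B: "\<And>p. Re p = ln \<rho> \<Longrightarrow> norm (g p) \<le> B" by simp
    have "norm (fourier g (int k)) * \<rho> ^ k \<le> B * (2 * pi)" for k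
    proof -
      have e: "exp (- of_int (int k) * ln \<rho>) * \<rho> ^ k = 1"
        using \<rho> by (simp add: exp_minus exp_of_nat_mult)
      have "norm (fourier g (int k)) * \<rho> ^ k \<le> (B * exp (- of_int (int k) * ln \<rho>) * (2 * pi)) * \<rho> ^ k"
      proof (rule mult_right_mono)
        show "norm (fourier g (int k)) \<le> B * exp (- of_int (int k) * ln \<rho>) * (2 * pi)"
          by (rule fourier_bound[OF g]) (rule B)
      qed (use \<rho> in simp)
      also have "\<dots> = B * (2 * pi) * (exp (- of_int (int k) * ln \<rho>) * \<rho> ^ k)" by (simp only: mult_ac)
      finally show ?thesis by (simp only: e mult_1_right)
    qed
    then show ?thesis by blast
  qed
  ultimately have "(\<lambda>k. fourier g (int k)) \<in> eventually_zero" using bifinite_rapidly_decaying by blast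
  then show ?thesis
    unfolding eventually_zero_def eventually_sequentially mem_Collect_eq by (meson less_imp_le)
qed

section \<open>Growth of entire periodic solutions of Mahler equations\<close>

lemma poly_bounded_below:
  fixes p :: "complex poly"
  assumes "p \<noteq> 0"
  shows "\<exists>c>0. \<exists>R. \<forall>z. norm z \<ge> R \<longrightarrow> norm (poly p z) \<ge> c"
proof (cases p)
  case (pCons a p')
  show ?thesis
  proof (cases "p' = 0")
    case True
    then show ?thesis using assms pCons by (intro exI[of _ "norm a"]) auto
  next
    case False
    then obtain R where "\<forall>z. R \<le> norm z \<longrightarrow> 1 \<le> norm (poly (pCons a p') z)"
      using poly_infinity[of p' 1 a] by blast
    then show ?thesis using pCons by (intro exI[of _ 1]) auto
  qed
qed

lemma poly_bounded_above:
  fixes p :: "complex poly"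
  assumes "degree p \<le> e" "norm z \<ge> 1"
  shows "norm (poly p z) \<le> (\<Sum>i\<le>e. norm (coeff p i)) * norm z ^ e"
proof -
  have "norm (poly p z) = norm (\<Sum>i\<le>e. coeff p i * z ^ i)" using poly_as_sum_le[OF assms(1)] by simp
  also have "\<dots> \<le> (\<Sum>i\<le>e. norm (coeff p i) * norm z ^ e)"
  proof (rule sum_norm_le)
    fix i assume "i \<in> {..e}"
    then show "norm (coeff p i * z ^ i) \<le> norm (coeff p i) * norm z ^ e"
      using assms(2) by (auto simp: norm_mult norm_power intro!: mult_left_mono power_increasing)
  qed
  finally show ?thesis by (simp add: sum_distrib_right)
qed

text \<open>The equation bounds \<open>g\<close> on the line \<open>Re p = q\<^sup>m t\<close> by \<open>exp(O(t))\<close> times its size on the lines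
  \<open>Re p = q\<^sup>j t\<close>, \<open>j < m\<close>; iterating gives exponential growth in \<open>Re p\<close>.\<close>

lemma mahler_growth:
  fixes g :: "complex \<Rightarrow> complex"
  assumes g: "entire_periodic g" and q: "q \<ge> (2 :: nat)"
    and r: "r m \<noteq> 0" "\<And>x. (\<Sum>j\<le>m. poly (r j) (exp x) * g (of_nat (q ^ j) * x)) = 0"
  shows "\<exists>A K t0. \<forall>p. Re p \<ge> t0 \<longrightarrow> norm (g p) \<le> A * exp (K * Re p)"
proof -
  obtain e where e: "\<And>j. j \<le> m \<Longrightarrow> degree (r j) \<le> e" using degree_bound_exists by blast
  obtain c R where c: "c > 0" "\<And>z. norm z \<ge> R \<Longrightarrow> norm (poly (r m) z) \<ge> c"
    using poly_bounded_below[OF r(1)] by blast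
  \<comment> \<open>To the right of \<open>t0\<close> the leading coefficient is bounded below by
    \<open>c\<close>, and \<open>t \<ge> 1\<close> lets constants be absorbed into exponentials of
    \<open>t\<close>.\<close>
  define t0 where "t0 = max 1 (ln (max R 1))"
  have t0: "t0 \<ge> 1" "exp t0 \<ge> R"
  proof -
    show "t0 \<ge> 1" by (simp add: t0_def)
    have "R \<le> exp (ln (max R 1))" by simp
    also have "\<dots> \<le> exp t0" unfolding exp_le_cancel_iff by (simp add: t0_def)
    finally show "exp t0 \<ge> R" .
  qed
  define L where "L = 1 + (\<Sum>j<m. \<Sum>i\<le>e. norm (coeff (r j) i)) / c"
  have L: "L \<ge> 1" using c by (simp add: L_def sum_nonneg)
  \<comment> \<open>One use of the equation costs at most a factor \<open>exp (e t)\<close> from the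
    degrees and \<open>L - 1 \<le> exp (ln L * t)\<close> from the sizes of the coefficients,
    together \<open>exp (K t)\<close>.\<close>
  define K where "K = real e + ln L"
  have K: "K \<ge> 0" using L by (simp add: K_def)
  obtain B where B: "\<And>p. t0 \<le> Re p \<Longrightarrow> Re p \<le> t0 * real q ^ m \<Longrightarrow> norm (g p) \<le> B"
    using periodic_bounded_on_vertical_strip[OF g] by blast
  define A where "A = max B 0"
  have A: "A \<ge> 0" "B \<le> A" by (auto simp: A_def)
  have step: "norm (g (of_nat (q ^ m) * p)) \<le> A * exp (K * Re (of_nat (q ^ m) * p))"
    if t: "Re p \<ge> t0" and IH: "\<And>j. j < m \<Longrightarrow> norm (g (of_nat (q ^ j) * p)) \<le> A * exp (K * Re (of_nat (q ^ j) * p))" for p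
  proof (cases "m = 0")
    case True
    have "norm (exp p) \<ge> R" using t t0 by (simp add: order_trans)
    then have "poly (r 0) (exp p) \<noteq> 0" using c True by fastforce
    then show ?thesis using r(2)[of p] True A by simp
  next
    case False
    define t where "t = Re p"
    have t1: "t \<ge> 1" using that(1) t0 by (simp add: t_def)
    have norm_exp: "norm (exp p) = exp t" by (simp add: t_def)
    have lower: "norm (poly (r m) (exp p)) \<ge> c"
      using c(2)[of "exp p"] t0 that(1) by (simp add: order_trans)
    \<comment> \<open>The largest scale on the right-hand side. Since \<open>q \<ge> 2\<close>,
      \<open>1 + q1 \<le> q ^ m\<close>, which leaves room for the extra factor
      \<open>exp (K t)\<close>.\<close>
    define q1 where "q1 = real q ^ (m - 1)"
    have q1: "q1 \<ge> 1" "real q ^ m \<ge> 2 * q1"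
    proof -
      show "q1 \<ge> 1" using q by (simp add: q1_def)
      have "real q ^ m = real q * q1" using False by (simp add: q1_def power_eq_if)
      also have "\<dots> \<ge> 2 * q1" using q \<open>q1 \<ge> 1\<close> by (intro mult_right_mono) auto
      finally show "real q ^ m \<ge> 2 * q1" .
    qed
    have summand: "norm (poly (r j) (exp p) * g (of_nat (q ^ j) * p)) \<le>
        (\<Sum>i\<le>e. norm (coeff (r j) i)) * (exp t ^ e * (A * exp (K * (q1 * t))))" if j: "j < m" for j
    proof -
      have "norm (poly (r j) (exp p)) \<le> (\<Sum>i\<le>e. norm (coeff (r j) i)) * exp t ^ e"
        using poly_bounded_above[of "r j" e "exp p"] e[of j] j t1 by (simp add: t_def)
      moreover have "norm (g (of_nat (q ^ j) * p)) \<le> A * exp (K * (q1 * t))"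
      proof -
        have "real q ^ j \<le> q1" using j q by (auto simp: q1_def intro: power_increasing)
        then have "K * Re (of_nat (q ^ j) * p) \<le> K * (q1 * t)"
          using K t1 by (intro mult_left_mono) (auto simp: t_def intro!: mult_right_mono)
        then have "A * exp (K * Re (of_nat (q ^ j) * p)) \<le> A * exp (K * (q1 * t))"
          using A by (intro mult_left_mono) auto
        then show ?thesis using IH[OF j] by (rule order_trans[rotated])
      qed
      ultimately have "norm (poly (r j) (exp p)) * norm (g (of_nat (q ^ j) * p)) \<le>
         ((\<Sum>i\<le>e. norm (coeff (r j) i)) * exp t ^ e) * (A * exp (K * (q1 * t)))"
        by (intro mult_mono) (auto intro!: mult_nonneg_nonneg sum_nonneg)
      then show ?thesis by (simp add: norm_mult mult.assoc)
    qed
    have "poly (r m) (exp p) * g (of_nat (q ^ m) * p) = - (\<Sum>j<m. poly (r j) (exp p) * g (of_nat (q ^ j) * p))"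
      using r(2)[of p] by (simp add: lessThan_Suc_atMost[symmetric] eq_neg_iff_add_eq_0 add.commute)
    then have "norm (poly (r m) (exp p)) * norm (g (of_nat (q ^ m) * p)) = norm (\<Sum>j<m. poly (r j) (exp p) * g (of_nat (q ^ j) * p))"
      by (metis norm_minus_cancel norm_mult)
    also have "\<dots> \<le> (\<Sum>j<m. (\<Sum>i\<le>e. norm (coeff (r j) i)) * (exp t ^ e * (A * exp (K * (q1 * t)))))"
      by (rule sum_norm_le) (use summand in auto)
    also have "\<dots> = (\<Sum>j<m. \<Sum>i\<le>e. norm (coeff (r j) i)) * (exp t ^ e * (A * exp (K * (q1 * t))))"
      by (rule sum_distrib_right[symmetric])
    also have "(\<Sum>j<m. \<Sum>i\<le>e. norm (coeff (r j) i)) = c * (L - 1)" using c by (simp add: L_def)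
    finally have "norm (poly (r m) (exp p)) * norm (g (of_nat (q ^ m) * p)) \<le> c * (L - 1) * (exp t ^ e * (A * exp (K * (q1 * t))))" .
    moreover have "c * norm (g (of_nat (q ^ m) * p)) \<le> norm (poly (r m) (exp p)) * norm (g (of_nat (q ^ m) * p))"
      using lower by (intro mult_right_mono) auto
    ultimately have "c * norm (g (of_nat (q ^ m) * p)) \<le> c * ((L - 1) * (exp t ^ e * (A * exp (K * (q1 * t)))))"
      by (simp only: mult.assoc)
    then have "norm (g (of_nat (q ^ m) * p)) \<le> (L - 1) * (exp t ^ e * (A * exp (K * (q1 * t))))"
      using c(1) by (subst (asm) mult_le_cancel_left_pos) auto
    also have "\<dots> \<le> exp (ln L * t) * (exp t ^ e * (A * exp (K * (q1 * t))))"
    proof (rule mult_right_mono)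
      have "ln L \<le> ln L * t" using L t1 by (simp add: mult_le_cancel_left1)
      then have "exp (ln L) \<le> exp (ln L * t)" by simp
      then show "L - 1 \<le> exp (ln L * t)" using L by simp
    qed (use A in auto)
    also have "\<dots> = A * exp (K * t + K * (q1 * t))"
      by (simp add: K_def exp_add ring_distribs mult_ac flip: exp_of_nat_mult)
    also have "\<dots> \<le> A * exp (K * Re (of_nat (q ^ m) * p))"
    proof -
      have "t + q1 * t \<le> 2 * q1 * t" using q1(1) t1 by simp
      also have "\<dots> \<le> real q ^ m * t" using q1(2) t1 by (intro mult_right_mono) auto
      finally have "K * (t + q1 * t) \<le> K * (real q ^ m * t)" using K by (rule mult_left_mono)
      then show ?thesis using A by (intro mult_left_mono) (auto simp: t_def ring_distribs)
    qed
    finally show ?thesis .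
  qed
  \<comment> \<open>Induction over strips that grow by the factor \<open>q\<close>: a point beyond
    the strip is \<open>q ^ m\<close> times a point \<open>p'\<close> whose multiples by
    \<open>q ^ j\<close>, \<open>j < m\<close>, lie in it.\<close>
  have "norm (g p) \<le> A * exp (K * Re p)" if "t0 \<le> Re p" "Re p \<le> t0 * real q ^ (m + n)" for n p
    using that
  proof (induction n arbitrary: p)
    case 0
    then have "norm (g p) \<le> A" using B[of p] A by simp
    also have "\<dots> \<le> A * exp (K * Re p)"
      using A K 0 t0 by (simp add: mult_le_cancel_left1)
    finally show ?case .
  next
    case (Suc n)
    show ?case
    proof (cases "Re p \<le> t0 * real q ^ (m + n)")
      case True
      then show ?thesis using Suc by blast
    next
      case False
      define p' where "p' = p / of_nat (q ^ m)"
      have q0: "real q > 0" using q by simp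
      have p: "p = of_nat (q ^ m) * p'" using q by (simp add: p'_def)
      have Re_p': "Re p' * real q ^ m = Re p"
        using arg_cong[OF p, of Re] by (simp add: mult.commute)
      have "t0 * real q ^ m \<le> t0 * real q ^ (m + n)"
        using t0 q by (intro mult_left_mono power_increasing) auto
      then have "t0 * real q ^ m \<le> Re p' * real q ^ m" using False Re_p' by simp
      then have ge: "t0 \<le> Re p'" using q0 by simp
      show ?thesis
        unfolding p
      proof (rule step[OF ge])
        fix j assume j: "j < m"
        have Re_j: "Re (of_nat (q ^ j) * p') = real q ^ j * Re p'" by simp
        show "norm (g (of_nat (q ^ j) * p')) \<le> A * exp (K * Re (of_nat (q ^ j) * p'))"
        proof (rule Suc.IH)
          have "1 * Re p' \<le> real q ^ j * Re p'" using q ge t0 by (intro mult_right_mono) auto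
          then show "t0 \<le> Re (of_nat (q ^ j) * p')" using ge Re_j by simp
          have "real q * (real q ^ j * Re p') = real q ^ Suc j * Re p'" by simp
          also have "\<dots> \<le> real q ^ m * Re p'" using j q ge t0 by (intro mult_right_mono power_increasing) auto
          also have "\<dots> \<le> t0 * real q ^ (m + Suc n)" using Suc.prems(2) Re_p' by (simp add: mult.commute)
          also have "\<dots> = real q * (t0 * real q ^ (m + n))" by simp
          finally show "Re (of_nat (q ^ j) * p') \<le> t0 * real q ^ (m + n)" using q0 Re_j by simp
        qed
      qed
    qed
  qed
  moreover have "\<exists>n. Re p \<le> t0 * real q ^ (m + n)" for p
  proof -
    obtain n where "Re p < real q ^ n" using real_arch_pow[of "real q" "Re p"] q by auto
    also have "real q ^ n \<le> real q ^ (m + n)" using q by (intro power_increasing) auto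
    also have "\<dots> \<le> t0 * real q ^ (m + n)" using t0 q by simp
    finally show ?thesis by (auto intro: less_imp_le)
  qed
  ultimately show ?thesis by blast
qed

text \<open>On the line \<open>Re p = \<rho>\<close> the \<open>k\<close>-th coefficient is bounded
  by a constant times \<open>exp ((K - k) \<rho>)\<close>, which tends to \<open>0\<close> for large
  \<open>\<rho>\<close> when \<open>k > K\<close>.\<close>

lemma fourier_vanish_mahler:
  assumes g: "entire_periodic g" and q: "q \<ge> (2 :: nat)"
    and r: "r m \<noteq> 0" "\<And>x. (\<Sum>j\<le>m. poly (r j) (exp x) * g (of_nat (q ^ j) * x)) = 0"
  shows "\<exists>K. \<forall>k>K. fourier g (int k) = 0"
proof -
  obtain A K t0 where bound: "\<And>p. Re p \<ge> t0 \<Longrightarrow> norm (g p) \<le> A * exp (K * Re p)"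
    using mahler_growth[OF assms] by blast
  have "fourier g (int k) = 0" if k: "k > nat \<lceil>K\<rceil>" for k
  proof -
    have kK: "real k > K" using k by linarith
    have "norm (fourier g (int k)) \<le> A * (2 * pi) * exp (- ((real k - K) * \<rho>))" if "\<rho> \<ge> t0" for \<rho>
    proof -
      have "norm (fourier g (int k)) \<le> (A * exp (K * \<rho>)) * exp (- of_int (int k) * \<rho>) * (2 * pi)"
        by (rule fourier_bound[OF g]) (use bound that in auto)
      also have "\<dots> = A * (2 * pi) * (exp (K * \<rho>) * exp (- of_int (int k) * \<rho>))" by (simp only: mult_ac)
      also have "exp (K * \<rho>) * exp (- of_int (int k) * \<rho>) = exp (- ((real k - K) * \<rho>))"
        by (simp add: algebra_simps flip: exp_add)
      finally show ?thesis .
    qed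
    then have "eventually (\<lambda>\<rho>. norm (fourier g (int k)) \<le> A * (2 * pi) * exp (- ((real k - K) * \<rho>))) at_top"
      using eventually_ge_at_top[of t0] by (rule eventually_mono[rotated])
    moreover have "((\<lambda>\<rho>. A * (2 * pi) * exp (- ((real k - K) * \<rho>))) \<longlongrightarrow> A * (2 * pi) * 0) at_top"
    proof (intro tendsto_mult tendsto_const filterlim_compose[OF exp_at_bot])
      have "filterlim (\<lambda>\<rho>. (real k - K) * \<rho>) at_top at_top"
        using kK by (intro filterlim_tendsto_pos_mult_at_top[OF tendsto_const] filterlim_ident) auto
      then show "filterlim (\<lambda>\<rho>. - ((real k - K) * \<rho>)) at_bot at_top"
        by (simp add: filterlim_uminus_at_bot)
    qed
    ultimately have "norm (fourier g (int k)) \<le> A * (2 * pi) * 0"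
      by (intro tendsto_lowerbound[of _ "A * (2 * pi) * 0" at_top]) auto
    then show ?thesis by simp
  qed
  then show ?thesis by blast
qed

section \<open>Periodic solutions\<close>

notation fls_nth (infixl \<open>$$\<close> 75)

lemma fls_mult_nth_bounds:
  fixes F G :: "'a :: idom fls"
  assumes "\<And>k. k < a \<Longrightarrow> F $$ k = 0" "\<And>k. k < b \<Longrightarrow> G $$ k = 0"
  shows "(F * G) $$ (a + b) = F $$ a * G $$ b" "k < a + b \<Longrightarrow> (F * G) $$ k = 0"
proof -
  have "(F * G) $$ (a + b) = F $$ a * G $$ b \<and> (k < a + b \<longrightarrow> (F * G) $$ k = 0)"
  proof (cases "F = 0 \<or> G = 0")
    case False
    then have F: "fls_subdegree F \<ge> a" and G: "fls_subdegree G \<ge> b"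
      using assms by (auto intro!: fls_subdegree_geI)
    show ?thesis
    proof (cases "fls_subdegree F = a \<and> fls_subdegree G = b")
      case True
      then show ?thesis using fls_times_base[of F G] by (auto intro: fls_times_nth_eq0)
    next
      case ne: False
      then have lt: "a + b < fls_subdegree F + fls_subdegree G" using F G by linarith
      moreover have "F $$ a = 0 \<or> G $$ b = 0" using ne F G by (metis fls_eq0_below_subdegree order_le_less)
      ultimately show ?thesis by (auto intro: fls_times_nth_eq0)
    qed
  qed auto
  then show "(F * G) $$ (a + b) = F $$ a * G $$ b" "k < a + b \<Longrightarrow> (F * G) $$ k = 0" by blast+
qed

lemma fls_funpow_deriv_nth_bounds:
  fixes F :: "'a :: {idom, ring_char_0} fls"
  assumes "\<And>k. k < s \<Longrightarrow> F $$ k = 0"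
  shows "(\<forall>k < s - int i. (fls_deriv ^^ i) F $$ k = 0) \<and>
    (fls_deriv ^^ i) F $$ (s - int i) = (\<Prod>j<i. of_int (s - int j)) * F $$ s"
proof (induction i)
  case 0
  then show ?case using assms by simp
next
  case (Suc i)
  have step: "(fls_deriv ^^ Suc i) F $$ k = of_int (k + 1) * (fls_deriv ^^ i) F $$ (k + 1)" for k
    by simp
  have e: "s - int (Suc i) + 1 = s - int i" by simp
  have "\<forall>k < s - int (Suc i). (fls_deriv ^^ Suc i) F $$ k = 0"
    unfolding step using Suc by auto
  moreover have "(fls_deriv ^^ Suc i) F $$ (s - int (Suc i)) = (\<Prod>j<Suc i. of_int (s - int j)) * F $$ s"
    unfolding step e using Suc by (simp add: mult_ac)
  ultimately show ?case by blast
qed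

text \<open>Where the leading coefficient does not vanish, the lowest term of the equation is a
  nonzero multiple of \<open>s (s - 1) ... (s - n + 1)\<close>, with \<open>s\<close> the order of
  \<open>F\<close>. So a solution has no pole there, and it vanishes if its coefficients of index
  \<open>0\<close> to \<open>n - 1\<close> do.\<close>

lemma fls_ode_subdegree:
  fixes F :: "'a :: {idom, ring_char_0} fls"
  assumes "(\<Sum>i\<le>n. fps_to_fls (P i) * (fls_deriv ^^ i) F) = 0" "fps_nth (P n) 0 \<noteq> 0" "F \<noteq> 0"
  shows "0 \<le> fls_subdegree F \<and> fls_subdegree F < int n"
proof -
  define s where "s = fls_subdegree F"
  have low: "F $$ k = 0" if "k < s" for k using that by (simp add: s_def)
  note d = fls_funpow_deriv_nth_bounds[of s F, OF low]
  have zero: "(fps_to_fls (P i) * (fls_deriv ^^ i) F) $$ (s - int n) = 0" if "i < n" for i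
    by (rule fls_mult_nth_bounds(2)[where a = 0 and b = "s - int i"]) (use d[of i] that in auto)
  have top: "(fps_to_fls (P n) * (fls_deriv ^^ n) F) $$ (s - int n) = fps_nth (P n) 0 * ((\<Prod>j<n. of_int (s - int j)) * F $$ s)"
    using fls_mult_nth_bounds(1)[where a = 0 and F = "fps_to_fls (P n)" and b = "s - int n" and G = "(fls_deriv ^^ n) F"] d[of n]
    by simp
  have "0 = (\<Sum>i\<le>n. fps_to_fls (P i) * (fls_deriv ^^ i) F) $$ (s - int n)" by (simp add: assms)
  also have "\<dots> = (\<Sum>i\<le>n. (fps_to_fls (P i) * (fls_deriv ^^ i) F) $$ (s - int n))" by (rule fls_nth_sum)
  also have "\<dots> = fps_nth (P n) 0 * ((\<Prod>j<n. of_int (s - int j)) * F $$ s)"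
    using zero top by (simp add: lessThan_Suc_atMost[symmetric])
  finally have "(\<Prod>j<n. of_int (s - int j) :: 'a) = 0" using assms by (simp add: s_def)
  then obtain j where "j < n" "of_int (s - int j) = (0 :: 'a)" by (subst (asm) prod_zero_iff) auto
  then have "j < n" "s = int j" by (simp_all only: of_int_eq_0_iff right_minus_eq)
  then show ?thesis by (simp add: s_def)
qed

lemma deriv_translate: "deriv (\<lambda>w. f (z + w)) = (\<lambda>w. deriv f (z + w))"
  using DERIV_shift[of f _ _ z] by (simp add: fun_eq_iff deriv_def add.commute)

lemma funpow_deriv_translate: "(deriv ^^ i) (\<lambda>w. f (z + w)) = (\<lambda>w. (deriv ^^ i) f (z + w))"
  by (induction i) (auto simp: deriv_translate)

lemma has_laurent_expansion_funpow_deriv: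
  assumes "(\<lambda>w. f (z + w)) has_laurent_expansion F"
  shows "(\<lambda>w. (deriv ^^ i) f (z + w)) has_laurent_expansion (fls_deriv ^^ i) F"
proof -
  have "(deriv ^^ i) (\<lambda>w. f (z + w)) has_laurent_expansion (fls_deriv ^^ i) F"
    by (induction i) (auto intro: assms has_laurent_expansion_deriv)
  then show ?thesis by (simp add: funpow_deriv_translate)
qed

lemma exp_poly_has_fps_expansion:
  "(\<lambda>w. poly u (exp (z + w))) has_fps_expansion fps_expansion (\<lambda>p. poly u (exp p)) z"
  by (rule analytic_at_imp_has_fps_expansion) (unfold poly_altdef, intro analytic_intros)

lemma fps_expansion_exp_poly_0: "fps_nth (fps_expansion (\<lambda>p. poly u (exp p)) z) 0 = poly u (exp z)"
  by (simp add: fps_expansion_def)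

lemma ode_laurent:
  assumes "(\<lambda>w. f (z + w)) has_laurent_expansion F"
    and "eventually (\<lambda>x. (\<Sum>i\<le>n. poly (p i) (exp x) * (deriv ^^ i) f x) = 0) (at z)"
  shows "(\<Sum>i\<le>n. fps_to_fls (fps_expansion (\<lambda>x. poly (p i) (exp x)) z) * (fls_deriv ^^ i) F) = 0"
proof -
  have "(\<lambda>w. \<Sum>i\<le>n. poly (p i) (exp (z + w)) * (deriv ^^ i) f (z + w)) has_laurent_expansion
     (\<Sum>i\<le>n. fps_to_fls (fps_expansion (\<lambda>x. poly (p i) (exp x)) z) * (fls_deriv ^^ i) F)"
    by (intro has_laurent_expansion_sum has_laurent_expansion_mult has_laurent_expansion_fps
        exp_poly_has_fps_expansion has_laurent_expansion_funpow_deriv assms)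
  then show ?thesis using assms(2)
    by (simp add: has_laurent_expansion_eventually_zero_iff[of "\<lambda>x. \<Sum>i\<le>n. poly (p i) (exp x) * (deriv ^^ i) f x"])
qed

lemma meromorphic_identity:
  assumes "f meromorphic_on A" "open A" "connected A" "z \<in> A" "eventually (\<lambda>x. f x = 0) (at z)"
  shows "eventually (\<lambda>x. f x = 0) (cosparse A)"
proof -
  have "\<not> eventually (\<lambda>x. f x \<noteq> 0) (cosparse A)"
  proof
    assume "eventually (\<lambda>x. f x \<noteq> 0) (cosparse A)"
    then have "eventually (\<lambda>x. f x \<noteq> 0) (at z)" using assms by (simp add: eventually_cosparse_open_eq)
    with assms(5) have "eventually (\<lambda>x. False) (at z)" by eventually_elim simp
    then show False by simp
  qed
  then show ?thesis using meromorphic_imp_constant_or_avoid[OF assms(1-3), of 0] by blast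
qed

lemma almost_zero_iff_eventually:
  "f \<in> almost_zero \<longleftrightarrow> (\<forall>z. eventually (\<lambda>x. f x = 0) (at z))"
  by (simp add: almost_zero_def hat_eq_iff)

text \<open>A linear equation of order \<open>n\<close> has at most \<open>n\<close> independent solutions: at a regular point a
  solution is determined by its first \<open>n\<close> Taylor coefficients.\<close>

lemma ode_solutions_dependent:
  assumes "\<And>k. k \<le> n \<Longrightarrow> f k \<in> meromorphic" "p n \<noteq> 0"
    and "\<And>k. k \<le> n \<Longrightarrow> (\<lambda>x. \<Sum>i\<le>n. poly (p i) (exp x) * (deriv ^^ i) (f k) x) \<in> almost_zero"
  shows "\<exists>\<gamma>. (\<exists>k\<le>n. \<gamma> k \<noteq> 0) \<and> (\<lambda>x. \<Sum>k\<le>n. \<gamma> k * f k x) \<in> almost_zero"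
proof -
  have "eventually (\<lambda>z. poly (p n) (exp z) \<noteq> 0) (at (0::complex))"
    using eventually_poly_exp_nonzero[OF assms(2)] by (simp add: eventually_cosparse_open_eq)
  then obtain z :: complex where z: "poly (p n) (exp z) \<noteq> 0"
    using eventually_happens'[of "at (0::complex)"] by auto
  define F where "F = (\<lambda>k. laurent_expansion (f k) z)"
  have F: "(\<lambda>w. f k (z + w)) has_laurent_expansion F k" if "k \<le> n" for k
    unfolding F_def by (rule meromorphic_on_imp_has_laurent_expansion[of _ UNIV]) (use assms(1)[OF that] in auto)
  define P where "P = (\<lambda>i. fps_expansion (\<lambda>x. poly (p i) (exp x)) z)"
  have ode: "(\<Sum>i\<le>n. fps_to_fls (P i) * (fls_deriv ^^ i) (F k)) = 0" if "k \<le> n" for k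
    unfolding P_def by (rule ode_laurent[OF F[OF that]]) (use assms(3)[OF that] in \<open>simp add: almost_zero_iff_eventually\<close>)
  have P0: "fps_nth (P n) 0 \<noteq> 0" using z by (simp add: P_def fps_expansion_exp_poly_0)
  \<comment> \<open>There are \<open>n + 1\<close> functions and \<open>n\<close> conditions, so
    some combination has zero coefficients of index \<open>0\<close> to
    \<open>n - 1\<close>.\<close>
  obtain \<gamma> where \<gamma>: "\<exists>k\<in>{..n}. \<gamma> k \<noteq> 0" "\<forall>i\<in>{..<n}. (\<Sum>k\<in>{..n}. \<gamma> k * F k $$ int i) = 0"
    using idom_linear_dependence[of "{..<n}" "{..n}" "\<lambda>k i. F k $$ int i"] by auto
  define G where "G = (\<Sum>k\<le>n. fls_const (\<gamma> k) * F k)"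
  have dG: "(fls_deriv ^^ i) G = (\<Sum>k\<le>n. fls_const (\<gamma> k) * (fls_deriv ^^ i) (F k))" for i
    by (induction i) (auto simp: G_def fls_deriv_sum)
  have "(\<Sum>i\<le>n. fps_to_fls (P i) * (fls_deriv ^^ i) G) = (\<Sum>k\<le>n. fls_const (\<gamma> k) * (\<Sum>i\<le>n. fps_to_fls (P i) * (fls_deriv ^^ i) (F k)))"
    unfolding dG sum_distrib_left by (subst sum.swap) (simp add: mult_ac)
  also have "\<dots> = 0" by (intro sum.neutral) (use ode in auto)
  finally have odeG: "(\<Sum>i\<le>n. fps_to_fls (P i) * (fls_deriv ^^ i) G) = 0" .
  have "G = 0"
  proof (rule ccontr)
    assume G0: "G \<noteq> 0"
    from fls_ode_subdegree[OF odeG P0 this] obtain i where i: "i < n" "fls_subdegree G = int i"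
      by (metis nonneg_int_cases of_nat_less_iff)
    have "G $$ int i = (\<Sum>k\<in>{..n}. \<gamma> k * F k $$ int i)" by (simp add: G_def fls_nth_sum)
    then have "G $$ fls_subdegree G = 0" using \<gamma>(2) i by simp
    then show False using G0 by simp
  qed
  moreover have "(\<lambda>w. \<Sum>k\<le>n. \<gamma> k * f k (z + w)) has_laurent_expansion G"
    unfolding G_def by (intro has_laurent_expansion_sum has_laurent_expansion_mult has_laurent_expansion_const F) auto
  ultimately have "eventually (\<lambda>x. (\<Sum>k\<le>n. \<gamma> k * f k x) = 0) (at z)"
    by (simp add: has_laurent_expansion_eventually_zero_iff[of "\<lambda>x. \<Sum>k\<le>n. \<gamma> k * f k x"])
  moreover have "(\<lambda>x. \<Sum>k\<le>n. \<gamma> k * f k x) meromorphic_on UNIV"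
    using assms(1) by (auto intro!: meromorphic_intros)
  ultimately have "(\<lambda>x. \<Sum>k\<le>n. \<gamma> k * f k x) \<in> almost_zero"
    using meromorphic_identity[of _ UNIV z] by (auto simp: almost_zero_def hat_eq_def)
  then show ?thesis using \<gamma>(1) by (intro exI[of _ \<gamma>]) auto
qed

lemma entire_almost_zero:
  assumes "f holomorphic_on UNIV" "f \<in> almost_zero"
  shows "f z = 0"
proof -
  have "isCont f z" using assms(1) by (meson UNIV_I continuous_on_eq_continuous_at holomorphic_on_imp_continuous_on open_UNIV)
  then have "(f \<longlongrightarrow> f z) (at z)" by (simp add: isCont_def)
  moreover have "(f \<longlongrightarrow> 0) (at z)"
    by (rule tendsto_eventually) (use assms(2) in \<open>simp add: almost_zero_iff_eventually\<close>)
  ultimately show ?thesis by (rule tendsto_unique[rotated]) simp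
qed

lemma hat_eq_period_int:
  assumes "hat_eq (\<lambda>p. g (p + period)) g"
  shows "hat_eq (\<lambda>p. g (p + of_int m * period)) g"
proof -
  have nat: "hat_eq (\<lambda>p. g (p + of_nat k * period)) g" for k
  proof (induction k)
    case (Suc k)
    have "hat_eq (\<lambda>p. g ((p + of_nat k * period) + period)) (\<lambda>p. g (p + of_nat k * period))"
      using hat_eq_affine[OF assms, of 1 "of_nat k * period"] by simp
    then show ?case using hat_eq_trans[OF _ Suc] by (simp add: algebra_simps)
  qed simp
  show ?thesis
  proof (cases "m \<ge> 0")
    case True
    then show ?thesis using nat[of "nat m"] by simp
  next
    case False
    then have "hat_eq g (\<lambda>p. g (p + of_int m * period))"
      using hat_eq_affine[OF nat[of "nat (- m)"], of 1 "of_int m * period"] by simp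
    then show ?thesis by (rule hat_eq_sym)
  qed
qed

text \<open>Poles lie only over zeros of the leading coefficient. By periodicity the pole order at
  \<open>z\<close> depends only on \<open>exp z\<close>, so the finitely many points
  \<open>Ln r\<close> account for all of them, and a power of the leading coefficient cancels the
  poles.\<close>

lemma clear_poles:
  assumes g: "g \<in> meromorphic" and per: "hat_eq (\<lambda>p. g (p + period)) g"
    and p: "p n \<noteq> 0" "(\<lambda>x. \<Sum>i\<le>n. poly (p i) (exp x) * (deriv ^^ i) g x) \<in> almost_zero"
  shows "\<exists>K H. entire_periodic H \<and> hat_eq H (\<lambda>x. poly (p n ^ K) (exp x) * g x)"
proof -
  define E where "E = (\<lambda>z. laurent_expansion g z)"
  have E: "(\<lambda>w. g (z + w)) has_laurent_expansion E z" for z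
    unfolding E_def by (rule meromorphic_on_imp_has_laurent_expansion[of _ UNIV]) (use g in auto)
  define R where "R = {r. poly (p n) r = 0}"
  have R: "finite R" using p(1) by (simp add: R_def poly_roots_finite)
  \<comment> \<open>A common bound for the pole orders: the sum over the roots dominates each
    summand.\<close>
  define K where "K = (\<Sum>r\<in>R. nat (- fls_subdegree (E (Ln r))))"
  define \<Phi> where "\<Phi> = (\<lambda>x. poly (p n ^ K) (exp x) * g x)"
  have lim: "\<exists>c. \<Phi> \<midarrow>z\<rightarrow> c" for z
  proof -
    define P where "P = fps_expansion (\<lambda>x. poly (p n) (exp x)) z"
    have P: "(\<lambda>w. poly (p n) (exp (z + w))) has_fps_expansion P"
      unfolding P_def by (rule exp_poly_has_fps_expansion)
    have exp\<Phi>: "(\<lambda>w. \<Phi> (z + w)) has_laurent_expansion fps_to_fls (P ^ K) * E z"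
      unfolding \<Phi>_def poly_power fps_to_fls_power
      by (intro has_laurent_expansion_mult has_laurent_expansion_power has_laurent_expansion_fps P E)
    have "fls_subdegree (fps_to_fls (P ^ K) * E z) \<ge> 0"
    proof (cases "poly (p n) (exp z) = 0")
      case False
      have "fps_nth P 0 \<noteq> 0" using False by (simp add: P_def fps_expansion_exp_poly_0)
      moreover have "(\<Sum>i\<le>n. fps_to_fls (fps_expansion (\<lambda>x. poly (p i) (exp x)) z) * (fls_deriv ^^ i) (E z)) = 0"
        by (rule ode_laurent[OF E]) (use p(2) in \<open>simp add: almost_zero_iff_eventually\<close>)
      ultimately have "fls_subdegree (E z) \<ge> 0"
        using fls_ode_subdegree[where n = n and P = "\<lambda>i. fps_expansion (\<lambda>x. poly (p i) (exp x)) z" and F = "E z"]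
        by (cases "E z = 0") (auto simp: P_def)
      then have low: "E z $$ k = 0" if "k < 0" for k using that by simp
      show ?thesis
      proof (cases "fps_to_fls (P ^ K) * E z = 0")
        case nz: False
        then show ?thesis
          by (rule fls_subdegree_geI) (use fls_mult_nth_bounds(2)[where a = 0 and F = "fps_to_fls (P ^ K)" and b = 0 and G = "E z"] low in auto)
      qed (metis fls_zero_subdegree order_refl)
    next
      case True
      then have r: "exp z \<in> R" by (simp add: R_def)
      define r where "r = exp z"
      have "exp z = exp (Ln r)" by (simp add: r_def)
      then obtain m :: int where "z = Ln r + of_real (of_int (2 * m) * pi) * \<i>" unfolding exp_eq by blast
      then have m: "z = Ln r + of_int m * period" by simp
      \<comment> \<open>The points \<open>z\<close> and \<open>Ln r\<close> differ by a multiple of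
        the period, so the Laurent expansions there coincide.\<close>
      have "eventually (\<lambda>x. g (x + of_int m * period) = g x) (at (Ln r))"
        using hat_eq_period_int[OF per, of m] by (simp add: hat_eq_iff)
      then have "eventually (\<lambda>w. g (z + w) = g (Ln r + w)) (at 0)"
        unfolding at_to_0[of "Ln r"] eventually_filtermap m by (simp add: algebra_simps)
      then have "(\<lambda>w. g (z + w)) has_laurent_expansion E (Ln r) \<longleftrightarrow>
          (\<lambda>w. g (Ln r + w)) has_laurent_expansion E (Ln r)"
        by (rule has_laurent_expansion_cong) simp
      then have "(\<lambda>w. g (z + w)) has_laurent_expansion E (Ln r)" using E by blast
      then have Eeq: "E z = E (Ln r)" using E[of z] has_laurent_expansion_unique by blast
      have "nat (- fls_subdegree (E (Ln r))) \<le> K"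
        unfolding K_def by (rule member_le_sum[OF _ _ R]) (use r in \<open>auto simp: r_def\<close>)
      then have low: "E z $$ k = 0" if "k < - int K" for k using that by (simp add: Eeq)
      have "fps_nth P 0 = 0" using True by (simp add: P_def fps_expansion_exp_poly_0)
      then have "fps_nth (P ^ K) k = 0" if "k < K" for k
        using startsby_zero_power_prefix[of P K] that by simp
      then have lowP: "fps_to_fls (P ^ K) $$ k = 0" if "k < int K" for k using that by auto
      show ?thesis
      proof (cases "fps_to_fls (P ^ K) * E z = 0")
        case nz: False
        then show ?thesis
          by (rule fls_subdegree_geI)
             (use fls_mult_nth_bounds(2)[where a = "int K" and F = "fps_to_fls (P ^ K)" and b = "- int K" and G = "E z"] low lowP in auto)
      qed (metis fls_zero_subdegree order_refl)
    qed
    from has_laurent_expansion_imp_tendsto[OF exp\<Phi> this] show ?thesis by blast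
  qed
  have \<Phi>m: "\<Phi> meromorphic_on UNIV"
    unfolding \<Phi>_def using g by (auto intro!: meromorphic_intros meromorphic_exp_poly)
  define H where "H = remove_sings \<Phi>"
  have "H analytic_on {z}" for z
  proof -
    obtain c where "\<Phi> \<midarrow>z\<rightarrow> c" using lim by blast
    then show ?thesis unfolding H_def
      by (intro remove_sings_analytic_at[of _ _ c] meromorphic_on_isolated_singularity)
         (use \<Phi>m meromorphic_on_subset in blast)+
  qed
  then have Hh: "H holomorphic_on UNIV"
    by (meson analytic_imp_holomorphic analytic_on_analytic_at)
  have H\<Phi>: "hat_eq H \<Phi>"
    using eventually_remove_sings_eq[OF \<Phi>m] by (simp add: H_def hat_eq_def)
  have "hat_eq (\<lambda>x. \<Phi> (x + period)) \<Phi>"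
  proof (rule hat_eqI_eventually)
    show "eventually (\<lambda>x. g (x + period) = g x) (cosparse UNIV)" using per by (simp add: hat_eq_def)
    show "\<Phi> (x + period) = \<Phi> x" if "g (x + period) = g x" for x
      using that exp_period[of x] by (simp add: \<Phi>_def)
  qed
  then have "hat_eq (\<lambda>x. H (x + period)) H"
    using hat_eq_affine[OF H\<Phi>, of 1 period] hat_eq_trans[OF _ hat_eq_sym[OF H\<Phi>]]
      hat_eq_trans[of "\<lambda>x. H (x + period)" "\<lambda>x. \<Phi> (x + period)" \<Phi>] by simp
  then have "(\<lambda>x. H (x + period) - H x) \<in> almost_zero" by (simp add: diff_almost_zero_iff)
  moreover have "(\<lambda>x. H (x + period) - H x) holomorphic_on UNIV"
  proof -
    have "H \<circ> (\<lambda>x. x + period) holomorphic_on UNIV"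
      using Hh by (intro holomorphic_on_compose_gen[of _ _ H UNIV]) (auto intro!: holomorphic_intros)
    then show ?thesis using Hh by (auto simp: o_def intro!: holomorphic_intros)
  qed
  ultimately have "H (x + period) - H x = 0" for x by (rule entire_almost_zero[rotated])
  then have "entire_periodic H" using Hh by (simp add: entire_periodic_def)
  then show ?thesis using H\<Phi> unfolding \<Phi>_def by blast
qed

text \<open>The reciprocal polynomial. It serves the reflection \<open>p \<mapsto> -p\<close>, which
  exchanges \<open>x = 0\<close> and \<open>x = \<infinity>\<close>.\<close>

lemma reverse_poly:
  fixes P :: "complex poly"
  assumes "degree P \<le> N"
  obtains P' where "P \<noteq> 0 \<Longrightarrow> P' \<noteq> 0" "\<And>x. poly P' (exp x) = poly P (exp (- x)) * exp x ^ N"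
proof
  define P' where "P' = (\<Sum>i\<le>N. monom (coeff P i) (N - i))"
  show "P' \<noteq> 0" if "P \<noteq> 0"
  proof -
    have "coeff P' (N - degree P) = (\<Sum>i\<le>N. if i = degree P then coeff P i else 0)"
      unfolding P'_def coeff_sum by (rule sum.cong) (use assms in auto)
    then show ?thesis using that assms by auto
  qed
  fix x :: complex
  have "poly P (exp (- x)) = (\<Sum>i\<le>N. coeff P i * exp (- x) ^ i)" by (rule poly_as_sum_le[OF assms])
  moreover have "exp (- x) ^ i * exp x ^ N = exp x ^ (N - i)" if "i \<le> N" for i
    using that by (simp add: exp_minus power_diff field_simps)
  ultimately show "poly P' (exp x) = poly P (exp (- x)) * exp x ^ N"
    by (simp add: P'_def poly_sum poly_monom sum_distrib_right mult.assoc)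
qed

lemma reverse_polys:
  fixes p :: "nat \<Rightarrow> complex poly"
  shows "\<exists>N p'. \<forall>j\<in>{..n}. (p j \<noteq> 0 \<longrightarrow> p' j \<noteq> 0) \<and>
    (\<forall>x. poly (p' j) (exp x) = poly (p j) (exp (- x)) * exp x ^ N)"
proof -
  obtain N where N: "\<And>j. j \<le> n \<Longrightarrow> degree (p j) \<le> N" using degree_bound_exists by blast
  have "\<forall>j\<in>{..n}. \<exists>P'. (p j \<noteq> 0 \<longrightarrow> P' \<noteq> 0) \<and> (\<forall>x. poly P' (exp x) = poly (p j) (exp (- x)) * exp x ^ N)"
    using reverse_poly[OF N] by (metis atMost_iff)
  from bchoice[OF this] show ?thesis by blast
qed

lemma funpow_deriv_reflect:
  assumes "H holomorphic_on UNIV"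
  shows "(deriv ^^ j) (\<lambda>x. H (- x)) = (\<lambda>x. (- 1) ^ j * (deriv ^^ j) H (- x))"
proof (induction j)
  case (Suc j)
  have "((deriv ^^ j) H has_field_derivative (deriv ^^ Suc j) H (- x)) (at (- x))" for x
    using holomorphic_derivI[OF holomorphic_higher_deriv[OF assms open_UNIV, of j] open_UNIV] by simp
  then have "((\<lambda>x. (- 1) ^ j * (deriv ^^ j) H (- x)) has_field_derivative (- 1) ^ j * ((deriv ^^ Suc j) H (- x) * (- 1))) (at x)" for x
    by (intro DERIV_cmult DERIV_chain2[of _ _ uminus]) (auto intro!: derivative_eq_intros)
  then have "deriv (\<lambda>x. (- 1) ^ j * (deriv ^^ j) H (- x)) = (\<lambda>x. (- 1) ^ j * ((deriv ^^ Suc j) H (- x) * (- 1)))"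
    using DERIV_imp_deriv by (metis (no_types, lifting))
  moreover have "(deriv ^^ Suc j) (\<lambda>x. H (- x)) = deriv (\<lambda>x. (- 1) ^ j * (deriv ^^ j) H (- x))"
    by (simp add: Suc)
  ultimately show ?case by simp
qed simp

lemma funpow_hat_sigma:
  "(hat_sigma (CaseQ q l) ^^ j) f = (\<lambda>x. f (x + of_nat j * l))"
  "(hat_sigma (CaseM b) ^^ j) f = (\<lambda>x. f (of_nat (b ^ j) * x))"
  by (induction j) (auto simp: fun_eq_iff algebra_simps)

text \<open>The coefficients of negative index are those of the reflected function \<open>G\<close>,
  which satisfies equations of the same kind: for dilations \<open>q\<close> and \<open>l\<close>
  become \<open>1 / q\<close> and \<open>- l\<close>, while the Mahler operator is
  unchanged.\<close>

lemma fourier_vanish: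
  assumes c: "admissible c" and H: "entire_periodic H"
    and p: "p n \<noteq> 0" "\<And>x. (\<Sum>j\<le>n. poly (p j) (exp x) * (deriv ^^ j) H x) = 0"
    and r: "r m \<noteq> 0" "\<And>x. (\<Sum>j\<le>m. poly (r j) (exp x) * (hat_sigma c ^^ j) H x) = 0"
  shows "\<exists>N. \<forall>k. \<bar>k\<bar> > int N \<longrightarrow> fourier H k = 0"
proof -
  define G where "G = (\<lambda>x. H (- x))"
  have G: "entire_periodic G" using entire_periodic_affine[OF H, of "-1" 0] by (simp add: G_def)
  have Hh: "H holomorphic_on UNIV" using H by (simp add: entire_periodic_def)
  obtain N p' where "\<forall>j\<in>{..n}. (p j \<noteq> 0 \<longrightarrow> p' j \<noteq> 0) \<and>
      (\<forall>x. poly (p' j) (exp x) = poly (p j) (exp (- x)) * exp x ^ N)"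
    using reverse_polys[of n p] by blast
  then have p': "\<And>j. j \<le> n \<Longrightarrow> p j \<noteq> 0 \<Longrightarrow> p' j \<noteq> 0"
    "\<And>j x. j \<le> n \<Longrightarrow> poly (p' j) (exp x) = poly (p j) (exp (- x)) * exp x ^ N" by auto
  obtain M r' where "\<forall>j\<in>{..m}. (r j \<noteq> 0 \<longrightarrow> r' j \<noteq> 0) \<and>
      (\<forall>x. poly (r' j) (exp x) = poly (r j) (exp (- x)) * exp x ^ M)"
    using reverse_polys[of m r] by blast
  then have r': "\<And>j. j \<le> m \<Longrightarrow> r j \<noteq> 0 \<Longrightarrow> r' j \<noteq> 0"
    "\<And>j x. j \<le> m \<Longrightarrow> poly (r' j) (exp x) = poly (r j) (exp (- x)) * exp x ^ M" by auto
  define p'' where "p'' = (\<lambda>j. smult ((- 1) ^ j) (p' j))"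
  have p''n: "p'' n \<noteq> 0" using p'(1) p(1) by (simp add: p''_def)
  have odeG: "(\<Sum>j\<le>n. poly (p'' j) (exp x) * (deriv ^^ j) G x) = 0" for x
  proof -
    have "poly (p'' j) (exp x) * (deriv ^^ j) G x = exp x ^ N * (poly (p j) (exp (- x)) * (deriv ^^ j) H (- x))" if "j \<le> n" for j
    proof -
      have "(- 1) ^ j * ((- 1) ^ j * y) = (y :: complex)" for y by (simp flip: mult.assoc power_mult_distrib)
      then show ?thesis using p'(2)[OF that] by (simp add: p''_def G_def funpow_deriv_reflect[OF Hh] mult_ac)
    qed
    then have "(\<Sum>j\<le>n. poly (p'' j) (exp x) * (deriv ^^ j) G x) = exp x ^ N * (\<Sum>j\<le>n. poly (p j) (exp (- x)) * (deriv ^^ j) H (- x))"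
      by (simp add: sum_distrib_left)
    then show ?thesis using p(2)[of "- x"] by simp
  qed
  have "(\<exists>K. \<forall>k>K. fourier H (int k) = 0) \<and> (\<exists>K. \<forall>k>K. fourier G (int k) = 0)"
  proof (cases c)
    case (CaseQ q l)
    then have q: "q \<noteq> 0" "\<And>k. k > 0 \<Longrightarrow> q ^ k \<noteq> 1" "exp l = q" using c by auto
    interpret q: not_root_of_unity q by standard (use q in auto)
    interpret q': not_root_of_unity "1 / q" by standard (use q in \<open>auto simp: power_divide\<close>)
    have relG: "(\<Sum>j\<le>m. poly (r' j) (exp x) * G (x + of_nat j * (- l))) = 0" for x
    proof -
      have "(\<Sum>j\<le>m. poly (r' j) (exp x) * G (x + of_nat j * (- l))) = exp x ^ M * (\<Sum>j\<le>m. poly (r j) (exp (- x)) * H (- x + of_nat j * l))"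
        unfolding sum_distrib_left by (rule sum.cong) (auto simp: r'(2) G_def algebra_simps)
      then show ?thesis using r(2)[of "- x"] by (simp add: CaseQ funpow_hat_sigma)
    qed
    have "\<exists>K. \<forall>k>K. fourier H (int k) = 0"
      by (rule q.fourier_vanish_dilation[where j = n and n = n and p = p and i = m and m = m and r = r and l = l])
         (use H q p r in \<open>auto simp: CaseQ funpow_hat_sigma\<close>)
    moreover have "\<exists>K. \<forall>k>K. fourier G (int k) = 0"
      by (rule q'.fourier_vanish_dilation[where j = n and n = n and p = p'' and i = m and m = m and r = r' and l = "- l"])
         (use G q p''n r'(1) r(1) odeG relG in \<open>auto simp: exp_minus field_simps\<close>)
    ultimately show ?thesis by blast
  next
    case (CaseM b)
    then have b: "b \<ge> 2" using c by simp
    have relG: "(\<Sum>j\<le>m. poly (r' j) (exp x) * G (of_nat (b ^ j) * x)) = 0" for x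
    proof -
      have "(\<Sum>j\<le>m. poly (r' j) (exp x) * G (of_nat (b ^ j) * x)) = exp x ^ M * (\<Sum>j\<le>m. poly (r j) (exp (- x)) * H (of_nat (b ^ j) * (- x)))"
        unfolding sum_distrib_left by (rule sum.cong) (auto simp: r'(2) G_def algebra_simps)
      then show ?thesis using r(2)[of "- x"] by (simp only: CaseM funpow_hat_sigma) simp
    qed
    have "\<exists>K. \<forall>k>K. fourier H (int k) = 0"
      by (rule fourier_vanish_mahler[OF H b, of r m]) (use r in \<open>simp_all only: CaseM funpow_hat_sigma not_False_eq_True\<close>)
    moreover have "\<exists>K. \<forall>k>K. fourier G (int k) = 0"
      by (rule fourier_vanish_mahler[OF G b, of r' m]) (use r'(1) r(1) relG in auto)
    ultimately show ?thesis by blast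
  qed
  then obtain K K' where K: "\<And>k. k > K \<Longrightarrow> fourier H (int k) = 0" "\<And>k. k > K' \<Longrightarrow> fourier G (int k) = 0" by blast
  have "fourier H k = 0" if "\<bar>k\<bar> > int (max K K')" for k
  proof (cases "k \<ge> 0")
    case True
    then show ?thesis using K(1)[of "nat k"] that by simp
  next
    case False
    then show ?thesis using K(2)[of "nat (- k)"] that fourier_reflect[OF H, of "- k"] by (simp add: G_def)
  qed
  then show ?thesis by blast
qed

theorem periodic_bifinite_rational:
  assumes c: "admissible c" and g: "g \<in> meromorphic" and per: "hat_eq (\<lambda>p. g (p + period)) g"
    and D: "hat_D.has_relation g"
    and S: "skew_operator.has_relation exp almost_zero (hat_sigma c) g"
  shows "\<exists>u v. v \<noteq> 0 \<and> hat_eq g (\<lambda>p. poly u (exp p) / poly v (exp p))"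
proof -
  interpret S: skew_operator exp almost_zero meromorphic "hat_sigma c" "sigma_poly c" "\<lambda>_. 0"
    by (rule hat_sigma_skew_operator[OF c])
  obtain n p where p: "p n \<noteq> 0" "(\<lambda>x. \<Sum>i\<le>n. poly (p i) (exp x) * (deriv ^^ i) g x) \<in> almost_zero"
    using D unfolding hat_D.has_relation_def by blast
  obtain K H where H: "entire_periodic H" "hat_eq H (\<lambda>x. poly (p n ^ K) (exp x) * g x)"
    using clear_poles[of g p n, OF g per p] by blast
  have Hh: "H holomorphic_on UNIV" using H by (simp add: entire_periodic_def)
  then have Hm: "H \<in> meromorphic"
    by (simp add: analytic_on_imp_meromorphic_on analytic_on_open)
  have H\<Phi>: "(\<lambda>x. H x - poly (p n ^ K) (exp x) * g x) \<in> almost_zero"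
    using H(2) by (simp add: diff_almost_zero_iff)
  have "hat_D.has_relation H"
    by (rule hat_D.has_relation_cong[OF hat_D.has_relation_scale[OF D g] hat_D.C_scale[OF g] Hm H\<Phi>])
  then obtain n' p' where p': "p' n' \<noteq> 0" "(\<lambda>x. \<Sum>i\<le>n'. poly (p' i) (exp x) * (deriv ^^ i) H x) \<in> almost_zero"
    unfolding hat_D.has_relation_def by blast
  have "S.has_relation H"
    by (rule S.has_relation_cong[OF S.has_relation_scale[OF S g] S.C_scale[OF g] Hm H\<Phi>])
  then obtain m r where r: "r m \<noteq> 0" "(\<lambda>x. \<Sum>i\<le>m. poly (r i) (exp x) * (hat_sigma c ^^ i) H x) \<in> almost_zero"
    unfolding S.has_relation_def by blast
  have poly_h: "(\<lambda>x. poly u (exp x)) holomorphic_on UNIV" for u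
    unfolding poly_altdef by (intro holomorphic_intros)
  \<comment> \<open>The left-hand sides are entire, so relations that hold off isolated points hold
    everywhere.\<close>
  have ode: "(\<Sum>i\<le>n'. poly (p' i) (exp x) * (deriv ^^ i) H x) = 0" for x
    by (rule entire_almost_zero[OF _ p'(2)]) (intro holomorphic_intros poly_h holomorphic_higher_deriv Hh open_UNIV)
  have sh: "(hat_sigma c ^^ i) H holomorphic_on UNIV" for i
  proof (induction i)
    case (Suc i)
    have "(hat_sigma c ^^ i) H \<circ> (\<lambda>x. slope c * x + offset c) holomorphic_on UNIV"
      using Suc by (intro holomorphic_on_compose_gen[of _ _ _ UNIV]) (auto intro!: holomorphic_intros)
    then show ?case by (simp add: hat_sigma_affine[of c "(hat_sigma c ^^ i) H"] o_def)
  qed (simp add: Hh)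
  have rel: "(\<Sum>i\<le>m. poly (r i) (exp x) * (hat_sigma c ^^ i) H x) = 0" for x
    by (rule entire_almost_zero[OF _ r(2)]) (intro holomorphic_intros poly_h sh)
  obtain N where "\<And>k. \<bar>k\<bar> > int N \<Longrightarrow> fourier H k = 0"
    using fourier_vanish[where p = p' and n = n' and r = r and m = m, OF c H(1) p'(1) ode r(1) rel] by blast
  from entire_periodic_laurent_polynomial[OF H(1) this] obtain u where u: "\<And>x. H x = poly u (exp x) / exp x ^ N" by blast
  define v where "v = p n ^ K * monom 1 N"
  have v: "v \<noteq> 0" using p(1) by (simp add: v_def monom_eq_0_iff)
  have "hat_eq g (\<lambda>x. poly u (exp x) / poly v (exp x))"
  proof (rule hat_eqI_eventually)
    show "eventually (\<lambda>x. H x = poly (p n ^ K) (exp x) * g x \<and> poly v (exp x) \<noteq> 0) (cosparse UNIV)"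
      using H(2) v by (intro eventually_conj eventually_poly_exp_nonzero) (auto simp: hat_eq_def)
    show "g x = poly u (exp x) / poly v (exp x)" if "H x = poly (p n ^ K) (exp x) * g x \<and> poly v (exp x) \<noteq> 0" for x
      using that u[of x] by (auto simp: v_def poly_monom field_simps)
  qed
  then show ?thesis using v by blast
qed

section \<open>Powers and logarithms\<close>

lemma hat_ratfuns_zero: "(\<lambda>_. 0) \<in> hat_ratfuns"
  unfolding hat_ratfuns_def by (rule CollectI, rule exI[of _ 0], rule exI[of _ 1]) simp

lemma hat_ratfunsI: "v \<noteq> 0 \<Longrightarrow> (\<lambda>p. poly u (exp p) / poly v (exp p)) \<in> hat_ratfuns"
  unfolding hat_ratfuns_def hat_x_def by blast

lemma hat_ratfuns_meromorphic: "r \<in> hat_ratfuns \<Longrightarrow> r meromorphic_on UNIV"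
  unfolding hat_ratfuns_def hat_x_def by (auto intro!: meromorphic_intros meromorphic_exp_poly)

lemma power_log_form_cong:
  assumes "power_log_form c f" "hat_eq g f"
  shows "power_log_form c g"
  using assms(1) hat_eq_trans[OF assms(2)] unfolding power_log_form_def by blast

lemma power_log_form_zero: "power_log_form c (\<lambda>_. 0)"
  unfolding power_log_form_def by (intro exI[of _ 0] exI[of _ "\<lambda>_. 0"] exI[of _ "\<lambda>_ _ _. 0"]) simp

lemma power_log_form_term:
  assumes "\<alpha> \<in> exponents c" "r \<in> hat_ratfuns"
  shows "power_log_form c (\<lambda>p. r p * exp (\<alpha> * p) * p ^ j)"
  unfolding power_log_form_def
proof (intro exI conjI ballI)
  \<comment> \<open>One number \<open>t\<close> bounds both the terms and the powers of the
    logarithm, so a single term is padded with zeros up to \<open>t = Suc j\<close>.\<close>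
  let ?r = "\<lambda>i j'. if i = 1 \<and> j' = j then r else (\<lambda>_. 0)"
  show "\<alpha> \<in> exponents c" by fact
  show "?r i j' \<in> hat_ratfuns" for i j' using assms(2) hat_ratfuns_zero by simp
  have "(\<Sum>i=1..Suc j. \<Sum>j'=0..Suc j. ?r i j' p * hat_pow \<alpha> p * hat_log p ^ j') = r p * exp (\<alpha> * p) * p ^ j" for p
  proof -
    have inner: "(\<Sum>j'=0..Suc j. ?r i j' p * hat_pow \<alpha> p * hat_log p ^ j') = (if i = 1 then r p * exp (\<alpha> * p) * p ^ j else 0)" for i
    proof -
      have "(\<Sum>j'=0..Suc j. ?r i j' p * hat_pow \<alpha> p * hat_log p ^ j') =
        (\<Sum>j'=0..Suc j. if j' = j then (if i = 1 then r p * exp (\<alpha> * p) * p ^ j else 0) else 0)"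
        by (rule sum.cong) (auto simp: hat_pow_def hat_log_def)
      then show ?thesis by (simp del: sum.cl_ivl_Suc)
    qed
    have "(\<Sum>i=1..Suc j. \<Sum>j'=0..Suc j. ?r i j' p * hat_pow \<alpha> p * hat_log p ^ j') =
      (\<Sum>i=1..Suc j. if i = 1 then r p * exp (\<alpha> * p) * p ^ j else 0)"
      by (rule sum.cong[OF refl inner])
    also have "\<dots> = r p * exp (\<alpha> * p) * p ^ j" by (simp del: sum.cl_ivl_Suc)
    finally show ?thesis .
  qed
  then show "hat_eq (\<lambda>p. r p * exp (\<alpha> * p) * p ^ j) (\<lambda>p. \<Sum>i=1..Suc j. \<Sum>j'=0..Suc j. ?r i j' p * hat_pow \<alpha> p * hat_log p ^ j')"
    by simp
qed

lemma power_log_form_add: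
  assumes "power_log_form c f" "power_log_form c g"
  shows "power_log_form c (\<lambda>p. f p + g p)"
proof -
  obtain t \<alpha> r where f: "\<forall>i\<in>{1..t}. \<alpha> i \<in> exponents c" "\<forall>i\<in>{1..t}. \<forall>j\<in>{0..t}. r i j \<in> hat_ratfuns"
    "hat_eq f (\<lambda>p. \<Sum>i=1..t. \<Sum>j=0..t. r i j p * hat_pow (\<alpha> i) p * hat_log p ^ j)"
    using assms(1) unfolding power_log_form_def by blast
  obtain t' \<alpha>' r' where g: "\<forall>i\<in>{1..t'}. \<alpha>' i \<in> exponents c" "\<forall>i\<in>{1..t'}. \<forall>j\<in>{0..t'}. r' i j \<in> hat_ratfuns"
    "hat_eq g (\<lambda>p. \<Sum>i=1..t'. \<Sum>j=0..t'. r' i j p * hat_pow (\<alpha>' i) p * hat_log p ^ j)"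
    using assms(2) unfolding power_log_form_def by blast
  define A where "A = (\<lambda>i. if i \<le> t then \<alpha> i else \<alpha>' (i - t))"
  define R where "R = (\<lambda>i j. if i \<le> t then (if j \<le> t then r i j else (\<lambda>_. 0)) else (if j \<le> t' then r' (i - t) j else (\<lambda>_. 0)))"
  have idx: "i - t \<in> {1..t'}" if "i \<in> {1..t + t'}" "\<not> i \<le> t" for i using that by auto
  have 1: "A i \<in> exponents c" if "i \<in> {1..t + t'}" for i
    unfolding A_def using f(1) g(1) idx[OF that] that by (cases "i \<le> t") simp_all
  have 2: "R i j \<in> hat_ratfuns" if "i \<in> {1..t + t'}" for i j
    unfolding R_def using f(2) g(2) idx[OF that] that hat_ratfuns_zero by (cases "i \<le> t") simp_all
  have 3: "(\<Sum>i=1..t + t'. \<Sum>j=0..t + t'. R i j p * hat_pow (A i) p * hat_log p ^ j) =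
     (\<Sum>i=1..t. \<Sum>j=0..t. r i j p * hat_pow (\<alpha> i) p * hat_log p ^ j) +
     (\<Sum>i=1..t'. \<Sum>j=0..t'. r' i j p * hat_pow (\<alpha>' i) p * hat_log p ^ j)" for p
  proof -
    have l: "(\<Sum>j=0..t + t'. R i j p * hat_pow (A i) p * hat_log p ^ j) = (\<Sum>j=0..t. r i j p * hat_pow (\<alpha> i) p * hat_log p ^ j)"
      if "i \<in> {1..t}" for i
    proof -
      have "(\<Sum>j=0..t + t'. R i j p * hat_pow (A i) p * hat_log p ^ j) = (\<Sum>j=0..t. R i j p * hat_pow (A i) p * hat_log p ^ j)"
        by (rule sum.mono_neutral_right) (use that in \<open>auto simp: R_def\<close>)
      then show ?thesis using that by (simp add: R_def A_def)
    qed
    have rr: "(\<Sum>j=0..t + t'. R (i + t) j p * hat_pow (A (i + t)) p * hat_log p ^ j) = (\<Sum>j=0..t'. r' i j p * hat_pow (\<alpha>' i) p * hat_log p ^ j)"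
      if "i \<in> {1..t'}" for i
    proof -
      have "(\<Sum>j=0..t + t'. R (i + t) j p * hat_pow (A (i + t)) p * hat_log p ^ j) = (\<Sum>j=0..t'. R (i + t) j p * hat_pow (A (i + t)) p * hat_log p ^ j)"
        by (rule sum.mono_neutral_right) (use that in \<open>auto simp: R_def\<close>)
      then show ?thesis using that by (simp add: R_def A_def)
    qed
    have "{1..t + t'} = {1..t} \<union> {t + 1..t + t'}" "{1..t} \<inter> {t + 1..t + t'} = {}" by auto
    then have "(\<Sum>i=1..t + t'. \<Sum>j=0..t + t'. R i j p * hat_pow (A i) p * hat_log p ^ j) =
      (\<Sum>i=1..t. \<Sum>j=0..t + t'. R i j p * hat_pow (A i) p * hat_log p ^ j) +
      (\<Sum>i=t+1..t + t'. \<Sum>j=0..t + t'. R i j p * hat_pow (A i) p * hat_log p ^ j)"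
      by (simp add: sum.union_disjoint)
    also have "(\<Sum>i=t+1..t + t'. \<Sum>j=0..t + t'. R i j p * hat_pow (A i) p * hat_log p ^ j) =
       (\<Sum>i=1..t'. \<Sum>j=0..t + t'. R (i + t) j p * hat_pow (A (i + t)) p * hat_log p ^ j)"
      using sum.shift_bounds_cl_nat_ivl[of "\<lambda>i. \<Sum>j=0..t + t'. R i j p * hat_pow (A i) p * hat_log p ^ j" 1 t t']
      by (simp add: add.commute)
    finally show ?thesis using l rr by simp
  qed
  have "hat_eq (\<lambda>p. f p + g p) (\<lambda>p. \<Sum>i=1..t + t'. \<Sum>j=0..t + t'. R i j p * hat_pow (A i) p * hat_log p ^ j)"
    unfolding 3 using f(3) g(3) unfolding hat_eq_def by eventually_elim simp
  then show ?thesis using 1 2 unfolding power_log_form_def by blast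
qed

lemma power_log_form_sum:
  "(\<And>i. i \<in> I \<Longrightarrow> power_log_form c (f i)) \<Longrightarrow> power_log_form c (\<lambda>p. \<Sum>i\<in>I. f i p)"
proof (induction I rule: infinite_finite_induct)
  case (insert i I)
  have "power_log_form c (\<lambda>p. f i p + (\<Sum>i\<in>I. f i p))"
    by (rule power_log_form_add[OF insert.prems insert.IH]) (auto intro: insert.prems)
  then show ?case using insert.hyps by simp
qed (simp_all add: power_log_form_zero)

lemma sspan_sum_cmult:
  fixes \<theta> :: "'a \<Rightarrow> complex"
  assumes "polymod \<theta> Z" "finite J" "I \<subseteq> J"
  shows "(\<lambda>x. \<Sum>i\<in>I. c i * w i x) \<in> polymod.sspan \<theta> Z J w"
proof -
  interpret polymod \<theta> Z by fact
  show ?thesis by (intro sspan_sum sspan_cmult sspan_base; use assms in auto)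
qed

definition power_log :: "complex \<Rightarrow> nat \<Rightarrow> complex \<Rightarrow> complex" where
  "power_log \<alpha> j p = exp (\<alpha> * p) * p ^ j"

lemma power_log_meromorphic: "power_log \<alpha> j \<in> meromorphic"
proof -
  have "(\<lambda>p. exp (\<alpha> * p) * p ^ j) analytic_on UNIV" by (intro analytic_intros)
  then show ?thesis by (simp add: power_log_def [abs_def] analytic_on_imp_meromorphic_on)
qed

lemma power_log_stable_deriv: "hat_D.stable {..j} (power_log \<alpha>)"
  unfolding hat_D.stable_def
proof (intro conjI ballI power_log_meromorphic)
  fix i assume i: "i \<in> {..j}"
  have "(power_log \<alpha> i has_field_derivative (\<alpha> * power_log \<alpha> i p + of_nat i * power_log \<alpha> (i - 1) p)) (at p)" for p
    unfolding power_log_def [abs_def]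
    by (rule derivative_eq_intros refl | simp add: algebra_simps)+
  then have "deriv (power_log \<alpha> i) = (\<lambda>p. \<alpha> * power_log \<alpha> i p + of_nat i * power_log \<alpha> (i - 1) p)"
    by (auto intro: DERIV_imp_deriv)
  also have "\<dots> \<in> almost.sspan {..j} (power_log \<alpha>)"
    by (intro almost.sspan_add almost.sspan_cmult almost.sspan_base) (use i in auto)
  finally show "deriv (power_log \<alpha> i) \<in> almost.sspan {..j} (power_log \<alpha>)" .
qed simp

text \<open>The factor \<open>exp p ^ n\<close> admits negative integral powers of \<open>x\<close>
  in \<open>f\<close>; together with the denominator of \<open>r\<close> it is cancelled by
  saturation.\<close>

lemma ratfun_mult_sspan:
  assumes "finite J" "i \<in> J" "r \<in> hat_ratfuns" "n \<ge> 0"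
    and "\<And>p. exp p ^ n * f p = r p * w i p"
  shows "f \<in> almost.sspan J w"
proof -
  obtain u v where uv: "v \<noteq> 0" "r = (\<lambda>p. poly u (exp p) / poly v (exp p))"
    using assms(3) unfolding hat_ratfuns_def hat_x_def by blast
  show ?thesis
  proof (rule almost.sspan_sat)
    show "v * monom 1 n \<noteq> 0" using uv by (simp add: monom_eq_0_iff)
    show "(\<lambda>p. poly (v * monom 1 n) (exp p) * f p) \<in> almost.sspan J w"
    proof (rule almost.sspan_cong)
      show "(\<lambda>p. poly u (exp p) * w i p) \<in> almost.sspan J w"
        by (intro almost.sspan_scale almost.sspan_base assms)
      have "hat_eq (\<lambda>p. poly (v * monom 1 n) (exp p) * f p) (\<lambda>p. poly u (exp p) * w i p)"
      proof (rule hat_eqI_eventually[OF eventually_poly_exp_nonzero[OF uv(1)]])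
        fix p :: complex assume "poly v (exp p) \<noteq> 0"
        then show "poly (v * monom 1 n) (exp p) * f p = poly u (exp p) * w i p"
          using assms(5)[of p] by (simp add: poly_monom uv(2) mult.assoc)
      qed
      then show "(\<lambda>p. poly (v * monom 1 n) (exp p) * f p - poly u (exp p) * w i p) \<in> almost_zero"
        by (simp add: diff_almost_zero_iff)
    qed
  qed
qed

text \<open>Each operator preserves the span of a finite family. The functions
  \<open>exp (\<alpha> p) p ^ i\<close>, \<open>i \<le> j\<close>, serve the derivation and, by the
  binomial theorem, dilations. For the Mahler operator the exponents are \<open>s / M\<close> with
  \<open>0 \<le> s < M\<close>: multiplication by \<open>q\<close> acts on them modulo
  \<open>1\<close>, and the carry is an integral power of \<open>x\<close>.\<close>

lemma power_log_term_relation: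
  fixes j :: nat
  assumes c: "admissible c" and \<alpha>: "\<alpha> \<in> exponents c" and r: "r \<in> hat_ratfuns"
  defines "f \<equiv> \<lambda>p. r p * exp (\<alpha> * p) * p ^ j"
  shows "f \<in> meromorphic" "hat_D.has_relation f"
    "skew_operator.has_relation exp almost_zero (hat_sigma c) f"
proof -
  show fm: "f \<in> meromorphic"
    using power_log_meromorphic[of \<alpha> j] hat_ratfuns_meromorphic[OF r]
    unfolding f_def power_log_def [abs_def] by (auto intro!: meromorphic_on_mult simp: mult.assoc)
  show "hat_D.has_relation f"
    by (rule hat_D.has_relationI_sspan[where J = "{..j}" and w = "power_log \<alpha>", OF power_log_stable_deriv _ fm],
        rule ratfun_mult_sspan[where i = j and r = r and n = 0]) (auto simp: r f_def power_log_def)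
  interpret S: skew_operator exp almost_zero meromorphic "hat_sigma c" "sigma_poly c" "\<lambda>_. 0"
    by (rule hat_sigma_skew_operator[OF c])
  show "S.has_relation f"
  proof (cases c)
    case (CaseQ q l)
    have "S.stable {..j} (power_log \<alpha>)"
      unfolding S.stable_def
    proof (intro conjI ballI power_log_meromorphic)
      fix i assume i: "i \<in> {..j}"
      have "hat_sigma c (power_log \<alpha> i) = (\<lambda>p. \<Sum>k\<le>i. (exp (\<alpha> * l) * of_nat (i choose k) * l ^ (i - k)) * power_log \<alpha> k p)"
      proof
        fix p
        have "(p + l) ^ i = (\<Sum>k\<le>i. of_nat (i choose k) * p ^ k * l ^ (i - k))" by (rule binomial_ring)
        then show "hat_sigma c (power_log \<alpha> i) p = (\<Sum>k\<le>i. (exp (\<alpha> * l) * of_nat (i choose k) * l ^ (i - k)) * power_log \<alpha> k p)"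
          by (simp add: CaseQ power_log_def add.commute[of l p] distrib_left exp_add sum_distrib_left mult_ac)
      qed
      also have "\<dots> \<in> almost.sspan {..j} (power_log \<alpha>)"
        by (rule sspan_sum_cmult) (use i in \<open>auto intro: almost.polymod_axioms\<close>)
      finally show "hat_sigma c (power_log \<alpha> i) \<in> almost.sspan {..j} (power_log \<alpha>)" .
    qed simp
    moreover have "f \<in> almost.sspan {..j} (power_log \<alpha>)"
      by (rule ratfun_mult_sspan[where i = j and r = r and n = 0]) (auto simp: r f_def power_log_def)
    ultimately show ?thesis using fm by (rule S.has_relationI_sspan)
  next
    case (CaseM q)
    then have "\<alpha> \<in> \<rat>" using \<alpha> by simp
    then obtain a :: int and N :: int where N: "N > 0" "\<alpha> = of_int a / of_int N"
      by (rule Rats_cases')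
    define M where "M = nat N"
    have M: "M > 0" "of_int N = (of_nat M :: complex)" "N = int M" using N by (auto simp: M_def)
    define J where "J = {..<M} \<times> {..j}"
    define w where "w = (\<lambda>(s, i). power_log (of_nat s / of_nat M) i)"
    have fJ: "finite J" by (simp add: J_def)
    have "S.stable J w"
      unfolding S.stable_def
    proof (intro conjI ballI fJ)
      fix si assume "si \<in> J"
      then obtain s i where si: "si = (s, i)" "s < M" "i \<le> j" by (auto simp: J_def)
      show "w si \<in> meromorphic" using power_log_meromorphic by (simp add: w_def si)
      have "hat_sigma c (w si) = (\<lambda>p. poly (monom (of_nat q ^ i) (q * s div M)) (exp p) * w (q * s mod M, i) p)"
      proof
        fix p :: complex
        have qs: "of_nat (q * s) = of_nat (q * s div M) * of_nat M + (of_nat (q * s mod M) :: complex)"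
          by (metis div_mult_mod_eq of_nat_add of_nat_mult)
        have "of_nat s / of_nat M * (of_nat q * p) = of_nat (q * s) / of_nat M * p" by (simp add: mult_ac)
        also have "\<dots> = of_nat (q * s div M) * p + of_nat (q * s mod M) / of_nat M * p"
          unfolding qs using M(1) by (simp add: add_divide_distrib distrib_right)
        finally have "of_nat s / of_nat M * (of_nat q * p) = of_nat (q * s div M) * p + of_nat (q * s mod M) / of_nat M * p" .
        then have "exp (of_nat s / of_nat M * (of_nat q * p)) = exp p ^ (q * s div M) * exp (of_nat (q * s mod M) / of_nat M * p)"
          by (simp add: exp_add exp_of_nat_mult)
        then show "hat_sigma c (w si) p = poly (monom (of_nat q ^ i) (q * s div M)) (exp p) * w (q * s mod M, i) p"
          by (simp add: CaseM w_def si power_log_def poly_monom power_mult_distrib mult_ac)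
      qed
      also have "\<dots> \<in> almost.sspan J w"
        by (intro almost.sspan_scale almost.sspan_base fJ) (use si M in \<open>auto simp: J_def\<close>)
      finally show "hat_sigma c (w si) \<in> almost.sspan J w" .
    qed
    moreover have "f \<in> almost.sspan J w"
    proof -
      \<comment> \<open>The fractional part \<open>s / M\<close> of \<open>\<alpha>\<close> selects
        the generator; the integral part \<open>d\<close>, possibly negative, is a power of
        \<open>x\<close>.\<close>
      define s where "s = nat (a mod int M)"
      define d where "d = a div int M"
      have s: "s < M" "int s = a mod int M" using M by (auto simp: s_def nat_less_iff)
      have "of_int a = of_int d * of_nat M + (of_nat s :: complex)"
        by (metis d_def s(2) div_mult_mod_eq of_int_add of_int_mult of_int_of_nat_eq)
      then have \<alpha>eq: "\<alpha> = of_int d + of_nat s / of_nat M" using M N by (simp add: field_simps)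
      then have e: "exp (\<alpha> * p) = exp (of_int d * p) * exp (of_nat s / of_nat M * p)" for p
        by (simp add: distrib_right exp_add)
      show ?thesis
      proof (cases "d \<ge> 0")
        case True
        define r' where "r' = (\<lambda>p. exp p ^ nat d * r p)"
        have "r' \<in> hat_ratfuns"
        proof -
          obtain u v where uv: "v \<noteq> 0" "r = (\<lambda>p. poly u (exp p) / poly v (exp p))"
            using r unfolding hat_ratfuns_def hat_x_def by blast
          then have "r' = (\<lambda>p. poly (monom 1 (nat d) * u) (exp p) / poly v (exp p))"
            by (simp add: r'_def poly_monom)
          then show ?thesis by (simp only: hat_ratfunsI[OF uv(1)])
        qed
        moreover have "exp (of_int d * p) = exp p ^ nat d" for p :: complex
          using True exp_of_nat_mult[of "nat d" p] by simp
        ultimately show ?thesis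
          by (intro ratfun_mult_sspan[OF fJ, where i = "(s, j)" and r = r' and n = 0]) (auto simp: J_def s w_def power_log_def f_def e r'_def)
      next
        case False
        have ex: "exp p ^ nat (- d) * exp (of_int d * p) = 1" for p :: complex
        proof -
          have "exp p ^ nat (- d) = exp (of_nat (nat (- d)) * p)" by (simp only: exp_of_nat_mult)
          also have "\<dots> = exp (- (of_int d * p))" using False by simp
          finally show ?thesis by (simp add: exp_minus)
        qed
        have "exp p ^ nat (- d) * f p = r p * w (s, j) p" for p
        proof -
          have "exp p ^ nat (- d) * f p = (exp p ^ nat (- d) * exp (of_int d * p)) * (r p * (exp (of_nat s / of_nat M * p) * p ^ j))"
            by (simp add: f_def e mult_ac)
          then show ?thesis by (simp only: ex) (simp add: w_def power_log_def)
        qed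
        then show ?thesis
          by (intro ratfun_mult_sspan[OF fJ, where i = "(s, j)" and r = r and n = "nat (- d)"]) (auto simp: J_def s r)
      qed
    qed
    ultimately show ?thesis using fm by (rule S.has_relationI_sspan)
  qed
qed

lemma power_log_form_relations:
  assumes c: "admissible c" and f: "power_log_form c f"
  shows "\<exists>g \<in> meromorphic. hat_eq f g \<and> hat_D.has_relation g \<and>
    skew_operator.has_relation exp almost_zero (hat_sigma c) g"
proof -
  interpret S: skew_operator exp almost_zero meromorphic "hat_sigma c" "sigma_poly c" "\<lambda>_. 0"
    by (rule hat_sigma_skew_operator[OF c])
  obtain t \<alpha> r where t: "\<forall>i\<in>{1..t}. \<alpha> i \<in> exponents c" "\<forall>i\<in>{1..t}. \<forall>j\<in>{0..t}. r i j \<in> hat_ratfuns"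
    "hat_eq f (\<lambda>p. \<Sum>i=1..t. \<Sum>j=0..t. r i j p * hat_pow (\<alpha> i) p * hat_log p ^ j)"
    using f unfolding power_log_form_def by blast
  define w where "w = (\<lambda>i j p. r i j p * exp (\<alpha> i * p) * p ^ j)"
  have w: "w i j \<in> meromorphic \<and> hat_D.has_relation (w i j) \<and> S.has_relation (w i j)"
    if "i \<in> {1..t}" "j \<in> {0..t}" for i j
    using power_log_term_relation[OF c, of "\<alpha> i" "r i j" j] t(1,2) that unfolding w_def by blast
  define g where "g = (\<lambda>p. \<Sum>i=1..t. \<Sum>j=0..t. w i j p)"
  have gm: "g \<in> meromorphic"
    unfolding g_def by (intro hat_D.C_sum) (use w in blast)
  have "hat_D.has_relation g"
    unfolding g_def
    by (rule hat_D.has_relation_sum, rule conjI, rule hat_D.C_sum, use w in blast,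
        rule hat_D.has_relation_sum, use w in blast)
  moreover have "S.has_relation g"
    unfolding g_def
    by (rule S.has_relation_sum, rule conjI, rule S.C_sum, use w in blast,
        rule S.has_relation_sum, use w in blast)
  moreover have "hat_eq f g" using t(3) by (simp add: g_def w_def hat_pow_def hat_log_def)
  ultimately show ?thesis using gm by blast
qed

theorem power_log_form_satisfies:
  assumes c: "admissible c" and f: "power_log_form c f"
  shows "\<exists>n>0. \<exists>m>0. hat_satisfies hat_delta n f \<and> hat_satisfies (hat_sigma c) m f"
proof -
  obtain g where g: "g \<in> meromorphic" "hat_eq f g" "hat_D.has_relation g"
    "skew_operator.has_relation exp almost_zero (hat_sigma c) g"
    using power_log_form_relations[OF assms] by blast
  obtain n where n: "n > 0" "hat_satisfies deriv n g"
    using skew_relation_imp_hat_satisfies[OF hat_D.skew_operator_axioms g(3,1)] by blast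
  obtain m where m: "m > 0" "hat_satisfies (hat_sigma c) m g"
    using skew_relation_imp_hat_satisfies[OF hat_sigma_skew_operator[OF c] g(4,1)] by blast
  have "hat_satisfies deriv n f" by (rule hat_satisfies_cong[OF hat_eq_deriv g(2) n(2)])
  moreover have "hat_delta = deriv" by (simp add: fun_eq_iff hat_delta_eq_deriv)
  moreover have "hat_satisfies (hat_sigma c) m f"
    by (rule hat_satisfies_cong[OF hat_eq_sigma[OF c] g(2) m(2)])
  ultimately show ?thesis using n(1) m(1) by auto
qed

section \<open>Monodromy and expansions in powers of the logarithm\<close>

text \<open>The translation by \<open>2 pi i\<close> is the monodromy around \<open>x = 0\<close>,
  and \<open>\<mu>\<close> is the multiplier; \<open>x ^ \<alpha>\<close> has multiplier
  \<open>exp (2 pi i \<alpha>)\<close>. Rational functions of \<open>x\<close> are invariant, so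
  multiplying by them keeps \<open>\<mu>\<close>.\<close>

definition eigenfunction :: "complex \<Rightarrow> (complex \<Rightarrow> complex) \<Rightarrow> bool" where
  "eigenfunction \<mu> g \<longleftrightarrow> g \<in> meromorphic \<and> hat_eq (\<lambda>p. g (p + period)) (\<lambda>p. \<mu> * g p)"

lemma eigenfunction_eventually:
  "eigenfunction \<mu> g \<Longrightarrow> eventually (\<lambda>p. g (p + period) = \<mu> * g p) (cosparse UNIV)"
  by (simp add: eigenfunction_def hat_eq_def)

lemma eigenfunctionI:
  "g \<in> meromorphic \<Longrightarrow> eventually (\<lambda>p. g (p + period) = \<mu> * g p) (cosparse UNIV) \<Longrightarrow> eigenfunction \<mu> g"
  by (simp add: eigenfunction_def hat_eq_def)

lemma eigenfunction_meromorphic: "eigenfunction \<mu> g \<Longrightarrow> g \<in> meromorphic"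
  by (simp add: eigenfunction_def)

lemma eigenfunction_zero: "eigenfunction \<mu> (\<lambda>_. 0)"
  using hat_D.C_zero by (simp add: eigenfunction_def)

lemma eigenfunction_add:
  assumes "eigenfunction \<mu> f" "eigenfunction \<mu> g"
  shows "eigenfunction \<mu> (\<lambda>p. f p + g p)"
proof (rule eigenfunctionI)
  show "(\<lambda>p. f p + g p) \<in> meromorphic" by (rule hat_D.C_add[OF assms[THEN eigenfunction_meromorphic]])
  show "eventually (\<lambda>p. f (p + period) + g (p + period) = \<mu> * (f p + g p)) (cosparse UNIV)"
    using assms[THEN eigenfunction_eventually] by eventually_elim (simp add: algebra_simps)
qed

lemma eigenfunction_scale:
  assumes "eigenfunction \<mu> f"
  shows "eigenfunction \<mu> (\<lambda>p. poly u (exp p) * f p)"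
proof (rule eigenfunctionI)
  show "(\<lambda>p. poly u (exp p) * f p) \<in> meromorphic" by (rule hat_D.C_scale[OF eigenfunction_meromorphic[OF assms]])
  show "eventually (\<lambda>p. poly u (exp (p + period)) * f (p + period) = \<mu> * (poly u (exp p) * f p)) (cosparse UNIV)"
    using eigenfunction_eventually[OF assms] unfolding exp_period by eventually_elim simp
qed

lemma eigenfunction_cmult: "eigenfunction \<mu> f \<Longrightarrow> eigenfunction \<mu> (\<lambda>p. a * f p)"
  using eigenfunction_scale[of \<mu> f "[:a:]"] by simp

lemma eigenfunction_sum:
  "(\<And>i. i \<in> I \<Longrightarrow> eigenfunction \<mu> (f i)) \<Longrightarrow> eigenfunction \<mu> (\<lambda>p. \<Sum>i\<in>I. f i p)"
proof (induction I rule: infinite_finite_induct)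
  case (insert i I)
  have "eigenfunction \<mu> (\<lambda>p. f i p + (\<Sum>i\<in>I. f i p))"
    by (rule eigenfunction_add[OF insert.prems insert.IH]) (auto intro: insert.prems)
  then show ?case using insert.hyps by simp
qed (simp_all add: eigenfunction_zero)

lemma eigenfunction_deriv:
  assumes "eigenfunction \<mu> f"
  shows "eigenfunction \<mu> (deriv f)"
  unfolding eigenfunction_def
proof
  show "deriv f \<in> meromorphic" by (rule hat_D.T_C[OF eigenfunction_meromorphic[OF assms]])
  have "hat_eq (deriv (\<lambda>p. f (period + p))) (deriv (\<lambda>p. \<mu> * f p))"
    using assms by (intro hat_eq_deriv) (simp add: eigenfunction_def add.commute)
  then have 1: "hat_eq (\<lambda>p. deriv f (p + period)) (deriv (\<lambda>p. \<mu> * f p))"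
    unfolding deriv_translate by (simp add: add.commute)
  have "hat_eq (deriv (\<lambda>p. \<mu> * f p)) (\<lambda>p. \<mu> * deriv f p)"
    using meromorphic_eventually_differentiable[of f] assms
    by (intro hat_eqI_eventually[of "\<lambda>z. f field_differentiable at z"] deriv_cmult) (auto simp: eigenfunction_def)
  with 1 show "hat_eq (\<lambda>p. deriv f (p + period)) (\<lambda>p. \<mu> * deriv f p)" by (rule hat_eq_trans)
qed

lemma eigenfunction_translate:
  assumes "eigenfunction \<mu> f"
  shows "eigenfunction \<mu> (\<lambda>p. f (p + s))"
proof (rule eigenfunctionI)
  show "(\<lambda>p. f (p + s)) \<in> meromorphic"
    using meromorphic_affine[of f 1 s] assms by (simp add: eigenfunction_def)
  show "eventually (\<lambda>p. f (p + period + s) = \<mu> * f (p + s)) (cosparse UNIV)"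
    using eventually_cosparse_affine[OF eigenfunction_eventually[OF assms], of 1 s] by (simp add: add_ac)
qed

lemma eigenfunction_iterate:
  assumes "eigenfunction \<mu> f"
  shows "eventually (\<lambda>p. f (p + of_nat k * period) = \<mu> ^ k * f p) (cosparse UNIV)"
proof (induction k)
  case (Suc k)
  have "eventually (\<lambda>p. f ((p + of_nat k * period) + period) = \<mu> * f (p + of_nat k * period)) (cosparse UNIV)"
    using eventually_cosparse_affine[OF eigenfunction_eventually[OF assms], of 1 "of_nat k * period"] by simp
  with Suc show ?case
  proof eventually_elim
    case (elim p)
    have *: "p + of_nat (Suc k) * period = (p + of_nat k * period) + period" by (simp add: algebra_simps)
    show ?case unfolding * elim by simp
  qed
qed simp

lemma eigenfunction_dilate:
  assumes "eigenfunction \<mu> f" "n > 0"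
  shows "eigenfunction (\<mu> ^ n) (\<lambda>p. f (of_nat n * p))"
proof (rule eigenfunctionI)
  show "(\<lambda>p. f (of_nat n * p)) \<in> meromorphic"
    using meromorphic_affine[of f "of_nat n" 0] assms by (simp add: eigenfunction_def)
  show "eventually (\<lambda>p. f (of_nat n * (p + period)) = \<mu> ^ n * f (of_nat n * p)) (cosparse UNIV)"
    using eventually_cosparse_affine[OF eigenfunction_iterate[OF assms(1), of n], of "of_nat n" 0] assms(2)
    by (simp add: distrib_left)
qed

text \<open>A decomposition into generalised eigenspaces of the monodromy, since
  \<open>p = log x\<close>. A single bound \<open>J\<close> serves all multipliers, so that
  coefficients of the same power of \<open>p\<close> can be compared.\<close>

definition log_expansion ::
  "complex set \<Rightarrow> nat \<Rightarrow> (complex \<Rightarrow> nat \<Rightarrow> complex \<Rightarrow> complex) \<Rightarrow> (complex \<Rightarrow> complex) \<Rightarrow> bool" where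
  "log_expansion \<Lambda> J G f \<longleftrightarrow> finite \<Lambda> \<and> 0 \<notin> \<Lambda> \<and> (\<forall>\<mu>\<in>\<Lambda>. \<forall>j<J. eigenfunction \<mu> (G \<mu> j)) \<and>
     hat_eq f (\<lambda>p. \<Sum>\<mu>\<in>\<Lambda>. \<Sum>j<J. G \<mu> j p * p ^ j)"

lemma log_expansion_cong: "log_expansion \<Lambda> J G f \<Longrightarrow> hat_eq g f \<Longrightarrow> log_expansion \<Lambda> J G g"
  unfolding log_expansion_def using hat_eq_trans by blast

lemma log_expansion_zero: "log_expansion {} 0 G (\<lambda>_. 0)"
  by (simp add: log_expansion_def)

lemma log_expansion_basic:
  assumes "eigenfunction \<mu> g" "\<mu> \<noteq> 0"
  shows "log_expansion {\<mu>} (Suc (degree Q)) (\<lambda>_ j p. coeff Q j * g p) (\<lambda>p. g p * poly Q p)"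
proof -
  have "g p * poly Q p = (\<Sum>j<Suc (degree Q). coeff Q j * g p * p ^ j)" for p
    by (simp add: poly_altdef sum_distrib_left lessThan_Suc_atMost mult_ac del: sum.lessThan_Suc)
  then show ?thesis unfolding log_expansion_def using assms by (simp add: eigenfunction_cmult)
qed

lemma log_expansion_add:
  assumes "log_expansion \<Lambda> J G f" "log_expansion \<Lambda>' J' G' g"
  shows "\<exists>G''. log_expansion (\<Lambda> \<union> \<Lambda>') (max J J') G'' (\<lambda>p. f p + g p)"
proof -
  define e where "e = (\<lambda>\<mu> j p. if \<mu> \<in> \<Lambda> \<and> j < J then G \<mu> j p else 0)"
  define e' where "e' = (\<lambda>\<mu> j p. if \<mu> \<in> \<Lambda>' \<and> j < J' then G' \<mu> j p else 0)"
  have fin: "finite \<Lambda>" "finite \<Lambda>'" using assms by (auto simp: log_expansion_def)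
  have ext: "(\<Sum>\<mu>\<in>A \<union> B. \<Sum>j<max m n. (if \<mu> \<in> A \<and> j < m then F \<mu> j p else 0) * p ^ j) = (\<Sum>\<mu>\<in>A. \<Sum>j<m. F \<mu> j p * p ^ j)"
    if "finite A" "finite B" for A B :: "complex set" and m n :: nat and F :: "complex \<Rightarrow> nat \<Rightarrow> complex \<Rightarrow> complex" and p
  proof -
    have "(\<Sum>\<mu>\<in>A \<union> B. \<Sum>j<max m n. (if \<mu> \<in> A \<and> j < m then F \<mu> j p else 0) * p ^ j) =
      (\<Sum>\<mu>\<in>A. \<Sum>j<max m n. (if \<mu> \<in> A \<and> j < m then F \<mu> j p else 0) * p ^ j)"
      by (rule sum.mono_neutral_right) (use that in \<open>auto intro!: sum.neutral\<close>)
    also have "\<dots> = (\<Sum>\<mu>\<in>A. \<Sum>j<m. (if \<mu> \<in> A \<and> j < m then F \<mu> j p else 0) * p ^ j)"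
      by (intro sum.cong refl sum.mono_neutral_right) auto
    also have "\<dots> = (\<Sum>\<mu>\<in>A. \<Sum>j<m. F \<mu> j p * p ^ j)" by (intro sum.cong refl) auto
    finally show ?thesis .
  qed
  have "log_expansion (\<Lambda> \<union> \<Lambda>') (max J J') (\<lambda>\<mu> j p. e \<mu> j p + e' \<mu> j p) (\<lambda>p. f p + g p)"
    unfolding log_expansion_def
  proof (intro conjI ballI allI impI)
    show "finite (\<Lambda> \<union> \<Lambda>')" "0 \<notin> \<Lambda> \<union> \<Lambda>'" using assms by (auto simp: log_expansion_def)
    fix \<mu> j
    have "eigenfunction \<mu> (e \<mu> j)"
      using assms(1) unfolding e_def by (cases "\<mu> \<in> \<Lambda> \<and> j < J") (auto simp: log_expansion_def eigenfunction_zero)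
    moreover have "eigenfunction \<mu> (e' \<mu> j)"
      using assms(2) unfolding e'_def by (cases "\<mu> \<in> \<Lambda>' \<and> j < J'") (auto simp: log_expansion_def eigenfunction_zero)
    ultimately show "eigenfunction \<mu> (\<lambda>p. e \<mu> j p + e' \<mu> j p)" by (rule eigenfunction_add)
  next
    have "(\<Sum>\<mu>\<in>\<Lambda> \<union> \<Lambda>'. \<Sum>j<max J J'. (e \<mu> j p + e' \<mu> j p) * p ^ j) =
      (\<Sum>\<mu>\<in>\<Lambda>. \<Sum>j<J. G \<mu> j p * p ^ j) + (\<Sum>\<mu>\<in>\<Lambda>'. \<Sum>j<J'. G' \<mu> j p * p ^ j)" for p
      using ext[OF fin, where m = J and n = J' and F = G and p = p] ext[OF fin(2,1), where m = J' and n = J and F = G' and p = p]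
      by (simp add: e_def e'_def distrib_right sum.distrib Un_commute max.commute)
    moreover have "hat_eq f (\<lambda>p. \<Sum>\<mu>\<in>\<Lambda>. \<Sum>j<J. G \<mu> j p * p ^ j)" "hat_eq g (\<lambda>p. \<Sum>\<mu>\<in>\<Lambda>'. \<Sum>j<J'. G' \<mu> j p * p ^ j)"
      using assms by (auto simp: log_expansion_def)
    then have "hat_eq (\<lambda>p. f p + g p) (\<lambda>p. (\<Sum>\<mu>\<in>\<Lambda>. \<Sum>j<J. G \<mu> j p * p ^ j) + (\<Sum>\<mu>\<in>\<Lambda>'. \<Sum>j<J'. G' \<mu> j p * p ^ j))"
      unfolding hat_eq_def by eventually_elim simp
    ultimately show "hat_eq (\<lambda>p. f p + g p) (\<lambda>p. \<Sum>\<mu>\<in>\<Lambda> \<union> \<Lambda>'. \<Sum>j<max J J'. (e \<mu> j p + e' \<mu> j p) * p ^ j)"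
      by simp
  qed
  then show ?thesis by blast
qed

definition log_expandable :: "(complex \<Rightarrow> complex) \<Rightarrow> bool" where
  "log_expandable f \<longleftrightarrow> (\<exists>\<Lambda> J G. log_expansion \<Lambda> J G f)"

lemma log_expandable_add: "log_expandable f \<Longrightarrow> log_expandable g \<Longrightarrow> log_expandable (\<lambda>p. f p + g p)"
  unfolding log_expandable_def using log_expansion_add by blast

lemma log_expandable_cong: "log_expandable f \<Longrightarrow> hat_eq g f \<Longrightarrow> log_expandable g"
  unfolding log_expandable_def using log_expansion_cong by blast

lemma log_expandable_basic: "eigenfunction \<mu> g \<Longrightarrow> \<mu> \<noteq> 0 \<Longrightarrow> log_expandable (\<lambda>p. g p * poly Q p)"
  unfolding log_expandable_def using log_expansion_basic by blast

lemma log_expandable_zero: "log_expandable (\<lambda>_. 0)"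
  unfolding log_expandable_def using log_expansion_zero by blast

lemma log_expandable_sum:
  "(\<And>i. i \<in> I \<Longrightarrow> log_expandable (f i)) \<Longrightarrow> log_expandable (\<lambda>p. \<Sum>i\<in>I. f i p)"
proof (induction I rule: infinite_finite_induct)
  case (insert i I)
  have "log_expandable (\<lambda>p. f i p + (\<Sum>i\<in>I. f i p))"
    by (rule log_expandable_add[OF insert.prems insert.IH]) (auto intro: insert.prems)
  then show ?case using insert.hyps by simp
qed (simp_all add: log_expandable_zero)

text \<open>The scheme for recurrences with constant coefficients, with the monodromy as shift. A
  root \<open>\<nu>\<close> of \<open>\<gamma>\<close> lowers the degree; the equation
  \<open>f(p + period) - \<nu> f(p) = f'(p)\<close> is solved term by term, and the difference from
  that solution is an eigenfunction for \<open>\<nu>\<close>. A root \<open>0\<close> is dropped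
  because translations are invertible.\<close>

lemma log_expandableI_monodromy:
  assumes "\<gamma> \<noteq> 0" "f \<in> meromorphic"
    and "(\<lambda>p. \<Sum>i\<le>degree \<gamma>. coeff \<gamma> i * f (p + of_nat i * period)) \<in> almost_zero"
  shows "log_expandable f"
  using assms
proof (induction "degree \<gamma>" arbitrary: \<gamma> f)
  case 0
  then obtain a where a: "\<gamma> = [:a:]" "a \<noteq> 0" by (metis degree_eq_zeroE pCons_0_0)
  then have "(\<lambda>p. a * f p) \<in> almost_zero" using 0 by simp
  then have "hat_eq f (\<lambda>_. 0)" using a(2) unfolding almost_zero_def hat_eq_def by auto
  then show ?case using log_expandable_cong log_expandable_zero by blast
next
  case (Suc n)
  then obtain \<nu> where "poly \<gamma> \<nu> = 0"
    using fundamental_theorem_of_algebra_alt[of \<gamma>] by fastforce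
  then obtain r where r: "\<gamma> = [:-\<nu>, 1:] * r" by (metis poly_eq_0_iff_dvd dvdE)
  then have r0: "r \<noteq> 0" using Suc.prems by auto
  have deg: "degree \<gamma> = Suc (degree r)" unfolding r using r0 by (subst degree_mult_eq) auto
  define f' where "f' = (\<lambda>p. f (p + period) - \<nu> * f p)"
  have f'm: "f' \<in> meromorphic"
    using meromorphic_affine[of f 1 period] Suc.prems(2)
    unfolding f'_def by (intro hat_D.C_diff hat_D.C_cmult) auto
  have "(\<Sum>i\<le>degree \<gamma>. coeff \<gamma> i * f (p + of_nat i * period)) = (\<Sum>i\<le>degree r. coeff r i * f' (p + of_nat i * period))" for p
  proof -
    define c where "c = (\<lambda>k. f (p + of_nat k * period))"
    have c': "f' (p + of_nat k * period) = c (Suc k) - \<nu> * c k" for k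
      by (simp add: f'_def c_def algebra_simps)
    have cp: "coeff \<gamma> i = (case i of 0 \<Rightarrow> 0 | Suc j \<Rightarrow> coeff r j) - \<nu> * coeff r i" for i
      by (simp add: r coeff_pCons split: nat.splits)
    have "(\<Sum>i\<le>degree \<gamma>. coeff \<gamma> i * c i) =
      (\<Sum>i\<le>Suc (degree r). (case i of 0 \<Rightarrow> 0 | Suc j \<Rightarrow> coeff r j) * c i) - \<nu> * (\<Sum>i\<le>Suc (degree r). coeff r i * c i)"
      by (simp add: deg cp sum_subtractf sum_distrib_left algebra_simps del: sum.atMost_Suc)
    also have "(\<Sum>i\<le>Suc (degree r). (case i of 0 \<Rightarrow> 0 | Suc j \<Rightarrow> coeff r j) * c i) =
      (\<Sum>i\<le>degree r. coeff r i * c (Suc i))"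
      by (subst sum.atMost_Suc_shift) simp
    also have "(\<Sum>i\<le>Suc (degree r). coeff r i * c i) = (\<Sum>i\<le>degree r. coeff r i * c i)"
      by (simp add: coeff_eq_0)
    finally show ?thesis unfolding c' by (simp add: c_def sum_subtractf sum_distrib_left algebra_simps)
  qed
  then have z: "(\<lambda>p. \<Sum>i\<le>degree r. coeff r i * f' (p + of_nat i * period)) \<in> almost_zero"
    using Suc.prems(3) by simp
  show ?case
  proof (cases "\<nu> = 0")
    case True
    have "hat_eq (\<lambda>p. \<Sum>i\<le>degree r. coeff r i * f' (1 * p + - period + of_nat i * period)) (\<lambda>_. 0)"
      by (rule hat_eq_affine[of "\<lambda>p. \<Sum>i\<le>degree r. coeff r i * f' (p + of_nat i * period)" "\<lambda>_. 0" 1 "- period"])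
         (use z in \<open>simp_all add: almost_zero_def\<close>)
    then have "(\<lambda>p. \<Sum>i\<le>degree r. coeff r i * f (p + of_nat i * period)) \<in> almost_zero"
      by (simp add: almost_zero_def f'_def True algebra_simps)
    then show ?thesis using Suc.hyps(1)[of r f] Suc.hyps(2) deg r0 Suc.prems(2) by simp
  next
    case False
    have "log_expandable f'" using Suc.hyps(1)[of r f'] Suc.hyps(2) deg r0 f'm z by simp
    then obtain \<Lambda> J G where G: "log_expansion \<Lambda> J G f'" unfolding log_expandable_def by blast
    have \<Lambda>: "finite \<Lambda>" "0 \<notin> \<Lambda>" "\<And>\<mu> j. \<mu> \<in> \<Lambda> \<Longrightarrow> j < J \<Longrightarrow> eigenfunction \<mu> (G \<mu> j)"
      "hat_eq f' (\<lambda>p. \<Sum>\<mu>\<in>\<Lambda>. \<Sum>j<J. G \<mu> j p * p ^ j)" using G by (auto simp: log_expansion_def)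
    define Q where "Q = (\<lambda>\<mu> j. SOME R. smult \<mu> (pcompose R [:period, 1:]) - smult \<nu> R = monom 1 j)"
    have Q: "smult \<mu> (pcompose (Q \<mu> j) [:period, 1:]) - smult \<nu> (Q \<mu> j) = monom 1 j" if "\<mu> \<in> \<Lambda>" for \<mu> j
    proof -
      have "\<exists>R. smult \<mu> (pcompose R [:period, 1:]) - smult \<nu> R = monom 1 j"
        by (rule twisted_difference_surj) (use that \<Lambda>(2) in auto)
      then show ?thesis unfolding Q_def by (rule someI_ex)
    qed
    have Qp: "\<mu> * poly (Q \<mu> j) (p + period) - \<nu> * poly (Q \<mu> j) p = p ^ j" if "\<mu> \<in> \<Lambda>" for \<mu> j p
      using arg_cong[OF Q[OF that, of j], of "\<lambda>R. poly R p"] by (simp add: poly_pcompose poly_monom add.commute)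
    define S where "S = (\<lambda>p. \<Sum>\<mu>\<in>\<Lambda>. \<Sum>j<J. G \<mu> j p * poly (Q \<mu> j) p)"
    have id_m: "(\<lambda>p. poly R p) \<in> meromorphic" for R
    proof -
      have "(\<lambda>p. poly R p) analytic_on UNIV" unfolding poly_altdef by (intro analytic_intros)
      then show ?thesis by (simp add: analytic_on_imp_meromorphic_on)
    qed
    have Sm: "S \<in> meromorphic"
    proof -
      have "(\<lambda>p. G \<mu> j p * poly (Q \<mu> j) p) \<in> meromorphic" if "\<mu> \<in> \<Lambda>" "j < J" for \<mu> j
        using eigenfunction_meromorphic[OF \<Lambda>(3)[OF that]] id_m[of "Q \<mu> j"] by (auto intro: meromorphic_on_mult)
      then show ?thesis unfolding S_def by (intro hat_D.C_sum) auto
    qed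
    have Se: "log_expandable S"
      unfolding S_def by (rule log_expandable_sum, rule log_expandable_sum, rule log_expandable_basic) (use \<Lambda> in auto)
    define h where "h = (\<lambda>p. f p - S p)"
    have hm: "h \<in> meromorphic" unfolding h_def by (intro hat_D.C_diff Suc.prems Sm)
    have "eventually (\<lambda>p. \<forall>(\<mu>, j)\<in>\<Lambda> \<times> {..<J}. G \<mu> j (p + period) = \<mu> * G \<mu> j p) (cosparse UNIV)"
      by (rule eventually_ball_finite) (use \<Lambda> eigenfunction_eventually in auto)
    moreover have "eventually (\<lambda>p. f' p = (\<Sum>\<mu>\<in>\<Lambda>. \<Sum>j<J. G \<mu> j p * p ^ j)) (cosparse UNIV)"
      using \<Lambda>(4) by (simp add: hat_eq_def)
    ultimately have "eventually (\<lambda>p. h (p + period) = \<nu> * h p) (cosparse UNIV)"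
    proof eventually_elim
      case (elim p)
      have "S (p + period) = (\<Sum>\<mu>\<in>\<Lambda>. \<Sum>j<J. (\<mu> * G \<mu> j p) * poly (Q \<mu> j) (p + period))"
        unfolding S_def by (intro sum.cong refl) (use elim in auto)
      then have "S (p + period) - \<nu> * S p = (\<Sum>\<mu>\<in>\<Lambda>. \<Sum>j<J. G \<mu> j p * (\<mu> * poly (Q \<mu> j) (p + period) - \<nu> * poly (Q \<mu> j) p))"
        by (simp add: S_def sum_distrib_left sum_subtractf algebra_simps)
      also have "\<dots> = (\<Sum>\<mu>\<in>\<Lambda>. \<Sum>j<J. G \<mu> j p * p ^ j)"
        by (intro sum.cong refl) (use Qp in auto)
      also have "\<dots> = f (p + period) - \<nu> * f p" using elim by (simp add: f'_def)
      finally show ?case by (simp add: h_def algebra_simps)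
    qed
    then have "eigenfunction \<nu> h" by (rule eigenfunctionI[OF hm])
    then have "log_expandable (\<lambda>p. h p * poly 1 p)" using False by (rule log_expandable_basic)
    then have "log_expandable (\<lambda>p. h p * poly 1 p + S p)" using Se by (rule log_expandable_add)
    then show ?thesis by (simp add: h_def)
  qed
qed

text \<open>Along the points \<open>p + k * period\<close> the expansion is an exponential
  polynomial in \<open>k\<close>. It is determined by a window of \<open>card \<Lambda> * J\<close>
  consecutive \<open>k\<close>, so only finitely many exceptional sets of \<open>p\<close> have to
  be avoided.\<close>

lemma log_expansion_unique:
  assumes "log_expansion \<Lambda> J G f" "f \<in> almost_zero" "\<mu> \<in> \<Lambda>" "j < J"
  shows "G \<mu> j \<in> almost_zero"
proof -
  have \<Lambda>: "finite \<Lambda>" "0 \<notin> \<Lambda>" "\<And>\<mu> j. \<mu> \<in> \<Lambda> \<Longrightarrow> j < J \<Longrightarrow> eigenfunction \<mu> (G \<mu> j)"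
    "hat_eq f (\<lambda>p. \<Sum>\<mu>\<in>\<Lambda>. \<Sum>j<J. G \<mu> j p * p ^ j)" using assms(1) by (auto simp: log_expansion_def)
  define S where "S = (\<lambda>p. \<Sum>\<mu>\<in>\<Lambda>. \<Sum>j<J. G \<mu> j p * p ^ j)"
  have "hat_eq S (\<lambda>_. 0)"
    using hat_eq_trans[OF hat_eq_sym[OF \<Lambda>(4)]] assms(2) by (simp add: S_def almost_zero_def)
  then have S: "eventually (\<lambda>p. S p = 0) (cosparse UNIV)" by (simp add: hat_eq_def)
  define N where "N = card \<Lambda> * J"
  have 1: "eventually (\<lambda>p. \<forall>k\<in>{..<N}. S (p + of_nat k * period) = 0) (cosparse UNIV)"
    by (rule eventually_ball_finite) (use eventually_cosparse_affine[OF S, of 1] in auto)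
  have 2: "eventually (\<lambda>p. \<forall>(\<mu>, j, k)\<in>\<Lambda> \<times> {..<J} \<times> {..<N}. G \<mu> j (p + of_nat k * period) = \<mu> ^ k * G \<mu> j p) (cosparse UNIV)"
    by (rule eventually_ball_finite) (use \<Lambda> eigenfunction_iterate in auto)
  have "eventually (\<lambda>p. G \<mu> j p = 0) (cosparse UNIV)"
    using 1 2
  proof eventually_elim
    case (elim p)
    define R where "R = (\<lambda>\<mu>. \<Sum>j<J. monom (G \<mu> j p) j)"
    define Q where "Q = (\<lambda>\<mu>. pcompose (R \<mu>) [:p, period:])"
    have Qk: "poly (Q \<mu>) (of_nat k) = (\<Sum>j<J. G \<mu> j p * (p + of_nat k * period) ^ j)" for \<mu> k
      by (simp add: Q_def R_def poly_pcompose poly_sum poly_monom)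
    have size: "(if Q \<mu> = 0 then 0 else Suc (degree (Q \<mu>))) \<le> J" for \<mu>
    proof (cases "Q \<mu> = 0")
      case False
      then have "R \<mu> \<noteq> 0" by (auto simp: Q_def)
      have "degree (R \<mu>) < J"
      proof (rule ccontr)
        assume "\<not> degree (R \<mu>) < J"
        then have "coeff (R \<mu>) (degree (R \<mu>)) = 0" by (simp add: R_def coeff_sum)
        then show False using \<open>R \<mu> \<noteq> 0\<close> by simp
      qed
      then show ?thesis using False by (simp add: Q_def degree_pcompose)
    qed simp
    have "(\<Sum>\<mu>\<in>\<Lambda>. if Q \<mu> = 0 then 0 else Suc (degree (Q \<mu>))) \<le> N"
      using sum_bounded_above[of \<Lambda> "\<lambda>\<mu>. if Q \<mu> = 0 then 0 else Suc (degree (Q \<mu>))" J] size by (simp add: N_def)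
    moreover have "(\<Sum>\<mu>\<in>\<Lambda>. poly (Q \<mu>) (of_nat k) * \<mu> ^ k) = 0" if "k < N" for k
    proof -
      have "(\<Sum>\<mu>\<in>\<Lambda>. poly (Q \<mu>) (of_nat k) * \<mu> ^ k) = (\<Sum>\<mu>\<in>\<Lambda>. \<Sum>j<J. (\<mu> ^ k * G \<mu> j p) * (p + of_nat k * period) ^ j)"
        unfolding Qk sum_distrib_right by (intro sum.cong refl) (simp add: mult_ac)
      also have "\<dots> = S (p + of_nat k * period)"
        unfolding S_def by (intro sum.cong refl) (use elim that in auto)
      also have "\<dots> = 0" using elim that by simp
      finally show ?thesis .
    qed
    ultimately have "Q \<mu> = 0"
      by (intro exp_polynomial_independent[OF \<Lambda>(1,2) _ assms(3), of 0]) auto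
    then have "R \<mu> = 0" by (simp add: Q_def pcompose_eq_0_iff)
    then have "coeff (R \<mu>) j = 0" by simp
    then show ?case using assms(4) by (simp add: R_def coeff_sum)
  qed
  then show ?thesis by (simp add: almost_zero_def hat_eq_def)
qed

lemma log_expansion_combination:
  fixes q :: "nat \<Rightarrow> complex poly"
  assumes "\<And>i. i \<le> n \<Longrightarrow> log_expansion \<Lambda> J (G i) (f i)"
  shows "log_expansion \<Lambda> J (\<lambda>\<mu> j p. \<Sum>i\<le>n. poly (q i) (exp p) * G i \<mu> j p) (\<lambda>p. \<Sum>i\<le>n. poly (q i) (exp p) * f i p)"
  unfolding log_expansion_def
proof (intro conjI ballI allI impI)
  show "finite \<Lambda>" "0 \<notin> \<Lambda>" using assms[of 0] by (auto simp: log_expansion_def)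
  show "eigenfunction \<mu> (\<lambda>p. \<Sum>i\<le>n. poly (q i) (exp p) * G i \<mu> j p)" if "\<mu> \<in> \<Lambda>" "j < J" for \<mu> j
    by (rule eigenfunction_sum, rule eigenfunction_scale) (use assms that in \<open>auto simp: log_expansion_def\<close>)
  have "eventually (\<lambda>p. \<forall>i\<in>{..n}. f i p = (\<Sum>\<mu>\<in>\<Lambda>. \<Sum>j<J. G i \<mu> j p * p ^ j)) (cosparse UNIV)"
    by (rule eventually_ball_finite) (use assms in \<open>auto simp: log_expansion_def hat_eq_def\<close>)
  then show "hat_eq (\<lambda>p. \<Sum>i\<le>n. poly (q i) (exp p) * f i p) (\<lambda>p. \<Sum>\<mu>\<in>\<Lambda>. \<Sum>j<J. (\<Sum>i\<le>n. poly (q i) (exp p) * G i \<mu> j p) * p ^ j)"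
  proof (rule hat_eqI_eventually)
    fix p assume *: "\<forall>i\<in>{..n}. f i p = (\<Sum>\<mu>\<in>\<Lambda>. \<Sum>j<J. G i \<mu> j p * p ^ j)"
    have "(\<Sum>i\<le>n. poly (q i) (exp p) * f i p) = (\<Sum>i\<le>n. \<Sum>\<mu>\<in>\<Lambda>. \<Sum>j<J. poly (q i) (exp p) * G i \<mu> j p * p ^ j)"
      using * by (simp add: sum_distrib_left mult.assoc)
    also have "\<dots> = (\<Sum>\<mu>\<in>\<Lambda>. \<Sum>i\<le>n. \<Sum>j<J. poly (q i) (exp p) * G i \<mu> j p * p ^ j)" by (rule sum.swap)
    also have "\<dots> = (\<Sum>\<mu>\<in>\<Lambda>. \<Sum>j<J. \<Sum>i\<le>n. poly (q i) (exp p) * G i \<mu> j p * p ^ j)"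
      by (intro sum.cong refl sum.swap)
    finally show "(\<Sum>i\<le>n. poly (q i) (exp p) * f i p) = (\<Sum>\<mu>\<in>\<Lambda>. \<Sum>j<J. (\<Sum>i\<le>n. poly (q i) (exp p) * G i \<mu> j p) * p ^ j)"
      by (simp add: sum_distrib_right)
  qed
qed

text \<open>Product rule: differentiating \<open>p ^ (j + 1)\<close> contributes to the coefficient
  of \<open>p ^ j\<close>. The top coefficient receives no such contribution, so it inherits the
  differential equation unchanged.\<close>

definition deriv_coeffs ::
  "nat \<Rightarrow> (complex \<Rightarrow> nat \<Rightarrow> complex \<Rightarrow> complex) \<Rightarrow> complex \<Rightarrow> nat \<Rightarrow> complex \<Rightarrow> complex" where
  "deriv_coeffs J G \<mu> j = (\<lambda>p. deriv (G \<mu> j) p + (if Suc j < J then of_nat (Suc j) * G \<mu> (Suc j) p else 0))"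

lemma log_expansion_deriv:
  assumes "log_expansion \<Lambda> J G f"
  shows "log_expansion \<Lambda> J (deriv_coeffs J G) (deriv f)"
  unfolding log_expansion_def
proof (intro conjI ballI allI impI)
  have \<Lambda>: "finite \<Lambda>" "0 \<notin> \<Lambda>" "\<And>\<mu> j. \<mu> \<in> \<Lambda> \<Longrightarrow> j < J \<Longrightarrow> eigenfunction \<mu> (G \<mu> j)"
    "hat_eq f (\<lambda>p. \<Sum>\<mu>\<in>\<Lambda>. \<Sum>j<J. G \<mu> j p * p ^ j)" using assms(1) by (auto simp: log_expansion_def)
  show "finite \<Lambda>" "0 \<notin> \<Lambda>" by fact+
  show "eigenfunction \<mu> (deriv_coeffs J G \<mu> j)" if "\<mu> \<in> \<Lambda>" "j < J" for \<mu> j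
  proof -
    have "eigenfunction \<mu> (\<lambda>p. if Suc j < J then of_nat (Suc j) * G \<mu> (Suc j) p else 0)"
      using \<Lambda>(3)[of \<mu> "Suc j"] that by (cases "Suc j < J") (auto simp: eigenfunction_zero intro: eigenfunction_cmult)
    then show ?thesis unfolding deriv_coeffs_def
      by (intro eigenfunction_add eigenfunction_deriv \<Lambda>(3) that)
  qed
  have "eventually (\<lambda>p. \<forall>(\<mu>, j)\<in>\<Lambda> \<times> {..<J}. G \<mu> j field_differentiable at p) (cosparse UNIV)"
    by (rule eventually_ball_finite)
       (use \<Lambda> eigenfunction_meromorphic in \<open>auto intro!: meromorphic_eventually_differentiable\<close>)
  then have "hat_eq (deriv (\<lambda>p. \<Sum>\<mu>\<in>\<Lambda>. \<Sum>j<J. G \<mu> j p * p ^ j)) (\<lambda>p. \<Sum>\<mu>\<in>\<Lambda>. \<Sum>j<J. deriv_coeffs J G \<mu> j p * p ^ j)"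
  proof (rule hat_eqI_eventually)
    fix p assume *: "\<forall>(\<mu>, j)\<in>\<Lambda> \<times> {..<J}. G \<mu> j field_differentiable at p"
    have "((\<lambda>p. \<Sum>\<mu>\<in>\<Lambda>. \<Sum>j<J. G \<mu> j p * p ^ j) has_field_derivative
       (\<Sum>\<mu>\<in>\<Lambda>. \<Sum>j<J. deriv (G \<mu> j) p * p ^ j + (of_nat j * p ^ (j - 1)) * G \<mu> j p)) (at p)"
    proof (intro DERIV_sum)
      fix \<mu> j assume "\<mu> \<in> \<Lambda>" "j \<in> {..<J}"
      then have "(G \<mu> j has_field_derivative deriv (G \<mu> j) p) (at p)"
        using * by (auto simp: field_differentiable_derivI)
      then show "((\<lambda>p. G \<mu> j p * p ^ j) has_field_derivative deriv (G \<mu> j) p * p ^ j + (of_nat j * p ^ (j - 1)) * G \<mu> j p) (at p)"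
        by (rule DERIV_mult) (auto intro!: derivative_eq_intros)
    qed
    then have "deriv (\<lambda>p. \<Sum>\<mu>\<in>\<Lambda>. \<Sum>j<J. G \<mu> j p * p ^ j) p =
      (\<Sum>\<mu>\<in>\<Lambda>. \<Sum>j<J. deriv (G \<mu> j) p * p ^ j + (of_nat j * p ^ (j - 1)) * G \<mu> j p)"
      by (rule DERIV_imp_deriv)
    also have "\<dots> = (\<Sum>\<mu>\<in>\<Lambda>. \<Sum>j<J. deriv_coeffs J G \<mu> j p * p ^ j)"
    proof (rule sum.cong[OF refl])
      fix \<mu>
      have "(\<Sum>j<J. of_nat j * p ^ (j - 1) * G \<mu> j p) = (\<Sum>j<J. (if Suc j < J then of_nat (Suc j) * G \<mu> (Suc j) p else 0) * p ^ j)"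
      proof (cases J)
        case (Suc J')
        have "(\<Sum>j<Suc J'. of_nat j * p ^ (j - 1) * G \<mu> j p) = (\<Sum>j<J'. of_nat (Suc j) * p ^ j * G \<mu> (Suc j) p)"
          by (subst sum.lessThan_Suc_shift) simp
        moreover have "(\<Sum>j<Suc J'. (if Suc j < Suc J' then of_nat (Suc j) * G \<mu> (Suc j) p else 0) * p ^ j) =
           (\<Sum>j<J'. of_nat (Suc j) * p ^ j * G \<mu> (Suc j) p)"
          by (simp add: mult_ac)
        ultimately show ?thesis by (simp only: Suc)
      qed simp
      then show "(\<Sum>j<J. deriv (G \<mu> j) p * p ^ j + (of_nat j * p ^ (j - 1)) * G \<mu> j p) = (\<Sum>j<J. deriv_coeffs J G \<mu> j p * p ^ j)"
        unfolding deriv_coeffs_def distrib_right sum.distrib by (simp only:)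
    qed
    finally show "deriv (\<lambda>p. \<Sum>\<mu>\<in>\<Lambda>. \<Sum>j<J. G \<mu> j p * p ^ j) p = (\<Sum>\<mu>\<in>\<Lambda>. \<Sum>j<J. deriv_coeffs J G \<mu> j p * p ^ j)" .
  qed
  then show "hat_eq (deriv f) (\<lambda>p. \<Sum>\<mu>\<in>\<Lambda>. \<Sum>j<J. deriv_coeffs J G \<mu> j p * p ^ j)"
    using hat_eq_trans[OF hat_eq_deriv[OF \<Lambda>(4)]] by blast
qed

lemma log_expansion_funpow_deriv:
  "log_expansion \<Lambda> J G f \<Longrightarrow> log_expansion \<Lambda> J ((deriv_coeffs J ^^ i) G) ((deriv ^^ i) f)"
  by (induction i) (auto intro: log_expansion_deriv)

lemma deriv_coeffs_top: "(deriv_coeffs (Suc J) ^^ i) G \<mu> J = (deriv ^^ i) (G \<mu> J)"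
  by (induction i) (auto simp: deriv_coeffs_def)

lemma log_expansion_translate:
  assumes "log_expansion \<Lambda> J G f"
  shows "log_expansion \<Lambda> J (\<lambda>\<mu> j p. \<Sum>j'<J. (of_nat (j' choose j) * s ^ (j' - j)) * G \<mu> j' (p + s)) (\<lambda>p. f (p + s))"
  unfolding log_expansion_def
proof (intro conjI ballI allI impI)
  have \<Lambda>: "finite \<Lambda>" "0 \<notin> \<Lambda>" "\<And>\<mu> j. \<mu> \<in> \<Lambda> \<Longrightarrow> j < J \<Longrightarrow> eigenfunction \<mu> (G \<mu> j)"
    "hat_eq f (\<lambda>p. \<Sum>\<mu>\<in>\<Lambda>. \<Sum>j<J. G \<mu> j p * p ^ j)" using assms(1) by (auto simp: log_expansion_def)
  show "finite \<Lambda>" "0 \<notin> \<Lambda>" by fact+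
  show "eigenfunction \<mu> (\<lambda>p. \<Sum>j'<J. (of_nat (j' choose j) * s ^ (j' - j)) * G \<mu> j' (p + s))" if "\<mu> \<in> \<Lambda>" "j < J" for \<mu> j
    by (rule eigenfunction_sum, rule eigenfunction_cmult, rule eigenfunction_translate) (use \<Lambda> that in auto)
  have "hat_eq (\<lambda>p. f (p + s)) (\<lambda>p. \<Sum>\<mu>\<in>\<Lambda>. \<Sum>j<J. G \<mu> j (p + s) * (p + s) ^ j)"
    using hat_eq_affine[OF \<Lambda>(4), of 1 s] by simp
  moreover have "(\<Sum>j<J. G \<mu> j (p + s) * (p + s) ^ j) = (\<Sum>j<J. (\<Sum>j'<J. (of_nat (j' choose j) * s ^ (j' - j)) * G \<mu> j' (p + s)) * p ^ j)" for \<mu> p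
  proof -
    have "(p + s) ^ j' = (\<Sum>j<J. of_nat (j' choose j) * p ^ j * s ^ (j' - j))" if "j' < J" for j'
    proof -
      have "(p + s) ^ j' = (\<Sum>j\<le>j'. of_nat (j' choose j) * p ^ j * s ^ (j' - j))" by (rule binomial_ring)
      also have "\<dots> = (\<Sum>j<J. of_nat (j' choose j) * p ^ j * s ^ (j' - j))"
        by (rule sum.mono_neutral_left) (use that in \<open>auto simp: binomial_eq_0\<close>)
      finally show ?thesis .
    qed
    then have "(\<Sum>j'<J. G \<mu> j' (p + s) * (p + s) ^ j') = (\<Sum>j'<J. \<Sum>j<J. (of_nat (j' choose j) * s ^ (j' - j)) * G \<mu> j' (p + s) * p ^ j)"
      by (simp add: sum_distrib_left mult_ac)
    also have "\<dots> = (\<Sum>j<J. \<Sum>j'<J. (of_nat (j' choose j) * s ^ (j' - j)) * G \<mu> j' (p + s) * p ^ j)" by (rule sum.swap)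
    finally show ?thesis by (simp add: sum_distrib_right)
  qed
  ultimately show "hat_eq (\<lambda>p. f (p + s)) (\<lambda>p. \<Sum>\<mu>\<in>\<Lambda>. \<Sum>j<J. (\<Sum>j'<J. (of_nat (j' choose j) * s ^ (j' - j)) * G \<mu> j' (p + s)) * p ^ j)"
    by simp
qed

text \<open>For the top power only the binomial coefficient \<open>J choose J\<close> survives, so a
  translation of \<open>f\<close> merely translates the top coefficient.\<close>

lemma translate_coeffs_top:
  "(\<Sum>j'<Suc J. (of_nat (j' choose J) * s ^ (j' - J)) * g j') = (g J :: complex)"
  by (simp add: binomial_eq_0)

lemma log_expansion_relation_zero:
  fixes q :: "nat \<Rightarrow> complex poly"
  assumes "\<And>i. i \<le> n \<Longrightarrow> log_expansion \<Lambda> J (G i) (f i)"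
    and "(\<lambda>p. \<Sum>i\<le>n. poly (q i) (exp p) * f i p) \<in> almost_zero" "\<mu> \<in> \<Lambda>" "j < J"
  shows "(\<lambda>p. \<Sum>i\<le>n. poly (q i) (exp p) * G i \<mu> j p) \<in> almost_zero"
  using log_expansion_unique[OF log_expansion_combination[where q = q, OF assms(1)] assms(2-4)] by blast

lemma log_expansion_top_deriv:
  assumes G: "log_expansion \<Lambda> (Suc J) G f" and D: "hat_D.has_relation f" and \<mu>: "\<mu> \<in> \<Lambda>"
  shows "hat_D.has_relation (G \<mu> J)"
proof -
  obtain n p where p: "p n \<noteq> 0" "(\<lambda>x. \<Sum>i\<le>n. poly (p i) (exp x) * (deriv ^^ i) f x) \<in> almost_zero"
    using D unfolding hat_D.has_relation_def by blast
  have "(\<lambda>x. \<Sum>i\<le>n. poly (p i) (exp x) * (deriv_coeffs (Suc J) ^^ i) G \<mu> J x) \<in> almost_zero"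
    by (rule log_expansion_relation_zero[OF _ p(2) \<mu>]) (use log_expansion_funpow_deriv[OF G] in auto)
  then show ?thesis using p(1) unfolding deriv_coeffs_top hat_D.has_relation_def by blast
qed

text \<open>The products of \<open>exp (a p)\<close> with the derivatives of \<open>g\<close> form a
  stable system, as differentiating the exponential only adds \<open>a\<close> times the same
  function.\<close>

lemma exp_mult_has_relation:
  fixes a :: complex
  assumes D: "hat_D.has_relation g" and g: "g \<in> meromorphic"
  shows "hat_D.has_relation (\<lambda>p. exp (a * p) * g p)"
proof -
  obtain n p where p: "p n \<noteq> 0" "(\<lambda>x. \<Sum>i\<le>n. poly (p i) (exp x) * (deriv ^^ i) g x) \<in> almost_zero"
    using D unfolding hat_D.has_relation_def by blast
  note st = hat_D.relation_stable[OF p g]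
  define w where "w = (\<lambda>i x. exp (a * x) * (deriv ^^ i) g x)"
  have em: "(\<lambda>x. exp (a * x)) meromorphic_on UNIV"
    by (intro analytic_on_imp_meromorphic_on analytic_intros)
  have wm: "(\<lambda>x. exp (a * x) * h x) \<in> meromorphic" if "h \<in> meromorphic" for h
    using meromorphic_on_mult[OF em] that by simp
  have span: "(\<lambda>x. exp (a * x) * v x) \<in> almost.sspan {..<n} w"
    if "v \<in> almost.sspan {..<n} (\<lambda>i. (deriv ^^ i) g)" for v
  proof -
    obtain d u where d: "d \<noteq> 0" "(\<lambda>x. poly d (exp x) * v x - (\<Sum>j<n. poly (u j) (exp x) * (deriv ^^ j) g x)) \<in> almost_zero"
      using \<open>v \<in> _\<close> by (rule almost.sspanE)
    show ?thesis
    proof (rule almost.sspanI[OF d(1), of _ u])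
      have "eventually (\<lambda>x. poly d (exp x) * v x - (\<Sum>j<n. poly (u j) (exp x) * (deriv ^^ j) g x) = 0) (cosparse UNIV)"
        using d(2) by (simp add: almost_zero_def hat_eq_def)
      then show "(\<lambda>x. poly d (exp x) * (exp (a * x) * v x) - (\<Sum>j<n. poly (u j) (exp x) * w j x)) \<in> almost_zero"
        unfolding almost_zero_def hat_eq_def mem_Collect_eq
        by eventually_elim (simp add: w_def mult.left_commute[of _ "exp (a * _)"] sum_distrib_left[symmetric])
    qed
  qed
  have "hat_D.stable {..<n} w"
    unfolding hat_D.stable_def
  proof (intro conjI ballI)
    fix j assume j: "j \<in> {..<n}"
    have gj: "(deriv ^^ j) g \<in> meromorphic" by (rule hat_D.C_funpow[OF g])
    then show "w j \<in> meromorphic" unfolding w_def by (rule wm)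
    have "eventually (\<lambda>z. (deriv ^^ j) g field_differentiable at z) (cosparse UNIV)"
      using meromorphic_eventually_differentiable gj by blast
    then have "hat_eq (deriv (w j)) (\<lambda>x. a * w j x + exp (a * x) * deriv ((deriv ^^ j) g) x)"
    proof (rule hat_eqI_eventually)
      fix z assume "(deriv ^^ j) g field_differentiable at z"
      then have "((deriv ^^ j) g has_field_derivative deriv ((deriv ^^ j) g) z) (at z)"
        by (simp add: field_differentiable_derivI)
      then have "(w j has_field_derivative a * w j z + exp (a * z) * deriv ((deriv ^^ j) g) z) (at z)"
        unfolding w_def by (auto intro!: derivative_eq_intros)
      then show "deriv (w j) z = a * w j z + exp (a * z) * deriv ((deriv ^^ j) g) z" by (rule DERIV_imp_deriv)
    qed
    moreover have "(\<lambda>x. a * w j x + exp (a * x) * deriv ((deriv ^^ j) g) x) \<in> almost.sspan {..<n} w"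
      by (rule almost.sspan_add[OF almost.sspan_cmult[OF almost.sspan_base[OF _ j]] span])
         (use st(1) j in \<open>auto simp: hat_D.stable_def\<close>)
    ultimately show "deriv (w j) \<in> almost.sspan {..<n} w"
      using almost.sspan_cong[of _ "{..<n}" w "deriv (w j)"] by (simp add: diff_almost_zero_iff)
  qed simp
  then show ?thesis by (rule hat_D.has_relationI_sspan[OF _ span[OF st(2)] wm[OF g]])
qed

section \<open>The coefficient of the highest power of the logarithm\<close>

text \<open>Dilations commute with the monodromy, so the relations separate by multipliers and each
  top coefficient satisfies them on its own. With \<open>exp (\<alpha> * period) = \<mu>\<close>,
  the twist by \<open>exp (- \<alpha> p)\<close> makes it periodic, hence rational in
  \<open>x\<close>.\<close>

lemma top_coefficient_dilation:
  assumes c: "admissible (CaseQ q l)" and G: "log_expansion \<Lambda> (Suc J) G f"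
    and D: "hat_D.has_relation f"
    and S: "skew_operator.has_relation exp almost_zero (hat_sigma (CaseQ q l)) f"
    and \<mu>: "\<mu> \<in> \<Lambda>"
  shows "power_log_form (CaseQ q l) (\<lambda>p. G \<mu> J p * p ^ J)"
proof -
  interpret S: skew_operator exp almost_zero meromorphic "hat_sigma (CaseQ q l)" "sigma_poly (CaseQ q l)" "\<lambda>_. 0"
    by (rule hat_sigma_skew_operator[OF c])
  obtain m b where b: "b m \<noteq> 0" "(\<lambda>x. \<Sum>i\<le>m. poly (b i) (exp x) * (hat_sigma (CaseQ q l) ^^ i) f x) \<in> almost_zero"
    using S unfolding S.has_relation_def by blast
  have \<mu>0: "\<mu> \<noteq> 0" using G \<mu> by (auto simp: log_expansion_def)
  have ef: "eigenfunction \<mu> (G \<mu> J)" using G \<mu> by (auto simp: log_expansion_def)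
  define \<alpha> where "\<alpha> = Ln \<mu> / period"
  have \<alpha>: "exp (\<alpha> * period) = \<mu>" using \<mu>0 by (simp add: \<alpha>_def)
  define g where "g = (\<lambda>p. exp (- \<alpha> * p) * G \<mu> J p)"
  have gm: "g \<in> meromorphic"
  proof -
    have "(\<lambda>x. exp (- \<alpha> * x)) meromorphic_on UNIV"
      by (intro analytic_on_imp_meromorphic_on analytic_intros)
    then show ?thesis unfolding g_def using eigenfunction_meromorphic[OF ef] by (simp add: meromorphic_on_mult)
  qed
  have per: "hat_eq (\<lambda>p. g (p + period)) g"
    using eigenfunction_eventually[OF ef]
  proof (rule hat_eqI_eventually)
    fix p assume "G \<mu> J (p + period) = \<mu> * G \<mu> J p"
    moreover have "exp (- \<alpha> * (p + period)) * \<mu> = exp (- \<alpha> * p)"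
      unfolding \<alpha>[symmetric] by (simp add: exp_add[symmetric] algebra_simps del: exp_add)
    ultimately show "g (p + period) = g p" unfolding g_def by (metis mult.assoc)
  qed
  have "hat_D.has_relation g"
    unfolding g_def by (rule exp_mult_has_relation[OF log_expansion_top_deriv[OF G D \<mu>] eigenfunction_meromorphic[OF ef]])
  moreover have "S.has_relation g"
  proof -
    have "(\<lambda>x. \<Sum>i\<le>m. poly (b i) (exp x) * (\<Sum>j'<Suc J. (of_nat (j' choose J) * (of_nat i * l) ^ (j' - J)) * G \<mu> j' (x + of_nat i * l))) \<in> almost_zero"
      by (rule log_expansion_relation_zero[where j = J and f = "\<lambda>i x. f (x + of_nat i * l)", OF log_expansion_translate[OF G] _ \<mu>])
         (use b(2) in \<open>simp_all add: funpow_hat_sigma\<close>)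
    then have "(\<lambda>x. \<Sum>i\<le>m. poly (b i) (exp x) * G \<mu> J (x + of_nat i * l)) \<in> almost_zero"
      unfolding translate_coeffs_top .
    then have ev: "eventually (\<lambda>x. (\<Sum>i\<le>m. poly (b i) (exp x) * G \<mu> J (x + of_nat i * l)) = 0) (cosparse UNIV)"
      by (simp add: almost_zero_def hat_eq_def)
    \<comment> \<open>A dilation changes the twisting factor by a constant only, and that constant
      goes into the coefficient.\<close>
    have tm: "poly (smult (exp (\<alpha> * (of_nat i * l))) (b i)) (exp x) * (hat_sigma (CaseQ q l) ^^ i) g x =
      exp (- \<alpha> * x) * (poly (b i) (exp x) * G \<mu> J (x + of_nat i * l))" for i x
    proof -
      have "exp (\<alpha> * (of_nat i * l)) * exp (- \<alpha> * (x + of_nat i * l)) = exp (- \<alpha> * x)"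
        by (simp add: exp_add[symmetric] algebra_simps del: exp_add)
      then show ?thesis by (simp add: funpow_hat_sigma g_def)
    qed
    from ev have "(\<lambda>x. \<Sum>i\<le>m. poly (smult (exp (\<alpha> * (of_nat i * l))) (b i)) (exp x) * (hat_sigma (CaseQ q l) ^^ i) g x) \<in> almost_zero"
      unfolding almost_zero_def hat_eq_def mem_Collect_eq tm sum_distrib_left[symmetric] by eventually_elim simp
    then show ?thesis using b(1) by (intro S.has_relationI[of m m "\<lambda>i. smult (exp (\<alpha> * (of_nat i * l))) (b i)"]) auto
  qed
  ultimately obtain u v where uv: "v \<noteq> 0" "hat_eq g (\<lambda>p. poly u (exp p) / poly v (exp p))"
    using periodic_bifinite_rational[OF c gm per] by blast
  have "hat_eq (\<lambda>p. G \<mu> J p * p ^ J) (\<lambda>p. (poly u (exp p) / poly v (exp p)) * exp (\<alpha> * p) * p ^ J)"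
    using uv(2)[unfolded hat_eq_def]
  proof (rule hat_eqI_eventually)
    fix p assume "g p = poly u (exp p) / poly v (exp p)"
    moreover have "g p * exp (\<alpha> * p) = G \<mu> J p" by (simp add: g_def exp_minus)
    ultimately show "G \<mu> J p * p ^ J = (poly u (exp p) / poly v (exp p)) * exp (\<alpha> * p) * p ^ J" by metis
  qed
  moreover have "power_log_form (CaseQ q l) (\<lambda>p. (poly u (exp p) / poly v (exp p)) * exp (\<alpha> * p) * p ^ J)"
    by (rule power_log_form_term[OF _ hat_ratfunsI[OF uv(1)]]) simp
  ultimately show ?thesis by (rule power_log_form_cong[rotated])
qed

text \<open>For a linear factor, \<open>X - z\<close> divides \<open>X ^ N - z ^ N\<close>;
  composition respects products.\<close>

lemma poly_dvd_pcompose_monom: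
  fixes v :: "complex poly"
  assumes "v \<noteq> 0" "N > 0"
  shows "\<exists>V. V \<noteq> 0 \<and> v dvd pcompose V (monom 1 N)"
  using assms(1)
proof (induction "degree v" arbitrary: v)
  case 0
  then show ?case by (intro exI[of _ 1]) (simp add: is_unit_iff_degree pcompose_1)
next
  case (Suc d)
  then obtain z where "poly v z = 0"
    using fundamental_theorem_of_algebra_alt[of v] by fastforce
  then obtain r where r: "v = [:-z, 1:] * r" by (metis poly_eq_0_iff_dvd dvdE)
  have r0: "r \<noteq> 0" using Suc.prems r by auto
  have "degree v = Suc (degree r)" unfolding r using r0 by (subst degree_mult_eq) auto
  then obtain V where V: "V \<noteq> 0" "r dvd pcompose V (monom 1 N)" using Suc.hyps(1)[of r] Suc.hyps(2) r0 by auto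
  have "[:-z, 1:] dvd pcompose [:-(z ^ N), 1:] (monom 1 N)"
    by (simp add: poly_eq_0_iff_dvd[symmetric] poly_pcompose poly_monom)
  then have "v dvd pcompose ([:-(z ^ N), 1:] * V) (monom 1 N)"
    unfolding r pcompose_mult using V(2) by (rule mult_dvd_mono)
  moreover have "[:-(z ^ N), 1:] * V \<noteq> 0" using V(1) by (subst mult_eq_0_iff) auto
  ultimately show ?case by blast
qed

text \<open>In the variable \<open>y = exp (p / N)\<close> the denominator is enlarged to a
  polynomial in \<open>y ^ N = x\<close>; each monomial \<open>y ^ k\<close> of the numerator is
  then the power \<open>x ^ (k / N)\<close>.\<close>

lemma power_log_form_root:
  assumes v: "v \<noteq> 0" and N: "N > 0"
    and g: "hat_eq g (\<lambda>p. poly u (exp (p / of_nat N)) / poly v (exp (p / of_nat N)))"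
  shows "power_log_form (CaseM q) (\<lambda>p. g p * p ^ J)"
proof -
  obtain V w where V: "V \<noteq> 0" "pcompose V (monom 1 N) = v * w"
    using poly_dvd_pcompose_monom[OF v N] by (auto simp: dvd_def)
  define P where "P = u * w"
  let ?t = "\<lambda>k p. (poly [:coeff P k:] (exp p) / poly V (exp p)) * exp ((of_nat k / of_nat N) * p) * p ^ J"
  have nz: "eventually (\<lambda>p. poly V (exp p) \<noteq> 0) (cosparse UNIV)" by (rule eventually_poly_exp_nonzero[OF V(1)])
  have "hat_eq (\<lambda>p. g p * p ^ J) (\<lambda>p. \<Sum>k\<le>degree P. ?t k p)"
  proof (rule hat_eqI_eventually[OF eventually_conj[OF g[unfolded hat_eq_def] nz]])
    fix p :: complex
    define y where "y = exp (p / of_nat N)"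
    assume "g p = poly u (exp (p / of_nat N)) / poly v (exp (p / of_nat N)) \<and> poly V (exp p) \<noteq> 0"
    then have gp: "g p = poly u y / poly v y" and V0: "poly V (exp p) \<noteq> 0" by (auto simp: y_def)
    have yN: "y ^ N = exp p" using N by (simp add: y_def exp_of_nat_mult[symmetric])
    have vw: "poly v y * poly w y = poly V (exp p)"
      using arg_cong[OF V(2), of "\<lambda>P. poly P y"] by (simp add: poly_pcompose poly_monom yN)
    then have "g p = poly P y / poly V (exp p)"
      using V0 unfolding gp P_def by (auto simp: field_simps simp flip: vw)
    moreover have "y ^ k = exp ((of_nat k / of_nat N) * p)" for k
      by (simp add: y_def exp_of_nat_mult[symmetric])
    ultimately show "g p * p ^ J = (\<Sum>k\<le>degree P. ?t k p)"
      by (simp add: poly_altdef sum_distrib_right sum_divide_distrib)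
  qed
  moreover have "power_log_form (CaseM q) (\<lambda>p. \<Sum>k\<le>degree P. ?t k p)"
    by (rule power_log_form_sum, rule power_log_form_term[OF _ hat_ratfunsI[OF V(1)]]) simp
  ultimately show ?thesis by (rule power_log_form_cong[rotated])
qed

lemma dilate_has_relation:
  assumes D: "hat_D.has_relation g" and g: "g \<in> meromorphic" and N: "N > 0"
  shows "hat_D.has_relation (\<lambda>p. g (of_nat N * p))"
proof -
  obtain n p where p: "p n \<noteq> 0" "(\<lambda>x. \<Sum>i\<le>n. poly (p i) (exp x) * (deriv ^^ i) g x) \<in> almost_zero"
    using D unfolding hat_D.has_relation_def by blast
  let ?N = "of_nat N :: complex"
  have dd: "hat_eq ((deriv ^^ i) (\<lambda>p. g (?N * p))) (\<lambda>p. ?N ^ i * (deriv ^^ i) g (?N * p))" for i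
  proof (induction i)
    case (Suc i)
    have "(deriv ^^ i) g \<in> meromorphic" by (rule hat_D.C_funpow[OF g])
    then have "eventually (\<lambda>z. (deriv ^^ i) g field_differentiable at z) (cosparse UNIV)"
      using meromorphic_eventually_differentiable by blast
    from eventually_cosparse_affine[OF this, of ?N 0]
    have "eventually (\<lambda>z. (deriv ^^ i) g field_differentiable at (?N * z)) (cosparse UNIV)" using N by simp
    then have "hat_eq (deriv (\<lambda>p. ?N ^ i * (deriv ^^ i) g (?N * p))) (\<lambda>p. ?N ^ Suc i * deriv ((deriv ^^ i) g) (?N * p))"
    proof (rule hat_eqI_eventually)
      fix z assume "(deriv ^^ i) g field_differentiable at (?N * z)"
      then have "((deriv ^^ i) g has_field_derivative deriv ((deriv ^^ i) g) (?N * z)) (at (?N * z))"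
        by (simp add: field_differentiable_derivI)
      from DERIV_cmult[OF DERIV_chain2[OF this DERIV_cmult_Id], of "?N ^ i"]
      show "deriv (\<lambda>p. ?N ^ i * (deriv ^^ i) g (?N * p)) z = ?N ^ Suc i * deriv ((deriv ^^ i) g) (?N * z)"
        by (intro DERIV_imp_deriv) (simp add: mult_ac)
    qed
    then show ?case using hat_eq_trans[OF hat_eq_deriv[OF Suc.IH]] by simp
  qed simp
  have ev: "eventually (\<lambda>x. (\<Sum>i\<le>n. poly (p i) (exp (?N * x)) * (deriv ^^ i) g (?N * x)) = 0) (cosparse UNIV)"
    using eventually_cosparse_affine[of "\<lambda>x. (\<Sum>i\<le>n. poly (p i) (exp x) * (deriv ^^ i) g x) = 0" ?N 0] p(2) N
    by (simp add: almost_zero_def hat_eq_def)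
  have ev2: "eventually (\<lambda>x. \<forall>i\<in>{..n}. (deriv ^^ i) (\<lambda>p. g (?N * p)) x = ?N ^ i * (deriv ^^ i) g (?N * x)) (cosparse UNIV)"
    by (rule eventually_ball_finite) (use dd in \<open>auto simp: hat_eq_def\<close>)
  let ?k = "\<lambda>i. smult (inverse (?N ^ i)) (pcompose (p i) (monom 1 N))"
  have "(\<lambda>x. \<Sum>i\<le>n. poly (?k i) (exp x) * (deriv ^^ i) (\<lambda>p. g (?N * p)) x) \<in> almost_zero"
    using ev ev2 unfolding almost_zero_def hat_eq_def mem_Collect_eq
  proof eventually_elim
    case (elim x)
    have "poly (?k i) (exp x) * (deriv ^^ i) (\<lambda>p. g (?N * p)) x = poly (p i) (exp (?N * x)) * (deriv ^^ i) g (?N * x)"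
      if "i \<le> n" for i
      using elim(2) that N by (simp add: poly_pcompose poly_monom exp_of_nat_mult[symmetric])
    then show ?case using elim(1) by simp
  qed
  moreover have "?k n \<noteq> 0" using p(1) N by (simp add: pcompose_eq_0_iff degree_monom_eq)
  ultimately show ?thesis by (intro hat_D.has_relationI[of n n ?k]) auto
qed

text \<open>Iterating the choice of \<open>\<kappa>\<close> runs into a cycle, on which the exponents of \<open>q\<close> strictly increase.\<close>

lemma finite_power_cycle:
  fixes \<Lambda> :: "complex set"
  assumes fin: "finite \<Lambda>" and nz: "0 \<notin> \<Lambda>" and q: "q \<ge> (2::nat)"
    and step: "\<And>\<mu>. \<mu> \<in> \<Lambda> \<Longrightarrow> \<exists>\<kappa>\<in>\<Lambda>. \<exists>i<m. \<kappa> ^ (q ^ i) = \<mu> ^ (q ^ m)"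
    and \<mu>: "\<mu> \<in> \<Lambda>"
  shows "\<exists>\<kappa>\<in>\<Lambda>. \<exists>N>0. \<kappa> ^ N = 1"
proof -
  from step obtain \<phi> where \<phi>: "\<And>\<mu>. \<mu> \<in> \<Lambda> \<Longrightarrow> \<phi> \<mu> \<in> \<Lambda> \<and> (\<exists>i<m. \<phi> \<mu> ^ (q ^ i) = \<mu> ^ (q ^ m))" by metis
  have in\<Lambda>: "(\<phi> ^^ k) \<mu> \<in> \<Lambda>" for k by (induction k) (use \<mu> \<phi> in auto)
  have it: "\<exists>a b. a + d \<le> b \<and> (\<phi> ^^ (k + d)) \<mu> ^ (q ^ a) = (\<phi> ^^ k) \<mu> ^ (q ^ b)" for k d
  proof (induction d)
    case 0
    show ?case by (intro exI[of _ 0]) simp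
  next
    case (Suc d)
    then obtain a b where ab: "a + d \<le> b" "(\<phi> ^^ (k + d)) \<mu> ^ (q ^ a) = (\<phi> ^^ k) \<mu> ^ (q ^ b)" by blast
    define x where "x = (\<phi> ^^ (k + d)) \<mu>"
    obtain i where i: "i < m" "\<phi> x ^ (q ^ i) = x ^ (q ^ m)" using \<phi>[of x] in\<Lambda> by (auto simp: x_def)
    have "\<phi> x ^ (q ^ (i + a)) = (x ^ (q ^ a)) ^ (q ^ m)"
      by (metis i(2) power_add power_mult mult.commute)
    also have "\<dots> = (\<phi> ^^ k) \<mu> ^ (q ^ (b + m))" using ab(2) by (metis x_def power_add power_mult)
    finally show ?case using ab(1) i(1)
      by (intro exI[of _ "i + a"] exI[of _ "b + m"]) (auto simp: x_def)
  qed
  have "\<not> inj (\<lambda>k. (\<phi> ^^ k) \<mu>)"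
  proof
    assume "inj (\<lambda>k. (\<phi> ^^ k) \<mu>)"
    moreover have "range (\<lambda>k. (\<phi> ^^ k) \<mu>) \<subseteq> \<Lambda>" using in\<Lambda> by auto
    ultimately show False using fin finite_imageD finite_subset infinite_UNIV_nat by blast
  qed
  then obtain k k' where "k < k'" "(\<phi> ^^ k) \<mu> = (\<phi> ^^ k') \<mu>" unfolding inj_def by (metis linorder_neqE_nat)
  then obtain d where d: "d > 0" "(\<phi> ^^ (k + d)) \<mu> = (\<phi> ^^ k) \<mu>" by (metis less_imp_add_positive)
  define \<kappa> where "\<kappa> = (\<phi> ^^ k) \<mu>"
  obtain a b where ab: "a + d \<le> b" "\<kappa> ^ (q ^ a) = \<kappa> ^ (q ^ b)" using it[of d k] d(2) by (auto simp: \<kappa>_def)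
  have lt: "q ^ a < q ^ b" by (rule power_strict_increasing) (use ab d q in auto)
  have k0: "\<kappa> \<noteq> 0" using in\<Lambda>[of k] nz by (auto simp: \<kappa>_def)
  have "\<kappa> ^ (q ^ a) * \<kappa> ^ (q ^ b - q ^ a) = \<kappa> ^ (q ^ a)"
    unfolding power_add[symmetric] using lt ab(2) by simp
  then have "\<kappa> ^ (q ^ b - q ^ a) = 1" using k0 by simp
  then show ?thesis using lt in\<Lambda>[of k] unfolding \<kappa>_def by (intro bexI exI[of _ "q ^ b - q ^ a"]) auto
qed

lemma common_torsion_exponent:
  fixes A :: "complex set"
  assumes "finite A" "\<And>\<mu>. \<mu> \<in> A \<Longrightarrow> \<exists>n>0. \<mu> ^ n = 1"
  shows "\<exists>N>0. \<forall>\<mu>\<in>A. \<mu> ^ N = 1"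
  using assms
proof (induction A rule: finite_induct)
  case (insert a A)
  then obtain N where N: "N > 0" "\<forall>\<mu>\<in>A. \<mu> ^ N = 1" by auto
  obtain n where n: "n > 0" "a ^ n = 1" using insert.prems by blast
  have "\<forall>\<mu>\<in>insert a A. \<mu> ^ (n * N) = 1"
    using N n by (auto simp: power_mult) (metis mult.commute power_mult power_one)
  then show ?case using N n by (intro exI[of _ "n * N"]) auto
qed auto

text \<open>The substitution \<open>p \<mapsto> q ^ i p\<close> takes the multiplier
  \<open>\<mu>\<close> to \<open>\<mu> ^ (q ^ i)\<close>, so the component for \<open>\<nu>\<close>
  collects, for each \<open>i\<close>, all \<open>\<mu>\<close> with that power equal to
  \<open>\<nu>\<close>. The set \<open>\<Lambda>'\<close> holds every multiplier that can arise, so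
  that uniqueness of expansions applies to all terms at once.\<close>

lemma log_expansion_mahler_top:
  assumes q: "q > 0" and G: "log_expansion \<Lambda> (Suc J) G f"
    and b: "(\<lambda>x. \<Sum>i\<le>m. poly (b i) (exp x) * f (of_nat (q ^ i) * x)) \<in> almost_zero"
  shows "(\<lambda>x. \<Sum>i\<le>m. poly (b i) (exp x) * of_nat ((q ^ i) ^ J) *
    (\<Sum>\<mu>\<in>{\<mu>\<in>\<Lambda>. \<mu> ^ (q ^ i) = \<nu>}. G \<mu> J (of_nat (q ^ i) * x))) \<in> almost_zero"
proof -
  have \<Lambda>: "finite \<Lambda>" "0 \<notin> \<Lambda>" "\<And>\<mu> j. \<mu> \<in> \<Lambda> \<Longrightarrow> j < Suc J \<Longrightarrow> eigenfunction \<mu> (G \<mu> j)"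
    "hat_eq f (\<lambda>p. \<Sum>\<mu>\<in>\<Lambda>. \<Sum>j<Suc J. G \<mu> j p * p ^ j)" using G by (auto simp: log_expansion_def)
  define \<Lambda>' where "\<Lambda>' = insert \<nu> (\<Union>i\<le>m. (\<lambda>\<mu>. \<mu> ^ (q ^ i)) ` \<Lambda>) - {0}"
  define H where "H = (\<lambda>i \<nu> j p. of_nat ((q ^ i) ^ j) * (\<Sum>\<mu>\<in>{\<mu>\<in>\<Lambda>. \<mu> ^ (q ^ i) = \<nu>}. G \<mu> j (of_nat (q ^ i) * p)))"
  have E: "log_expansion \<Lambda>' (Suc J) (H i) (\<lambda>x. f (of_nat (q ^ i) * x))" if i: "i \<le> m" for i
    unfolding log_expansion_def
  proof (intro conjI ballI allI impI)
    show "finite \<Lambda>'" "0 \<notin> \<Lambda>'" using \<Lambda>(1) by (auto simp: \<Lambda>'_def)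
    fix \<nu> j assume "\<nu> \<in> \<Lambda>'" "j < Suc J"
    have "eigenfunction \<nu> (\<lambda>p. G \<mu> j (of_nat (q ^ i) * p))" if "\<mu> \<in> \<Lambda>" "\<mu> ^ (q ^ i) = \<nu>" for \<mu>
      using eigenfunction_dilate[OF \<Lambda>(3)[OF that(1) \<open>j < Suc J\<close>], of "q ^ i"] that(2) q by simp
    then show "eigenfunction \<nu> (H i \<nu> j)"
      unfolding H_def by (intro eigenfunction_cmult eigenfunction_sum) auto
  next
    have sub: "(\<lambda>\<mu>. \<mu> ^ (q ^ i)) ` \<Lambda> \<subseteq> \<Lambda>'" using \<Lambda>(2) i q by (auto simp: \<Lambda>'_def)
    have fin': "finite \<Lambda>'" using \<Lambda>(1) by (auto simp: \<Lambda>'_def)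
    have "hat_eq (\<lambda>p. f (of_nat (q ^ i) * p)) (\<lambda>p. \<Sum>\<mu>\<in>\<Lambda>. \<Sum>j<Suc J. G \<mu> j (of_nat (q ^ i) * p) * (of_nat (q ^ i) * p) ^ j)"
      using hat_eq_affine[OF \<Lambda>(4), of "of_nat (q ^ i)" 0] q by simp
    moreover have "(\<Sum>\<mu>\<in>\<Lambda>. \<Sum>j<Suc J. G \<mu> j (of_nat (q ^ i) * p) * (of_nat (q ^ i) * p) ^ j) =
      (\<Sum>\<nu>\<in>\<Lambda>'. \<Sum>j<Suc J. H i \<nu> j p * p ^ j)" for p
    proof -
      have "(\<Sum>\<mu>\<in>\<Lambda>. \<Sum>j<Suc J. G \<mu> j (of_nat (q ^ i) * p) * (of_nat (q ^ i) * p) ^ j) =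
        (\<Sum>\<nu>\<in>\<Lambda>'. \<Sum>\<mu>\<in>{\<mu>\<in>\<Lambda>. \<mu> ^ (q ^ i) = \<nu>}. \<Sum>j<Suc J. G \<mu> j (of_nat (q ^ i) * p) * (of_nat (q ^ i) * p) ^ j)"
        by (rule sum.group[OF \<Lambda>(1) fin' sub, symmetric])
      also have "\<dots> = (\<Sum>\<nu>\<in>\<Lambda>'. \<Sum>j<Suc J. \<Sum>\<mu>\<in>{\<mu>\<in>\<Lambda>. \<mu> ^ (q ^ i) = \<nu>}. G \<mu> j (of_nat (q ^ i) * p) * (of_nat (q ^ i) * p) ^ j)"
        by (intro sum.cong refl sum.swap)
      finally show ?thesis
        by (simp add: H_def sum_distrib_left sum_distrib_right power_mult_distrib mult_ac del: sum.lessThan_Suc)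
    qed
    ultimately show "hat_eq (\<lambda>p. f (of_nat (q ^ i) * p)) (\<lambda>p. \<Sum>\<nu>\<in>\<Lambda>'. \<Sum>j<Suc J. H i \<nu> j p * p ^ j)" by simp
  qed
  show ?thesis
  proof (cases "\<nu> = 0")
    case True
    then have e: "{\<mu>\<in>\<Lambda>. \<mu> ^ (q ^ i) = \<nu>} = {}" for i using \<Lambda>(2) by auto
    show ?thesis unfolding e by (simp add: almost.Z_zero)
  next
    case False
    then have "(\<lambda>x. \<Sum>i\<le>m. poly (b i) (exp x) * H i \<nu> J x) \<in> almost_zero"
      by (intro log_expansion_relation_zero[OF E b]) (auto simp: \<Lambda>'_def)
    then show ?thesis by (simp add: H_def mult.assoc)
  qed
qed

text \<open>The Mahler operator mixes multipliers, so the sum over \<open>\<mu>\<close> is treated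
  as a whole. Once all multipliers with nonzero top coefficient are known to be \<open>N\<close>-th
  roots of unity, the sum becomes periodic after \<open>p \<mapsto> N p\<close>. That they are roots
  of unity is read off from single components of the relation.\<close>

lemma top_coefficient_mahler:
  assumes c: "admissible (CaseM q)" and G: "log_expansion \<Lambda> (Suc J) G f"
    and D: "hat_D.has_relation f"
    and S: "skew_operator.has_relation exp almost_zero (hat_sigma (CaseM q)) f"
  shows "power_log_form (CaseM q) (\<lambda>p. (\<Sum>\<mu>\<in>\<Lambda>. G \<mu> J p) * p ^ J)"
proof -
  interpret S: skew_operator exp almost_zero meromorphic "hat_sigma (CaseM q)" "sigma_poly (CaseM q)" "\<lambda>_. 0"
    by (rule hat_sigma_skew_operator[OF c])
  have q: "q \<ge> 2" using c by simp
  have \<Lambda>: "finite \<Lambda>" "0 \<notin> \<Lambda>" "\<And>\<mu>. \<mu> \<in> \<Lambda> \<Longrightarrow> eigenfunction \<mu> (G \<mu> J)" using G by (auto simp: log_expansion_def)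
  obtain m b where b: "b m \<noteq> 0" "(\<lambda>x. \<Sum>i\<le>m. poly (b i) (exp x) * (hat_sigma (CaseM q) ^^ i) f x) \<in> almost_zero"
    using S unfolding S.has_relation_def by blast
  have b2: "(\<lambda>x. \<Sum>i\<le>m. poly (b i) (exp x) * f (of_nat (q ^ i) * x)) \<in> almost_zero"
    using b(2) unfolding funpow_hat_sigma .
  note top = log_expansion_mahler_top[OF _ G b2]
  define \<Lambda>1 where "\<Lambda>1 = {\<mu>\<in>\<Lambda>. G \<mu> J \<notin> almost_zero}"
  \<comment> \<open>Multipliers that occur and are not roots of unity; the aim is to show that there
    are none.\<close>
  define \<Lambda>2 where "\<Lambda>2 = {\<mu>\<in>\<Lambda>1. \<not> (\<exists>n>0. \<mu> ^ n = 1)}"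
  have "\<exists>\<kappa>\<in>\<Lambda>2. \<exists>i<m. \<kappa> ^ (q ^ i) = \<mu> ^ (q ^ m)" if \<mu>: "\<mu> \<in> \<Lambda>2" for \<mu>
  proof (rule ccontr)
    assume no: "\<not> ?thesis"
    define \<nu> where "\<nu> = \<mu> ^ (q ^ m)"
    have no1: "\<kappa> ^ (q ^ i) \<noteq> \<nu>" if \<kappa>: "\<kappa> \<in> \<Lambda>1" "i < m" for \<kappa> i
    proof
      assume eq: "\<kappa> ^ (q ^ i) = \<nu>"
      then have "\<kappa> \<notin> \<Lambda>2" using no that by (auto simp: \<nu>_def)
      then obtain n where n: "n > 0" "\<kappa> ^ n = 1" using \<kappa>(1) by (auto simp: \<Lambda>2_def)
      have "\<mu> ^ (q ^ m * n) = (\<kappa> ^ n) ^ (q ^ i)" by (metis eq \<nu>_def mult.commute power_mult)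
      then have "\<mu> ^ (q ^ m * n) = 1" using n by simp
      moreover have "q ^ m * n > 0" using n q by simp
      ultimately have "\<exists>n>0. \<mu> ^ n = 1" by blast
      then show False using \<mu> unfolding \<Lambda>2_def by blast
    qed
    \<comment> \<open>In the component for \<open>\<nu> = \<mu> ^ (q ^ m)\<close> only the term of
      order \<open>m\<close> survives, so the sum over \<open>K\<close> vanishes, and by uniqueness
      so does the coefficient for \<open>\<mu>\<close>.\<close>
    define K where "K = {\<kappa>\<in>\<Lambda>. \<kappa> ^ (q ^ m) = \<nu>}"
    have "eventually (\<lambda>x. \<forall>(i,\<kappa>)\<in>{..<m} \<times> (\<Lambda> - \<Lambda>1). G \<kappa> J (of_nat (q ^ i) * x) = 0) (cosparse UNIV)"
    proof (rule eventually_ball_finite; clarsimp simp: \<Lambda>(1))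
      fix i \<kappa> assume "\<kappa> \<in> \<Lambda>" "\<kappa> \<notin> \<Lambda>1"
      then have "eventually (\<lambda>x. G \<kappa> J x = 0) (cosparse UNIV)" by (simp add: \<Lambda>1_def almost_zero_def hat_eq_def)
      from eventually_cosparse_affine[OF this, of "of_nat q ^ i" 0]
      show "eventually (\<lambda>x. G \<kappa> J (of_nat q ^ i * x) = 0) (cosparse UNIV)" using q by simp
    qed
    moreover have "eventually (\<lambda>x. poly (b m) (exp x) \<noteq> 0) (cosparse UNIV)" by (rule eventually_poly_exp_nonzero[OF b(1)])
    moreover have "eventually (\<lambda>x. (\<Sum>i\<le>m. poly (b i) (exp x) * of_nat ((q ^ i) ^ J) *
        (\<Sum>\<mu>\<in>{\<mu>\<in>\<Lambda>. \<mu> ^ (q ^ i) = \<nu>}. G \<mu> J (of_nat (q ^ i) * x))) = 0) (cosparse UNIV)"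
      using top[of \<nu>] q by (simp add: almost_zero_def hat_eq_def)
    ultimately have "eventually (\<lambda>x. (\<Sum>\<kappa>\<in>K. G \<kappa> J (of_nat (q ^ m) * x)) = 0) (cosparse UNIV)"
    proof eventually_elim
      case (elim x)
      have "(\<Sum>\<mu>\<in>{\<mu>\<in>\<Lambda>. \<mu> ^ (q ^ i) = \<nu>}. G \<mu> J (of_nat (q ^ i) * x)) = 0" if "i < m" for i
        by (rule sum.neutral) (use elim(1) that no1 in auto)
      then have "(\<Sum>i<m. poly (b i) (exp x) * of_nat ((q ^ i) ^ J) *
        (\<Sum>\<mu>\<in>{\<mu>\<in>\<Lambda>. \<mu> ^ (q ^ i) = \<nu>}. G \<mu> J (of_nat (q ^ i) * x))) = 0"
        by (intro sum.neutral) auto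
      then have "poly (b m) (exp x) * of_nat ((q ^ m) ^ J) * (\<Sum>\<mu>\<in>K. G \<mu> J (of_nat (q ^ m) * x)) = 0"
        using elim(3) by (simp add: lessThan_Suc_atMost[symmetric] K_def del: of_nat_power)
      then show ?case using elim(2) q by simp
    qed
    from eventually_cosparse_affine[OF this, of "inverse (of_nat (q ^ m))" 0]
    have "eventually (\<lambda>x. (\<Sum>\<kappa>\<in>K. G \<kappa> J x) = 0) (cosparse UNIV)" using q by (simp add: mult.assoc[symmetric])
    then have "(\<lambda>x. \<Sum>\<kappa>\<in>K. G \<kappa> J x) \<in> almost_zero" by (simp add: almost_zero_def hat_eq_def)
    moreover have "log_expansion K (Suc 0) (\<lambda>\<mu> _. G \<mu> J) (\<lambda>x. \<Sum>\<kappa>\<in>K. G \<kappa> J x)"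
      using \<Lambda> by (auto simp: log_expansion_def K_def)
    moreover have "\<mu> \<in> K" using \<mu> by (auto simp: K_def \<nu>_def \<Lambda>2_def \<Lambda>1_def)
    ultimately have "G \<mu> J \<in> almost_zero" using log_expansion_unique[of K "Suc 0" "\<lambda>\<mu> _. G \<mu> J"] by blast
    then show False using \<mu> by (auto simp: \<Lambda>2_def \<Lambda>1_def)
  qed
  moreover have "finite \<Lambda>2" "0 \<notin> \<Lambda>2" using \<Lambda>(1,2) by (auto simp: \<Lambda>1_def \<Lambda>2_def)
  ultimately have "\<exists>\<kappa>\<in>\<Lambda>2. \<exists>N>0. \<kappa> ^ N = 1" if "\<mu> \<in> \<Lambda>2" for \<mu>
    using finite_power_cycle[of \<Lambda>2 q m \<mu>] q that by blast
  then have "\<Lambda>2 = {}" unfolding \<Lambda>2_def by blast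
  then obtain N where N: "N > 0" "\<And>\<mu>. \<mu> \<in> \<Lambda>1 \<Longrightarrow> \<mu> ^ N = 1"
    using common_torsion_exponent[of \<Lambda>1] \<Lambda>(1) by (auto simp: \<Lambda>1_def \<Lambda>2_def)
  let ?N = "of_nat N :: complex"
  define F where "F = (\<lambda>p. \<Sum>\<mu>\<in>\<Lambda>. G \<mu> J p)"
  have Fm: "F \<in> meromorphic" unfolding F_def by (rule hat_D.C_sum) (use \<Lambda>(3) eigenfunction_meromorphic in blast)
  define H where "H = (\<lambda>p. F (?N * p))"
  have Hm: "H \<in> meromorphic" using meromorphic_affine[of F ?N 0] Fm by (simp add: H_def)
  have "eventually (\<lambda>p. G \<mu> J (p + ?N * period) = G \<mu> J p) (cosparse UNIV)" if \<mu>: "\<mu> \<in> \<Lambda>" for \<mu>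
  proof (cases "\<mu> \<in> \<Lambda>1")
    case True
    then show ?thesis using eigenfunction_iterate[OF \<Lambda>(3)[OF \<mu>], of N] N by simp
  next
    case False
    then have z: "eventually (\<lambda>p. G \<mu> J p = 0) (cosparse UNIV)" using \<mu> by (simp add: \<Lambda>1_def almost_zero_def hat_eq_def)
    have "eventually (\<lambda>p. G \<mu> J (p + ?N * period) = 0) (cosparse UNIV)"
      using eventually_cosparse_affine[OF z, of 1 "?N * period"] by simp
    with z show ?thesis by eventually_elim simp
  qed
  then have "eventually (\<lambda>p. \<forall>\<mu>\<in>\<Lambda>. G \<mu> J (p + ?N * period) = G \<mu> J p) (cosparse UNIV)"
    by (intro eventually_ball_finite \<Lambda>(1)) blast
  from eventually_cosparse_affine[OF this, of ?N 0]
  have "eventually (\<lambda>p. \<forall>\<mu>\<in>\<Lambda>. G \<mu> J (?N * (p + period)) = G \<mu> J (?N * p)) (cosparse UNIV)"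
    using N(1) by (simp add: distrib_left)
  then have per: "hat_eq (\<lambda>p. H (p + period)) H"
    by (rule hat_eqI_eventually) (simp add: H_def F_def)
  have "hat_D.has_relation F"
    unfolding F_def
    by (rule hat_D.has_relation_sum)
       (use log_expansion_top_deriv[OF G D] eigenfunction_meromorphic \<Lambda>(3) in blast)
  then have HD: "hat_D.has_relation H" unfolding H_def by (rule dilate_has_relation[OF _ Fm N(1)])
  have "S.has_relation H"
  proof -
    \<comment> \<open>Summing the components over all \<open>\<nu>\<close> gives a relation for the
      full sum \<open>F\<close>; the powers of \<open>q\<close> coming from \<open>p ^ J\<close> are
      constants in its coefficients.\<close>
    define V where "V = (\<Union>i\<le>m. (\<lambda>\<mu>. \<mu> ^ (q ^ i)) ` \<Lambda>)"
    have fV: "finite V" using \<Lambda>(1) by (simp add: V_def)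
    have "(\<lambda>x. \<Sum>\<nu>\<in>V. \<Sum>i\<le>m. poly (b i) (exp x) * of_nat ((q ^ i) ^ J) *
        (\<Sum>\<mu>\<in>{\<mu>\<in>\<Lambda>. \<mu> ^ (q ^ i) = \<nu>}. G \<mu> J (of_nat (q ^ i) * x))) \<in> almost_zero"
      by (rule almost.Z_sum) (use top q in auto)
    moreover have "(\<Sum>\<nu>\<in>V. \<Sum>i\<le>m. poly (b i) (exp x) * of_nat ((q ^ i) ^ J) *
        (\<Sum>\<mu>\<in>{\<mu>\<in>\<Lambda>. \<mu> ^ (q ^ i) = \<nu>}. G \<mu> J (of_nat (q ^ i) * x))) =
        (\<Sum>i\<le>m. poly (b i) (exp x) * of_nat ((q ^ i) ^ J) * F (of_nat (q ^ i) * x))" for x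
    proof (subst sum.swap, rule sum.cong[OF refl])
      fix i assume "i \<in> {..m}"
      then have "(\<lambda>\<mu>. \<mu> ^ (q ^ i)) ` \<Lambda> \<subseteq> V" by (auto simp: V_def)
      from sum.group[OF \<Lambda>(1) fV this, of "\<lambda>\<mu>. G \<mu> J (of_nat (q ^ i) * x)"]
      show "(\<Sum>\<nu>\<in>V. poly (b i) (exp x) * of_nat ((q ^ i) ^ J) * (\<Sum>\<mu>\<in>{\<mu>\<in>\<Lambda>. \<mu> ^ (q ^ i) = \<nu>}. G \<mu> J (of_nat (q ^ i) * x))) =
        poly (b i) (exp x) * of_nat ((q ^ i) ^ J) * F (of_nat (q ^ i) * x)"
        unfolding F_def sum_distrib_left[symmetric] by simp
    qed
    ultimately have "eventually (\<lambda>x. (\<Sum>i\<le>m. poly (b i) (exp x) * of_nat ((q ^ i) ^ J) * F (of_nat (q ^ i) * x)) = 0) (cosparse UNIV)"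
      by (simp add: almost_zero_def hat_eq_def)
    from eventually_cosparse_affine[OF this, of ?N 0] N(1)
    have "eventually (\<lambda>x. (\<Sum>i\<le>m. poly (b i) (exp (?N * x)) * of_nat ((q ^ i) ^ J) * F (of_nat (q ^ i) * (?N * x))) = 0) (cosparse UNIV)"
      by simp
    moreover let ?k = "\<lambda>i. smult (of_nat ((q ^ i) ^ J)) (pcompose (b i) (monom 1 N))"
    have "poly (?k i) (exp x) * (hat_sigma (CaseM q) ^^ i) H x =
      poly (b i) (exp (?N * x)) * of_nat ((q ^ i) ^ J) * F (of_nat (q ^ i) * (?N * x))" for i x
      unfolding funpow_hat_sigma H_def
      by (simp add: poly_pcompose poly_monom exp_of_nat_mult[symmetric] mult_ac)
    ultimately have "(\<lambda>x. \<Sum>i\<le>m. poly (?k i) (exp x) * (hat_sigma (CaseM q) ^^ i) H x) \<in> almost_zero"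
      unfolding almost_zero_def hat_eq_def mem_Collect_eq by (simp only:)
    moreover have "?k m \<noteq> 0" using b(1) N(1) q by (simp add: pcompose_eq_0_iff degree_monom_eq)
    ultimately show ?thesis by (intro S.has_relationI[of m m ?k]) auto
  qed
  then obtain u v where uv: "v \<noteq> 0" "hat_eq H (\<lambda>p. poly u (exp p) / poly v (exp p))"
    using periodic_bifinite_rational[OF c Hm per HD] by blast
  have "hat_eq F (\<lambda>p. poly u (exp (p / ?N)) / poly v (exp (p / ?N)))"
    using hat_eq_affine[OF uv(2), of "inverse ?N" 0] N(1) by (simp add: H_def divide_inverse mult_ac)
  then show ?thesis using power_log_form_root[OF uv(1) N(1)] by (simp add: F_def)
qed

text \<open>The top power of the logarithm is split off. Being of the required form, it satisfies
  both equations by the converse direction; so does the difference, whose expansion has one power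
  less.\<close>

lemma log_expansion_power_log_form:
  assumes c: "admissible c" and "log_expansion \<Lambda> J G f" "f \<in> meromorphic" "hat_D.has_relation f"
    and "skew_operator.has_relation exp almost_zero (hat_sigma c) f"
  shows "power_log_form c f"
  using assms(2-)
proof (induction J arbitrary: f)
  case 0
  then have "hat_eq f (\<lambda>_. 0)" by (simp add: log_expansion_def)
  then show ?case using power_log_form_cong[OF power_log_form_zero] by blast
next
  case (Suc J)
  interpret S: skew_operator exp almost_zero meromorphic "hat_sigma c" "sigma_poly c" "\<lambda>_. 0"
    by (rule hat_sigma_skew_operator[OF c])
  let ?t = "\<lambda>p. (\<Sum>\<mu>\<in>\<Lambda>. G \<mu> J p) * p ^ J"
  have t: "power_log_form c ?t"
  proof (cases c)
    case (CaseQ q l)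
    have "power_log_form c (\<lambda>p. \<Sum>\<mu>\<in>\<Lambda>. G \<mu> J p * p ^ J)"
      unfolding CaseQ
      by (rule power_log_form_sum, rule top_coefficient_dilation[OF c[unfolded CaseQ] Suc.prems(1,3) Suc.prems(4)[unfolded CaseQ]])
    then show ?thesis by (simp add: sum_distrib_right)
  next
    case (CaseM q)
    show ?thesis
      unfolding CaseM by (rule top_coefficient_mahler[OF c[unfolded CaseM] Suc.prems(1,3) Suc.prems(4)[unfolded CaseM]])
  qed
  then obtain g where g: "g \<in> meromorphic" "hat_eq ?t g" "hat_D.has_relation g" "S.has_relation g"
    using power_log_form_relations[OF c] by blast
  define h where "h = (\<lambda>p. f p + poly [:-1:] (exp p) * g p)"
  have gs: "(\<lambda>p. poly [:-1:] (exp p) * g p) \<in> meromorphic" by (rule hat_D.C_scale[OF g(1)])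
  have "h \<in> meromorphic" unfolding h_def by (rule hat_D.C_add[OF Suc.prems(2) gs])
  moreover have "hat_D.has_relation h"
    unfolding h_def by (rule hat_D.has_relation_add[OF Suc.prems(3) hat_D.has_relation_scale[OF g(3,1)] Suc.prems(2) gs])
  moreover have "S.has_relation h"
    unfolding h_def by (rule S.has_relation_add[OF Suc.prems(4) S.has_relation_scale[OF g(4,1)] Suc.prems(2) gs])
  moreover have "log_expansion \<Lambda> J G h"
  proof -
    have "eventually (\<lambda>p. f p = (\<Sum>\<mu>\<in>\<Lambda>. \<Sum>j<Suc J. G \<mu> j p * p ^ j)) (cosparse UNIV)"
      "eventually (\<lambda>p. ?t p = g p) (cosparse UNIV)"
      using Suc.prems(1) g(2) by (auto simp: log_expansion_def hat_eq_def)
    then have "hat_eq h (\<lambda>p. \<Sum>\<mu>\<in>\<Lambda>. \<Sum>j<J. G \<mu> j p * p ^ j)"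
      unfolding hat_eq_def by eventually_elim (simp add: h_def sum.distrib sum_distrib_right)
    then show ?thesis using Suc.prems(1) by (simp add: log_expansion_def)
  qed
  ultimately have "power_log_form c h" by (intro Suc.IH)
  then have "power_log_form c (\<lambda>p. h p + ?t p)" using t by (rule power_log_form_add)
  moreover have "hat_eq f (\<lambda>p. h p + ?t p)"
    using g(2)[unfolded hat_eq_def] by (rule hat_eqI_eventually) (simp add: h_def)
  ultimately show ?case by (rule power_log_form_cong)
qed

theorem satisfies_power_log_form:
  assumes c: "admissible c" and f: "f meromorphic_on UNIV"
    and D: "hat_satisfies hat_delta n f" and S: "hat_satisfies (hat_sigma c) m f"
  shows "power_log_form c f"
proof -
  interpret S: skew_operator exp almost_zero meromorphic "hat_sigma c" "sigma_poly c" "\<lambda>_. 0"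
    by (rule hat_sigma_skew_operator[OF c])
  have [simp]: "hat_delta = deriv" by (simp add: fun_eq_iff hat_delta_eq_deriv)
  have fm: "f \<in> meromorphic" using f by simp
  obtain p where p: "p n \<noteq> 0" "(\<lambda>x. \<Sum>i\<le>n. poly (p i) (exp x) * (deriv ^^ i) f x) \<in> almost_zero"
    using hat_satisfies_imp_relation[OF D] by auto
  have SD: "hat_D.has_relation f" using p unfolding hat_D.has_relation_def by blast
  have SS: "S.has_relation f"
    using hat_satisfies_imp_relation[OF S] unfolding S.has_relation_def by blast
  define F where "F = (\<lambda>k p. f (p + of_nat k * period))"
  \<comment> \<open>The coefficients of the equation are periodic, so the translates by
    \<open>0, ..., n\<close> periods all solve it. A dependence among these \<open>n + 1\<close>
    solutions is an equation for the monodromy with constant coefficients.\<close>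
  have "\<exists>\<gamma>. (\<exists>k\<le>n. \<gamma> k \<noteq> 0) \<and> (\<lambda>x. \<Sum>k\<le>n. \<gamma> k * F k x) \<in> almost_zero"
  proof (rule ode_solutions_dependent[where f = F and n = n and p = p, OF _ p(1)])
    fix k assume "k \<le> n"
    show "F k \<in> meromorphic" using meromorphic_affine[OF f, of 1] by (simp add: F_def)
    have "(deriv ^^ i) (F k) = (\<lambda>x. (deriv ^^ i) f (x + of_nat k * period))" for i
    proof (induction i)
      case (Suc i)
      have "deriv (\<lambda>x. (deriv ^^ i) f (of_nat k * period + x)) = (\<lambda>x. deriv ((deriv ^^ i) f) (of_nat k * period + x))"
        by (rule deriv_translate)
      then show ?case by (simp add: Suc.IH add.commute)
    qed (simp add: F_def)
    moreover have "exp (x + of_nat k * period) = exp x" for x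
      by (simp add: exp_add exp_of_nat_mult)
    moreover have "eventually (\<lambda>x. (\<Sum>i\<le>n. poly (p i) (exp (x + of_nat k * period)) * (deriv ^^ i) f (x + of_nat k * period)) = 0) (cosparse UNIV)"
      using eventually_cosparse_affine[of "\<lambda>x. (\<Sum>i\<le>n. poly (p i) (exp x) * (deriv ^^ i) f x) = 0" 1 "of_nat k * period"] p(2)
      by (simp add: almost_zero_def hat_eq_def)
    ultimately show "(\<lambda>x. \<Sum>i\<le>n. poly (p i) (exp x) * (deriv ^^ i) (F k) x) \<in> almost_zero"
      by (simp add: almost_zero_def hat_eq_def)
  qed
  then obtain \<gamma> k where \<gamma>: "k \<le> n" "\<gamma> k \<noteq> 0" "(\<lambda>x. \<Sum>k\<le>n. \<gamma> k * F k x) \<in> almost_zero" by blast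
  define g where "g = (\<Sum>k\<le>n. monom (\<gamma> k) k)"
  have cg: "coeff g i = (if i \<le> n then \<gamma> i else 0)" for i
    by (simp add: g_def coeff_sum)
  have "degree g \<le> n" by (rule degree_le) (simp add: cg)
  moreover have "\<gamma> i = 0" if "i \<le> n" "degree g < i" for i
    using cg[of i] that by (simp add: coeff_eq_0)
  ultimately have "(\<Sum>i\<le>degree g. coeff g i * F i x) = (\<Sum>i\<le>n. \<gamma> i * F i x)" for x
    by (intro sum.mono_neutral_cong_left) (auto simp: cg not_le)
  then have "(\<lambda>x. \<Sum>i\<le>degree g. coeff g i * f (x + of_nat i * period)) \<in> almost_zero"
    using \<gamma>(3) by (simp add: F_def)
  moreover have "g \<noteq> 0" using cg[of k] \<gamma> by auto
  ultimately have "log_expandable f" using log_expandableI_monodromy fm by blast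
  then show ?thesis
    unfolding log_expandable_def using log_expansion_power_log_form[OF c _ fm SD SS] by blast
qed

section \<open>Formal Laurent series\<close>

abbreviation fls_poly :: "complex poly \<Rightarrow> complex fls" where
  "fls_poly p \<equiv> fps_to_fls (fps_of_poly p)"

lemma fls_poly_mult: "fls_poly (p * q) = fls_poly p * fls_poly q"
  by (simp add: fps_of_poly_mult fls_times_fps_to_fls)

lemma fls_poly_mult_nth:
  assumes "degree p \<le> N"
  shows "(fls_poly p * f) $$ k = (\<Sum>i\<le>N. coeff p i * f $$ (k - int i))"
proof -
  have m: "fls_poly (monom a i) = fls_const a * fls_X ^ i" for a i
    by (simp add: fps_of_poly_monom fls_times_fps_to_fls fps_to_fls_power)
  have hom: "fls_poly (\<Sum>i\<in>A. g i) = (\<Sum>i\<in>A. fls_poly (g i))" for g and A :: "nat set"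
    by (induction A rule: infinite_finite_induct) (simp_all add: fps_of_poly_add)
  have "fls_poly p = fls_poly (\<Sum>i\<le>N. monom (coeff p i) i)"
    using poly_as_sum_of_monoms'[OF assms] by simp
  also have "\<dots> * f = (\<Sum>i\<le>N. fls_const (coeff p i) * (fls_X ^ i * f))"
    unfolding hom m by (simp add: sum_distrib_right mult.assoc)
  also have "\<dots> $$ k = (\<Sum>i\<le>N. coeff p i * f $$ (k - int i))"
    by (simp add: fls_nth_sum fls_X_power_times_conv_shift)
  finally show ?thesis .
qed

lemma fls_ratfunsI:
  assumes "v \<noteq> 0" "fls_poly v * f = fls_poly u"
  shows "f \<in> fls_ratfuns"
proof -
  have "f = fls_poly u / fls_poly v" using assms by (simp add: field_simps)
  then show ?thesis unfolding fls_ratfuns_def using assms(1) by blast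
qed

lemma fls_ratfunsE:
  assumes "f \<in> fls_ratfuns"
  obtains u v where "v \<noteq> 0" "fls_poly v * f = fls_poly u"
proof -
  obtain u v :: "complex poly" where "v \<noteq> 0" "f = fls_poly u / fls_poly v" using assms unfolding fls_ratfuns_def by blast
  then show ?thesis by (intro that[of v u]) auto
qed

lemma fls_satisfies_imp_relation:
  assumes "fls_satisfies T n f"
  shows "\<exists>p. p n \<noteq> 0 \<and> (\<Sum>i\<le>n. fls_poly (p i) * (T ^^ i) f) = 0"
proof -
  obtain a where a: "\<And>i. i < n \<Longrightarrow> a i \<in> fls_ratfuns" "(T ^^ n) f + (\<Sum>i<n. a i * (T ^^ i) f) = 0"
    using assms unfolding fls_satisfies_def by blast
  have "\<exists>D p. D \<noteq> 0 \<and> (\<forall>i<k. fls_poly D * a i = fls_poly (p i))" if "k \<le> n" for k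
    using that
  proof (induction k)
    case 0
    show ?case by (intro exI[of _ 1]) auto
  next
    case (Suc k)
    then obtain D p where D: "D \<noteq> 0" "\<And>i. i < k \<Longrightarrow> fls_poly D * a i = fls_poly (p i)" by auto
    obtain u v where uv: "v \<noteq> 0" "fls_poly v * a k = fls_poly u"
      by (rule fls_ratfunsE[OF a(1)[of k]]) (use Suc.prems in auto)
    have "\<forall>i<Suc k. fls_poly (v * D) * a i = fls_poly ((p(k := u)) i * (if i = k then D else v))"
      using D(2) uv(2) by (auto simp: fls_poly_mult less_Suc_eq mult_ac)
    then show ?case using D(1) uv(1) by (intro exI[of _ "v * D"] exI[of _ "\<lambda>i. (p(k := u)) i * (if i = k then D else v)"]) auto
  qed
  then obtain D p where D: "D \<noteq> 0" "\<And>i. i < n \<Longrightarrow> fls_poly D * a i = fls_poly (p i)" by blast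
  have "0 = fls_poly D * ((T ^^ n) f + (\<Sum>i<n. a i * (T ^^ i) f))" by (simp add: a(2))
  also have "\<dots> = fls_poly D * (T ^^ n) f + (\<Sum>i<n. fls_poly (p i) * (T ^^ i) f)"
    by (simp add: distrib_left sum_distrib_left mult.assoc[symmetric] D(2))
  also have "\<dots> = (\<Sum>i\<le>n. fls_poly ((p(n := D)) i) * (T ^^ i) f)"
    by (simp add: lessThan_Suc_atMost[symmetric] add.commute)
  finally show ?thesis using D(1) by (intro exI[of _ "p(n := D)"]) auto
qed

lemma fls_delta_funpow_nth: "(fls_delta ^^ j) f $$ k = of_int k ^ j * f $$ k"
  by (induction j arbitrary: k) (auto simp: fls_delta_def fls_X_times_conv_shift)

lemma fls_sigma_dilation_funpow_nth:
  assumes "q \<noteq> 0"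
  shows "(fls_sigma (CaseQ q l) ^^ j) f $$ k = (q powi k) ^ j * f $$ k"
proof (induction j)
  case (Suc j)
  have "(fls_sigma (CaseQ q l) ^^ Suc j) f $$ k = (fls_sigma (CaseQ q l) ^^ j) f $$ k * q powi k"
    by (simp add: fls_nth_fls_compose_fps_linear assms)
  then show ?case by (simp only: Suc.IH power_Suc mult_ac)
qed simp

lemma fls_sigma_mahler_funpow:
  assumes "q > 0"
  shows "(fls_sigma (CaseM q) ^^ j) f = fls_compose_power f (q ^ j)"
proof (induction j)
  case 0
  show ?case by (rule fls_eqI) (simp add: fls_nth_compose_power)
next
  case (Suc j)
  have "int q dvd k \<and> int q ^ j dvd k div int q \<longleftrightarrow> int q ^ Suc j dvd k" for k
    using assms by (auto elim!: dvdE simp: mult.assoc)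
  then show ?case unfolding funpow.simps o_apply Suc.IH
    using assms by (intro fls_eqI) (auto simp: fls_nth_compose_power zdiv_zmult2_eq[symmetric])
qed

text \<open>The series is a Laurent polynomial, and multiplication by \<open>x ^ K\<close> clears
  its pole at \<open>0\<close>.\<close>

lemma fls_ratfuns_tail:
  assumes "\<And>k. k > int N \<Longrightarrow> f $$ k = 0"
  shows "f \<in> fls_ratfuns"
proof -
  define K where "K = nat (- fls_subdegree f)"
  define u where "u = (\<Sum>i\<le>N + K. monom (f $$ (int i - int K)) i)"
  have "fls_poly (monom 1 K) * f = fls_poly u"
  proof (rule fls_eqI)
    fix k
    have c: "coeff u i = (if i \<le> N + K then f $$ (int i - int K) else 0)" for i by (simp add: u_def coeff_sum)
    have "(fls_poly (monom 1 K) * f) $$ k = f $$ (k - int K)"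
      by (simp add: fps_of_poly_monom' fps_to_fls_power fls_X_power_times_conv_shift)
    moreover have "f $$ (k - int K) = 0" if "k < 0"
      by (rule fls_eq0_below_subdegree) (use that in \<open>auto simp: K_def\<close>)
    moreover have "f $$ (k - int K) = 0" if "nat k > N + K" by (rule assms) (use that in auto)
    ultimately show "(fls_poly (monom 1 K) * f) $$ k = fls_poly u $$ k" by (auto simp: c)
  qed
  then show ?thesis by (rule fls_ratfunsI[rotated]) simp
qed

lemma fls_ratfuns_poly_mult_cancel:
  assumes "v \<noteq> 0" "fls_poly v * f \<in> fls_ratfuns"
  shows "f \<in> fls_ratfuns"
proof -
  obtain u w where "w \<noteq> 0" "fls_poly w * (fls_poly v * f) = fls_poly u" using assms(2) by (elim fls_ratfunsE)
  then show ?thesis using assms(1) by (intro fls_ratfunsI[of "w * v" f u]) (auto simp: fls_poly_mult mult.assoc)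
qed

lemma fls_ratfuns_add:
  assumes "f \<in> fls_ratfuns" "g \<in> fls_ratfuns"
  shows "f + g \<in> fls_ratfuns"
proof -
  obtain u v u' v' where "v \<noteq> 0" "fls_poly v * f = fls_poly u" "v' \<noteq> 0" "fls_poly v' * g = fls_poly u'"
    using assms by (metis fls_ratfunsE)
  moreover have "fls_poly (v * v') * (f + g) = fls_poly v' * (fls_poly v * f) + fls_poly v * (fls_poly v' * g)"
    by (simp add: fls_poly_mult algebra_simps)
  ultimately show ?thesis
    by (intro fls_ratfunsI[of "v * v'" "f + g" "v' * u + v * u'"]) (auto simp: fls_poly_mult fps_of_poly_add)
qed

lemma fls_ratfuns_sum: "(\<And>i. i \<in> I \<Longrightarrow> f i \<in> fls_ratfuns) \<Longrightarrow> (\<Sum>i\<in>I. f i) \<in> fls_ratfuns"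
  by (induction I rule: infinite_finite_induct)
     (auto intro: fls_ratfuns_add fls_ratfunsI[of 1 0 0])

text \<open>Multiplication by \<open>1 - \<mu> x\<close> replaces \<open>Q(k)\<close> by
  \<open>Q(k) - Q(k - 1)\<close>, which has smaller degree. It looks one index back, so the bound
  \<open>N\<close> grows by one.\<close>

lemma fls_ratfuns_poly_geometric:
  assumes "\<And>k. k \<ge> N \<Longrightarrow> f $$ int k = poly Q (of_nat k) * \<mu> ^ k" "Q = 0 \<or> degree Q < d"
  shows "f \<in> fls_ratfuns"
  using assms
proof (induction d arbitrary: Q f N)
  case 0
  have "f $$ k = 0" if "k > int N" for k
    using 0(1)[of "nat k"] 0(2) that by simp
  then show ?case by (rule fls_ratfuns_tail)
next
  case (Suc d)
  define P where "P = Q - pcompose Q [:-1, 1:]"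
  have "fls_poly [:1, -\<mu>:] * f \<in> fls_ratfuns"
  proof (rule Suc.IH)
    fix k assume k: "k \<ge> Suc N"
    then obtain k' where k': "k = Suc k'" "k' \<ge> N" by (cases k) auto
    have "(fls_poly [:1, -\<mu>:] * f) $$ int k = f $$ int k - \<mu> * f $$ int k'"
      by (subst fls_poly_mult_nth[of _ 1]) (simp_all add: k'(1))
    also have "\<dots> = poly P (of_nat k) * \<mu> ^ k"
      using Suc.prems(1)[of k] Suc.prems(1)[of k'] k' k by (simp add: P_def poly_pcompose algebra_simps)
    finally show "(fls_poly [:1, -\<mu>:] * f) $$ int k = poly P (of_nat k) * \<mu> ^ k" .
  next
    show "P = 0 \<or> degree P < d"
    proof (cases "P = 0")
      case False
      have dg: "degree (pcompose Q [:-1, 1:]) = degree Q" by (simp add: degree_pcompose)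
      have "lead_coeff (pcompose Q [:-1, 1:]) = lead_coeff Q" by (subst lead_coeff_comp) auto
      then have "coeff P (degree Q) = 0" using dg by (simp add: P_def)
      moreover have "degree P \<le> degree Q" unfolding P_def using degree_diff_le_max[of Q "pcompose Q [:-1, 1:]"] dg by simp
      ultimately have "degree P \<noteq> degree Q" using False by (metis leading_coeff_0_iff)
      then have "degree P < degree Q" using \<open>degree P \<le> degree Q\<close> by simp
      moreover have "Q \<noteq> 0" using False by (auto simp: P_def)
      ultimately show ?thesis using Suc.prems(2) by auto
    qed simp
  qed
  then show ?case by (rule fls_ratfuns_poly_mult_cancel[rotated]) simp
qed

text \<open>Each term is the coefficient sequence of a rational function, and the difference from
  their sum has only finitely many nonzero coefficients.\<close>

lemma fls_ratfuns_exp_polynomial: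
  assumes "exp_polynomial (\<lambda>k. f $$ int k)"
  shows "f \<in> fls_ratfuns"
proof -
  obtain \<Lambda> Q N where \<Lambda>: "finite \<Lambda>" "\<And>k. k \<ge> N \<Longrightarrow> f $$ int k = (\<Sum>\<mu>\<in>\<Lambda>. poly (Q \<mu>) (of_nat k) * \<mu> ^ k)"
    using assms unfolding exp_polynomial_def eventually_sequentially by blast
  define F where "F = (\<lambda>\<mu>. fps_to_fls (Abs_fps (\<lambda>k. poly (Q \<mu>) (of_nat k) * \<mu> ^ k)))"
  have F: "F \<mu> \<in> fls_ratfuns" for \<mu>
    by (rule fls_ratfuns_poly_geometric[of 0 _ "Q \<mu>" \<mu> "Suc (degree (Q \<mu>))"]) (auto simp: F_def)
  have "f - (\<Sum>\<mu>\<in>\<Lambda>. F \<mu>) \<in> fls_ratfuns"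
  proof (rule fls_ratfuns_tail)
    fix k assume "k > int N"
    then show "(f - (\<Sum>\<mu>\<in>\<Lambda>. F \<mu>)) $$ k = 0" using \<Lambda>(2)[of "nat k"] by (simp add: F_def fls_nth_sum)
  qed
  moreover have "(\<Sum>\<mu>\<in>\<Lambda>. F \<mu>) \<in> fls_ratfuns" by (rule fls_ratfuns_sum) (rule F)
  ultimately have "(f - (\<Sum>\<mu>\<in>\<Lambda>. F \<mu>)) + (\<Sum>\<mu>\<in>\<Lambda>. F \<mu>) \<in> fls_ratfuns" by (rule fls_ratfuns_add)
  then show ?thesis by simp
qed

lemma fls_relation_nth:
  assumes "(\<Sum>j\<le>n. fls_poly (p j) * g j) = 0" "\<And>j. j \<le> n \<Longrightarrow> degree (p j) \<le> N"
  shows "(\<Sum>j\<le>n. \<Sum>i\<le>N. coeff (p j) i * g j $$ (k - int i)) = 0"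
proof -
  have "(\<Sum>j\<le>n. fls_poly (p j) * g j) $$ k = 0" by (simp add: assms(1))
  moreover have "(\<Sum>j\<le>n. fls_poly (p j) * g j) $$ k = (\<Sum>j\<le>n. \<Sum>i\<le>N. coeff (p j) i * g j $$ (k - int i))"
    unfolding fls_nth_sum by (rule sum.cong) (auto simp: fls_poly_mult_nth[OF assms(2)])
  ultimately show ?thesis by simp
qed

theorem fls_dilation_rational:
  assumes c: "admissible (CaseQ q l)" and D: "fls_satisfies fls_delta n f"
    and S: "fls_satisfies (fls_sigma (CaseQ q l)) m f"
  shows "f \<in> fls_ratfuns"
proof -
  interpret not_root_of_unity q
    by standard (use c in auto)
  obtain p where p: "p n \<noteq> 0" "(\<Sum>i\<le>n. fls_poly (p i) * (fls_delta ^^ i) f) = 0"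
    using fls_satisfies_imp_relation[OF D] by blast
  obtain b where b: "b m \<noteq> 0" "(\<Sum>i\<le>m. fls_poly (b i) * (fls_sigma (CaseQ q l) ^^ i) f) = 0"
    using fls_satisfies_imp_relation[OF S] by blast
  obtain N where N: "\<And>j. j \<le> n \<Longrightarrow> degree (p j) \<le> N" using degree_bound_exists by blast
  obtain M where M: "\<And>j. j \<le> m \<Longrightarrow> degree (b j) \<le> M" using degree_bound_exists by blast
  have "index_shift.has_relation (\<lambda>k. f $$ int k)"
    by (rule index_shift_coefficients[of n n p N, OF order_refl p(1) N])
       (use fls_relation_nth[OF p(2) N] in \<open>auto simp: fls_delta_funpow_nth\<close>)
  moreover have "E0.S.has_relation (\<lambda>k. f $$ int k)"
    by (rule geometric_shift_coefficients[of m m b M, OF order_refl b(1) M])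
       (use fls_relation_nth[OF b(2) M] q_nonzero in \<open>auto simp: fls_sigma_dilation_funpow_nth\<close>)
  ultimately have "exp_polynomial (\<lambda>k. f $$ int k)" by (intro bifinite_exp_polynomial)
  then show ?thesis by (rule fls_ratfuns_exp_polynomial)
qed

section \<open>Mahler equations for Laurent series and their convergence\<close>

lemma fls_compose_power_sum: "fls_compose_power (\<Sum>i\<in>I. f i) d = (\<Sum>i\<in>I. fls_compose_power (f i) d)"
  by (induction I rule: infinite_finite_induct) auto

lemma fls_compose_power_poly:
  "d > 0 \<Longrightarrow> fls_compose_power (fls_poly p) d = fls_poly (pcompose p (monom 1 d))"
  by (simp add: fls_compose_power_fps_to_fls fps_of_poly_pcompose fps_of_poly_monom')

text \<open>The denominator is enlarged to a polynomial \<open>V\<close> in \<open>x ^ d\<close>.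
  The product of \<open>V\<close> and \<open>h\<close>, taken at \<open>x ^ d\<close>, is then a
  polynomial, and its coefficients at multiples of \<open>d\<close> are those of
  \<open>V h\<close>.\<close>

lemma fls_ratfuns_compose_power_cancel:
  assumes "fls_compose_power h d \<in> fls_ratfuns" "d > 0"
  shows "h \<in> fls_ratfuns"
proof -
  obtain u v where uv: "v \<noteq> 0" "fls_poly v * fls_compose_power h d = fls_poly u" using assms(1) by (elim fls_ratfunsE)
  obtain V w where V: "V \<noteq> 0" "pcompose V (monom 1 d) = v * w"
    using poly_dvd_pcompose_monom[OF uv(1) assms(2)] by (auto simp: dvd_def)
  have "fls_compose_power (fls_poly V * h) d = fls_poly (v * w) * fls_compose_power h d"
    using assms(2) V(2) by (simp add: fls_compose_power_poly)
  also have "\<dots> = fls_poly (u * w)" using uv(2) by (simp add: fls_poly_mult mult_ac)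
  finally have e: "fls_compose_power (fls_poly V * h) d = fls_poly (u * w)" .
  have "(fls_poly V * h) $$ k = 0" if k: "k > int (degree (u * w))" for k
  proof -
    have "(fls_poly V * h) $$ k = fls_compose_power (fls_poly V * h) d $$ (int d * k)"
      using fls_nth_compose_power[OF assms(2), of "fls_poly V * h" "int d * k"] assms(2) by (simp del: fls_compose_power_mult)
    also have "\<dots> = coeff (u * w) (nat (int d * k))"
    proof -
      have "int d * k \<ge> 0" using k by simp
      then show ?thesis unfolding e by simp
    qed
    also have "\<dots> = 0"
    proof (rule coeff_eq_0)
      have "1 * k \<le> int d * k" using k assms(2) by (intro mult_right_mono) auto
      then show "degree (u * w) < nat (int d * k)" using k by linarith
    qed
    finally show ?thesis .
  qed
  then have "fls_poly V * h \<in> fls_ratfuns" by (rule fls_ratfuns_tail)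
  then show ?thesis by (rule fls_ratfuns_poly_mult_cancel[OF V(1)])
qed

lemma fls_compose_fps_X_power:
  fixes F :: "complex fls"
  assumes "d > 0"
  shows "fls_compose_fps F (fps_X ^ d) = fls_compose_power F d"
proof -
  have X: "fps_X ^ d \<noteq> (0 :: complex fps)" "fps_nth (fps_X ^ d :: complex fps) 0 = 0" using assms by auto
  define n where "n = nat (- fls_subdegree F)"
  have "- fls_subdegree F \<le> int n" by (simp add: n_def)
  from fls_as_fps[OF this] obtain f' where f': "F = fls_shift n (fps_to_fls f')" by blast
  have F: "fls_X ^ n * F = fps_to_fls f'" by (simp add: f' fls_X_power_times_conv_shift)
  have "fls_compose_fps (fls_X ^ n * F) (fps_X ^ d) = fls_compose_power (fls_X ^ n * F) d"
    unfolding F using X assms by (simp add: fls_compose_power_fps_to_fls)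
  moreover have "fls_compose_fps (fls_X ^ n * F) (fps_X ^ d) = fps_to_fls (fps_X ^ (d * n)) * fls_compose_fps F (fps_X ^ d)"
  proof -
    have "fps_X ^ n oo fps_X ^ d = (fps_X ^ (d * n) :: complex fps)"
      using fps_compose_power[OF X(2), of fps_X n] X(2) by (simp add: power_mult)
    then have "fls_compose_fps (fps_to_fls (fps_X ^ n)) (fps_X ^ d) = (fps_to_fls (fps_X ^ (d * n)) :: complex fls)"
      unfolding fls_compose_fps_to_fls[OF X] by simp
    then show ?thesis using fls_compose_fps_mult[OF X, of "fls_X ^ n" F] by (simp add: fps_to_fls_power)
  qed
  moreover have "fls_compose_power (fls_X ^ n * F) d = fps_to_fls (fps_X ^ (d * n)) * fls_compose_power F d"
  proof -
    have "fls_compose_power (fps_to_fls (fps_X ^ n)) d = (fps_to_fls (fps_X ^ (d * n)) :: complex fls)"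
      unfolding fls_compose_power_fps_to_fls[OF assms] using fps_compose_power[OF X(2), of fps_X n] X(2) by (simp add: power_mult)
    then show ?thesis by (simp only: fls_compose_power_mult fps_to_fls_power fps_X_to_fls)
  qed
  ultimately have "fps_to_fls (fps_X ^ (d * n)) * fls_compose_fps F (fps_X ^ d) = fps_to_fls (fps_X ^ (d * n)) * fls_compose_power F d"
    by (simp only:)
  then show ?thesis by simp
qed

text \<open>At radius \<open>1 / (2 * R)\<close> the series is majorised by a geometric series of
  ratio \<open>1 / 2\<close>.\<close>

lemma fps_conv_radius_geometric_bound:
  assumes "\<And>k. norm (fps_nth F k) \<le> A * R ^ k" "R > 0"
  shows "fps_conv_radius (F :: complex fps) > 0"
proof -
  have nz: "norm (of_real (1 / (2 * R)) :: complex) = 1 / (2 * R)" unfolding norm_of_real using assms(2) by simp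
  have "summable (\<lambda>k. fps_nth F k * of_real (1 / (2 * R)) ^ k)"
  proof (rule summable_comparison_test')
    show "summable (\<lambda>k. A * (1 / 2 :: real) ^ k)" by (intro summable_mult summable_geometric) auto
    fix k :: nat
    have "norm (fps_nth F k * of_real (1 / (2 * R)) ^ k) = norm (fps_nth F k) * (1 / (2 * R)) ^ k"
      by (simp only: norm_mult norm_power nz)
    also have "\<dots> \<le> A * R ^ k * (1 / (2 * R)) ^ k"
      using assms by (intro mult_right_mono) auto
    also have "\<dots> = A * (1 / 2) ^ k" using assms(2) by (simp add: power_divide power_mult_distrib)
    finally show "norm (fps_nth F k * of_real (1 / (2 * R)) ^ k) \<le> A * (1 / 2) ^ k" .
  qed
  then have "ereal (norm (of_real (1 / (2 * R)) :: complex)) \<le> fps_conv_radius F"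
    unfolding fps_conv_radius_def by (rule conv_radius_geI)
  moreover have "0 < ereal (norm (of_real (1 / (2 * R)) :: complex))" using assms(2) by simp
  ultimately show ?thesis by (rule less_le_trans[rotated])
qed

text \<open>With \<open>d\<close> the order of vanishing of \<open>B 0\<close>, the coefficient of
  \<open>x ^ (n + d)\<close> in the relation expresses the \<open>n\<close>-th coefficient of
  \<open>h\<close> by earlier ones: the further terms of \<open>B 0\<close> have smaller index, and
  for \<open>i \<ge> 1\<close> the index is divided by at least \<open>2\<close>. A bounded number
  of terms per step gives geometric growth.\<close>

lemma fls_mahler_converges:
  assumes q: "q \<ge> 2" and B0: "B 0 \<noteq> 0"
    and rel: "(\<Sum>i\<le>m. fls_poly (B i) * fls_compose_power h (q ^ i)) = 0"
  shows "fls_conv_radius h > 0"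
proof -
  obtain D where D: "\<And>j. j \<le> m \<Longrightarrow> degree (B j) \<le> D" using degree_bound_exists by blast
  define d where "d = (LEAST d. coeff (B 0) d \<noteq> 0)"
  have "\<exists>d. coeff (B 0) d \<noteq> 0" using B0 by (auto simp: poly_eq_iff)
  then have d: "coeff (B 0) d \<noteq> 0" unfolding d_def by (rule LeastI_ex)
  have dlow: "coeff (B 0) i = 0" if "i < d" for i using not_less_Least[of i] that unfolding d_def by blast
  have dD: "d \<le> D" using le_degree[OF d] D[of 0] by simp
  define I where "I = {..m} \<times> {..D}"
  define I' where "I' = I - {(0, d)}"
  have I: "finite I" "finite I'" "(0, d) \<in> I" using dD by (auto simp: I_def I'_def)
  define e where "e = (\<lambda>n (j, i). fls_compose_power h (q ^ j) $$ (int (n + d) - int i))"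
  define c where "c = (\<lambda>(j, i). coeff (B j) i)"
  have rec: "c (0, d) * h $$ int n = - (\<Sum>x\<in>I'. c x * e n x)" for n
  proof -
    have "(\<Sum>j\<le>m. \<Sum>i\<le>D. coeff (B j) i * fls_compose_power h (q ^ j) $$ (int (n + d) - int i)) = 0"
      by (rule fls_relation_nth[OF rel D])
    then have "(\<Sum>x\<in>I. c x * e n x) = 0" unfolding I_def c_def e_def by (simp add: sum.cartesian_product case_prod_unfold)
    then have "c (0, d) * e n (0, d) + (\<Sum>x\<in>I'. c x * e n x) = 0" unfolding I'_def using I by (simp add: sum.remove)
    moreover have "e n (0, d) = h $$ int n" by (simp add: e_def fls_nth_compose_power)
    ultimately show ?thesis by (simp add: add_eq_0_iff)
  qed
  define S where "S = (\<Sum>x\<in>I'. norm (c x))"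
  \<comment> \<open>\<open>R\<close> pays for one step of the recurrence; beyond \<open>N\<close>
    all indices on its right-hand side are nonnegative before the division and below
    \<open>n\<close> after it.\<close>
  define R where "R = max 1 (S / norm (c (0, d)))"
  define N where "N = D + d + 2"
  define A where "A = (\<Sum>k\<le>N. norm (h $$ int k))"
  have c0: "norm (c (0, d)) > 0" using d by (simp add: c_def)
  have A0: "A \<ge> 0" by (auto simp: A_def intro: sum_nonneg)
  have R1: "R \<ge> 1" by (simp add: R_def)
  have bound: "norm (h $$ int n) \<le> A * R ^ n" for n
  proof (induction n rule: less_induct)
    case (less n)
    show ?case
    proof (cases "n \<le> N")
      case True
      then have "norm (h $$ int n) \<le> A * 1" unfolding A_def mult_1_right by (intro member_le_sum) auto
      also have "\<dots> \<le> A * R ^ n" using A0 R1 by (intro mult_left_mono one_le_power) auto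
      finally show ?thesis .
    next
      case False
      then have nN: "n > N" by simp
      have small: "norm (h $$ int k) \<le> A * R ^ (n - 1)" if "k < n" for k
        using less.IH[OF that] A0 R1 that
        by (elim order_trans) (intro mult_left_mono power_increasing, auto)
      have e: "norm (c x * e n x) \<le> norm (c x) * (A * R ^ (n - 1))" if x: "x \<in> I'" for x
      proof -
        obtain j i where ji: "x = (j, i)" "i \<le> D" using x by (auto simp: I'_def I_def)
        have nd: "int (n + d) - int i = int (n + d - i)" using nN ji by (simp add: N_def of_nat_diff)
        have "c x = 0 \<or> norm (e n x) \<le> A * R ^ (n - 1)"
        proof (cases "j = 0")
          case True
          then have "i \<noteq> d" using x ji by (auto simp: I'_def)
          then consider "i < d" | "i > d" by linarith
          then show ?thesis
          proof cases
            case 2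
            then have "n + d - i < n" using nN by (auto simp: N_def)
            then show ?thesis using small[of "n + d - i"] True unfolding e_def ji prod.case nd by (simp add: fls_nth_compose_power)
          qed (use True dlow ji in \<open>auto simp: c_def\<close>)
        next
          case False
          have "(n + d - i) div q ^ j \<le> (n + d - i) div 2"
          proof (rule div_le_mono2)
            have "q ^ 1 \<le> q ^ j" using q False by (intro power_increasing) auto
            then show "2 \<le> q ^ j" using q by simp
          qed simp
          also have "\<dots> < n" using nN by (auto simp: N_def)
          finally have k: "(n + d - i) div q ^ j < n" .
          have "fls_compose_power h (q ^ j) $$ int (n + d - i) =
            (if q ^ j dvd n + d - i then h $$ int ((n + d - i) div q ^ j) else 0)"
            using q by (subst fls_nth_compose_power) (simp_all del: of_nat_power add: int_dvd_int_iff zdiv_int[symmetric])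
          then show ?thesis using small[OF k] A0 R1 unfolding e_def ji prod.case nd by simp
        qed
        then show ?thesis by (auto simp: norm_mult intro: mult_left_mono)
      qed
      have "norm (c (0, d)) * norm (h $$ int n) = norm (\<Sum>x\<in>I'. c x * e n x)"
        using arg_cong[OF rec[of n], of norm] by (simp add: norm_mult)
      also have "\<dots> \<le> (\<Sum>x\<in>I'. norm (c x) * (A * R ^ (n - 1)))" by (rule sum_norm_le) (rule e)
      also have "\<dots> = S * (A * R ^ (n - 1))" by (simp add: S_def sum_distrib_right)
      finally have "norm (h $$ int n) \<le> S / norm (c (0, d)) * (A * R ^ (n - 1))" using c0 by (simp add: field_simps)
      also have "\<dots> \<le> R * (A * R ^ (n - 1))" using A0 R1 by (intro mult_right_mono) (auto simp: R_def)
      also have "\<dots> = A * R ^ n" using nN by (simp add: N_def power_eq_if)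
      finally show ?thesis .
    qed
  qed
  have "fps_conv_radius (fls_regpart h) > 0"
    by (rule fps_conv_radius_geometric_bound[of _ A R]) (use bound R1 in auto)
  then show ?thesis by (simp add: fls_conv_radius_def)
qed

lemma poly_has_fps_expansion: "(\<lambda>x :: complex. poly p x) has_fps_expansion fps_of_poly p"
proof -
  have "eval_fps (fps_of_poly p) = poly p" by (rule ext) simp
  then show ?thesis using eval_fps_has_fps_expansion[of "fps_of_poly p"] by simp
qed

lemma eval_fls_relation_near_zero:
  assumes "\<And>i. i \<le> n \<Longrightarrow> f i has_laurent_expansion g i" "(\<Sum>i\<le>n. fls_poly (p i) * g i) = 0"
  shows "eventually (\<lambda>x. (\<Sum>i\<le>n. poly (p i) x * f i x) = 0) (at 0)"
proof -
  have "(\<lambda>x. \<Sum>i\<le>n. poly (p i) (0 + x) * f i (0 + x)) has_laurent_expansion (\<Sum>i\<le>n. fls_poly (p i) * g i)"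
    unfolding add_0 by (intro has_laurent_expansion_sum has_laurent_expansion_mult has_laurent_expansion_fps poly_has_fps_expansion assms) auto
  then show ?thesis using assms(2) by (subst (asm) has_laurent_expansion_eventually_zero_iff[symmetric]) auto
qed

lemma eventually_at_zero_exp:
  assumes "eventually P (at (0 :: complex))"
  shows "\<exists>s. \<forall>p. Re p < s \<longrightarrow> P (exp p)"
proof -
  obtain e where e: "e > 0" "\<And>x. x \<noteq> 0 \<Longrightarrow> dist x 0 < e \<Longrightarrow> P x" using assms unfolding eventually_at by auto
  have "P (exp p)" if "Re p < ln e" for p
  proof (rule e(2))
    have "exp (Re p) < exp (ln e)" using that by simp
    then show "dist (exp p) 0 < e" using e(1) by simp
  qed simp
  then show ?thesis by blast
qed

lemma funpow_deriv_exp: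
  assumes f: "f holomorphic_on U" and U: "open U" and p: "exp p \<in> U"
  shows "(deriv ^^ i) (\<lambda>p. f (exp p)) p = ((\<lambda>f x. x * deriv f x) ^^ i) f (exp p)"
proof -
  let ?T = "\<lambda>f x. x * deriv f (x :: complex)"
  have h: "(?T ^^ i) f holomorphic_on U" for i
    by (induction i) (auto intro!: holomorphic_intros f U)
  have V: "open (exp -` U)" by (intro open_vimage U continuous_intros)
  have "\<forall>p\<in>exp -` U. (deriv ^^ i) (\<lambda>p. f (exp p)) p = (?T ^^ i) f (exp p)"
  proof (induction i)
    case (Suc i)
    show ?case
    proof
      fix p assume p: "p \<in> exp -` U"
      have "eventually (\<lambda>p. p \<in> exp -` U) (nhds p)" by (rule eventually_nhds_in_open[OF V p])
      then have "eventually (\<lambda>p. (deriv ^^ i) (\<lambda>p. f (exp p)) p = (?T ^^ i) f (exp p)) (nhds p)"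
        by eventually_elim (use Suc in auto)
      then have "deriv ((deriv ^^ i) (\<lambda>p. f (exp p))) p = deriv (\<lambda>p. (?T ^^ i) f (exp p)) p" by (rule deriv_cong_ev) simp
      also have "\<dots> = deriv ((?T ^^ i) f) (exp p) * exp p"
      proof (rule DERIV_imp_deriv, rule DERIV_chain2[OF _ DERIV_exp])
        show "((?T ^^ i) f has_field_derivative deriv ((?T ^^ i) f) (exp p)) (at (exp p))"
          by (rule holomorphic_derivI[OF h U]) (use p in auto)
      qed
      finally show "(deriv ^^ Suc i) (\<lambda>p. f (exp p)) p = (?T ^^ Suc i) f (exp p)" by (simp add: mult.commute)
    qed
  qed simp
  then show ?thesis using p by auto
qed

text \<open>Identities of formal series become identities of convergent expansions near
  \<open>x = 0\<close>, and a punctured disc around \<open>0\<close> corresponds to a half-plane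
  \<open>Re p < s\<close>.\<close>

lemma fls_relations_on_half_plane:
  assumes h: "fls_conv_radius h > 0" and q: "q > 0"
    and P: "(\<Sum>i\<le>n. fls_poly (P i) * (fls_delta ^^ i) h) = 0"
    and B: "(\<Sum>i\<le>m. fls_poly (B i) * fls_compose_power h (q ^ i)) = 0"
  defines "g \<equiv> \<lambda>p. eval_fls h (exp p)"
  shows "\<exists>s. g analytic_on {p. Re p < s} \<and>
    (\<forall>p. Re p < s \<longrightarrow> (\<Sum>i\<le>n. poly (P i) (exp p) * (deriv ^^ i) g p) = 0) \<and>
    (\<forall>p. Re p < s \<longrightarrow> (\<Sum>i\<le>m. poly (B i) (exp p) * g (of_nat (q ^ i) * p)) = 0)"
proof -
  let ?T = "\<lambda>f x. x * deriv f (x :: complex)"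
  let ?U = "eball 0 (fls_conv_radius h) - {0} :: complex set"
  have U: "open ?U" by auto
  have hol: "eval_fls h holomorphic_on ?U" by (rule holomorphic_on_eval_fls) auto
  have "(?T ^^ i) (eval_fls h) has_laurent_expansion (fls_delta ^^ i) h" for i
  proof (induction i)
    case (Suc i)
    show ?case unfolding funpow.simps o_apply fls_delta_def[of "(fls_delta ^^ i) h"]
      by (intro has_laurent_expansion_mult has_laurent_expansion_deriv Suc has_laurent_expansion_fps[OF has_fps_expansion_fps_X, unfolded fps_X_to_fls])
  qed (simp add: eval_fls_has_laurent_expansion[OF h])
  then have "eventually (\<lambda>x. (\<Sum>i\<le>n. poly (P i) x * (?T ^^ i) (eval_fls h) x) = 0) (at 0)"
    by (intro eval_fls_relation_near_zero[OF _ P])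
  then obtain s1 where s1: "\<And>p. Re p < s1 \<Longrightarrow> (\<Sum>i\<le>n. poly (P i) (exp p) * (?T ^^ i) (eval_fls h) (exp p)) = 0"
    using eventually_at_zero_exp by blast
  have "(\<lambda>x. eval_fls h (x ^ (q ^ i))) has_laurent_expansion fls_compose_power h (q ^ i)" for i
  proof -
    have qi: "q ^ i > 0" using q by simp
    have "(eval_fls h \<circ> (\<lambda>x. x ^ (q ^ i))) has_laurent_expansion fls_compose_fps h (fps_X ^ (q ^ i))"
      by (intro has_laurent_expansion_compose eval_fls_has_laurent_expansion h has_laurent_expansion_fps has_fps_expansion_fps_X_power)
         (use qi in auto)
    then show ?thesis unfolding fls_compose_fps_X_power[OF qi] by (simp add: o_def)
  qed
  then have "eventually (\<lambda>x. (\<Sum>i\<le>m. poly (B i) x * eval_fls h (x ^ (q ^ i))) = 0) (at 0)"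
    by (intro eval_fls_relation_near_zero[OF _ B])
  then obtain s2 where s2: "\<And>p. Re p < s2 \<Longrightarrow> (\<Sum>i\<le>m. poly (B i) (exp p) * eval_fls h (exp p ^ (q ^ i))) = 0"
    using eventually_at_zero_exp by blast
  have "eventually (\<lambda>x. x \<in> ?U) (at 0)" by (rule eventually_at_in_open) (use h in \<open>auto simp: zero_ereal_def\<close>)
  then obtain s3 where s3: "\<And>p. Re p < s3 \<Longrightarrow> exp p \<in> ?U"
    using eventually_at_zero_exp by blast
  show ?thesis
  proof (intro exI[of _ "min s1 (min s2 s3)"] conjI allI impI)
    show "g analytic_on {p. Re p < min s1 (min s2 s3)}"
      unfolding g_def
    proof (rule analytic_on_eval_fls')
      show "exp analytic_on {p. Re p < min s1 (min s2 s3)}" by (intro analytic_intros)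
      show "exp ` {p. Re p < min s1 (min s2 s3)} \<subseteq> eball 0 (fls_conv_radius h) - (if 0 \<le> fls_subdegree h then {} else {0})"
        using s3 by auto
    qed
    fix p assume p: "Re p < min s1 (min s2 s3)"
    then show "(\<Sum>i\<le>n. poly (P i) (exp p) * (deriv ^^ i) g p) = 0"
      unfolding g_def using s1[of p] funpow_deriv_exp[OF hol U] s3[of p] by simp
    have "exp p ^ (q ^ i) = exp (of_nat (q ^ i) * p)" for i by (simp only: exp_of_nat_mult)
    then show "(\<Sum>i\<le>m. poly (B i) (exp p) * g (of_nat (q ^ i) * p)) = 0"
      unfolding g_def using s2[of p] p by simp
  qed
qed

lemma fls_eq_quotient:
  assumes h: "fls_conv_radius h > 0" and "v \<noteq> 0"
    and ev: "eventually (\<lambda>x. eval_fls h x = poly u x / poly v x) (at 0)"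
  shows "h \<in> fls_ratfuns"
proof (rule fls_ratfunsI[OF assms(2)])
  have v: "(\<lambda>x. poly v x) has_laurent_expansion fls_poly v"
    by (rule has_laurent_expansion_fps[OF poly_has_fps_expansion])
  have u: "(\<lambda>x. poly u x) has_laurent_expansion fls_poly u"
    by (rule has_laurent_expansion_fps[OF poly_has_fps_expansion])
  have "eventually (\<lambda>x. poly v x \<noteq> 0) (at 0)"
    using has_laurent_expansion_nonzero_imp_eventually_nonzero[OF v] assms(2) by simp
  with ev have "eventually (\<lambda>x. poly v x * eval_fls h x = poly u x) (at 0)" by eventually_elim simp
  moreover have "(\<lambda>x. poly v x * eval_fls h x) has_laurent_expansion fls_poly v * h"
    by (intro has_laurent_expansion_mult v eval_fls_has_laurent_expansion h)
  ultimately have "(\<lambda>x. poly u x) has_laurent_expansion fls_poly v * h"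
    using has_laurent_expansion_cong[of "\<lambda>x. poly v x * eval_fls h x" "\<lambda>x. poly u x"] by blast
  then show "fls_poly v * h = fls_poly u" using u by (rule has_laurent_expansion_unique)
qed

text \<open>With \<open>m k\<close> the size of the \<open>k\<close>-th coefficients of \<open>F, \<dots>, F\<^bsup>(n-1)\<^esup>\<close> at radius \<open>t\<close>, the partial sums
  \<open>S k\<close> of \<open>m\<close> satisfy \<open>S (k + 1) \<le> (1 + B / (k + 1)) S k\<close>, so they grow subexponentially.\<close>

lemma fps_ode_conv_radius:
  fixes F :: "complex fps"
  assumes ode: "(fps_deriv ^^ n) F = (\<Sum>i<n. A i * (fps_deriv ^^ i) F)"
    and A: "\<And>i. i < n \<Longrightarrow> fps_conv_radius (A i) \<ge> ereal R"
  shows "fps_conv_radius F \<ge> ereal R"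
proof (cases "n = 0")
  case True
  then have "F = 0" using ode by simp
  then show ?thesis by simp
next
  case n: False
  show ?thesis
    unfolding fps_conv_radius_def
  proof (rule conv_radius_geI_ex')
    fix r :: real assume r: "0 < r" "ereal r < ereal R"
    \<comment> \<open>At a radius \<open>t\<close> strictly between \<open>r\<close> and
      \<open>R\<close> the coefficients of the equation are bounded, and the ratio
      \<open>x = r / t < 1\<close> is left for convergence.\<close>
    then obtain t where t: "r < t" "t < R" using dense[of r R] by auto
    define u where "u = (\<lambda>i. (fps_deriv ^^ i) F)"
    have "\<exists>M. \<forall>l. norm (fps_nth (A i) l) * t ^ l \<le> M" if "i < n" for i
    proof -
      have "ereal (norm (of_real t :: complex)) < fps_conv_radius (A i)"
        using A[OF that] t r by (intro less_le_trans[OF _ A[OF that]]) auto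
      then have "summable (\<lambda>l. fps_nth (A i) l * of_real t ^ l)"
        unfolding fps_conv_radius_def by (rule summable_in_conv_radius)
      then have "Bseq (\<lambda>l. fps_nth (A i) l * of_real t ^ l)" by (rule convergent_imp_Bseq[OF convergentI[OF summable_LIMSEQ_zero]])
      then obtain M where "\<And>l. norm (fps_nth (A i) l * of_real t ^ l) \<le> M" by (auto simp: Bseq_def)
      then show ?thesis using t r by (intro exI[of _ M]) (simp add: norm_mult norm_power)
    qed
    then obtain M0 where M0: "\<And>i l. i < n \<Longrightarrow> norm (fps_nth (A i) l) * t ^ l \<le> M0 i" by metis
    define M where "M = (\<Sum>i<n. \<bar>M0 i\<bar>)"
    have M: "norm (fps_nth (A i) l) * t ^ l \<le> M" if "i < n" for i l
    proof -
      have "norm (fps_nth (A i) l) * t ^ l \<le> \<bar>M0 i\<bar>" using M0[OF that, of l] by simp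
      also have "\<dots> \<le> M" unfolding M_def by (rule member_le_sum) (use that in auto)
      finally show ?thesis .
    qed
    have M_nonneg: "M \<ge> 0" by (simp add: M_def sum_nonneg)
    define m where "m = (\<lambda>k. \<Sum>i<n. norm (fps_nth (u i) k) * t ^ k)"
    define S where "S = (\<lambda>k. \<Sum>l\<le>k. m l)"
    have t0: "t > 0" using t r by simp
    have m0: "m k \<ge> 0" for k using t0 by (auto simp: m_def intro!: sum_nonneg)
    have S0: "S k \<ge> 0" for k using m0 by (simp add: S_def sum_nonneg)
    have um: "norm (fps_nth (u i) k) * t ^ k \<le> m k" if "i < n" for i k
      unfolding m_def by (rule member_le_sum) (use that t0 in auto)
    have mS: "m k \<le> S k" for k unfolding S_def by (rule member_le_sum) (use m0 in auto)
    have step: "real (Suc k) * (norm (fps_nth (u i) (Suc k)) * t ^ Suc k) \<le> t * (1 + real n * M) * S k" if i: "i < n" for i k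
    proof -
      have e: "of_nat (Suc k) * fps_nth (u i) (Suc k) = fps_nth (u (Suc i)) k" by (simp add: u_def)
      have "real (Suc k) * (norm (fps_nth (u i) (Suc k)) * t ^ Suc k) = t * (norm (fps_nth (u (Suc i)) k) * t ^ k)"
        unfolding e[symmetric] norm_mult norm_of_nat by simp
      also have "norm (fps_nth (u (Suc i)) k) * t ^ k \<le> (1 + real n * M) * S k"
      \<comment> \<open>Below the top order the derivative is again one of the \<open>u i\<close>.
        At the top order the equation expresses it by convolutions, which is why the partial sums
        \<open>S\<close> enter.\<close>
      proof (cases "Suc i < n")
        case True
        have "norm (fps_nth (u (Suc i)) k) * t ^ k \<le> 1 * S k" using um[OF True, of k] mS[of k] by simp
        also have "\<dots> \<le> (1 + real n * M) * S k" using M_nonneg S0 by (intro mult_right_mono) auto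
        finally show ?thesis .
      next
        case False
        then have "Suc i = n" using i by simp
        then have "u (Suc i) = (\<Sum>i<n. A i * u i)" using ode by (simp add: u_def)
        then have "fps_nth (u (Suc i)) k = (\<Sum>i<n. \<Sum>l=0..k. fps_nth (A i) l * fps_nth (u i) (k - l))"
          by (simp add: fps_sum_nth fps_mult_nth)
        then have "norm (fps_nth (u (Suc i)) k) \<le> (\<Sum>i<n. \<Sum>l=0..k. norm (fps_nth (A i) l) * norm (fps_nth (u i) (k - l)))"
          by (auto intro!: order_trans[OF norm_sum] sum_mono simp: norm_mult simp flip: norm_mult)
        then have "norm (fps_nth (u (Suc i)) k) * t ^ k \<le> (\<Sum>i<n. \<Sum>l=0..k. norm (fps_nth (A i) l) * norm (fps_nth (u i) (k - l))) * t ^ k"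
          using t0 by (intro mult_right_mono) auto
        also have "\<dots> = (\<Sum>i<n. \<Sum>l=0..k. (norm (fps_nth (A i) l) * t ^ l) * (norm (fps_nth (u i) (k - l)) * t ^ (k - l)))"
          unfolding sum_distrib_right
        proof (intro sum.cong refl)
          fix i l assume "l \<in> {0..k}"
          then have "t ^ k = t ^ l * t ^ (k - l)" by (simp flip: power_add)
          then show "norm (fps_nth (A i) l) * norm (fps_nth (u i) (k - l)) * t ^ k =
             (norm (fps_nth (A i) l) * t ^ l) * (norm (fps_nth (u i) (k - l)) * t ^ (k - l))" by simp
        qed
        also have "\<dots> \<le> (\<Sum>i<n. \<Sum>l=0..k. M * m (k - l))"
          using M um t0 M_nonneg by (intro sum_mono mult_mono) auto
        also have "\<dots> = real n * M * (\<Sum>l=0..k. m (k - l))" by (simp add: sum_distrib_left mult.assoc)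
        also have "(\<Sum>l=0..k. m (k - l)) = S k"
          unfolding S_def by (rule sum.reindex_bij_witness[of _ "\<lambda>l. k - l" "\<lambda>l. k - l"]) auto
        also have "real n * M * S k \<le> (1 + real n * M) * S k" using S0[of k] by (simp add: algebra_simps)
        finally show ?thesis .
      qed
      finally show ?thesis using t0 by (simp add: mult.assoc)
    qed
    define B where "B = real n * (t * (1 + real n * M))"
    have B0: "B \<ge> 0" using t0 M_nonneg by (simp add: B_def)
    have Srec: "S (Suc k) \<le> (1 + B / real (Suc k)) * S k" for k
    proof -
      have "real (Suc k) * m (Suc k) = (\<Sum>i<n. real (Suc k) * (norm (fps_nth (u i) (Suc k)) * t ^ Suc k))"
        by (simp only: m_def sum_distrib_left)
      also have "\<dots> \<le> (\<Sum>i<n. t * (1 + real n * M) * S k)" by (rule sum_mono) (use step in auto)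
      also have "\<dots> = B * S k" by (simp add: B_def)
      finally have "m (Suc k) \<le> B * S k / real (Suc k)" by (simp add: field_simps)
      then show ?thesis by (simp add: S_def algebra_simps)
    qed
    define x where "x = r / t"
    have x: "0 < x" "x < 1" using t r by (auto simp: x_def)
    \<comment> \<open>From \<open>K\<close> on, the ratio of consecutive terms is at most
      \<open>(1 + x) / 2 < 1\<close>.\<close>
    obtain K :: nat where K: "2 * B * x / (1 - x) \<le> real K" using real_arch_simple by blast
    have "summable (\<lambda>k. S k * x ^ k)"
    proof (rule summable_ratio_test[of "(1 + x) / 2" K])
      fix k assume "k \<ge> K"
      then have "2 * B * x / (1 - x) \<le> real (Suc k)" using K by linarith
      then have "B * x / real (Suc k) \<le> (1 - x) / 2" using x by (simp add: field_simps)
      then have "(1 + B / real (Suc k)) * x \<le> (1 + x) / 2" by (simp add: field_simps)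
      then have "(1 + B / real (Suc k)) * x * (S k * x ^ k) \<le> (1 + x) / 2 * (S k * x ^ k)"
        using S0 x by (intro mult_right_mono) auto
      moreover have "S (Suc k) * x ^ Suc k \<le> (1 + B / real (Suc k)) * S k * x ^ Suc k"
        using Srec[of k] x by (intro mult_right_mono) auto
      moreover have "(1 + B / real (Suc k)) * S k * x ^ Suc k = (1 + B / real (Suc k)) * x * (S k * x ^ k)" by simp
      moreover have "norm (S k * x ^ k) = S k * x ^ k" for k using S0[of k] x by simp
      ultimately show "norm (S (Suc k) * x ^ Suc k) \<le> (1 + x) / 2 * norm (S k * x ^ k)" by (simp only:)
    qed (use x in auto)
    then show "summable (\<lambda>k. fps_nth F k * of_real r ^ k)"
    proof (rule summable_comparison_test'[of _ 0])
      fix k :: nat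
      have "norm (fps_nth F k * of_real r ^ k) = norm (fps_nth (u 0) k) * t ^ k * x ^ k"
        using r t0 by (simp add: norm_mult norm_power u_def x_def power_divide)
      also have "\<dots> \<le> S k * x ^ k"
        using um[of 0 k] mS[of k] n x by (intro mult_right_mono) auto
      finally show "norm (fps_nth F k * of_real r ^ k) \<le> S k * x ^ k" .
    qed
  qed
qed

text \<open>At the regular point \<open>z\<close> a meromorphic solution has no pole, so its
  expansion is a power series. After division by the leading coefficient, which has no zero in the
  ball, the coefficients are holomorphic there, and the series converges in the whole ball.\<close>

lemma ode_continuation_ball:
  assumes G: "G meromorphic_on {z}" and R: "R > 0" and p: "\<And>w. w \<in> ball z R \<Longrightarrow> poly (P n) (exp w) \<noteq> 0"
    and ode: "eventually (\<lambda>x. (\<Sum>i\<le>n. poly (P i) (exp x) * (deriv ^^ i) G x) = 0) (at z)"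
  shows "\<exists>E. E holomorphic_on ball z R \<and> eventually (\<lambda>x. E x = G x) (at z)"
proof -
  define L where "L = laurent_expansion G z"
  have L: "(\<lambda>w. G (z + w)) has_laurent_expansion L"
    unfolding L_def by (rule meromorphic_on_imp_has_laurent_expansion[OF G]) simp
  define C where "C = (\<lambda>i. fps_expansion (\<lambda>p. poly (P i) (exp p)) z)"
  have rel: "(\<Sum>i\<le>n. fps_to_fls (C i) * (fls_deriv ^^ i) L) = 0"
    unfolding C_def by (rule ode_laurent[OF L ode])
  have Cn: "fps_nth (C n) 0 \<noteq> 0" unfolding C_def fps_expansion_exp_poly_0 using p[of z] R by simp
  have "fls_subdegree L \<ge> 0"
    using fls_ode_subdegree[OF rel Cn] by (cases "L = 0") auto
  then obtain F where F: "L = fps_to_fls F" by (metis fls_regpart_to_fls_trivial)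
  have dF: "(fls_deriv ^^ i) L = fps_to_fls ((fps_deriv ^^ i) F)" for i
    by (induction i) (simp_all add: F fls_deriv_fps_to_fls)
  have "fps_to_fls (\<Sum>i\<le>k. C i * (fps_deriv ^^ i) F) = (\<Sum>i\<le>k. fps_to_fls (C i) * (fls_deriv ^^ i) L)" for k
    by (induction k) (simp_all only: sum.atMost_Suc atMost_0 sum.insert sum.empty finite.emptyI empty_iff not_False_eq_True add_0_right fps_to_fls_plus fls_times_fps_to_fls dF)
  then have ps: "(\<Sum>i\<le>n. C i * (fps_deriv ^^ i) F) = 0" using rel by (metis fps_to_fls_eq_0_iff)
  have inv: "inverse (C n) * C n = 1" using Cn by (rule inverse_mult_eq_1)
  have "fps_conv_radius F \<ge> ereal R"
  proof (rule fps_ode_conv_radius)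
    have "C n * (fps_deriv ^^ n) F = - (\<Sum>i<n. C i * (fps_deriv ^^ i) F)"
      using ps by (simp add: lessThan_Suc_atMost[symmetric] eq_neg_iff_add_eq_0 add.commute)
    then have "inverse (C n) * C n * (fps_deriv ^^ n) F = inverse (C n) * - (\<Sum>i<n. C i * (fps_deriv ^^ i) F)"
      by (simp only: mult.assoc)
    then show "(fps_deriv ^^ n) F = (\<Sum>i<n. (- (inverse (C n) * C i)) * (fps_deriv ^^ i) F)"
      by (simp add: inv sum_distrib_left sum_negf mult.assoc)
    fix i
    have "(\<lambda>w. - (inverse (poly (P n) (exp (z + w))) * poly (P i) (exp (z + w)))) has_fps_expansion - (inverse (C n) * C i)"
      unfolding C_def
      by (intro has_fps_expansion_minus has_fps_expansion_mult has_fps_expansion_inverse exp_poly_has_fps_expansion Cn[unfolded C_def])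
    moreover have "(\<lambda>w. - (inverse (poly (P n) (exp (z + w))) * poly (P i) (exp (z + w)))) holomorphic_on eball 0 (ereal R)"
    proof -
      have "poly (P n) (exp (z + w)) \<noteq> 0" if "w \<in> eball 0 (ereal R)" for w
        by (rule p) (use that in \<open>auto simp: dist_norm\<close>)
      moreover have "(\<lambda>w. poly u (exp (z + w))) holomorphic_on A" for u A
        unfolding poly_altdef by (intro holomorphic_intros)
      ultimately show ?thesis by (intro holomorphic_intros) auto
    qed
    ultimately show "fps_conv_radius (- (inverse (C n) * C i)) \<ge> ereal R" by (rule holomorphic_on_imp_fps_conv_radius_ge)
  qed
  then have hol: "eval_fps F holomorphic_on ball 0 R"
  proof (intro holomorphic_on_eval_fps subsetI)
    fix w :: complex assume "w \<in> ball 0 R"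
    then have "ereal (norm w) < ereal R" by simp
    also have "\<dots> \<le> fps_conv_radius F" by fact
    finally show "w \<in> eball 0 (fps_conv_radius F)" by simp
  qed
  have "(\<lambda>w. eval_fps F (w - z)) holomorphic_on ball z R"
    by (rule holomorphic_on_compose_gen[OF _ hol, unfolded o_def])
       (auto intro!: holomorphic_intros simp: dist_norm norm_minus_commute)
  moreover have "eventually (\<lambda>x. eval_fps F (x - z) = G x) (at z)"
  proof -
    have "eventually (\<lambda>w. eval_fls L w = G (z + w)) (at 0)" using L by (simp add: has_laurent_expansion_def)
    moreover have "eventually (\<lambda>w. w \<in> ball 0 R - {0}) (at (0::complex))" by (rule eventually_at_in_open) (use R in auto)
    ultimately have "eventually (\<lambda>w. eval_fps F w = G (z + w)) (at 0)"
    proof eventually_elim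
      case (elim w)
      have "ereal (norm w) < fps_conv_radius F"
        using elim(2) by (intro less_le_trans[OF _ \<open>fps_conv_radius F \<ge> ereal R\<close>]) auto
      then have "eval_fls L w = eval_fps F w" unfolding F by (intro eval_fps_to_fls) auto
      then show ?case using elim(1) by simp
    qed
    then show ?thesis unfolding at_to_0[of z] eventually_filtermap by (simp add: add.commute)
  qed
  ultimately show ?thesis by (intro exI[of _ "\<lambda>w. eval_fps F (w - z)"]) auto
qed

text \<open>The normalisation by \<open>remove_sings\<close> matters: the points where \<open>E (k + 1)\<close> and \<open>E k\<close> differ may
  accumulate at the boundary of \<open>X k\<close>.\<close>

lemma meromorphic_glue:
  fixes X :: "nat \<Rightarrow> complex set"
  assumes X: "\<And>k. open (X k)" "\<And>k. X k \<subseteq> X (Suc k)" and E: "\<And>k. E k meromorphic_on X k"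
    and agree: "\<And>k z. z \<in> X k \<Longrightarrow> eventually (\<lambda>w. E (Suc k) w = E k w) (at z)"
  shows "\<exists>F. F meromorphic_on (\<Union>k. X k) \<and> (\<forall>k. \<forall>z\<in>X k. eventually (\<lambda>w. F w = E k w) (at z))"
proof -
  have mono: "X k \<subseteq> X l" if "k \<le> l" for k l using X(2) that by (rule lift_Suc_mono_le)
  have ag: "eventually (\<lambda>w. E (k + d) w = E k w) (at z)" if z: "z \<in> X k" for k d z
  proof (induction d)
    case (Suc d)
    have "eventually (\<lambda>w. E (Suc (k + d)) w = E (k + d) w) (at z)"
      by (rule agree) (use mono[of k "k + d"] z in auto)
    with Suc show ?case by eventually_elim simp
  qed simp
  define F where "F = (\<lambda>z. remove_sings (E (LEAST k. z \<in> X k)) z)"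
  have F: "F z = remove_sings (E k) z" if z: "z \<in> X k" for k z
  proof -
    define l where "l = (LEAST k. z \<in> X k)"
    have l: "z \<in> X l" "l \<le> k" unfolding l_def using z by (auto intro: LeastI Least_le)
    have "eventually (\<lambda>w. E l w = E k w) (at z)"
      using ag[OF l(1), of "k - l"] l(2) by (simp add: eq_commute)
    then show ?thesis unfolding F_def l_def[symmetric] by (rule remove_sings_cong) simp
  qed
  have ev: "eventually (\<lambda>w. F w = E k w) (at z)" if z: "z \<in> X k" for k z
  proof -
    have "eventually (\<lambda>w. w \<in> X k) (at z)" using X(1) z by (intro eventually_at_in_open')
    moreover have "eventually (\<lambda>w. remove_sings (E k) w = E k w) (at z)"
      using eventually_remove_sings_eq[OF E] X(1) z by (simp add: eventually_cosparse_open_eq)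
    ultimately show ?thesis by eventually_elim (simp add: F)
  qed
  have "F meromorphic_on X k" for k using E meromorphic_on_cong[of "X k" F "E k" "X k"] ev by blast
  then have "F meromorphic_on (\<Union>k. X k)" by (rule meromorphic_on_UN)
  then show ?thesis using ev by blast
qed

section \<open>Continuation of Mahler functions\<close>

text \<open>Equality of meromorphic functions on \<open>A\<close>: exceptional points have no
  accumulation point in \<open>A\<close>, but they may accumulate at its boundary.\<close>

definition agree_on :: "(complex \<Rightarrow> complex) \<Rightarrow> (complex \<Rightarrow> complex) \<Rightarrow> complex set \<Rightarrow> bool" where
  "agree_on f g A \<longleftrightarrow> (\<forall>z\<in>A. eventually (\<lambda>w. f w = g w) (at z))"

lemma agree_onI: "(\<And>z. z \<in> A \<Longrightarrow> eventually (\<lambda>w. f w = g w) (at z)) \<Longrightarrow> agree_on f g A"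
  by (simp add: agree_on_def)

lemma agree_onD: "agree_on f g A \<Longrightarrow> z \<in> A \<Longrightarrow> eventually (\<lambda>w. f w = g w) (at z)"
  by (simp add: agree_on_def)

lemma agree_on_trans:
  assumes "agree_on f g A" "agree_on g h A"
  shows "agree_on f h A"
proof (rule agree_onI)
  fix z assume "z \<in> A"
  from agree_onD[OF assms(1) this] agree_onD[OF assms(2) this]
  show "eventually (\<lambda>w. f w = h w) (at z)" by eventually_elim simp
qed

lemma agree_on_subset: "agree_on f g A \<Longrightarrow> B \<subseteq> A \<Longrightarrow> agree_on f g B"
  unfolding agree_on_def by blast

lemma agree_on_hat_eq: "agree_on f g UNIV \<longleftrightarrow> hat_eq f g"
  by (simp add: agree_on_def hat_eq_iff)

lemma agree_on_affine:
  assumes "agree_on f g A" "a \<noteq> 0" "\<And>p. p \<in> B \<Longrightarrow> a * p + b \<in> A"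
  shows "agree_on (\<lambda>p. f (a * p + b)) (\<lambda>p. g (a * p + b)) B"
  unfolding agree_on_def using assms(1,3) by (auto intro!: eventually_at_affine[OF _ assms(2)] simp: agree_on_def)

lemma agree_on_deriv: "agree_on f g A \<Longrightarrow> agree_on (deriv f) (deriv g) A"
  by (simp add: agree_on_def eventually_at_deriv_eq)

lemma agree_on_funpow_deriv: "agree_on f g A \<Longrightarrow> agree_on ((deriv ^^ i) f) ((deriv ^^ i) g) A"
  by (induction i) (auto intro: agree_on_deriv)

lemma agree_on_identity:
  assumes "f meromorphic_on A" "g meromorphic_on A" "open A" "connected A" "z \<in> A"
    and "eventually (\<lambda>w. f w = g w) (at z)"
  shows "agree_on f g A"
proof -
  have "eventually (\<lambda>w. f w - g w = 0) (cosparse A)"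
    by (rule meromorphic_identity[OF meromorphic_on_diff[OF assms(1,2)] assms(3-5)]) (use assms(6) in simp)
  then show ?thesis using assms(3) by (simp add: eventually_cosparse_open_eq agree_on_def)
qed

lemma agree_on_relation:
  fixes p :: "nat \<Rightarrow> complex poly"
  assumes "\<And>i. i \<le> n \<Longrightarrow> agree_on (f i) (g i) A"
  shows "agree_on (\<lambda>x. \<Sum>i\<le>n. poly (p i) (exp x) * f i x) (\<lambda>x. \<Sum>i\<le>n. poly (p i) (exp x) * g i x) A"
proof (rule agree_onI)
  fix z assume "z \<in> A"
  then have "eventually (\<lambda>x. \<forall>i\<in>{..n}. f i x = g i x) (at z)"
    by (intro eventually_ball_finite) (use assms in \<open>auto simp: agree_on_def\<close>)
  then show "eventually (\<lambda>x. (\<Sum>i\<le>n. poly (p i) (exp x) * f i x) = (\<Sum>i\<le>n. poly (p i) (exp x) * g i x)) (at z)"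
    by eventually_elim auto
qed

lemma meromorphic_on_relation:
  fixes p :: "nat \<Rightarrow> complex poly"
  assumes "\<And>i. i \<le> n \<Longrightarrow> f i meromorphic_on A"
  shows "(\<lambda>x. \<Sum>i\<le>n. poly (p i) (exp x) * f i x) meromorphic_on A"
  using assms by (intro meromorphic_on_sum meromorphic_on_mult meromorphic_exp_poly) auto

lemma meromorphic_on_funpow_deriv: "f meromorphic_on A \<Longrightarrow> (deriv ^^ i) f meromorphic_on A"
  by (induction i) (auto intro: meromorphic_on_deriv)

lemma meromorphic_on_affine:
  assumes "f meromorphic_on A" "\<And>p. p \<in> B \<Longrightarrow> a * p + b \<in> A"
  shows "(\<lambda>p. f (a * p + b)) meromorphic_on B"
  by (rule meromorphic_on_compose[OF assms(1)]) (use assms(2) in \<open>auto intro!: analytic_intros\<close>)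

text \<open>Solving \<open>b\<^sub>0(e\<^sup>\<kappa>\<^sup>p) E(p) + (\<Sum>i. b\<^sub>i(e\<^sup>\<kappa>\<^sup>p) E(a\<^sub>i p)) = 0\<close> for \<open>E(p)\<close>.\<close>

definition solve_mahler ::
  "complex poly \<Rightarrow> (nat \<Rightarrow> complex poly) \<Rightarrow> complex \<Rightarrow> nat set \<Rightarrow> (nat \<Rightarrow> complex) \<Rightarrow> (complex \<Rightarrow> complex) \<Rightarrow> complex \<Rightarrow> complex" where
  "solve_mahler b0 b \<kappa> I a E p = - (\<Sum>i\<in>I. poly (b i) (exp (\<kappa> * p)) * E (a i * p)) / poly b0 (exp (\<kappa> * p))"

lemma solve_mahler_meromorphic:
  assumes "E meromorphic_on A" "\<And>i p. i \<in> I \<Longrightarrow> p \<in> B \<Longrightarrow> a i * p \<in> A"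
  shows "solve_mahler b0 b \<kappa> I a E meromorphic_on B"
proof -
  have "(\<lambda>p. poly u (exp (\<kappa> * p))) meromorphic_on B" for u
    unfolding poly_altdef by (intro analytic_on_imp_meromorphic_on analytic_intros)
  moreover have "(\<lambda>p. E (a i * p)) meromorphic_on B" if "i \<in> I" for i
    using meromorphic_on_affine[OF assms(1), of B "a i" 0] assms(2)[OF that] by simp
  ultimately show ?thesis
    unfolding solve_mahler_def[abs_def]
    by (intro meromorphic_on_divide meromorphic_on_uminus meromorphic_on_sum meromorphic_on_mult) auto
qed

lemma solve_mahler_agree:
  assumes "agree_on E E' A" "finite I" "\<And>i. i \<in> I \<Longrightarrow> a i \<noteq> 0" "\<And>i p. i \<in> I \<Longrightarrow> p \<in> B \<Longrightarrow> a i * p \<in> A"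
  shows "agree_on (solve_mahler b0 b \<kappa> I a E) (solve_mahler b0 b \<kappa> I a E') B"
proof (rule agree_onI)
  fix z assume z: "z \<in> B"
  have "eventually (\<lambda>w. E (a i * w) = E' (a i * w)) (at z)" if "i \<in> I" for i
    using agree_onD[OF agree_on_affine[OF assms(1) assms(3)[OF that], of B 0] z] assms(4)[OF that] by simp
  then have "eventually (\<lambda>w. \<forall>i\<in>I. E (a i * w) = E' (a i * w)) (at z)"
    using assms(2) by (simp add: eventually_ball_finite)
  then show "eventually (\<lambda>w. solve_mahler b0 b \<kappa> I a E w = solve_mahler b0 b \<kappa> I a E' w) (at z)"
    by eventually_elim (simp add: solve_mahler_def)
qed

lemma solve_mahler_solves:
  assumes "b0 \<noteq> 0" "\<kappa> \<noteq> 0"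
    and "eventually (\<lambda>w. poly b0 (exp (\<kappa> * w)) * E w + (\<Sum>i\<in>I. poly (b i) (exp (\<kappa> * w)) * E (a i * w)) = 0) (at z)"
  shows "eventually (\<lambda>w. solve_mahler b0 b \<kappa> I a E w = E w) (at z)"
proof -
  have "eventually (\<lambda>w. poly b0 (exp (\<kappa> * w)) \<noteq> 0) (at z)"
    using eventually_cosparse_affine[OF eventually_poly_exp_nonzero[OF assms(1)] assms(2), of 0]
    by (simp add: eventually_cosparse_open_eq)
  with assms(3) show ?thesis
  proof eventually_elim
    case (elim w)
    then have "- (\<Sum>i\<in>I. poly (b i) (exp (\<kappa> * w)) * E (a i * w)) = E w * poly b0 (exp (\<kappa> * w))"
      by (simp add: neg_eq_iff_add_eq_0 add.commute mult.commute)
    then show ?case using elim(2) by (simp add: solve_mahler_def)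
  qed
qed

lemma open_left_half_plane: "open {p. Re p < s}" and connected_left_half_plane: "connected {p. Re p < s}"
  by (simp_all add: open_halfspace_Re_lt convex_connected convex_halfspace_Re_lt)

text \<open>The equation is solved for its term of lowest order; the other arguments
  \<open>q ^ (i + 1) p\<close> lie further to the left. Each application divides the abscissa of the
  boundary by \<open>q\<close>.\<close>

lemma mahler_extend_inward:
  assumes g: "g meromorphic_on {p. Re p < s}" and s: "s < 0" and q: "q \<ge> (2 :: nat)" and B0: "B 0 \<noteq> 0"
    and rel: "\<And>p. Re p < s \<Longrightarrow> (\<Sum>i\<le>m. poly (B i) (exp p) * g (of_nat (q ^ i) * p)) = 0"
  shows "\<exists>G. G meromorphic_on {p. Re p < s / of_nat (q ^ k)} \<and> agree_on G g {p. Re p < s}"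
proof (induction k)
  case 0
  show ?case using g by (intro exI[of _ g]) (auto simp: agree_on_def)
next
  case (Suc k)
  then obtain G where G: "G meromorphic_on {p. Re p < s / of_nat (q ^ k)}" "agree_on G g {p. Re p < s}" by blast
  let ?S = "solve_mahler (B 0) (\<lambda>i. B (Suc i)) 1 {..<m} (\<lambda>i. of_nat (q ^ Suc i))"
  have mem: "Re (of_nat (q ^ Suc i) * p) < s' " if "Re p < s' / of_nat q" "s' < 0" for i p and s' :: real
  proof -
    have 1: "of_nat q * Re p < s'" using that(1) q by (simp add: field_simps)
    then have neg: "of_nat q * Re p < 0" using that(2) by linarith
    have "of_nat (q ^ i) * (of_nat q * Re p) \<le> 1 * (of_nat q * Re p)"
      using neg q by (intro mult_right_mono_neg) auto
    then show ?thesis using 1 by (simp add: mult_ac)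
  qed
  have sq: "s / of_nat (q ^ Suc k) = (s / of_nat (q ^ k)) / of_nat q" by (simp add: mult.commute)
  have mer: "?S G meromorphic_on {p. Re p < s / of_nat (q ^ Suc k)}"
  proof (rule solve_mahler_meromorphic[OF G(1)])
    fix i p assume "p \<in> {p. Re p < s / of_nat (q ^ Suc k)}"
    moreover have "s / of_nat (q ^ k) < 0" using s q by (simp add: divide_neg_pos)
    ultimately show "of_nat (q ^ Suc i) * p \<in> {p. Re p < s / of_nat (q ^ k)}"
      unfolding sq using mem[of p "s / of_nat (q ^ k)" i] by blast
  qed
  have "agree_on (?S G) (?S g) {p. Re p < s}"
  proof (rule solve_mahler_agree[OF G(2)])
    fix i p assume "p \<in> {p. Re p < s}"
    then have p: "Re p < s" by simp
    have "s * 1 \<ge> s * of_nat q" using s q by (intro mult_left_mono_neg) auto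
    then have "s \<le> s / of_nat q" using q by (simp add: field_simps)
    then show "of_nat (q ^ Suc i) * p \<in> {p. Re p < s}" using mem[of p s i] p s by auto
  qed (use q in auto)
  moreover have "agree_on (?S g) g {p. Re p < s}"
  proof (rule agree_onI, rule solve_mahler_solves[OF B0])
    fix z assume "z \<in> {p. Re p < s}"
    then have "eventually (\<lambda>w. w \<in> {p. Re p < s}) (at z)" by (intro eventually_at_in_open' open_left_half_plane)
    then show "eventually (\<lambda>w. poly (B 0) (exp (1 * w)) * g w +
      (\<Sum>i\<in>{..<m}. poly (B (Suc i)) (exp (1 * w)) * g (of_nat (q ^ Suc i) * w)) = 0) (at z)"
    proof eventually_elim
      case (elim w)
      then have "(\<Sum>i\<le>m. poly (B i) (exp w) * g (of_nat (q ^ i) * w)) = 0" using rel by simp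
      then show ?case by (subst (asm) sum.atMost_shift) simp
    qed
  qed simp
  ultimately show ?case using mer by (blast intro: agree_on_trans)
qed

text \<open>The disc with centre \<open>r (-1 + \<i>)\<close> through \<open>0\<close>. Scaling by \<open>a\<close> maps it to the disc for \<open>a r\<close>, and
  the union over all \<open>r\<close> is a half-plane.\<close>

definition tangent_disc :: "real \<Rightarrow> complex set" where
  "tangent_disc r = {p. (norm p)\<^sup>2 < 2 * r * (Im p - Re p)}"

lemma tangent_disc_eq_ball: "r > 0 \<Longrightarrow> tangent_disc r = ball (of_real r * (-1 + \<i>)) (r * sqrt 2)"
proof -
  assume r: "r > 0"
  have "dist (of_real r * (-1 + \<i>)) p < r * sqrt 2 \<longleftrightarrow> (norm p)\<^sup>2 < 2 * r * (Im p - Re p)" for p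
  proof -
    have "dist (of_real r * (-1 + \<i>)) p < r * sqrt 2 \<longleftrightarrow> (dist (of_real r * (-1 + \<i>)) p)\<^sup>2 < (r * sqrt 2)\<^sup>2"
      using r by (simp add: power_mono_iff flip: not_le)
    also have "(dist (of_real r * (-1 + \<i>)) p)\<^sup>2 = (- r - Re p)\<^sup>2 + (r - Im p)\<^sup>2"
      by (simp add: dist_norm cmod_power2)
    also have "(r * sqrt 2)\<^sup>2 = 2 * r\<^sup>2" by (simp add: power_mult_distrib)
    also have "(- r - Re p)\<^sup>2 + (r - Im p)\<^sup>2 = 2 * r\<^sup>2 + (((Re p)\<^sup>2 + (Im p)\<^sup>2) - 2 * r * (Im p - Re p))"
      by (simp add: power2_eq_square algebra_simps)
    finally show ?thesis by (simp add: cmod_power2)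
  qed
  then show ?thesis unfolding tangent_disc_def ball_def by blast
qed

lemma tangent_disc_center: "r > 0 \<Longrightarrow> of_real r * (-1 + \<i>) \<in> tangent_disc r"
  by (simp add: tangent_disc_eq_ball)

lemma tangent_disc_pos: "p \<in> tangent_disc r \<Longrightarrow> r > 0 \<Longrightarrow> Im p - Re p > 0"
proof -
  assume "p \<in> tangent_disc r" "r > 0"
  then have "0 < 2 * r * (Im p - Re p)" using le_less_trans[OF zero_le_power2[of "norm p"]] by (simp add: tangent_disc_def)
  then show ?thesis using \<open>r > 0\<close> by (simp add: zero_less_mult_iff)
qed

lemma tangent_disc_mono:
  assumes "0 < r" "r \<le> r'" "p \<in> tangent_disc r"
  shows "p \<in> tangent_disc r'"
proof -
  have "2 * r * (Im p - Re p) \<le> 2 * r' * (Im p - Re p)"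
    using assms tangent_disc_pos[OF assms(3,1)] by (intro mult_right_mono) auto
  then show ?thesis using assms(3) by (simp add: tangent_disc_def)
qed

lemma tangent_disc_scale:
  assumes "a > 0" "p \<in> tangent_disc r"
  shows "of_real a * p \<in> tangent_disc (a * r)"
proof -
  have "a\<^sup>2 * (norm p)\<^sup>2 < a\<^sup>2 * (2 * r * (Im p - Re p))"
    using assms by (intro mult_strict_left_mono) (auto simp: tangent_disc_def)
  moreover have "(norm (of_real a * p))\<^sup>2 = a\<^sup>2 * (norm p)\<^sup>2" by (simp add: norm_mult power_mult_distrib)
  moreover have "2 * (a * r) * (Im (of_real a * p) - Re (of_real a * p)) = a\<^sup>2 * (2 * r * (Im p - Re p))"
    by (simp add: power2_eq_square algebra_simps)
  ultimately show ?thesis by (simp only: tangent_disc_def mem_Collect_eq)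
qed

lemma tangent_disc_bounded:
  assumes "p \<in> tangent_disc r" "r > 0"
  shows "p \<noteq> 0" "norm p < 4 * r"
proof -
  show p0: "p \<noteq> 0" using assms by (auto simp: tangent_disc_def)
  have "norm p * norm p < 2 * r * (Im p - Re p)" using assms by (simp add: tangent_disc_def power2_eq_square)
  also have "\<dots> \<le> 2 * r * (2 * norm p)"
    using abs_Im_le_cmod[of p] abs_Re_le_cmod[of p] assms(2) by (intro mult_left_mono) linarith+
  finally have "norm p * norm p < norm p * (4 * r)" by (simp add: mult_ac)
  then show "norm p < 4 * r" using p0 by (simp add: mult_less_cancel_left_pos)
qed

text \<open>For \<open>Im p > Re p\<close> membership only asks the parameter of the disc to be
  large.\<close>

lemma tangent_disc_exhausts:
  assumes "Im p > Re p" "t > 0" "q \<ge> (2 :: nat)"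
  shows "\<exists>j. p \<in> tangent_disc (of_nat (q ^ j) * t)"
proof -
  define R where "R = (norm p)\<^sup>2 / (2 * t * (Im p - Re p))"
  obtain j :: nat where "R < of_nat q ^ j" using real_arch_pow[of "real q" R] assms(3) by auto
  then have "(norm p)\<^sup>2 < of_nat q ^ j * (2 * t * (Im p - Re p))"
    using assms by (simp add: R_def divide_less_eq mult_pos_pos)
  then show ?thesis by (intro exI[of _ j]) (simp add: tangent_disc_def algebra_simps)
qed

lemma open_above_diagonal: "open {p. Im p > Re p + a}" and convex_above_diagonal: "convex {p. Im p > Re p}"
proof -
  show "open {p. Im p > Re p + a}" by (intro open_Collect_less continuous_intros)
  have "{p. Im p > Re p} = {p. inner (1 - \<i>) p < 0}" by (auto simp: inner_complex_def)
  then show "convex {p. Im p > Re p}" by (simp add: convex_halfspace_lt)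
qed

text \<open>The condition \<open>B 0 \<noteq> 0\<close> gives convergence and inward continuation;
  \<open>B m \<noteq> 0\<close> gives outward continuation. The half-plane above the diagonal is
  used because it is mapped into itself by positive scalings and by
  \<open>p \<mapsto> p + period\<close>, while its translates downwards exhaust the plane; the
  half-plane \<open>Re p < 0\<close>, being invariant under the period, could not be enlarged in
  this way.\<close>

lemma fls_mahler_rational_regular:
  assumes q: "q \<ge> (2 :: nat)" and Pn: "P n \<noteq> 0" and B0: "B 0 \<noteq> 0" and Bm: "B m \<noteq> 0"
    and Prel: "(\<Sum>i\<le>n. fls_poly (P i) * (fls_delta ^^ i) h) = 0"
    and Brel: "(\<Sum>i\<le>m. fls_poly (B i) * fls_compose_power h (q ^ i)) = 0"
  shows "h \<in> fls_ratfuns"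
proof -
  define H where "H = (\<lambda>a. {p :: complex. Re p < a})"
  have H: "open (H a)" "convex (H a)" "connected (H a)" for a
    unfolding H_def by (simp_all add: open_left_half_plane connected_left_half_plane convex_halfspace_Re_lt)
  have conv: "fls_conv_radius h > 0" by (rule fls_mahler_converges[OF q B0 Brel])
  define g where "g = (\<lambda>p. eval_fls h (exp p))"
  obtain s1 where s1: "g analytic_on H s1"
    "\<And>p. Re p < s1 \<Longrightarrow> (\<Sum>i\<le>n. poly (P i) (exp p) * (deriv ^^ i) g p) = 0"
    "\<And>p. Re p < s1 \<Longrightarrow> (\<Sum>i\<le>m. poly (B i) (exp p) * g (of_nat (q ^ i) * p)) = 0"
    using fls_relations_on_half_plane[OF conv _ Prel Brel] q unfolding g_def H_def by auto
  \<comment> \<open>Negative, so that multiplication by \<open>q ^ i\<close> maps the half-plane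
    into itself.\<close>
  define s where "s = min s1 (-1)"
  have s: "s < 0" "s \<le> s1" by (auto simp: s_def)
  have ga: "g analytic_on H s" using s1(1) by (rule analytic_on_subset) (use s in \<open>auto simp: H_def\<close>)
  have gm: "g meromorphic_on H s" using ga by (rule analytic_on_imp_meromorphic_on)
  have gper: "g (p + period) = g p" for p unfolding g_def exp_period ..
  obtain e where e: "e > 0" "\<And>p. p \<noteq> 0 \<Longrightarrow> norm p < e \<Longrightarrow> poly (P n) (exp p) \<noteq> 0"
  proof -
    have "eventually (\<lambda>p. poly (P n) (exp p) \<noteq> 0) (at 0)"
      using eventually_poly_exp_nonzero[OF Pn] by (simp add: eventually_cosparse_open_eq)
    then show ?thesis using that unfolding eventually_at by auto
  qed
  \<comment> \<open>The disc with parameter \<open>t\<close> lies within distance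
    \<open>4 * t = e\<close> of \<open>0\<close> and omits \<open>0\<close>, so the leading
    coefficient has no zero on it.\<close>
  define t where "t = e / 4"
  have t: "t > 0" using e by (simp add: t_def)
  have q0: "of_nat (q ^ i) > (0 :: real)" "of_nat (q ^ i) \<ge> (1 :: real)" "of_nat (q ^ i) \<noteq> (0 :: complex)" for i
    using q by auto
  \<comment> \<open>So large that the boundary \<open>a\<close> of the continued half-plane lies to
    the right of \<open>- t / q ^ m\<close>; then all scaled centres \<open>c i * z0\<close> lie in
    it.\<close>
  obtain k where "- s * of_nat (q ^ m) / t < of_nat q ^ k"
    using real_arch_pow[of "real q" "- s * of_nat (q ^ m) / t"] q by auto
  then have k: "- s * of_nat (q ^ m) < t * of_nat (q ^ k)" using t by (simp add: field_simps)
  define a where "a = s / of_nat (q ^ k)"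
  have a: "a < 0" "s \<le> a"
    using s(1) q0[of k] by (auto simp: a_def divide_neg_pos le_divide_eq_1 field_simps)
  have ta: "- t / of_nat (q ^ m) < a"
    using k q0[of k] q0[of m] by (simp add: a_def field_simps)
  have Hsa: "H s \<subseteq> H a" using a by (auto simp: H_def)
  define z1 where "z1 = (of_real (s - 1) :: complex)"
  have z1: "z1 \<in> H s" "z1 \<in> H a" using a by (auto simp: z1_def H_def)
  have HsE: "eventually (\<lambda>w. w \<in> H s) (at z)" if "z \<in> H s" for z using H(1) that by (rule eventually_at_in_open')
  have dil: "of_nat (q ^ i) * p \<in> H b" if "p \<in> H b" "b < 0" for i p b
  proof -
    have "of_nat (q ^ i) * Re p \<le> 1 * Re p" using q0(2)[of i] that by (intro mult_right_mono_neg) (auto simp: H_def)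
    moreover have "Re p < b" using that by (simp add: H_def)
    ultimately show ?thesis by (simp add: H_def)
  qed
  have dilm: "(\<lambda>x. f (of_nat (q ^ i) * x)) meromorphic_on H b" if "f meromorphic_on H b" "b < 0" for f b i
    using meromorphic_on_affine[OF that(1), of "H b" "of_nat (q ^ i)" 0] dil that(2) by simp
  have transm: "(\<lambda>x. f (x + period)) meromorphic_on A" if "f meromorphic_on A'" "\<And>p. p \<in> A \<Longrightarrow> p + period \<in> A'" for f A A'
    using meromorphic_on_affine[OF that(1), of A 1 period] that(2) by simp
  have transH: "p + period \<in> H b \<longleftrightarrow> p \<in> H b" for p b by (simp add: H_def)
  obtain G where G: "G meromorphic_on H a" "agree_on G g (H s)"
    using mahler_extend_inward[of g s q B m k] gm s q B0 s1(3) unfolding H_def a_def by auto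

  \<comment> \<open>By the identity theorem both equations and the period spread from the half-plane
    of \<open>g\<close> to every connected domain containing it that is invariant under the scalings
    and the period. This is applied to \<open>G\<close>, and again to the final
    \<open>F\<close>.\<close>
  have transfer: "agree_on (\<lambda>x. \<Sum>i\<le>n. poly (P i) (exp x) * (deriv ^^ i) F x) (\<lambda>_. 0) A"
    "agree_on (\<lambda>x. \<Sum>i\<le>m. poly (B i) (exp x) * F (of_nat (q ^ i) * x)) (\<lambda>_. 0) A"
    "agree_on (\<lambda>x. F (x + period)) F A"
    if F: "F meromorphic_on A" "agree_on F g (H s)" and A: "open A" "connected A" "H s \<subseteq> A"
      "\<And>i p. p \<in> A \<Longrightarrow> of_nat (q ^ i) * p \<in> A" "\<And>p. p \<in> A \<Longrightarrow> p + period \<in> A" for F A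
  proof -
    have z1A: "z1 \<in> A" using z1 A by auto
    show "agree_on (\<lambda>x. \<Sum>i\<le>n. poly (P i) (exp x) * (deriv ^^ i) F x) (\<lambda>_. 0) A"
    proof (rule agree_on_identity[OF _ meromorphic_on_const A(1,2) z1A])
      show "(\<lambda>x. \<Sum>i\<le>n. poly (P i) (exp x) * (deriv ^^ i) F x) meromorphic_on A"
        by (intro meromorphic_on_relation meromorphic_on_funpow_deriv F)
      have "agree_on (\<lambda>x. \<Sum>i\<le>n. poly (P i) (exp x) * (deriv ^^ i) F x) (\<lambda>x. \<Sum>i\<le>n. poly (P i) (exp x) * (deriv ^^ i) g x) (H s)"
        by (intro agree_on_relation agree_on_funpow_deriv F)
      from agree_onD[OF this z1(1)] HsE[OF z1(1)]
      show "eventually (\<lambda>x. (\<Sum>i\<le>n. poly (P i) (exp x) * (deriv ^^ i) F x) = 0) (at z1)"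
        by eventually_elim (use s1(2) s in \<open>auto simp: H_def\<close>)
    qed
    show "agree_on (\<lambda>x. \<Sum>i\<le>m. poly (B i) (exp x) * F (of_nat (q ^ i) * x)) (\<lambda>_. 0) A"
    proof (rule agree_on_identity[OF _ meromorphic_on_const A(1,2) z1A])
      have "(\<lambda>x. F (of_nat (q ^ i) * x)) meromorphic_on A" for i
        using meromorphic_on_affine[OF F(1), of A "of_nat (q ^ i)" 0] A(4) by simp
      then show "(\<lambda>x. \<Sum>i\<le>m. poly (B i) (exp x) * F (of_nat (q ^ i) * x)) meromorphic_on A"
        by (intro meromorphic_on_relation)
      have "agree_on (\<lambda>x. F (of_nat (q ^ i) * x)) (\<lambda>x. g (of_nat (q ^ i) * x)) (H s)" for i
        using agree_on_affine[OF F(2) q0(3)[of i], of "H s" 0] dil[of _ s i] s(1) by simp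
      then have "agree_on (\<lambda>x. \<Sum>i\<le>m. poly (B i) (exp x) * F (of_nat (q ^ i) * x))
        (\<lambda>x. \<Sum>i\<le>m. poly (B i) (exp x) * g (of_nat (q ^ i) * x)) (H s)"
        by (intro agree_on_relation)
      from agree_onD[OF this z1(1)] HsE[OF z1(1)]
      show "eventually (\<lambda>x. (\<Sum>i\<le>m. poly (B i) (exp x) * F (of_nat (q ^ i) * x)) = 0) (at z1)"
        by eventually_elim (use s1(3) s in \<open>auto simp: H_def\<close>)
    qed
    show "agree_on (\<lambda>x. F (x + period)) F A"
    proof (rule agree_on_identity[OF transm[OF F(1) A(5)] F(1) A(1,2) z1A])
      have "agree_on (\<lambda>p. F (1 * p + period)) (\<lambda>p. g (1 * p + period)) (H s)"
        by (rule agree_on_affine[OF F(2)]) (use transH in auto)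
      then have "agree_on (\<lambda>p. F (p + period)) g (H s)" unfolding mult_1_left gper .
      from agree_onD[OF this z1(1)] agree_onD[OF F(2) z1(1)]
      show "eventually (\<lambda>w. F (w + period) = F w) (at z1)" by eventually_elim simp
    qed
  qed
  note GR = transfer[OF G H(1,3) Hsa dil[OF _ a(1)] transH[THEN iffD2]]

  define z0 where "z0 = of_real t * (-1 + \<i>)"
  define D where "D = tangent_disc t"
  have Dball: "D = ball z0 (t * sqrt 2)" unfolding D_def z0_def by (rule tangent_disc_eq_ball[OF t])
  have z0D: "z0 \<in> D" unfolding D_def z0_def by (rule tangent_disc_center[OF t])
  \<comment> \<open>Outward continuation solves for the term of highest order: at the point
    \<open>\<kappa> * p\<close> the arguments are \<open>c i * p\<close>, with
    \<open>c m = 1\<close> and smaller factors for \<open>i < m\<close>.\<close>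
  define \<kappa> where "\<kappa> = 1 / (of_nat (q ^ m) :: complex)"
  have \<kappa>: "\<kappa> \<noteq> 0" using q0(3)[of m] by (simp add: \<kappa>_def)
  define c where "c = (\<lambda>i. of_nat (q ^ i) * \<kappa>)"
  have c_real: "c i = of_real (of_nat (q ^ i) / of_nat (q ^ m))" for i by (simp add: c_def \<kappa>_def)
  have c0: "c i \<noteq> 0" for i using \<kappa> q0(3)[of i] by (simp add: c_def)
  have cm: "c m = 1" using q0(3)[of m] by (simp add: c_def \<kappa>_def)
  have cz0H: "c i * z0 \<in> H a" for i
  proof -
    have "Re (c i * z0) = - (of_nat (q ^ i) * (t / of_nat (q ^ m)))" unfolding c_real z0_def by simp
    also have "\<dots> \<le> - (1 * (t / of_nat (q ^ m)))"
      using q0(2)[of i] t q0(1)[of m] by (intro le_imp_neg_le mult_right_mono) auto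
    also have "\<dots> < a" using ta by simp
    finally show ?thesis by (simp add: H_def)
  qed
  have z0H: "z0 \<in> H a" using cz0H[of m] by (simp add: cm)
  have \<kappa>z0H: "\<kappa> * z0 \<in> H a" using cz0H[of 0] by (simp add: c_def)
  have disc_scale: "c i * p \<in> tangent_disc r" if "p \<in> tangent_disc (of_nat (q ^ j) * r)" "i + j \<le> m" "r > 0" for i j p r
  proof -
    have "c i * p \<in> tangent_disc (of_nat (q ^ i) / of_nat (q ^ m) * (of_nat (q ^ j) * r))"
      unfolding c_real using q0(1)[of i] q0(1)[of m] that(1) by (intro tangent_disc_scale divide_pos_pos)
    moreover have "of_nat (q ^ i) / of_nat (q ^ m) * (of_nat (q ^ j) * r) \<le> r"
    proof -
      have "real (q ^ (i + j)) \<le> real (q ^ m)" using that(2) q by (intro of_nat_mono power_increasing) auto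
      then have "real (q ^ i) * real (q ^ j) \<le> real (q ^ m)" by (simp add: power_add)
      then have "real (q ^ i) * real (q ^ j) * r \<le> real (q ^ m) * r" using that(3) by (intro mult_right_mono) auto
      then show ?thesis using q0(1)[of m] by (simp add: divide_le_eq mult_ac)
    qed
    moreover have "0 < of_nat (q ^ i) / of_nat (q ^ m) * (of_nat (q ^ j) * r)"
      using q0(1) that(3) by (intro mult_pos_pos divide_pos_pos) auto
    ultimately show ?thesis using tangent_disc_mono by blast
  qed
  obtain E where E: "E holomorphic_on D" "eventually (\<lambda>x. E x = G x) (at z0)"
  proof -
    have "\<exists>E. E holomorphic_on ball z0 (t * sqrt 2) \<and> eventually (\<lambda>x. E x = G x) (at z0)"
    proof (rule ode_continuation_ball)
      show "G meromorphic_on {z0}" using G(1) by (rule meromorphic_on_subset) (use z0H in auto)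
      show "t * sqrt 2 > 0" using t by simp
      show "eventually (\<lambda>x. (\<Sum>i\<le>n. poly (P i) (exp x) * (deriv ^^ i) G x) = 0) (at z0)"
        using GR(1) z0H by (rule agree_onD)
      fix w assume "w \<in> ball z0 (t * sqrt 2)"
      then have "w \<in> tangent_disc t" using Dball D_def by simp
      then show "poly (P n) (exp w) \<noteq> 0" using e(2)[of w] tangent_disc_bounded[of w t] t by (auto simp: t_def)
    qed
    then show ?thesis using that Dball by auto
  qed
  have D: "open D" "convex D" by (simp_all add: Dball)
  have Em: "E meromorphic_on D" using E(1) D(1) by (simp add: analytic_on_imp_meromorphic_on analytic_on_open)
  have EG: "agree_on E G (D \<inter> H a)"
  proof (rule agree_on_identity)
    show "E meromorphic_on D \<inter> H a" "G meromorphic_on D \<inter> H a"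
      using Em G(1) meromorphic_on_subset by blast+
    show "open (D \<inter> H a)" "connected (D \<inter> H a)" using D H by (auto intro: convex_connected convex_Int)
    show "z0 \<in> D \<inter> H a" using z0D z0H by simp
  qed (rule E(2))

  \<comment> \<open>Each application of \<open>?\<Psi>\<close> enlarges the domain from
    \<open>X j\<close> to \<open>X (Suc j)\<close>, the disc scaled by \<open>q\<close>.\<close>
  let ?\<Psi> = "solve_mahler (B m) B \<kappa> {..<m} c"
  define X where "X = (\<lambda>j. tangent_disc (of_nat (q ^ j) * t))"
  define C where "C = (\<lambda>j. (?\<Psi> ^^ j) E)"
  have X0: "X 0 = D" by (simp add: X_def D_def)
  have rpos: "of_nat (q ^ j) * t > 0" for j using q0(1)[of j] t by (rule mult_pos_pos)
  have Xo: "open (X j)" for j unfolding X_def tangent_disc_eq_ball[OF rpos] by simp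
  have Xmono: "X j \<subseteq> X (Suc j)" for j
  proof
    fix p assume "p \<in> X j"
    moreover have "real (q ^ j) * t \<le> real (q ^ Suc j) * t" using t q by (intro mult_right_mono of_nat_mono power_increasing) auto
    ultimately show "p \<in> X (Suc j)" unfolding X_def using tangent_disc_mono[OF rpos] by blast
  qed
  have cX: "c i * p \<in> X j" if "i < m" "p \<in> X (Suc j)" for i p j
    unfolding X_def by (rule disc_scale[where j = 1]) (use that rpos in \<open>auto simp: X_def mult_ac\<close>)
  have Cm: "C j meromorphic_on X j" for j
  proof (induction j)
    case (Suc j)
    have "?\<Psi> (C j) meromorphic_on X (Suc j)" by (rule solve_mahler_meromorphic[OF Suc]) (use cX in auto)
    then show ?case by (simp add: C_def)
  qed (simp add: C_def X0 Em)
  \<comment> \<open>For \<open>i \<le> m\<close> the points \<open>c i * w\<close> with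
    \<open>w\<close> near \<open>z0\<close> lie where \<open>E\<close> agrees with \<open>G\<close>,
    so the equation for \<open>G\<close> shows that \<open>?\<Psi>\<close> leaves \<open>E\<close>
    unchanged there. The identity theorem then covers the disc.\<close>
  have start: "eventually (\<lambda>w. ?\<Psi> E w = E w) (at z0)"
  proof (rule solve_mahler_solves[OF Bm \<kappa>])
    have "eventually (\<lambda>w. E (c i * w) = G (c i * w)) (at z0)" if "i \<le> m" for i
    proof -
      have "c i * z0 \<in> D \<inter> H a" using disc_scale[of z0 0 t i] that z0D t cz0H by (simp add: D_def)
      then show ?thesis using eventually_at_affine[of "\<lambda>w. E w = G w" "c i" z0 0] agree_onD[OF EG] c0 by simp
    qed
    then have "eventually (\<lambda>w. \<forall>i\<in>{..m}. E (c i * w) = G (c i * w)) (at z0)" by (intro eventually_ball_finite) auto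
    moreover have "eventually (\<lambda>w. (\<Sum>i\<le>m. poly (B i) (exp (\<kappa> * w)) * G (of_nat (q ^ i) * (\<kappa> * w))) = 0) (at z0)"
      using eventually_at_affine[of "\<lambda>x. (\<Sum>i\<le>m. poly (B i) (exp x) * G (of_nat (q ^ i) * x)) = 0" \<kappa> z0 0]
        agree_onD[OF GR(2) \<kappa>z0H] \<kappa> by simp
    ultimately show "eventually (\<lambda>w. poly (B m) (exp (\<kappa> * w)) * E w + (\<Sum>i\<in>{..<m}. poly (B i) (exp (\<kappa> * w)) * E (c i * w)) = 0) (at z0)"
    proof eventually_elim
      case (elim w)
      have "(\<Sum>i\<le>m. poly (B i) (exp (\<kappa> * w)) * E (c i * w)) = (\<Sum>i\<le>m. poly (B i) (exp (\<kappa> * w)) * G (of_nat (q ^ i) * (\<kappa> * w)))"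
        using elim(1) by (intro sum.cong refl) (auto simp: c_def mult.assoc)
      then have "(\<Sum>i\<le>m. poly (B i) (exp (\<kappa> * w)) * E (c i * w)) = 0" using elim(2) by simp
      then show ?case by (simp add: lessThan_Suc_atMost[symmetric] cm add.commute)
    qed
  qed
  have Cag: "agree_on (C (Suc j)) (C j) (X j)" for j
  proof (induction j)
    case 0
    have "?\<Psi> E meromorphic_on D" using Cm[of 1] Xmono[of 0] by (auto simp: C_def X0 intro: meromorphic_on_subset)
    then show ?case
      using agree_on_identity[OF _ Em D(1) convex_connected[OF D(2)] z0D start] by (simp add: C_def X0)
  next
    case (Suc j)
    have "agree_on (?\<Psi> (C (Suc j))) (?\<Psi> (C j)) (X (Suc j))"
      by (rule solve_mahler_agree[OF Suc]) (use c0 cX in auto)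
    then show ?case by (simp add: C_def)
  qed
  obtain Eh where EI: "Eh meromorphic_on (\<Union>j. X j)" "\<And>j z. z \<in> X j \<Longrightarrow> eventually (\<lambda>w. Eh w = C j w) (at z)"
    using meromorphic_glue[of X C, OF Xo Xmono Cm agree_onD[OF Cag]] by blast
  define W where "W = {p :: complex. Im p > Re p}"
  have XW: "(\<Union>j. X j) = W"
    using tangent_disc_pos[OF _ rpos] tangent_disc_exhausts[OF _ t q] unfolding W_def X_def by fastforce
  have W: "open W" "convex W" "z0 \<in> W"
    using open_above_diagonal[of 0] convex_above_diagonal t by (auto simp: W_def z0_def)
  have Wper: "p + period \<in> W" if "p \<in> W" for p
    using that by (simp add: W_def) (use pi_gt_zero in linarith)
  have EIm: "Eh meromorphic_on W" using EI(1) XW by simp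
  have EIG: "agree_on Eh G (W \<inter> H a)"
  proof (rule agree_on_identity)
    show "Eh meromorphic_on W \<inter> H a" "G meromorphic_on W \<inter> H a"
      using EIm G(1) meromorphic_on_subset by blast+
    show "open (W \<inter> H a)" "connected (W \<inter> H a)" using W H by (auto intro: convex_connected convex_Int)
    show "z0 \<in> W \<inter> H a" using W z0H by simp
    have "eventually (\<lambda>w. Eh w = E w) (at z0)" using EI(2)[of z0 0] z0D by (simp add: X0 C_def)
    with E(2) show "eventually (\<lambda>w. Eh w = G w) (at z0)" by eventually_elim simp
  qed
  have EIper: "agree_on (\<lambda>p. Eh (p + period)) Eh W"
  proof (rule agree_on_identity[OF transm[OF EIm Wper] EIm W(1) convex_connected[OF W(2)] W(3)])
    have "z0 + period \<in> W \<inter> H a" using Wper[OF W(3)] z0H transH by blast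
    then have "eventually (\<lambda>w. Eh (w + period) = G (w + period)) (at z0)"
      using eventually_at_affine[of "\<lambda>w. Eh w = G w" 1 z0 period] agree_onD[OF EIG] by simp
    moreover have "eventually (\<lambda>w. Eh w = G w) (at z0)" using agree_onD[OF EIG] W z0H by blast
    moreover have "eventually (\<lambda>w. G (w + period) = G w) (at z0)" using GR(3) z0H by (rule agree_onD)
    ultimately show "eventually (\<lambda>w. Eh (w + period) = Eh w) (at z0)" by eventually_elim simp
  qed
  \<comment> \<open>The translates of \<open>W\<close> downwards by \<open>k\<close>
    periods.\<close>
  define Y where "Y = (\<lambda>k. {p :: complex. Im p > Re p + (- of_nat k * (2 * pi))})"
  have YW: "p \<in> Y k \<longleftrightarrow> p + of_nat k * period \<in> W" for p k by (simp add: Y_def W_def algebra_simps)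
  have "\<exists>F. F meromorphic_on (\<Union>k. Y k) \<and> (\<forall>k. \<forall>z\<in>Y k. eventually (\<lambda>w. F w = Eh (w + of_nat k * period)) (at z))"
  proof (rule meromorphic_glue)
    fix k
    show "open (Y k)" unfolding Y_def by (rule open_above_diagonal)
    have suc: "p + of_nat (Suc k) * period = (p + of_nat k * period) + period" for p by (simp add: algebra_simps)
    show "Y k \<subseteq> Y (Suc k)" unfolding subset_iff YW suc using Wper by blast
    show "(\<lambda>w. Eh (w + of_nat k * period)) meromorphic_on Y k"
      using meromorphic_on_affine[OF EIm, of "Y k" 1 "of_nat k * period"] YW by simp
    fix z assume "z \<in> Y k"
    then have "z + of_nat k * period \<in> W" by (simp only: YW)
    from eventually_at_affine[of _ 1 z "of_nat k * period", unfolded mult_1_left, OF agree_onD[OF EIper this]]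
    show "eventually (\<lambda>w. Eh (w + of_nat (Suc k) * period) = Eh (w + of_nat k * period)) (at z)"
      unfolding suc by simp
  qed
  moreover have "(\<Union>k. Y k) = UNIV"
  proof -
    have "\<exists>k. p \<in> Y k" for p
    proof -
      obtain k :: nat where "Re p - Im p < of_nat k * (2 * pi)" using reals_Archimedean3[of "2 * pi"] by auto
      then show ?thesis by (intro exI[of _ k]) (simp add: Y_def)
    qed
    then show ?thesis by blast
  qed
  ultimately obtain F where F: "F meromorphic_on UNIV"
    "\<And>k z. z \<in> Y k \<Longrightarrow> eventually (\<lambda>w. F w = Eh (w + of_nat k * period)) (at z)" by metis
  have "agree_on F G (H a)"
  proof (rule agree_on_identity[OF meromorphic_on_subset[OF F(1)] G(1) H(1,3) z0H])
    have "z0 \<in> Y 0" using W(3) by (simp add: YW)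
    from F(2)[OF this] agree_onD[OF EIG, of z0] W z0H
    have "eventually (\<lambda>w. F w = Eh w) (at z0)" "eventually (\<lambda>w. Eh w = G w) (at z0)" by auto
    then show "eventually (\<lambda>w. F w = G w) (at z0)" by eventually_elim simp
  qed simp
  then have Fg: "agree_on F g (H s)" using agree_on_trans[OF agree_on_subset[OF _ Hsa] G(2)] by blast
  note FR = transfer[OF F(1) Fg open_UNIV connected_UNIV subset_UNIV UNIV_I UNIV_I, unfolded agree_on_hat_eq]
  have c': "admissible (CaseM q)" using q by simp
  interpret S: skew_operator exp almost_zero meromorphic "hat_sigma (CaseM q)" "sigma_poly (CaseM q)" "\<lambda>_. 0"
    by (rule hat_sigma_skew_operator[OF c'])
  have "hat_D.has_relation F"
    unfolding hat_D.has_relation_def by (intro exI[of _ n] exI[of _ P] conjI Pn) (use FR(1) in \<open>simp add: almost_zero_def\<close>)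
  moreover have "S.has_relation F"
    unfolding S.has_relation_def funpow_hat_sigma
    by (intro exI[of _ m] exI[of _ B] conjI Bm) (use FR(2) in \<open>simp add: almost_zero_def\<close>)
  ultimately obtain u v where uv: "v \<noteq> 0" "hat_eq F (\<lambda>p. poly u (exp p) / poly v (exp p))"
    using periodic_bifinite_rational[OF c' _ FR(3)] F(1) by blast
  have "eventually (\<lambda>x. poly v x \<noteq> 0) (at 0)"
  proof -
    have "isCont (poly v') 0" for v' :: "complex poly" by simp
    have "finite {x. poly v x = 0}" by (rule poly_roots_finite[OF uv(1)])
    then have "eventually (\<lambda>x. \<forall>r\<in>{x. poly v x = 0}. x \<noteq> r) (at 0)"
      by (intro eventually_ball_finite ballI) (auto intro: eventually_neq_at_within)
    then show ?thesis by eventually_elim auto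
  qed
  moreover have "eventually (\<lambda>x. x \<in> ball 0 (exp s) - {0}) (at (0 :: complex))" by (rule eventually_at_in_open) auto
  ultimately have "eventually (\<lambda>x. eval_fls h x = poly u x / poly v x) (at 0)"
  proof eventually_elim
    case (elim x)
    define p where "p = Ln x"
    have p: "exp p = x" using elim by (simp add: p_def)
    have "exp (Re p) < exp s" using elim p norm_exp_eq_Re[of p] by simp
    then have pH: "p \<in> H s" by (simp add: H_def)
    \<comment> \<open>\<open>F\<close> agrees with \<open>g\<close> and with the rational function
      only off isolated points, so the value at \<open>p\<close> itself is obtained by
      continuity.\<close>
    have "isCont g p" using ga pH analytic_at_imp_isCont analytic_on_analytic_at by blast
    moreover have "isCont (\<lambda>p. poly u (exp p) / poly v (exp p)) p"
      using elim(1) p by (intro continuous_intros isCont_o2[OF isCont_exp]) auto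
    moreover have "eventually (\<lambda>w. g w = poly u (exp w) / poly v (exp w)) (at p)"
    proof -
      have "eventually (\<lambda>w. F w = poly u (exp w) / poly v (exp w)) (at p)" using uv(2) by (simp add: hat_eq_iff)
      with agree_onD[OF Fg pH] show ?thesis by eventually_elim simp
    qed
    ultimately have "g p = poly u (exp p) / poly v (exp p)"
      unfolding isCont_def using LIM_unique[of g "g p" p "poly u (exp p) / poly v (exp p)"]
        tendsto_cong[of g "\<lambda>p. poly u (exp p) / poly v (exp p)" "at p"] by blast
    then show ?case by (simp add: g_def p)
  qed
  then show ?thesis by (rule fls_eq_quotient[OF conv uv(1)])
qed

text \<open>The relation for \<open>f\<close> may begin with \<open>f(x ^ (q ^ j))\<close> for some
  \<open>j > 0\<close>. For \<open>h = f(x ^ Q)\<close> with \<open>Q = q ^ j\<close> it has a term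
  of order \<open>0\<close>, as the regular case requires; rationality of \<open>h\<close> is then
  brought back to \<open>f\<close>.\<close>

theorem fls_mahler_rational:
  assumes c: "admissible (CaseM q)" and D: "fls_satisfies fls_delta n f"
    and S: "fls_satisfies (fls_sigma (CaseM q)) m f"
  shows "f \<in> fls_ratfuns"
proof -
  have q: "q \<ge> 2" using c by simp
  then have q0: "q > 0" by simp
  obtain p where p: "p n \<noteq> 0" "(\<Sum>i\<le>n. fls_poly (p i) * (fls_delta ^^ i) f) = 0"
    using fls_satisfies_imp_relation[OF D] by blast
  obtain b where b: "b m \<noteq> 0" "(\<Sum>i\<le>m. fls_poly (b i) * fls_compose_power f (q ^ i)) = 0"
    using fls_satisfies_imp_relation[OF S] unfolding fls_sigma_mahler_funpow[OF q0] by blast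
  define j where "j = (LEAST j. b j \<noteq> 0)"
  have bj: "b j \<noteq> 0" unfolding j_def using b(1) by (rule LeastI)
  have jm: "j \<le> m" unfolding j_def using b(1) by (rule Least_le)
  have low: "b i = 0" if "i < j" for i using not_less_Least that unfolding j_def by blast
  define Q where "Q = q ^ j"
  have Q: "Q > 0" using q0 by (simp add: Q_def)
  define h where "h = fls_compose_power f Q"
  \<comment> \<open>\<open>\<delta>\<close> applied to \<open>f(x ^ Q)\<close> is \<open>Q\<close>
    times \<open>\<delta> f\<close> at \<open>x ^ Q\<close>; the resulting factors
    \<open>Q ^ i\<close> are divided out in the coefficients.\<close>
  define P where "P = (\<lambda>i. smult (1 / of_nat Q ^ i) (pcompose (p i) (monom 1 Q)))"
  have hi: "fls_compose_power h (q ^ i) = fls_compose_power f (q ^ (i + j))" for i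
    unfolding h_def Q_def fls_sigma_mahler_funpow[OF q0, symmetric] by (simp add: funpow_add)
  have "(\<Sum>i\<le>m - j. fls_poly (b (i + j)) * fls_compose_power h (q ^ i)) = (\<Sum>i=j..m. fls_poly (b i) * fls_compose_power f (q ^ i))"
    unfolding hi using jm by (intro sum.reindex_bij_witness[of _ "\<lambda>i. i - j" "\<lambda>i. i + j"]) auto
  also have "\<dots> = (\<Sum>i\<le>m. fls_poly (b i) * fls_compose_power f (q ^ i))"
    by (rule sum.mono_neutral_left) (use low in auto)
  finally have Brel: "(\<Sum>i\<le>m - j. fls_poly (b (i + j)) * fls_compose_power h (q ^ i)) = 0" using b(2) by simp
  have dh: "(fls_delta ^^ i) h = fls_const (of_nat Q ^ i) * fls_compose_power ((fls_delta ^^ i) f) Q" for i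
  proof (rule fls_eqI)
    fix k
    show "(fls_delta ^^ i) h $$ k = (fls_const (of_nat Q ^ i) * fls_compose_power ((fls_delta ^^ i) f) Q) $$ k"
      using Q by (auto simp: h_def fls_delta_funpow_nth fls_nth_compose_power power_mult_distrib elim!: dvdE)
  qed
  have pc: "fls_poly (smult a r) = fls_const a * fls_poly r" for a r
    by (simp add: fps_of_poly_smult fls_times_fps_to_fls)
  have "fls_poly (P i) * (fls_delta ^^ i) h = fls_compose_power (fls_poly (p i) * (fls_delta ^^ i) f) Q" for i
  proof -
    have "fls_const (1 / of_nat Q ^ i) * fls_const (of_nat Q ^ i) = (1 :: complex fls)"
      using Q by (simp add: fls_const_mult_const)
    moreover have "(x * y) * (z * w) = (x * z) * (y * w)" for x y z w :: "complex fls" by (simp only: mult_ac)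
    ultimately show ?thesis
      unfolding P_def pc dh fls_compose_power_mult fls_compose_power_poly[OF Q] by (simp only: mult_1_left)
  qed
  then have "(\<Sum>i\<le>n. fls_poly (P i) * (fls_delta ^^ i) h) = fls_compose_power (\<Sum>i\<le>n. fls_poly (p i) * (fls_delta ^^ i) f) Q"
    by (simp add: fls_compose_power_sum)
  then have Prel: "(\<Sum>i\<le>n. fls_poly (P i) * (fls_delta ^^ i) h) = 0" using p(2) by simp
  have "h \<in> fls_ratfuns"
    by (rule fls_mahler_rational_regular[where q = q and n = n and P = P and m = "m - j" and B = "\<lambda>i. b (i + j)"])
       (use q Prel Brel bj b(1) jm p(1) Q in \<open>simp_all add: P_def pcompose_eq_0_iff degree_monom_eq\<close>)
  then show ?thesis unfolding h_def by (rule fls_ratfuns_compose_power_cancel[OF _ Q])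
qed

theorem corollary3:
  fixes c :: sigma_case
  assumes "admissible c"
  shows
    "(\<forall>(f :: log_surface \<Rightarrow> complex) n m.
        f meromorphic_on UNIV \<longrightarrow> hat_satisfies hat_delta n f \<longrightarrow> hat_satisfies (hat_sigma c) m f
          \<longrightarrow> power_log_form c f) \<and>
     (\<forall>f :: log_surface \<Rightarrow> complex.
        power_log_form c f
          \<longrightarrow> (\<exists>n>0. \<exists>m>0. hat_satisfies hat_delta n f \<and> hat_satisfies (hat_sigma c) m f)) \<and>
     (\<forall>(f :: complex fls) n m.
        fls_satisfies fls_delta n f \<longrightarrow> fls_satisfies (fls_sigma c) m f \<longrightarrow> f \<in> fls_ratfuns)"
proof (intro conjI allI impI)
  fix f :: "log_surface \<Rightarrow> complex" and n m
  assume "f meromorphic_on UNIV" "hat_satisfies hat_delta n f" "hat_satisfies (hat_sigma c) m f"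
  then show "power_log_form c f" by (rule satisfies_power_log_form[OF assms])
next
  fix f :: "log_surface \<Rightarrow> complex"
  assume "power_log_form c f"
  then show "\<exists>n>0. \<exists>m>0. hat_satisfies hat_delta n f \<and> hat_satisfies (hat_sigma c) m f"
    by (rule power_log_form_satisfies[OF assms])
next
  fix f :: "complex fls" and n m
  assume "fls_satisfies fls_delta n f" "fls_satisfies (fls_sigma c) m f"
  then show "f \<in> fls_ratfuns"
    using assms by (cases c) (auto intro: fls_dilation_rational fls_mahler_rational simp del: fls_sigma.simps admissible.simps)
qed

end
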